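(* Let $H(p,q):(0,\infty)\times(0,\infty)\to\mathbb{R}$ be a smooth function and let $\gamma_0$ be a smooth convex closed plane curve with smooth parametrization $X_0:S^1\to\gamma_0$. Assume that the solution $L(t)$ of the ODE initial value problem $$\frac{dL}{dt}(t)=L(t)-2\pi H\!\left(L(t),\ \frac{L^2(t)}{4\pi}+E_1(t)-\frac{L^2(0)}{4\pi}e^{2t}\right),\qquad L(0)=\text{length of }\gamma_0,$$ is defined on $[0,\infty)$, where $E_1(t)$ is the function determined by $\gamma_0$ given in the context. Then the nonlocal flow $$\frac{\partial X}{\partial t}(\varphi,t)=\left(H(L(t),A(t))-\frac{1}{k(\varphi,t)}\right)\mathbf{N}_{in}(\varphi,t),\qquad X(\varphi,0)=X_0(\varphi),\quad \varphi\in S^1,$$ either develops a singularity (with $k=\infty$ somewhere) in finite time, or the flow is defined on $S^1\times[0,\infty)$, with each $\gamma_t$ remaining smooth and convex, and its support function $u(\theta,t)$ satisfies the following $C^\infty$ convergence on $S^1$: $$\lim_{t\to\infty}\left(u(\theta,t)-\frac{L(t)}{2\pi}\right)=\left(\frac1\pi\int_0^{2\pi}u(\theta,0)\cos\theta\,d\theta\right)\cos\theta+\left(\frac1\pi\int_0^{2\pi}u(\theta,0)\sin\theta\,d\theta\right)\sin\theta,\qquad\forall\,\theta\in S^1.$$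
   Context: "Convex" means strictly convex: a convex closed plane curve has positive curvature everywhere; closed curves are simple. $S^1=\mathbb{R}/2\pi\mathbb{Z}$. For each $t$, $\gamma_t$ is the closed curve parametrized by $X(\cdot,t)$; $k(\varphi,t)$ is its curvature and $\mathbf{N}_{in}(\varphi,t)$ its inward unit normal at the point $X(\varphi,t)$. In the flow equation $L(t)$ is the length of $\gamma_t$ and $A(t)$ its enclosed area; as long as the smooth convex flow exists, this length coincides with the solution $L(t)$ of the ODE. The support function of a convex closed curve $\gamma$ is $u(\theta)=\langle X(\theta),(\cos\theta,\sin\theta)\rangle$, where $X(\theta)$ is the unique point of $\gamma$ with outward unit normal $(\cos\theta,\sin\theta)$; $u(\theta,t)$ denotes the support function of $\gamma_t$, and $u(\theta,0)$, that of $\gamma_0$, is regarded as a $2\pi$-periodic function on $\mathbb{R}$. Define, for $t>0$, $$E_1(t)=\frac12\int_0^{2\pi}\left(\frac{e^t}{2\sqrt{\pi t}}\int_{-\infty}^{\infty}e^{-\frac{\xi^2}{4t}}u(\theta-\xi,0)\,d\xi\right)\left(\frac{e^t}{2\sqrt{\pi t}}\int_{-\infty}^{\infty}e^{-\frac{\xi^2}{4t}}\left[u_{\theta\theta}(\theta-\xi,0)+u(\theta-\xi,0)\right]d\xi\right)d\theta,$$ with $E_1(0)$ understood as the limit $t\to0^+$ (the area enclosed by $\gamma_0$). A solution of the ODE is required to have both arguments of $H$ in $(0,\infty)$. The flow "develops a singularity with $k=\infty$ somewhere" at a time $t_0>0$ if the smooth convex solution exists on $[0,t_0)$ and its curvature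 is unbounded as $t\to t_0^-$ (equivalently, the radius of curvature $1/k=u_{\theta\theta}+u$ reaches $0$ at some $\theta_0$ at time $t_0$). *)

theory Defs
  imports "HOL-Analysis.Analysis"
begin

text \<open>
  The Euclidean plane is \<^typ>\<open>complex\<close>, with its inner product as a real inner product space.
  Functions on the circle of length \<open>2\<pi>\<close> are \<open>2\<pi>\<close>-periodic functions on \<^typ>\<open>real\<close>.
\<close>

subsection \<open>Smooth functions\<close>

text \<open>
  Derivatives are taken within \<open>S\<close>, so that smoothness up to the boundary makes sense,
  e.g. at \<open>t = 0\<close> in \<open>UNIV \<times> {0..<T}\<close>. This is used only for sets on which
  \<^const>\<open>frechet_derivative\<close> within the set is uniquely determined (open sets, and products
  of nondegenerate intervals).
\<close>

primrec Ck_on :: "nat \<Rightarrow> 'a::real_normed_vector set \<Rightarrow> ('a \<Rightarrow> 'b::real_normed_vector) \<Rightarrow> bool" where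
  "Ck_on 0 S f \<longleftrightarrow> continuous_on S f"
| "Ck_on (Suc n) S f \<longleftrightarrow>
     f differentiable_on S \<and> (\<forall>v. Ck_on n S (\<lambda>x. frechet_derivative f (at x within S) v))"

definition smooth_on :: "'a::real_normed_vector set \<Rightarrow> ('a \<Rightarrow> 'b::real_normed_vector) \<Rightarrow> bool" where
  "smooth_on S f \<longleftrightarrow> (\<forall>n. Ck_on n S f)"

text \<open>\<open>C\<^sup>\<infinity>\<close> convergence of functions on the circle: all derivatives converge uniformly.\<close>

definition Cinf_limit :: "('t \<Rightarrow> real \<Rightarrow> real) \<Rightarrow> (real \<Rightarrow> real) \<Rightarrow> 't filter \<Rightarrow> bool" where
  "Cinf_limit f g F \<longleftrightarrow>
     (\<forall>\<^sub>F t in F. smooth_on UNIV (f t)) \<and> smooth_on UNIV g \<and>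
     (\<forall>n. uniform_limit UNIV (\<lambda>t. (deriv ^^ n) (f t)) ((deriv ^^ n) g) F)"

subsection \<open>Convex closed plane curves\<close>

definition curve_length :: "(real \<Rightarrow> complex) \<Rightarrow> real" where
  "curve_length g = integral {0..2*pi} (\<lambda>\<phi>. norm (vector_derivative g (at \<phi>)))"

definition enclosed_area :: "(real \<Rightarrow> complex) \<Rightarrow> real" where
  "enclosed_area g = measure lebesgue (inside (range g))"

definition inward_normal :: "(real \<Rightarrow> complex) \<Rightarrow> real \<Rightarrow> complex" where
  "inward_normal g \<phi> = (THE n. norm n = 1 \<and> n \<bullet> vector_derivative g (at \<phi>) = 0 \<and>
     (\<forall>\<^sub>F s in at_right 0. g \<phi> + s *\<^sub>R n \<in> inside (range g)))"

text \<open>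
  Signed curvature with respect to the inward normal, so that it does not depend on the
  orientation of the parametrization: the normal component of the derivative of the unit tangent
  with respect to arc length is that of the second derivative of \<open>g\<close> divided by the squared speed.
\<close>

definition curvature :: "(real \<Rightarrow> complex) \<Rightarrow> real \<Rightarrow> real" where
  "curvature g \<phi> =
     (vector_derivative (\<lambda>s. vector_derivative g (at s)) (at \<phi>) \<bullet> inward_normal g \<phi>)
       / (norm (vector_derivative g (at \<phi>)))\<^sup>2"

definition smooth_convex_closed_curve :: "(real \<Rightarrow> complex) \<Rightarrow> bool" where
  "smooth_convex_closed_curve g \<longleftrightarrow>
     smooth_on UNIV g \<and> (\<forall>\<phi>. g (\<phi> + 2*pi) = g \<phi>) \<and> inj_on g {0..<2*pi} \<and>
     (\<forall>\<phi>. vector_derivative g (at \<phi>) \<noteq> 0) \<and> (\<forall>\<phi>. curvature g \<phi> > 0)"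

text \<open>The outward unit normal is the negative of the inward one; \<open>cis \<theta> = (cos \<theta>, sin \<theta>)\<close>.\<close>

definition support_function :: "(real \<Rightarrow> complex) \<Rightarrow> real \<Rightarrow> real" where
  "support_function g \<theta> =
     (THE p. \<exists>\<phi>. p = g \<phi> \<and> - inward_normal g \<phi> = cis \<theta>) \<bullet> cis \<theta>"

subsection \<open>The nonlocal flow\<close>

definition heat_average :: "real \<Rightarrow> (real \<Rightarrow> real) \<Rightarrow> real \<Rightarrow> real" where
  "heat_average t f \<theta> =
     exp t / (2 * sqrt (pi * t)) * integral UNIV (\<lambda>\<xi>. exp (- \<xi>\<^sup>2 / (4 * t)) * f (\<theta> - \<xi>))"

text \<open>
  \<open>u\<close> is the support function of the initial curve. The formula applies for \<open>t > 0\<close>;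
  the value at \<open>0\<close> is the limit from the right. Negative times do not occur.
\<close>

definition E1_pos :: "(real \<Rightarrow> real) \<Rightarrow> real \<Rightarrow> real" where
  "E1_pos u t = 1/2 * integral {0..2*pi}
     (\<lambda>\<theta>. heat_average t u \<theta> * heat_average t (\<lambda>\<eta>. deriv (deriv u) \<eta> + u \<eta>) \<theta>)"

definition E1 :: "(real \<Rightarrow> real) \<Rightarrow> real \<Rightarrow> real" where
  "E1 u t = (if t > 0 then E1_pos u t else Lim (at_right 0) (E1_pos u))"

text \<open>
  \<open>X \<phi> t\<close> is a smooth convex solution, with initial parametrization \<open>X0\<close>, on the time interval \<open>J\<close>,
  which is \<open>{0..<T}\<close> with \<open>T > 0\<close>, or \<open>{0..}\<close>.
\<close>

definition nonlocal_flow ::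
    "(real \<Rightarrow> real \<Rightarrow> real) \<Rightarrow> (real \<Rightarrow> complex) \<Rightarrow> real set \<Rightarrow> (real \<Rightarrow> real \<Rightarrow> complex) \<Rightarrow> bool" where
  "nonlocal_flow H X0 J X \<longleftrightarrow>
     smooth_on (UNIV \<times> J) (\<lambda>(\<phi>, t). X \<phi> t) \<and>
     (\<forall>t\<in>J. smooth_convex_closed_curve (\<lambda>\<phi>. X \<phi> t)) \<and>
     (\<forall>\<phi>. \<forall>t\<in>J. ((\<lambda>s. X \<phi> s) has_vector_derivative
        (H (curve_length (\<lambda>\<phi>. X \<phi> t)) (enclosed_area (\<lambda>\<phi>. X \<phi> t)) - 1 / curvature (\<lambda>\<phi>. X \<phi> t) \<phi>)
          *\<^sub>R inward_normal (\<lambda>\<phi>. X \<phi> t) \<phi>) (at t within J)) \<and>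
     (\<forall>\<phi>. X \<phi> 0 = X0 \<phi>)"

definition curvature_blows_up :: "(real \<Rightarrow> real \<Rightarrow> complex) \<Rightarrow> real \<Rightarrow> bool" where
  "curvature_blows_up X t0 \<longleftrightarrow>
     (\<forall>K. \<exists>\<^sub>F t in at_left t0. \<exists>\<phi>. curvature (\<lambda>\<phi>. X \<phi> t) \<phi> > K)"

end

theory Submission
  imports Defs "HOL-Probability.Probability"
begin

text \<open>
  For a convex curve with support function \<open>u\<close> the radius of curvature is \<open>u'' + u\<close>, so the flow becomes
  \<open>u\<^sub>t = u'' + u - H(L, A)\<close>. The nonlocal term only enters the Fourier mode \<open>n = 0\<close>, that is, the length;
  every other mode is multiplied by \<open>e\<^bsup>(1 - n\<^sup>2)t\<^esup>\<close>. Hence \<open>u(\<theta>, t) = L(t)/2\<pi> + e\<^sup>t V(\<theta>, t)\<close>, where \<open>V\<close> solves the heat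
  equation, and computing the enclosed area from \<open>u\<close> turns the equation for \<open>L\<close> into the given ODE. As long as
  \<open>u'' + u > 0\<close> this \<open>u\<close> is the support function of a convex curve \<open>Y(\<theta>, t)\<close>; transporting \<open>\<theta>\<close> along the
  vector field \<open>- (u'' + u)\<^sub>\<theta> / (u'' + u)\<close> removes the tangential velocity and gives a solution \<open>X\<close> of the flow.
  Conversely, the support function of any solution, being a maximum over the parameter, satisfies the same
  equation by the envelope theorem, and the ODE determines its length. At the first zero of \<open>u'' + u\<close> the
  curvature blows up; if there is none, only the modes \<open>n = 1\<close> survive in \<open>u - L/2\<pi>\<close>.
\<close>

subsection \<open>Functions of class \<open>C\<^sup>k\<close> on sets with unique derivatives\<close>

text \<open>The definitions of normal, curvature and support function see a curve only through
  \<open>inside (range g)\<close> and \<open>THE\<close>. They become computable once every closed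
  curve of positive curvature is known to be \<open>support_curve u\<close> composed with a monotone
  angle; the Jordan curve theorem and a passage from local to global convexity serve this purpose.
  No uniqueness is proved for X itself. What is unique is its support function: each Fourier mode n
  > 0 solves a scalar linear equation, and the mean is fixed by uniqueness for the length equation.
  This is why one dichotomy can assert existence and at the same time speak about all solutions. The
  function \<open>E1\<close> enters because convolution with the Gaussian multiplies the mode n by
  exp (- n^2 t), and the factor exp t in \<open>heat_average\<close> turns this into exp ((1 - n^2)
  t). The term L(0)^2 exp (2 t) / (4 pi) in the length equation then removes exactly the mode 0 of
  \<open>E1\<close> and leaves \<open>osc_area\<close>, the contribution of the other modes to the
  area.\<close>

text \<open>The hypothesis of \<open>frechet_derivative_unique_within\<close>, under which derivatives within \<open>S\<close> are unique.\<close>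

definition fat :: "'a::euclidean_space set \<Rightarrow> bool" where
  "fat S \<longleftrightarrow> (\<forall>x\<in>S. \<forall>i\<in>Basis. \<forall>e>0. \<exists>d. 0 < \<bar>d\<bar> \<and> \<bar>d\<bar> < e \<and> x + d *\<^sub>R i \<in> S)"

lemma fat_unique:
  assumes "fat S" "x \<in> S" "(f has_derivative D) (at x within S)" "(f has_derivative D') (at x within S)"
  shows "D = D'"
  by (rule frechet_derivative_unique_within[OF assms(3,4)]) (use assms(1,2) in \<open>auto simp: fat_def\<close>)

lemma fat_frechet:
  assumes "fat S" "x \<in> S" "(f has_derivative D) (at x within S)"
  shows "frechet_derivative f (at x within S) = D"
  by (metis assms differentiable_def fat_unique frechet_derivative_works)

lemma fat_open:
  assumes "open S" shows "fat S"
  unfolding fat_def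
proof (intro ballI allI impI)
  fix x i :: 'a and e :: real assume x: "x \<in> S" and i: "i \<in> Basis" and e: "e > 0"
  obtain r where r: "r > 0" "ball x r \<subseteq> S" using assms x openE by blast
  let ?d = "min (e/2) (r/2)"
  have "x + ?d *\<^sub>R i \<in> ball x r" using r(1) e i by (simp add: dist_norm)
  then show "\<exists>d. 0 < \<bar>d\<bar> \<and> \<bar>d\<bar> < e \<and> x + d *\<^sub>R i \<in> S"
    using r e by (intro exI[of _ ?d]) auto
qed

lemma fat_Times:
  assumes "fat S" "fat T" shows "fat (S \<times> T)"
  using assms unfolding fat_def by (auto simp: Basis_prod_def)

lemma fat_real_convex:
  fixes J :: "real set"
  assumes "convex J" "a \<in> J" "b \<in> J" "a < b"
  shows "fat J"
  unfolding fat_def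
proof (intro ballI allI impI)
  fix x i e :: real assume x: "x \<in> J" and i: "i \<in> Basis" and e: "e > 0"
  obtain y where y: "y \<in> J" "y \<noteq> x" using assms by (metis less_irrefl)
  \<comment> \<open>The step goes a fraction s of the way to another point y of J; the factor 2
    keeps its length at most e / 2.\<close>
  define s where "s = min 1 (e / (2 * \<bar>y - x\<bar>))"
  have s: "0 < s" "s \<le> 1" using e y by (auto simp: s_def)
  have "s * \<bar>y - x\<bar> \<le> e / (2 * \<bar>y - x\<bar>) * \<bar>y - x\<bar>" by (intro mult_right_mono) (auto simp: s_def)
  also have "\<dots> < e" using e y by (simp add: field_simps)
  finally have 1: "s * \<bar>y - x\<bar> < e" .
  have "(1 - s) *\<^sub>R x + s *\<^sub>R y \<in> J" using assms(1) x y s by (intro convexD_alt) auto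
  then have "x + (s * (y - x)) *\<^sub>R i \<in> J" using i by (simp add: algebra_simps)
  then show "\<exists>d. 0 < \<bar>d\<bar> \<and> \<bar>d\<bar> < e \<and> x + d *\<^sub>R i \<in> J"
    using 1 s y by (intro exI[of _ "s * (y - x)"]) (auto simp: abs_mult)
qed

text \<open>Derivatives within S at points of S depend only on the values on S, so the induction
  never looks at f and g elsewhere.\<close>

lemma Ck_on_cong:
  assumes "\<And>x. x \<in> S \<Longrightarrow> f x = g x"
  shows "Ck_on n S f \<longleftrightarrow> Ck_on n S g"
  using assms
proof (induction n arbitrary: f g)
  case 0
  then show ?case by (simp cong: continuous_on_cong)
next
  case (Suc n)
  have *: "(f has_derivative D) (at x within S) \<longleftrightarrow> (g has_derivative D) (at x within S)" if "x \<in> S" for x D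
    using Suc.prems that by (metis has_derivative_transform)
  have "frechet_derivative f (at x within S) = frechet_derivative g (at x within S)" if "x \<in> S" for x
    using * that by (simp add: frechet_derivative_def)
  then have "Ck_on n S (\<lambda>x. frechet_derivative f (at x within S) v) =
    Ck_on n S (\<lambda>x. frechet_derivative g (at x within S) v)" for v
    by (intro Suc.IH) simp
  moreover have "f differentiable_on S \<longleftrightarrow> g differentiable_on S"
    using * by (simp add: differentiable_on_def differentiable_def)
  ultimately show ?case by simp
qed

text \<open>Uniqueness of derivatives on a \<open>fat\<close> set identifies the chosen
  \<open>frechet_derivative\<close> with the supplied D, so that smoothness can be checked with
  explicit formulas.\<close>

lemma Ck_on_SucI:
  assumes "fat S" "\<And>x. x \<in> S \<Longrightarrow> (f has_derivative D x) (at x within S)"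
    "\<And>v. Ck_on n S (\<lambda>x. D x v)"
  shows "Ck_on (Suc n) S f"
proof -
  have "Ck_on n S (\<lambda>x. frechet_derivative f (at x within S) v)" for v
    using assms(3)[of v] by (rule iffD1[OF Ck_on_cong, rotated]) (simp add: fat_frechet[OF assms(1) _ assms(2)])
  then show ?thesis using assms(2) by (auto simp: differentiable_on_def differentiable_def)
qed

lemma Ck_on_SucE:
  assumes "Ck_on (Suc n) S f"
  obtains D where "\<And>x. x \<in> S \<Longrightarrow> (f has_derivative D x) (at x within S)" "\<And>v. Ck_on n S (\<lambda>x. D x v)"
  using that[of "\<lambda>x. frechet_derivative f (at x within S)"] assms
  by (auto simp: differentiable_on_def frechet_derivative_works)

lemma Ck_on_imp_cont: assumes "Ck_on n S f" shows "continuous_on S f"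
proof (cases n)
  case 0 then show ?thesis using assms by simp
next
  case (Suc m)
  then have "f differentiable_on S" using assms by simp
  then show ?thesis by (rule differentiable_imp_continuous_on)
qed

lemma Ck_on_SucD: "Ck_on (Suc n) S f \<Longrightarrow> Ck_on n S f"
proof (induction n arbitrary: f)
  case 0 then show ?case using Ck_on_imp_cont[OF 0] by simp
next
  case (Suc n) then show ?case by (metis Ck_on.simps(2))
qed

lemma Ck_on_const: "fat S \<Longrightarrow> Ck_on n S (\<lambda>x. c)"
proof (induction n arbitrary: c)
  case (Suc n)
  show ?case by (rule Ck_on_SucI[where D="\<lambda>x v. 0"]) (use Suc in auto)
qed auto

lemma Ck_on_linear:
  assumes "fat S" "bounded_linear h" "Ck_on n S f"
  shows "Ck_on n S (\<lambda>x. h (f x))"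
  using assms(3)
proof (induction n arbitrary: f)
  case 0
  then show ?case using bounded_linear.continuous_on[OF assms(2)] by simp
next
  case (Suc n)
  then obtain D where D: "\<And>x. x \<in> S \<Longrightarrow> (f has_derivative D x) (at x within S)" "\<And>v. Ck_on n S (\<lambda>x. D x v)"
    by (metis Ck_on_SucE)
  show ?case
    by (rule Ck_on_SucI[OF assms(1), where D="\<lambda>x v. h (D x v)"])
      (use bounded_linear.has_derivative[OF assms(2) D(1)] Suc.IH[OF D(2)] in auto)
qed

lemma Ck_on_id: assumes "fat S" shows "Ck_on n S (\<lambda>x. x)"
proof (cases n)
  case (Suc m)
  show ?thesis unfolding Suc
    by (rule Ck_on_SucI[OF assms, where D="\<lambda>x v. v"]) (auto intro: Ck_on_const[OF assms])
qed auto

lemma Ck_on_add: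
  assumes "fat S" "Ck_on n S f" "Ck_on n S g"
  shows "Ck_on n S (\<lambda>x. f x + g x)"
  using assms(2,3)
proof (induction n arbitrary: f g)
  case 0
  then show ?case by (auto intro: continuous_intros)
next
  case (Suc n)
  obtain D where D: "\<And>x. x \<in> S \<Longrightarrow> (f has_derivative D x) (at x within S)" "\<And>v. Ck_on n S (\<lambda>x. D x v)"
    using Suc.prems by (metis Ck_on_SucE)
  obtain E where E: "\<And>x. x \<in> S \<Longrightarrow> (g has_derivative E x) (at x within S)" "\<And>v. Ck_on n S (\<lambda>x. E x v)"
    using Suc.prems by (metis Ck_on_SucE)
  show ?case
    by (rule Ck_on_SucI[OF assms(1), where D="\<lambda>x v. D x v + E x v"])
      (use has_derivative_add[OF D(1) E(1)] Suc.IH[OF D(2) E(2)] in auto)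
qed

text \<open>The product rule gives two terms of the same bilinear shape, each with one factor
  differentiated and the other one still of class C^n, so the induction hypothesis covers
  both.\<close>

lemma Ck_on_bilinear:
  assumes "fat S" "bounded_bilinear p" "Ck_on n S f" "Ck_on n S g"
  shows "Ck_on n S (\<lambda>x. p (f x) (g x))"
  using assms(3,4)
proof (induction n arbitrary: f g)
  case 0
  then show ?case using bounded_bilinear.continuous_on[OF assms(2)] by auto
next
  case (Suc n)
  obtain D where D: "\<And>x. x \<in> S \<Longrightarrow> (f has_derivative D x) (at x within S)" "\<And>v. Ck_on n S (\<lambda>x. D x v)"
    using Suc.prems by (metis Ck_on_SucE)
  obtain E where E: "\<And>x. x \<in> S \<Longrightarrow> (g has_derivative E x) (at x within S)" "\<And>v. Ck_on n S (\<lambda>x. E x v)"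
    using Suc.prems by (metis Ck_on_SucE)
  have fg: "Ck_on n S f" "Ck_on n S g" using Suc.prems Ck_on_SucD by auto
  show ?case
    by (rule Ck_on_SucI[OF assms(1), where D="\<lambda>x v. p (f x) (E x v) + p (D x v) (g x)"])
      (use bounded_bilinear.FDERIV[OF assms(2) D(1) E(1)] Suc.IH[OF D(2) fg(2)] Suc.IH[OF fg(1) E(2)] 
         in \<open>auto intro!: Ck_on_add[OF assms(1)]\<close>)
qed

lemma Ck_on_sum:
  assumes "fat S" "finite I" "\<And>i. i \<in> I \<Longrightarrow> Ck_on n S (f i)"
  shows "Ck_on n S (\<lambda>x. \<Sum>i\<in>I. f i x)"
  using assms(2,3) by (induction I rule: finite_induct) (auto intro: Ck_on_const Ck_on_add assms(1))

text \<open>In the chain rule the derivative \<open>D\<close> is applied to a direction that varies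
  with x, while \<open>Ck_on\<close> controls only fixed directions. Expanding \<open>E x v\<close>
  in the finite basis restores fixed directions, with coefficients of class C^n.\<close>

lemma Ck_on_compose:
  fixes f :: "'b::euclidean_space \<Rightarrow> 'c::real_normed_vector" and g :: "'a::euclidean_space \<Rightarrow> 'b"
  assumes "fat S" "g ` S \<subseteq> T" "Ck_on n T f" "Ck_on n S g"
  shows "Ck_on n S (\<lambda>x. f (g x))"
  using assms(3,4)
proof (induction n arbitrary: f)
  case 0
  then show ?case using assms(2) by (auto intro: continuous_on_compose2)
next
  case (Suc n)
  obtain D where D: "\<And>x. x \<in> T \<Longrightarrow> (f has_derivative D x) (at x within T)" "\<And>v. Ck_on n T (\<lambda>x. D x v)"
    using Suc.prems by (metis Ck_on_SucE)
  obtain E where E: "\<And>x. x \<in> S \<Longrightarrow> (g has_derivative E x) (at x within S)" "\<And>v. Ck_on n S (\<lambda>x. E x v)"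
    using Suc.prems by (metis Ck_on_SucE)
  have g: "Ck_on n S g" using Suc.prems Ck_on_SucD by auto
  have "Ck_on n S (\<lambda>x. D (g x) (E x v))" for v
  proof -
    have *: "D (g x) (E x v) = (\<Sum>b\<in>Basis. (E x v \<bullet> b) *\<^sub>R D (g x) b)" if "x \<in> S" for x
    proof -
      have "linear (D (g x))" using D(1)[of "g x"] assms(2) that
        by (auto simp: has_derivative_def bounded_linear.linear)
      then have "D (g x) (\<Sum>b\<in>Basis. (E x v \<bullet> b) *\<^sub>R b) = (\<Sum>b\<in>Basis. (E x v \<bullet> b) *\<^sub>R D (g x) b)"
        by (simp add: linear_sum linear_scale)
      then show ?thesis by (simp only: euclidean_representation)
    qed
    have "Ck_on n S (\<lambda>x. \<Sum>b\<in>Basis. (E x v \<bullet> b) *\<^sub>R D (g x) b)"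
      by (intro Ck_on_sum Ck_on_bilinear[OF assms(1) bounded_bilinear_scaleR] assms(1) finite_Basis
          Ck_on_linear[OF assms(1) bounded_linear_inner_left] E(2) Suc.IH[OF D(2) g])
    then show ?thesis by (rule iffD1[OF Ck_on_cong, rotated]) (simp add: *)
  qed
  moreover have "((\<lambda>x. f (g x)) has_derivative (\<lambda>v. D (g x) (E x v))) (at x within S)" if "x \<in> S" for x
    using that assms(2) by (intro has_derivative_in_compose2[of T, OF D(1)] E(1)) auto
  ultimately show ?case by (intro Ck_on_SucI[OF assms(1)])
qed

lemma Ck_on_subset:
  fixes f :: "'a::euclidean_space \<Rightarrow> 'c::real_normed_vector"
  assumes "fat S" "S \<subseteq> T" "Ck_on n T f" shows "Ck_on n S f"
  using Ck_on_compose[OF assms(1) _ assms(3) Ck_on_id[OF assms(1)]] assms(2) by auto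

lemma Ck_on_mult:
  fixes f g :: "'a::euclidean_space \<Rightarrow> 'b::real_normed_algebra"
  assumes "fat S" "Ck_on n S f" "Ck_on n S g" shows "Ck_on n S (\<lambda>x. f x * g x)"
  by (rule Ck_on_bilinear[OF assms(1) bounded_bilinear_mult assms(2,3)])

lemma Ck_on_scaleR:
  assumes "fat S" "Ck_on n S f" "Ck_on n S g" shows "Ck_on n S (\<lambda>x. f x *\<^sub>R g x)"
  by (rule Ck_on_bilinear[OF assms(1) bounded_bilinear_scaleR assms(2,3)])

lemma Ck_on_inner:
  assumes "fat S" "Ck_on n S f" "Ck_on n S g" shows "Ck_on n S (\<lambda>x. f x \<bullet> g x)"
  by (rule Ck_on_bilinear[OF assms(1) bounded_bilinear_inner assms(2,3)])

lemma Ck_on_minus: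
  assumes "fat S" "Ck_on n S f" shows "Ck_on n S (\<lambda>x. - f x)"
  by (rule Ck_on_linear[OF assms(1) bounded_linear_minus[OF bounded_linear_ident] assms(2)])

lemma Ck_on_diff:
  assumes "fat S" "Ck_on n S f" "Ck_on n S g" shows "Ck_on n S (\<lambda>x. f x - g x)"
  using Ck_on_add[OF assms(1,2) Ck_on_minus[OF assms(1,3)]] by simp

lemma Ck_on_Pair:
  assumes "fat S" "Ck_on n S f" "Ck_on n S g" shows "Ck_on n S (\<lambda>x. (f x, g x))"
proof -
  have 1: "bounded_linear (\<lambda>y::'b. (y, 0::'c))" "bounded_linear (\<lambda>y::'c. (0::'b, y))"
    by (intro bounded_linear_Pair bounded_linear_ident bounded_linear_zero)+
  show ?thesis
    using Ck_on_add[OF assms(1) Ck_on_linear[OF assms(1) 1(1) assms(2)] Ck_on_linear[OF assms(1) 1(2) assms(3)]]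
    by simp
qed

lemma Ck_on_real_SucI:
  fixes f :: "real \<Rightarrow> 'b::real_normed_vector"
  assumes "fat S" "\<And>x. x \<in> S \<Longrightarrow> (f has_vector_derivative f' x) (at x within S)" "Ck_on n S f'"
  shows "Ck_on (Suc n) S f"
  by (rule Ck_on_SucI[OF assms(1), where D="\<lambda>x v. v *\<^sub>R f' x"])
    (use assms in \<open>auto simp: has_vector_derivative_def intro!: Ck_on_scaleR Ck_on_const\<close>)

lemma Ck_on_real_SucE:
  fixes f :: "real \<Rightarrow> 'b::real_normed_vector"
  assumes "Ck_on (Suc n) S f"
  obtains f' where "\<And>x. x \<in> S \<Longrightarrow> (f has_vector_derivative f' x) (at x within S)" "Ck_on n S f'"
proof -
  obtain D where D: "\<And>x. x \<in> S \<Longrightarrow> (f has_derivative D x) (at x within S)" "\<And>v. Ck_on n S (\<lambda>x. D x v)"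
    using assms by (metis Ck_on_SucE)
  have "(f has_vector_derivative D x 1) (at x within S)" if "x \<in> S" for x
  proof -
    have "linear (D x)" using D(1)[OF that] by (auto simp: has_derivative_def bounded_linear.linear)
    then have "D x (v *\<^sub>R 1) = v *\<^sub>R D x 1" for v by (rule linear_scale)
    then have "D x = (\<lambda>v. v *\<^sub>R D x 1)" by (intro ext) (metis mult.right_neutral real_scaleR_def)
    then show ?thesis using D(1)[OF that] by (simp add: has_vector_derivative_def)
  qed
  then show ?thesis by (rule that[of "\<lambda>x. D x 1", OF _ D(2)])
qed

lemmas Ck_intros = Ck_on_add Ck_on_mult Ck_on_scaleR Ck_on_inner Ck_on_minus Ck_on_diff Ck_on_Pair Ck_on_const Ck_on_id

lemma Ck_on_exp: "Ck_on n (UNIV::real set) (exp :: real \<Rightarrow> real)"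
proof (induction n)
  case 0
  show ?case by (simp add: continuous_on_exp continuous_on_id)
next
  case (Suc n)
  have "(exp has_vector_derivative exp x) (at x)" for x :: real
    using DERIV_exp[of x] by (simp add: has_real_derivative_iff_has_vector_derivative)
  then show ?case by (rule Ck_on_real_SucI[OF fat_open[OF open_UNIV] _ Suc])
qed

lemma has_vector_derivative_cis: "(cis has_vector_derivative \<i> * cis x) (at x within S)"
  unfolding has_vector_derivative_def
  by (rule has_derivative_eq_rhs[OF has_derivative_cis[OF has_derivative_ident]]) (auto simp: fun_eq_iff scaleR_conv_of_real)

lemma Ck_on_cis: "Ck_on n (UNIV::real set) cis"
proof (induction n)
  case 0
  have "continuous_on UNIV cis"
    using has_vector_derivative_cis by (intro continuous_at_imp_continuous_on ballI has_vector_derivative_continuous)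
  then show ?case by simp
next
  case (Suc n)
  have "Ck_on n UNIV (\<lambda>x. \<i> * cis x)" by (intro Ck_on_mult Ck_on_const Suc fat_open) auto
  then show ?case
    by (rule Ck_on_real_SucI[OF fat_open[OF open_UNIV] has_vector_derivative_cis])
qed

text \<open>The derivative is minus the product of \<open>inverse\<close> with itself, so the
  induction closes on \<open>inverse\<close> alone.\<close>

lemma Ck_on_inverse: "Ck_on n (- {0}::real set) inverse"
proof (induction n)
  case 0
  show ?case by (simp add: continuous_on_inverse continuous_on_id)
next
  case (Suc n)
  have f: "fat (- {0}::real set)" by (intro fat_open open_Compl closed_singleton)
  have d: "Ck_on n (- {0}) (\<lambda>x. - (inverse x * inverse x) :: real)" by (intro Ck_on_minus Ck_on_mult Suc f)
  have "(inverse has_vector_derivative - (inverse x * inverse x)) (at x within - {0})" if "x \<in> - {0}" for x :: real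
    using DERIV_inverse[of x] that has_field_derivative_at_within
    by (fastforce simp: has_real_derivative_iff_has_vector_derivative[symmetric] power2_eq_square)
  then show ?case by (rule Ck_on_real_SucI[OF f _ d])
qed

lemma Ck_on_divide:
  fixes f g :: "'a::euclidean_space \<Rightarrow> real"
  assumes "fat S" "Ck_on n S f" "Ck_on n S g" "\<And>x. x \<in> S \<Longrightarrow> g x \<noteq> 0"
  shows "Ck_on n S (\<lambda>x. f x / g x)"
proof -
  have "Ck_on n S (\<lambda>x. inverse (g x))"
    by (rule Ck_on_compose[OF assms(1) _ Ck_on_inverse assms(3)]) (use assms(4) in auto)
  then show ?thesis unfolding divide_inverse using assms by (intro Ck_on_mult)
qed

section \<open>Joint smoothness in one space and one time variable\<close>

lemma has_derivative_partials:
  fixes f :: "real \<Rightarrow> real \<Rightarrow> 'b::real_normed_vector"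
  assumes J: "convex J" "t \<in> J"
    and fx: "((\<lambda>x. f x t) has_vector_derivative fx) (at x)"
    and ft: "\<And>x t. t \<in> J \<Longrightarrow> ((\<lambda>t. f x t) has_vector_derivative ft x t) (at t within J)"
    and cont: "continuous_on (UNIV \<times> J) (\<lambda>(x, t). ft x t)"
  shows "((\<lambda>(x, t). f x t) has_derivative (\<lambda>v. fst v *\<^sub>R fx + snd v *\<^sub>R ft x t)) (at (x, t) within UNIV \<times> J)"
proof -
  have "((\<lambda>(x, t). f x t) has_derivative
      (\<lambda>(vx, vt). vx *\<^sub>R fx + blinfun_apply (blinfun_scaleR_left (ft x t)) vt)) (at (x, t) within UNIV \<times> J)"
  proof (rule has_derivative_partialsI)
    show "((\<lambda>x. f x t) has_derivative (\<lambda>vx. vx *\<^sub>R fx)) (at x within UNIV)"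
      using fx by (simp add: has_vector_derivative_def)
    show "((\<lambda>y. f x y) has_derivative blinfun_apply (blinfun_scaleR_left (ft x y))) (at y within J)"
      if "y \<in> J" for x y
      using ft[OF that, of x] by (simp add: has_vector_derivative_def)
    have "continuous_on (UNIV \<times> J) (\<lambda>p. blinfun_scaleR_left ((\<lambda>(x, t). ft x t) p))"
      by (rule bounded_linear.continuous_on[OF bounded_linear_blinfun_scaleR_left cont])
    then have "continuous_on (UNIV \<times> J) (\<lambda>(x, t). blinfun_scaleR_left (ft x t))"
      by (simp add: case_prod_unfold)
    then show "continuous (at (x, t) within UNIV \<times> J) (\<lambda>(x, y). blinfun_scaleR_left (ft x y))"
      using J(2) by (auto simp: continuous_on_eq_continuous_within)
  qed (rule J)+
  then show ?thesis by (simp add: case_prod_unfold)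
qed

text \<open>The chain rule along a moving point; it gives the velocity of a curve point whose angle
  is transported while the curve itself moves.\<close>

lemma has_vector_derivative_along:
  fixes f :: "real \<Rightarrow> real \<Rightarrow> 'b::real_normed_vector"
  assumes J: "convex J" "t \<in> J"
    and fx: "((\<lambda>x. f x t) has_vector_derivative fx) (at (A t))"
    and ft: "\<And>x t. t \<in> J \<Longrightarrow> ((\<lambda>t. f x t) has_vector_derivative ft x t) (at t within J)"
    and cont: "continuous_on (UNIV \<times> J) (\<lambda>(x, t). ft x t)"
    and A: "(A has_real_derivative A') (at t within J)"
  shows "((\<lambda>t. f (A t) t) has_vector_derivative A' *\<^sub>R fx + ft (A t) t) (at t within J)"
proof -
  have P: "((\<lambda>t. (A t, t)) has_derivative (\<lambda>h. (A' * h, h))) (at t within J)"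
    using A by (intro has_derivative_Pair has_derivative_ident) (simp add: has_field_derivative_def)
  have "((\<lambda>(x, t). f x t) has_derivative (\<lambda>v. fst v *\<^sub>R fx + snd v *\<^sub>R ft (A t) t)) (at (A t, t) within (\<lambda>t. (A t, t)) ` J)"
    by (rule has_derivative_subset[OF has_derivative_partials[OF J fx ft cont]]) auto
  from has_derivative_in_compose[OF P this] show ?thesis
    by (simp add: has_vector_derivative_def algebra_simps)
qed

text \<open>The bootstrapping rule for everything that solves an equation: heat series, flows,
  integrals and the length have partial derivatives that are built from functions already known to
  be of class C^n.\<close>

lemma Ck_on_partialsI:
  fixes f :: "real \<Rightarrow> real \<Rightarrow> 'b::real_normed_vector"
  assumes J: "convex J" "fat J"
    and fx: "\<And>x t. t \<in> J \<Longrightarrow> ((\<lambda>x. f x t) has_vector_derivative fx x t) (at x)"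
    and ft: "\<And>x t. t \<in> J \<Longrightarrow> ((\<lambda>t. f x t) has_vector_derivative ft x t) (at t within J)"
    and Ck: "Ck_on n (UNIV \<times> J) (\<lambda>(x, t). fx x t)" "Ck_on n (UNIV \<times> J) (\<lambda>(x, t). ft x t)"
  shows "Ck_on (Suc n) (UNIV \<times> J) (\<lambda>(x, t). f x t)"
proof -
  have fat: "fat (UNIV \<times> J)" by (intro fat_Times fat_open[OF open_UNIV] J(2))
  show ?thesis
  proof (rule Ck_on_SucI[OF fat, where D="\<lambda>p v. fst v *\<^sub>R fx (fst p) (snd p) + snd v *\<^sub>R ft (fst p) (snd p)"])
    fix p :: "real \<times> real" assume p: "p \<in> UNIV \<times> J"
    then show "((\<lambda>(x, t). f x t) has_derivative
        (\<lambda>v. fst v *\<^sub>R fx (fst p) (snd p) + snd v *\<^sub>R ft (fst p) (snd p))) (at p within UNIV \<times> J)"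
      using has_derivative_partials[OF J(1) _ fx ft Ck_on_imp_cont[OF Ck(2)], of "snd p" "fst p"] by auto
  next
    fix v :: "real \<times> real"
    show "Ck_on n (UNIV \<times> J) (\<lambda>x. fst v *\<^sub>R fx (fst x) (snd x) + snd v *\<^sub>R ft (fst x) (snd x))"
      using Ck by (intro Ck_on_add Ck_on_scaleR Ck_on_const fat) (simp_all add: case_prod_unfold)
  qed
qed

lemma Ck_on_partialsE:
  fixes f :: "real \<Rightarrow> real \<Rightarrow> 'b::real_normed_vector"
  assumes "Ck_on (Suc n) (UNIV \<times> J) (\<lambda>(x, t). f x t)"
  obtains fx ft where "\<And>x t. t \<in> J \<Longrightarrow> ((\<lambda>x. f x t) has_vector_derivative fx x t) (at x)"
    "\<And>x t. t \<in> J \<Longrightarrow> ((\<lambda>t. f x t) has_vector_derivative ft x t) (at t within J)"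
    "Ck_on n (UNIV \<times> J) (\<lambda>(x, t). fx x t)" "Ck_on n (UNIV \<times> J) (\<lambda>(x, t). ft x t)"
proof -
  obtain D where D: "\<And>p. p \<in> UNIV \<times> J \<Longrightarrow> ((\<lambda>(x, t). f x t) has_derivative D p) (at p within UNIV \<times> J)"
    "\<And>v. Ck_on n (UNIV \<times> J) (\<lambda>p. D p v)"
    using Ck_on_SucE[OF assms] by blast
  have lin: "linear (D (x, t))" if "t \<in> J" for x t
    using D(1)[of "(x, t)"] that by (auto simp: has_derivative_def bounded_linear.linear)
  have 1: "((\<lambda>x. f x t) has_vector_derivative D (x, t) (1, 0)) (at x)" if "t \<in> J" for x t
  proof -
    have "((\<lambda>x. (\<lambda>(x, t). f x t) (x, t)) has_derivative (\<lambda>h. D (x, t) (h, 0))) (at x within UNIV)"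
      by (rule has_derivative_in_compose2[of "UNIV \<times> J", OF D(1)])
        (use that in \<open>auto intro!: derivative_eq_intros\<close>)
    moreover have "(\<lambda>h. D (x, t) (h, 0)) = (\<lambda>h. h *\<^sub>R D (x, t) (1, 0))"
    proof (rule ext)
      fix h show "D (x, t) (h, 0) = h *\<^sub>R D (x, t) (1, 0)"
        using linear_scale[OF lin[OF that, of x], of h "(1, 0)"] by simp
    qed
    ultimately show ?thesis by (simp only: has_vector_derivative_def case_prod_conv)
  qed
  have 2: "((\<lambda>t. f x t) has_vector_derivative D (x, t) (0, 1)) (at t within J)" if "t \<in> J" for x t
  proof -
    have "((\<lambda>t. (\<lambda>(x, t). f x t) (x, t)) has_derivative (\<lambda>h. D (x, t) (0, h))) (at t within J)"
      by (rule has_derivative_in_compose2[of "UNIV \<times> J", OF D(1)])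
        (use that in \<open>auto intro!: derivative_eq_intros\<close>)
    moreover have "(\<lambda>h. D (x, t) (0, h)) = (\<lambda>h. h *\<^sub>R D (x, t) (0, 1))"
    proof (rule ext)
      fix h show "D (x, t) (0, h) = h *\<^sub>R D (x, t) (0, 1)"
        using linear_scale[OF lin[OF that, of x], of h "(0, 1)"] by simp
    qed
    ultimately show ?thesis by (simp only: has_vector_derivative_def case_prod_conv)
  qed
  have 3: "Ck_on n (UNIV \<times> J) (\<lambda>(x, t). D (x, t) v)" for v
    using D(2)[of v] by (simp add: case_prod_unfold)
  show ?thesis
    by (rule that[of "\<lambda>x t. D (x, t) (1, 0)" "\<lambda>x t. D (x, t) (0, 1)", OF 1 2 3 3])
qed

text \<open>The intervals are open on the right, so every time in J is followed by a later one; near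
  t, the set J then agrees with a compact interval {0..b}, on which the theorems on integrals
  apply.\<close>

definition time_interval :: "real set \<Rightarrow> bool" where
  "time_interval J \<longleftrightarrow> J = {0..} \<or> (\<exists>T>0. J = {0..<T})"

lemma time_intervalD:
  assumes "time_interval J"
  shows "convex J" "fat J" "0 \<in> J" "\<And>t. t \<in> J \<Longrightarrow> 0 \<le> t" "\<And>t. t \<in> J \<Longrightarrow> {0..t} \<subseteq> J"
    "\<And>t. t \<in> J \<Longrightarrow> \<exists>b\<in>J. t < b"
proof -
  show c: "convex J" using assms by (auto simp: time_interval_def)
  show b: "\<exists>b\<in>J. t < b" if "t \<in> J" for t
    using assms unfolding time_interval_def
  proof (elim disjE exE conjE)
    assume "J = {0..}" then show ?thesis using that by (intro bexI[of _ "t + 1"]) auto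
  next
    fix T assume "J = {0..<T}" then show ?thesis using that by (intro bexI[of _ "(t + T) / 2"]) auto
  qed
  show z: "0 \<in> J" "\<And>t. t \<in> J \<Longrightarrow> 0 \<le> t" "\<And>t. t \<in> J \<Longrightarrow> {0..t} \<subseteq> J"
    using assms by (auto simp: time_interval_def)
  show "fat J" using fat_real_convex[OF c z(1)] b[OF z(1)] by blast
qed

lemma time_interval_fat: "time_interval J \<Longrightarrow> fat ((UNIV::real set) \<times> J)"
  using time_intervalD(2) by (intro fat_Times fat_open[OF open_UNIV])

lemma at_within_time_interval:
  assumes "time_interval J" "t \<in> J" "b \<in> J" "t < b"
  shows "at t within {0..b} = at t within J"
  by (rule at_within_nhd[of _ "{..<b}"]) (use assms time_intervalD[OF assms(1)] in auto)

lemma integral_within_time_interval: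
  fixes f :: "real \<Rightarrow> 'b::banach"
  assumes J: "time_interval J" "t \<in> J" and f: "continuous_on J f"
  shows "((\<lambda>t. integral {0..t} f) has_vector_derivative f t) (at t within J)"
proof -
  obtain b where b: "b \<in> J" "t < b" using time_intervalD(6)[OF J] by blast
  have "continuous_on {0..b} f" using f time_intervalD(5)[OF J(1) b(1)] by (rule continuous_on_subset)
  from integral_has_vector_derivative[OF this, of t] show ?thesis
    using b time_intervalD(4)[OF J] at_within_time_interval[OF J b] by auto
qed

lemma continuous_on_slice1:
  assumes "continuous_on (S \<times> J) (\<lambda>(x, t). f x t)" "A \<subseteq> J" "x \<in> S"
  shows "continuous_on A (f x)"
proof -
  have "continuous_on A (\<lambda>t. (\<lambda>(x, t). f x t) (x, t))"
    by (rule continuous_on_compose2[OF assms(1)]) (use assms in \<open>auto intro!: continuous_intros\<close>)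
  then show ?thesis by simp
qed

lemma continuous_on_slice2:
  assumes "continuous_on (S \<times> J) (\<lambda>(x, t). f x t)" "t \<in> J" "A \<subseteq> S"
  shows "continuous_on A (\<lambda>x. f x t)"
proof -
  have "continuous_on A (\<lambda>x. (\<lambda>(x, t). f x t) (x, t))"
    by (rule continuous_on_compose2[OF assms(1)]) (use assms in \<open>auto intro!: continuous_intros\<close>)
  then show ?thesis by simp
qed

text \<open>The derivative in t is the integrand itself, and the derivative in x is the time
  integral of \<open>fx\<close>, to which the induction hypothesis applies.\<close>

lemma Ck_on_time_integral:
  fixes f :: "real \<Rightarrow> real \<Rightarrow> 'b::euclidean_space"
  assumes J: "time_interval J" and "Ck_on n (UNIV \<times> J) (\<lambda>(x, t). f x t)"
  shows "Ck_on n (UNIV \<times> J) (\<lambda>(x, t). integral {0..t} (f x))"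
  using assms(2)
proof (induction n arbitrary: f)
  case 0
  note TI = time_intervalD[OF J]
  have cf: "continuous_on (UNIV \<times> J) (\<lambda>(x, t). f x t)" using 0 by simp
  \<comment> \<open>The substitution s = r * t moves the variable end point into the integrand; over
    the fixed interval {0..1} continuity in the parameters is available.\<close>
  have eq: "integral {0..t} (f x) = integral (cbox 0 1) (\<lambda>r. t *\<^sub>R f x (r * t))" if "t \<in> J" for x t
  proof -
    have c: "continuous_on {0..t} (f x)" by (rule continuous_on_slice1[OF cf TI(5)[OF that] UNIV_I])
    have "((\<lambda>r. t *\<^sub>R f x (r * t)) has_integral integral {0 * t..1 * t} (f x)) {0..1}"
      by (rule has_integral_substitution[of 0 1 "\<lambda>r. r * t" 0 t])
        (use c TI(4)[OF that] in \<open>auto intro!: derivative_eq_intros mult_left_le_one_le\<close>)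
    from integral_unique[OF this] show ?thesis by simp
  qed
  have "continuous_on ((UNIV \<times> J) \<times> cbox 0 1) (\<lambda>(p, r). snd p *\<^sub>R f (fst p) (r * snd p))"
  proof -
    have "continuous_on ((UNIV \<times> J) \<times> cbox 0 1)
        (\<lambda>z. (\<lambda>(x, t). f x t) (fst (fst z), snd z * snd (fst z)))"
    proof (rule continuous_on_compose2[OF cf])
      show "(\<lambda>z. (fst (fst z), snd z * snd (fst z))) ` ((UNIV \<times> J) \<times> cbox 0 1) \<subseteq> UNIV \<times> J"
      proof clarsimp
        fix t r :: real assume t: "t \<in> J" and r: "0 \<le> r" "r \<le> 1"
        have "r * t \<in> {0..t}" using TI(4)[OF t] r by (auto intro: mult_left_le_one_le)
        then show "r * t \<in> J" using TI(5)[OF t] by blast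
      qed
    qed (intro continuous_intros)
    then have "continuous_on ((UNIV \<times> J) \<times> cbox 0 1)
        (\<lambda>z. snd (fst z) *\<^sub>R (\<lambda>(x, t). f x t) (fst (fst z), snd z * snd (fst z)))"
      by (intro continuous_intros)
    then show ?thesis by (simp add: case_prod_unfold)
  qed
  then have "continuous_on (UNIV \<times> J) (\<lambda>p. integral (cbox 0 1) (\<lambda>r. snd p *\<^sub>R f (fst p) (r * snd p)))"
    by (rule integral_continuous_on_param)
  then have "continuous_on (UNIV \<times> J) (\<lambda>p. integral {0..snd p} (f (fst p)))"
    by (rule continuous_on_eq) (metis eq mem_Times_iff)
  then show ?case by (simp add: case_prod_unfold)
next
  case (Suc n)
  note TI = time_intervalD[OF J]
  obtain fx ft where f: "\<And>x t. t \<in> J \<Longrightarrow> ((\<lambda>x. f x t) has_vector_derivative fx x t) (at x)"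
    "\<And>x t. t \<in> J \<Longrightarrow> ((\<lambda>t. f x t) has_vector_derivative ft x t) (at t within J)"
    "Ck_on n (UNIV \<times> J) (\<lambda>(x, t). fx x t)" "Ck_on n (UNIV \<times> J) (\<lambda>(x, t). ft x t)"
    using Ck_on_partialsE[OF Suc.prems] by metis
  have cf: "continuous_on (UNIV \<times> J) (\<lambda>(x, t). f x t)" using Ck_on_imp_cont[OF Suc.prems] .
  have cfx: "continuous_on (UNIV \<times> J) (\<lambda>(x, t). fx x t)" using Ck_on_imp_cont[OF f(3)] .
  show ?case
  proof (rule Ck_on_partialsI[OF TI(1,2)])
    fix x t assume t: "t \<in> J"
    have c: "continuous_on J (f x)" by (rule continuous_on_slice1[OF cf order_refl UNIV_I])
    show "((\<lambda>t. integral {0..t} (f x)) has_vector_derivative f x t) (at t within J)"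
      by (rule integral_within_time_interval[OF J t c])
    have "((\<lambda>x. integral (cbox 0 t) (f x)) has_vector_derivative integral (cbox 0 t) (fx x)) (at x within UNIV)"
    proof (rule leibniz_rule_vector_derivative)
      show "((\<lambda>x. f x s) has_vector_derivative fx x s) (at x within UNIV)" if "s \<in> cbox 0 t" for x s
        using f(1)[of s x] that TI(5)[OF t] by auto
      show "f x integrable_on cbox 0 t" for x
        using continuous_on_slice1[OF cf TI(5)[OF t] UNIV_I] by (intro integrable_continuous) simp
      show "continuous_on (UNIV \<times> cbox 0 t) (\<lambda>(x, t). fx x t)"
        using TI(5)[OF t] by (intro continuous_on_subset[OF cfx]) auto
    qed auto
    then show "((\<lambda>x. integral {0..t} (f x)) has_vector_derivative integral {0..t} (fx x)) (at x)" by simp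
  next
    show "Ck_on n (UNIV \<times> J) (\<lambda>(x, t). integral {0..t} (fx x))" by (rule Suc.IH[OF f(3)])
    show "Ck_on n (UNIV \<times> J) (\<lambda>(x, t). f x t)" using Suc.prems by (rule Ck_on_SucD)
  qed
qed

text \<open>The dummy variable x keeps a function of time alone inside the two-variable
  calculus.\<close>

lemma Ck_on_space_integral:
  fixes f :: "real \<Rightarrow> real \<Rightarrow> 'b::euclidean_space"
  assumes J: "time_interval J" and "Ck_on n (UNIV \<times> J) (\<lambda>(x, t). f x t)"
  shows "Ck_on n (UNIV \<times> J) (\<lambda>(x::real, t). integral {a..b} (\<lambda>y. f y t))"
  using assms(2)
proof (induction n arbitrary: f)
  case 0
  have "continuous_on ((UNIV \<times> J) \<times> cbox a b) (\<lambda>z::(real \<times> real) \<times> real. (\<lambda>(x, t). f x t) (snd z, snd (fst z)))"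
    by (rule continuous_on_compose2[OF 0[simplified]]) (auto intro!: continuous_intros)
  then have "continuous_on (UNIV \<times> J) (\<lambda>p::real \<times> real. integral (cbox a b) (\<lambda>y. f y (snd p)))"
    by (intro integral_continuous_on_param) (simp add: case_prod_beta)
  then show ?case by (simp add: case_prod_unfold)
next
  case (Suc n)
  note TI = time_intervalD[OF J]
  obtain fx ft where f: "\<And>x t. t \<in> J \<Longrightarrow> ((\<lambda>x. f x t) has_vector_derivative fx x t) (at x)"
    "\<And>x t. t \<in> J \<Longrightarrow> ((\<lambda>t. f x t) has_vector_derivative ft x t) (at t within J)"
    "Ck_on n (UNIV \<times> J) (\<lambda>(x, t). fx x t)" "Ck_on n (UNIV \<times> J) (\<lambda>(x, t). ft x t)"
    using Ck_on_partialsE[OF Suc.prems] by metis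
  have cf: "continuous_on (UNIV \<times> J) (\<lambda>(x, t). f x t)" using Ck_on_imp_cont[OF Suc.prems] .
  have cft: "continuous_on (UNIV \<times> J) (\<lambda>(x, t). ft x t)" using Ck_on_imp_cont[OF f(4)] .
  show ?case
  proof (rule Ck_on_partialsI[OF TI(1,2)])
    fix x t :: real assume t: "t \<in> J"
    have "((\<lambda>t. integral (cbox a b) (\<lambda>y. f y t)) has_vector_derivative integral (cbox a b) (\<lambda>y. ft y t)) (at t within J)"
    proof (rule leibniz_rule_vector_derivative[OF _ _ _ t TI(1)])
      show "((\<lambda>t. f y t) has_vector_derivative ft y t) (at t within J)" if "t \<in> J" for t y
        using f(2)[OF that] .
      show "(\<lambda>y. f y t) integrable_on cbox a b" if "t \<in> J" for t
        by (intro integrable_continuous continuous_on_slice2[OF cf that subset_UNIV])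
      have "continuous_on (J \<times> cbox a b) (\<lambda>z. (\<lambda>(x, t). ft x t) (snd z, fst z))"
        by (rule continuous_on_compose2[OF cft]) (auto intro!: continuous_intros)
      then show "continuous_on (J \<times> cbox a b) (\<lambda>(t, y). ft y t)" by (simp add: case_prod_unfold)
    qed
    then show "((\<lambda>t. integral {a..b} (\<lambda>y. f y t)) has_vector_derivative integral {a..b} (\<lambda>y. ft y t)) (at t within J)"
      by simp
    show "((\<lambda>x. integral {a..b} (\<lambda>y. f y t)) has_vector_derivative 0) (at x)" by simp
  next
    show "Ck_on n (UNIV \<times> J) (\<lambda>(x::real, t). integral {a..b} (\<lambda>y. ft y t))" by (rule Suc.IH[OF f(4)])
    show "Ck_on n (UNIV \<times> J) (\<lambda>(x::real, t). 0)"
      using Ck_on_const[OF time_interval_fat[OF J], of n 0] by (simp add: case_prod_unfold)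
  qed
qed

subsection \<open>Fourier series solving the heat equation\<close>

text \<open>The decay of the Fourier coefficients of a smooth periodic function, phrased as
  summability so that it serves directly as a majorant for the series and all its
  derivatives.\<close>

definition rapid :: "(nat \<Rightarrow> complex) \<Rightarrow> bool" where
  "rapid c \<longleftrightarrow> (\<forall>p. summable (\<lambda>n. real n ^ p * norm (c n)))"

text \<open>The functions are real, so one complex coefficient per frequency n >= 0 encodes both the
  cosine and the sine mode.\<close>

definition hterm :: "(nat \<Rightarrow> complex) \<Rightarrow> nat \<Rightarrow> real \<Rightarrow> real \<Rightarrow> real" where
  "hterm c n \<theta> t = exp (- (real n)\<^sup>2 * t) * Re (c n * cis (real n * \<theta>))"

definition hsum :: "(nat \<Rightarrow> complex) \<Rightarrow> real \<Rightarrow> real \<Rightarrow> real" where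
  "hsum c \<theta> t = (\<Sum>n. hterm c n \<theta> t)"

text \<open>The Fourier multiplier of the derivative in \<theta>. Applied twice it is - n^2, which
  is also the multiplier of the derivative in t.\<close>

definition dcoef :: "(nat \<Rightarrow> complex) \<Rightarrow> nat \<Rightarrow> complex" where
  "dcoef c n = \<i> * of_nat n * c n"

lemma norm_dcoef: "norm (dcoef c n) = real n * norm (c n)"
  by (simp add: dcoef_def norm_mult)

lemma rapid_summable: "rapid c \<Longrightarrow> summable (\<lambda>n. norm (c n))"
  unfolding rapid_def by (drule spec[of _ 0]) simp

lemma rapid_dcoef: "rapid c \<Longrightarrow> rapid (dcoef c)"
  unfolding rapid_def
proof
  fix p assume "\<forall>p. summable (\<lambda>n. real n ^ p * norm (c n))"
  then have "summable (\<lambda>n. real n ^ Suc p * norm (c n))" by blast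
  then show "summable (\<lambda>n. real n ^ p * norm (dcoef c n))" by (simp add: norm_dcoef mult_ac)
qed

lemma rapid_add: assumes "rapid c" "rapid d" shows "rapid (\<lambda>n. c n + d n)"
  unfolding rapid_def
proof
  fix p
  have s: "summable (\<lambda>n. real n ^ p * norm (c n) + real n ^ p * norm (d n))"
    using assms by (intro summable_add) (auto simp: rapid_def)
  show "summable (\<lambda>n. real n ^ p * norm (c n + d n))"
    by (rule summable_comparison_test'[OF s, of 0])
      (simp add: abs_mult distrib_left[symmetric] mult_left_mono norm_triangle_ineq)
qed

lemma hterm_bound: "t \<ge> 0 \<Longrightarrow> \<bar>hterm c n \<theta> t\<bar> \<le> norm (c n)"
proof -
  assume t: "t \<ge> 0"
  have "\<bar>hterm c n \<theta> t\<bar> = exp (- (real n)\<^sup>2 * t) * \<bar>Re (c n * cis (real n * \<theta>))\<bar>"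
    by (simp add: hterm_def abs_mult)
  also have "\<dots> \<le> 1 * norm (c n * cis (real n * \<theta>))"
    using t by (intro mult_mono abs_Re_le_cmod) auto
  finally show ?thesis by (simp add: norm_mult)
qed

lemma hterm_summable: "rapid c \<Longrightarrow> t \<ge> 0 \<Longrightarrow> summable (\<lambda>n. hterm c n \<theta> t)"
  by (rule summable_comparison_test'[OF rapid_summable, of _ 0]) (auto simp: hterm_bound)

lemma hsum_sums: "rapid c \<Longrightarrow> t \<ge> 0 \<Longrightarrow> (\<lambda>n. hterm c n \<theta> t) sums hsum c \<theta> t"
  unfolding hsum_def by (rule summable_sums[OF hterm_summable])

lemma hsum_add:
  assumes "rapid c" "rapid d" "t \<ge> 0"
  shows "hsum (\<lambda>n. c n + d n) \<theta> t = hsum c \<theta> t + hsum d \<theta> t"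
proof -
  have "hterm (\<lambda>n. c n + d n) n \<theta> t = hterm c n \<theta> t + hterm d n \<theta> t" for n
    by (simp add: hterm_def algebra_simps)
  then show ?thesis unfolding hsum_def
    by (simp add: suminf_add[OF hterm_summable hterm_summable] assms)
qed

lemma hsum_uniform_limit:
  assumes "rapid c" "\<And>p. p \<in> A \<Longrightarrow> snd p \<ge> 0"
  shows "uniform_limit A (\<lambda>N p. \<Sum>n<N. hterm c n (fst p) (snd p)) (\<lambda>p. hsum c (fst p) (snd p)) sequentially"
  unfolding hsum_def
  by (rule Weierstrass_m_test[OF _ rapid_summable[OF assms(1)]]) (use assms(2) hterm_bound in auto)

lemma hterm_continuous: "continuous_on A (\<lambda>p. hterm c n (fst p) (snd p))"
  unfolding hterm_def by (intro continuous_intros)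

lemma hsum_continuous:
  assumes "rapid c" shows "continuous_on (UNIV \<times> {0..}) (\<lambda>(\<theta>, t). hsum c \<theta> t)"
proof -
  have "continuous_on (UNIV \<times> {0..}) (\<lambda>p. hsum c (fst p) (snd p))"
    by (rule uniform_limit_theorem[OF _ hsum_uniform_limit[OF assms]])
      (auto intro!: always_eventually continuous_on_sum hterm_continuous)
  then show ?thesis by (simp add: case_prod_unfold)
qed

lemma hterm_dtheta: "((\<lambda>\<theta>. hterm c n \<theta> t) has_real_derivative hterm (dcoef c) n \<theta> t) (at \<theta> within A)"
proof -
  have "((\<lambda>\<theta>. cis (real n * \<theta>)) has_vector_derivative (real n *\<^sub>R (\<i> * cis (real n * \<theta>)))) (at \<theta> within A)"
    using vector_diff_chain_within[OF _ has_vector_derivative_cis, of "\<lambda>\<theta>. real n * \<theta>" "real n" \<theta> A]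
    by (auto simp: o_def has_real_derivative_iff_has_vector_derivative[symmetric] intro!: derivative_eq_intros)
  then have "((\<lambda>\<theta>. Re (c n * cis (real n * \<theta>))) has_vector_derivative
      Re (c n * (real n *\<^sub>R (\<i> * cis (real n * \<theta>))))) (at \<theta> within A)"
    by (intro bounded_linear.has_vector_derivative[OF bounded_linear_Re]
        bounded_linear.has_vector_derivative[OF bounded_linear_mult_right])
  then have "((\<lambda>\<theta>. Re (c n * cis (real n * \<theta>))) has_real_derivative
      Re (dcoef c n * cis (real n * \<theta>))) (at \<theta> within A)"
    by (simp add: has_real_derivative_iff_has_vector_derivative dcoef_def scaleR_conv_of_real mult_ac)
  from DERIV_cmult[OF this] show ?thesis unfolding hterm_def .
qed

lemma hterm_dt: "((\<lambda>t. hterm c n \<theta> t) has_real_derivative hterm (dcoef (dcoef c)) n \<theta> t) (at t within A)"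
proof -
  have e: "dcoef (dcoef c) n = of_real (- (real n)\<^sup>2) * c n"
    by (simp add: dcoef_def power2_eq_square complex_eq_iff)
  show ?thesis unfolding hterm_def e
    by (rule derivative_eq_intros | simp add: algebra_simps)+
qed

lemma hsum_series_derivative:
  fixes F :: "nat \<Rightarrow> real \<Rightarrow> real"
  assumes "convex S" "x \<in> S"
    "\<And>n x. x \<in> S \<Longrightarrow> (F n has_real_derivative F' n x) (at x within S)"
    "\<And>n x. x \<in> S \<Longrightarrow> \<bar>F' n x\<bar> \<le> M n" "summable M" "\<And>x. x \<in> S \<Longrightarrow> summable (\<lambda>n. F n x)"
  shows "((\<lambda>x. \<Sum>n. F n x) has_real_derivative (\<Sum>n. F' n x)) (at x within S)"
proof -
  have ul: "uniform_limit S (\<lambda>n x. \<Sum>i<n. F' i x) (\<lambda>x. \<Sum>n. F' n x) sequentially"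
    by (rule Weierstrass_m_test[OF _ assms(5)]) (simp add: assms(4))
  obtain g where g: "\<And>x. x \<in> S \<Longrightarrow> (\<lambda>n. F n x) sums g x"
    "\<And>x. x \<in> S \<Longrightarrow> (g has_field_derivative (\<Sum>n. F' n x)) (at x within S)"
    using has_field_derivative_series[OF assms(1,3) ul assms(2) assms(6)[OF assms(2)]] by blast
  show ?thesis unfolding has_field_derivative_def
    by (rule has_derivative_transform[OF assms(2) _ g(2)[OF assms(2), unfolded has_field_derivative_def]])
      (use sums_unique[OF g(1)] in auto)
qed

lemma hsum_dtheta:
  assumes "rapid c" "t \<ge> 0"
  shows "((\<lambda>\<theta>. hsum c \<theta> t) has_real_derivative hsum (dcoef c) \<theta> t) (at \<theta>)"
  unfolding hsum_def
  by (rule hsum_series_derivative[OF convex_UNIV UNIV_I hterm_dtheta _ rapid_summable[OF rapid_dcoef[OF assms(1)]]])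
    (auto simp: hterm_bound assms intro: hterm_summable)

lemma hsum_dt:
  assumes "rapid c" "t \<ge> 0"
  shows "((\<lambda>t. hsum c \<theta> t) has_real_derivative hsum (dcoef (dcoef c)) \<theta> t) (at t within {0..})"
  unfolding hsum_def
  by (rule hsum_series_derivative[OF _ _ hterm_dt _ rapid_summable[OF rapid_dcoef[OF rapid_dcoef[OF assms(1)]]]])
    (auto simp: hterm_bound assms intro: hterm_summable)

lemma time_interval_Ici: "time_interval {0..}"
  by (simp add: time_interval_def)

text \<open>Both partial derivatives of a series are series of the same kind with other rapidly
  decaying coefficients, so an induction with arbitrary \<open>c\<close> gives all orders.\<close>

lemma Ck_on_hsum: "rapid c \<Longrightarrow> Ck_on k (UNIV \<times> {0..}) (\<lambda>(\<theta>, t). hsum c \<theta> t)"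
proof (induction k arbitrary: c)
  case 0
  then show ?case by (simp add: hsum_continuous)
next
  case (Suc k)
  note r = rapid_dcoef[OF Suc.prems]
  show ?case
    by (rule Ck_on_partialsI[OF time_intervalD(1,2)[OF time_interval_Ici] _ _ Suc.IH[OF r] Suc.IH[OF rapid_dcoef[OF r]]])
      (use hsum_dtheta hsum_dt Suc.prems in \<open>auto simp: has_real_derivative_iff_has_vector_derivative[symmetric]\<close>)
qed

lemma hsum_periodic: "hsum c (\<theta> + 2 * pi) t = hsum c \<theta> t"
proof -
  have "cis (real n * (\<theta> + 2 * pi)) = cis (real n * \<theta>)" for n
    using cis_multiple_2pi[of "real n"] by (simp add: distrib_left cis_mult[symmetric] mult_ac)
  then show ?thesis by (simp add: hsum_def hterm_def)
qed

text \<open>The exponents \<open>1 - n\<^sup>2\<close> with \<open>n \<ge> 2\<close> are at most \<open>-3\<close>.\<close>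

lemma hsum_decay:
  assumes "rapid c" "c 0 = 0" "t \<ge> 0"
  shows "\<bar>exp t * hsum c \<theta> t - Re (c 1 * cis \<theta>)\<bar> \<le> exp (- 3 * t) * (\<Sum>n. norm (c n))"
proof -
  have s: "(\<lambda>n. exp t * hterm c n \<theta> t) sums (exp t * hsum c \<theta> t)"
    by (intro sums_mult hsum_sums assms)
  have "(\<lambda>n. exp t * hterm c (n + 2) \<theta> t) sums (exp t * hsum c \<theta> t - (\<Sum>n<2. exp t * hterm c n \<theta> t))"
    using sums_split_initial_segment[OF s, of 2] by simp
  \<comment> \<open>The mode 0 vanishes by assumption, and the mode 1 does not depend on time
    because exp t * exp (- t) = 1.\<close>
  moreover have "(\<Sum>n<2. exp t * hterm c n \<theta> t) = Re (c 1 * cis \<theta>)"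
    by (simp add: numeral_2_eq_2 hterm_def assms(2) exp_minus field_simps)
  ultimately have s2: "(\<lambda>n. exp t * hterm c (n + 2) \<theta> t) sums (exp t * hsum c \<theta> t - Re (c 1 * cis \<theta>))"
    by simp
  have b: "\<bar>exp t * hterm c (n + 2) \<theta> t\<bar> \<le> exp (- 3 * t) * norm (c (n + 2))" for n
  proof -
    have "t * 4 \<le> t * (real (n + 2))\<^sup>2"
      using assms(3) power_mono[of 2 "real (n + 2)" 2] by (intro mult_left_mono) auto
    then have "exp t * exp (- (real (n + 2))\<^sup>2 * t) \<le> exp (- 3 * t)"
      by (simp add: exp_add[symmetric] mult.commute)
    then have "(exp t * exp (- (real (n + 2))\<^sup>2 * t)) * \<bar>Re (c (n + 2) * cis (real (n + 2) * \<theta>))\<bar>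
        \<le> exp (- 3 * t) * norm (c (n + 2) * cis (real (n + 2) * \<theta>))"
      by (intro mult_mono abs_Re_le_cmod) auto
    then show ?thesis by (simp add: hterm_def abs_mult norm_mult mult.assoc)
  qed
  have sc: "summable (\<lambda>n. norm (c n))" by (rule rapid_summable[OF assms(1)])
  have sm: "summable (\<lambda>n. exp (- 3 * t) * norm (c (n + 2)))"
    by (intro summable_mult summable_ignore_initial_segment sc)
  have "\<bar>exp t * hsum c \<theta> t - Re (c 1 * cis \<theta>)\<bar> = \<bar>\<Sum>n. exp t * hterm c (n + 2) \<theta> t\<bar>"
    using sums_unique[OF s2] by simp
  also have "\<dots> \<le> (\<Sum>n. exp (- 3 * t) * norm (c (n + 2)))"
    using norm_suminf_le[where f="\<lambda>n. exp t * hterm c (n + 2) \<theta> t", OF _ sm] b by simp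
  also have "\<dots> = exp (- 3 * t) * (\<Sum>n. norm (c (n + 2)))"
    by (intro suminf_mult summable_ignore_initial_segment sc)
  also have "\<dots> \<le> exp (- 3 * t) * (\<Sum>n. norm (c n))"
    using suminf_split_initial_segment[OF sc, of 2] by (intro mult_left_mono) (auto simp: sum_nonneg)
  finally show ?thesis .
qed

subsection \<open>Fourier coefficients\<close>

lemma integral_cis_period:
  "((\<lambda>x. cis (of_int k * x)) has_integral (if k = 0 then of_real (2 * pi) else 0)) {0..2 * pi}"
proof (cases "k = 0")
  case True
  then show ?thesis using has_integral_const_real[of "1::complex" 0 "2 * pi"] by (simp add: scaleR_conv_of_real)
next
  case False
  have d: "((\<lambda>x. cis (of_int k * x) / (\<i> * of_int k)) has_vector_derivative cis (of_int k * x)) (at x within {0..2 * pi})" for x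
  proof -
    have "((\<lambda>x. cis (of_int k * x)) has_vector_derivative (of_int k *\<^sub>R (\<i> * cis (of_int k * x)))) (at x within {0..2 * pi})"
      using vector_diff_chain_within[OF _ has_vector_derivative_cis, of "\<lambda>x. of_int k * x" "of_int k" x "{0..2 * pi}"]
      by (auto simp: o_def has_real_derivative_iff_has_vector_derivative[symmetric] intro!: derivative_eq_intros)
    from bounded_linear.has_vector_derivative[OF bounded_linear_mult_left this, of "inverse (\<i> * of_int k)"]
    show ?thesis using False by (simp add: scaleR_conv_of_real field_simps)
  qed
  have "((\<lambda>x. cis (of_int k * x)) has_integral
      (cis (of_int k * (2 * pi)) / (\<i> * of_int k) - cis (of_int k * 0) / (\<i> * of_int k))) {0..2 * pi}"
    by (rule fundamental_theorem_of_calculus[OF _ d]) simp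
  moreover have "cis (of_int k * (2 * pi)) = 1"
    using cis_multiple_2pi[of "of_int k"] by (simp add: mult.commute)
  ultimately show ?thesis using False by simp
qed

definition fint :: "(real \<Rightarrow> real) \<Rightarrow> nat \<Rightarrow> complex" where
  "fint f n = integral {0..2 * pi} (\<lambda>x. of_real (f x) * cis (- (real n * x)))"

text \<open>The mean is dropped because the mode 0 follows the length equation and not the heat
  equation. The divisor is pi rather than 2 * pi because the real part in \<open>hterm\<close> folds
  the frequencies n and - n together.\<close>

definition fcoef :: "(real \<Rightarrow> real) \<Rightarrow> nat \<Rightarrow> complex" where
  "fcoef f n = (if n = 0 then 0 else fint f n / of_real pi)"

text \<open>The real part is half the sum of a number and its conjugate, so the integrand has the
  frequencies n - m and - n - m. The second one vanishes only for n = m = 0, which accounts for the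
  separate case n = 0.\<close>

lemma fint_hterm:
  "((\<lambda>x. of_real (hterm c n x 0) * cis (- (real m * x))) has_integral
     (if n = 0 then (if m = 0 then of_real (2 * pi * Re (c 0)) else 0) else if m = n then of_real pi * c n else 0)) {0..2 * pi}"
proof -
  define a b where "a = integral {0..2 * pi} (\<lambda>x. cis (of_int (int n - int m) * x))"
    and "b = integral {0..2 * pi} (\<lambda>x. cis (of_int (- int n - int m) * x))"
  have "((\<lambda>x. (c n / 2) * cis (of_int (int n - int m) * x) + (cnj (c n) / 2) * cis (of_int (- int n - int m) * x)) has_integral
      ((c n / 2) * (if int n - int m = 0 then of_real (2 * pi) else 0)
        + (cnj (c n) / 2) * (if - int n - int m = 0 then of_real (2 * pi) else 0))) {0..2 * pi}"
    by (intro has_integral_add has_integral_mult_right integral_cis_period)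
  moreover have "of_real (hterm c n x 0) * cis (- (real m * x)) =
      (c n / 2) * cis (of_int (int n - int m) * x) + (cnj (c n) / 2) * cis (of_int (- int n - int m) * x)" for x
  proof -
    have "complex_of_real (hterm c n x 0) = (c n * cis (real n * x) + cnj (c n * cis (real n * x))) / 2"
      by (simp add: hterm_def complex_eq_iff)
    moreover have "cis (real n * x) * cis (- (real m * x)) = cis (of_int (int n - int m) * x)"
      "cis (- (real n * x)) * cis (- (real m * x)) = cis (of_int (- int n - int m) * x)"
      unfolding cis_mult by (rule arg_cong[where f=cis], simp add: algebra_simps)+
    ultimately show ?thesis by (simp add: cis_cnj algebra_simps add_divide_distrib)
  qed
  moreover have "(c n / 2) * (if int n - int m = 0 then of_real (2 * pi) else 0)
        + (cnj (c n) / 2) * (if - int n - int m = 0 then of_real (2 * pi) else 0) =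
     (if n = 0 then (if m = 0 then of_real (2 * pi * Re (c 0)) else 0) else if m = n then of_real pi * c n else 0)"
    by (auto simp: complex_eq_iff)
  ultimately show ?thesis by simp
qed

text \<open>Uniform convergence permits termwise integration; by orthogonality the integrals of the
  partial sums no longer change once N > m.\<close>

lemma fint_hsum:
  assumes "rapid c" "c 0 = 0"
  shows "fint (\<lambda>x. hsum c x 0) m = of_real pi * c m"
proof -
  have ul: "uniform_limit (cbox 0 (2 * pi)) (\<lambda>N x. \<Sum>n<N. hterm c n x 0) (\<lambda>x. hsum c x 0) sequentially"
    unfolding hsum_def
    by (rule Weierstrass_m_test[OF _ rapid_summable[OF assms(1)]]) (use hterm_bound in auto)
  have "uniform_limit (cbox 0 (2 * pi)) (\<lambda>N x. of_real (\<Sum>n<N. hterm c n x 0) * cis (- (real m * x)))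
     (\<lambda>x. of_real (hsum c x 0) * cis (- (real m * x))) sequentially"
  proof (rule uniform_limitI)
    fix e :: real assume "e > 0"
    from uniform_limitD[OF ul this]
    show "\<forall>\<^sub>F N in sequentially. \<forall>x\<in>cbox 0 (2 * pi). dist (of_real (\<Sum>n<N. hterm c n x 0) * cis (- (real m * x)))
       (of_real (hsum c x 0) * cis (- (real m * x))) < e"
      by eventually_elim (simp add: dist_norm left_diff_distrib[symmetric] norm_mult of_real_diff[symmetric] del: of_real_diff of_real_sum)
  qed
  then obtain I J where IJ: "\<And>N. ((\<lambda>x. of_real (\<Sum>n<N. hterm c n x 0) * cis (- (real m * x))) has_integral I N) (cbox 0 (2 * pi))"
    "((\<lambda>x. of_real (hsum c x 0) * cis (- (real m * x))) has_integral J) (cbox 0 (2 * pi))" "I \<longlonglongrightarrow> J"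
    by (rule uniform_limit_integral_cbox)
      (auto intro!: continuous_intros simp: hterm_def)
  have "I N = of_real pi * c m" if "N > m" for N
  proof -
    have "((\<lambda>x. \<Sum>n<N. of_real (hterm c n x 0) * cis (- (real m * x))) has_integral
       (\<Sum>n<N. if n = 0 then (if m = 0 then of_real (2 * pi * Re (c 0)) else 0) else if m = n then of_real pi * c n else 0)) {0..2 * pi}"
      by (intro has_integral_sum fint_hterm) auto
    moreover have "(\<Sum>n<N. if n = 0 then (if m = 0 then complex_of_real (2 * pi * Re (c 0)) else 0) else if m = n then of_real pi * c n else 0)
      = (\<Sum>n<N. if m = n then of_real pi * c n else 0)"
      by (intro sum.cong) (auto simp: assms(2))
    moreover have "\<dots> = of_real pi * c m" using that by simp
    ultimately show ?thesis using IJ(1)[of N] by (auto simp: sum_distrib_right intro: has_integral_unique)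
  qed
  then have "\<forall>\<^sub>F N in sequentially. I N = of_real pi * c m"
    by (auto simp: eventually_sequentially intro!: exI[of _ "Suc m"])
  then have "I \<longlonglongrightarrow> of_real pi * c m" by (rule tendsto_eventually)
  then have "J = of_real pi * c m" using IJ(3) LIMSEQ_unique by blast
  then show ?thesis using IJ(2) by (simp add: fint_def integral_unique)
qed

text \<open>
  Testing \<open>f\<close> against powers of \<open>1 - cos \<delta> + cos (x - x0)\<close>, which exceed \<open>1\<close> near \<open>x0\<close>
  and are at most \<open>1\<close> in absolute value away from it, detects a nonzero value of \<open>f\<close> at \<open>x0\<close>.
\<close>

lemma fourier_complete_interior:
  fixes f :: "real \<Rightarrow> real"
  assumes cont: "continuous_on {0..2 * pi} f" and orth: "\<And>n. fint f n = 0" and x0: "0 < x0" "x0 < 2 * pi"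
  shows "f x0 \<le> 0"
proof (rule ccontr)
  assume "\<not> f x0 \<le> 0"
  then have fx0: "f x0 > 0" by simp
  have "isCont f x0" using continuous_on_interior[OF cont] x0 by simp
  then obtain d1 where d1: "d1 > 0" "\<And>x. \<bar>x - x0\<bar> < d1 \<Longrightarrow> \<bar>f x - f x0\<bar> < f x0 / 2"
    using fx0 unfolding continuous_at_eps_delta dist_real_def by (metis half_gt_zero)
  \<comment> \<open>With \<delta> below the distances of x0 from both ends, 2 * pi - |x - x0| is
    also at least \<delta> for every x of the period. Hence cos (x - x0) cannot come close to 1
    again near the opposite end.\<close>
  define \<delta> where "\<delta> = min (d1 / 2) (min x0 (2 * pi - x0) / 2)"
  have \<delta>: "\<delta> > 0" "\<delta> < d1" "\<delta> < x0" "\<delta> < 2 * pi - x0" "\<delta> < pi"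
    using d1 x0 by (auto simp: \<delta>_def min_def)
  define q where "q x = 1 - cos \<delta> + cos (x - x0)" for x
  have cq: "continuous_on A q" for A unfolding q_def by (intro continuous_intros)
  obtain M where M: "\<And>x. x \<in> {0..2 * pi} \<Longrightarrow> \<bar>f x\<bar> \<le> M"
    using compact_imp_bounded[OF compact_continuous_image[OF cont]] by (force simp: bounded_iff)
  have q1: "q x \<ge> 1" if "\<bar>x - x0\<bar> \<le> \<delta>" for x
    using cos_monotone_0_pi_le[of "\<bar>x - x0\<bar>" \<delta>] that \<delta> by (simp add: q_def)
  have q2: "\<bar>q x\<bar> \<le> 1" if "\<bar>x - x0\<bar> \<ge> \<delta>" "x \<in> {0..2 * pi}" for x
  proof -
    have "cos \<bar>x - x0\<bar> \<le> cos \<delta>"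
    proof (cases "\<bar>x - x0\<bar> \<le> pi")
      case True then show ?thesis using that \<delta> by (intro cos_monotone_0_pi_le) auto
    next
      case False
      have "cos (2 * pi - \<bar>x - x0\<bar>) \<le> cos \<delta>"
        using False that \<delta> by (intro cos_monotone_0_pi_le) auto
      then show ?thesis by (simp add: cos_diff)
    qed
    then have "cos (x - x0) \<le> cos \<delta>" by simp
    then show ?thesis unfolding q_def abs_le_iff using cos_ge_minus_one[of "x - x0"] cos_le_one[of \<delta>] by linarith
  qed
  \<comment> \<open>Multiplication by q only shifts frequencies by at most 1, so f * q ^ N inherits
    the vanishing of all Fourier integrals from f * q ^ (N - 1), provided that all integer
    frequencies are treated together.\<close>
  have I0: "integral {0..2 * pi} (\<lambda>x. of_real (f x * q x ^ N) * cis (of_int k * x)) = 0" for N k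
  proof (induction N arbitrary: k)
    case 0
    show ?case
    proof (cases "k \<le> 0")
      case True
      then show ?thesis using orth[of "nat (- k)"] by (simp add: fint_def)
    next
      case False
      \<comment> \<open>As f is real, the positive frequencies follow from the negative ones by
        conjugation.\<close>
      have "integral {0..2 * pi} (\<lambda>x. cnj (of_real (f x) * cis (- (real (nat k) * x)))) = cnj (fint f (nat k))"
        unfolding fint_def
        by (rule integral_linear[of _ _ cnj, unfolded o_def])
          (auto intro!: integrable_continuous_interval continuous_intros cont bounded_linear_cnj)
      then show ?thesis using False orth by (simp add: cis_cnj)
    qed
  next
    case (Suc N)
    let ?g = "\<lambda>k x. of_real (f x * q x ^ N) * cis (of_int k * x)"
    have gi: "(?g k has_integral 0) {0..2 * pi}" for k
      using Suc.IH[of k] by (auto simp: has_integral_integral[symmetric] has_integral_iff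
          intro!: integrable_continuous_interval continuous_intros cont cq)
    have "((\<lambda>x. of_real (1 - cos \<delta>) * ?g k x + (cis (- x0) / 2 * ?g (k + 1) x + cis x0 / 2 * ?g (k - 1) x)) has_integral
        (of_real (1 - cos \<delta>) * 0 + (cis (- x0) / 2 * 0 + cis x0 / 2 * 0))) {0..2 * pi}"
      by (intro has_integral_add has_integral_mult_right gi)
    moreover have "of_real (1 - cos \<delta>) * ?g k x + (cis (- x0) / 2 * ?g (k + 1) x + cis x0 / 2 * ?g (k - 1) x)
        = of_real (f x * q x ^ Suc N) * cis (of_int k * x)" for x
    proof -
      have "complex_of_real (cos (x - x0)) = (cis (- x0) * cis x + cis x0 * cis (- x)) / 2"
        by (simp add: complex_eq_iff cos_diff)
      moreover have "cis (of_int (k + 1) * x) = cis x * cis (of_int k * x)" "cis (of_int (k - 1) * x) = cis (- x) * cis (of_int k * x)"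
        unfolding cis_mult by (rule arg_cong[where f=cis], simp add: algebra_simps)+
      ultimately show ?thesis by (simp add: q_def algebra_simps add_divide_distrib)
    qed
    ultimately show ?case by (simp add: integral_unique)
  qed
  have "((\<lambda>x. of_real (f x * q x ^ N)) has_integral (0::complex)) {0..2 * pi}" for N
    using I0[of N 0] by (auto simp: has_integral_iff simp del: of_real_mult of_real_power
        intro!: integrable_continuous_interval continuous_intros cont cq)
  from has_integral_Re[OF this] have I: "((\<lambda>x. f x * q x ^ N) has_integral 0) {0..2 * pi}" for N
    by (simp only: Re_complex_of_real  zero_complex.sel)
  let ?A = "{x0 - \<delta>..x0 + \<delta>}" and ?B = "{x0 - \<delta> / 2..x0 + \<delta> / 2}"
  have sub: "?A \<subseteq> {0..2 * pi}" "?B \<subseteq> ?A" using \<delta> by auto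
  have fpos: "f x \<ge> f x0 / 2" if "x \<in> ?A" for x
  proof -
    have "\<bar>x - x0\<bar> < d1" using that \<delta> by auto
    from d1(2)[OF this] show ?thesis unfolding abs_less_iff by linarith
  qed
  define r where "r = 1 - cos \<delta> + cos (\<delta> / 2)"
  have r: "r > 1" using cos_monotone_0_pi[of "\<delta> / 2" \<delta>] \<delta> by (simp add: r_def)
  have qr: "q x \<ge> r" if "x \<in> ?B" for x
  proof -
    have "\<bar>x - x0\<bar> \<le> \<delta> / 2" using that unfolding abs_le_iff by auto
    then have "cos (\<delta> / 2) \<le> cos \<bar>x - x0\<bar>" using \<delta> by (intro cos_monotone_0_pi_le) auto
    then show ?thesis by (simp add: q_def r_def)
  qed
  have M0: "M \<ge> 0" using M[of 0] by auto
  \<comment> \<open>On the inner interval ?B, of length \<delta>, the integrand is at least f x0 / 2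
    * r ^ N; on the rest of ?A it is nonnegative, and elsewhere it is at least - M. As the integral
    is 0, the growing part is bounded independently of N.\<close>
  have key: "f x0 / 2 * r ^ N * \<delta> \<le> M * (2 * pi)" for N
  proof -
    have L: "((\<lambda>x. if x \<in> ?B then f x0 / 2 * r ^ N else 0) has_integral (f x0 / 2 * r ^ N * \<delta>)) {0..2 * pi}"
    proof -
      have "((\<lambda>x. f x0 / 2 * r ^ N) has_integral (f x0 / 2 * r ^ N * \<delta>)) ?B"
        using has_integral_const_real[of "f x0 / 2 * r ^ N" "x0 - \<delta> / 2" "x0 + \<delta> / 2"] \<delta>(1)
        by (simp add: mult.commute)
      then show ?thesis using sub by (subst has_integral_restrict) auto
    qed
    have U: "((\<lambda>x. f x * q x ^ N + M) has_integral (0 + M * (2 * pi))) {0..2 * pi}"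
      using has_integral_add[OF I[of N] has_integral_const_real[of M 0 "2 * pi"]] by (simp add: mult.commute)
    have le: "(if x \<in> ?B then f x0 / 2 * r ^ N else 0) \<le> f x * q x ^ N + M" if x: "x \<in> {0..2 * pi}" for x
    proof (cases "x \<in> ?B")
      case True
      have "f x0 / 2 * r ^ N \<le> f x * q x ^ N"
        using fpos[of x] qr[OF True] True sub fx0 r by (intro mult_mono power_mono) auto
      then show ?thesis using True M0 by simp
    next
      case False
      show ?thesis
      proof (cases "\<bar>x - x0\<bar> \<le> \<delta>")
        case True
        have "0 \<le> f x * q x ^ N" using fpos[of x] q1[OF True] True fx0 
          by (intro mult_nonneg_nonneg) (auto simp: abs_le_iff)
        then show ?thesis unfolding if_not_P[OF False] using M0 by simp
      next
        case False2: False
        have "\<bar>f x * q x ^ N\<bar> \<le> M * 1"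
          unfolding abs_mult power_abs using q2[of x] False2 x M[OF x] M0
          by (intro mult_mono power_le_one) auto
        then show ?thesis unfolding if_not_P[OF False] by (simp add: abs_le_iff)
      qed
    qed
    show ?thesis using has_integral_le[OF L U le] by simp
  qed
  obtain N where "M * (2 * pi) / (f x0 / 2 * \<delta>) < r ^ N" using real_arch_pow[OF r] by blast
  then show False using key[of N] fx0 \<delta> by (simp add: field_simps)
qed

text \<open>The interior case for f and for - f gives both inequalities; continuity adds the end
  points, and periodicity the rest of the line.\<close>

lemma fourier_complete:
  fixes f :: "real \<Rightarrow> real"
  assumes cont: "continuous_on UNIV f" and per: "\<And>x. f (x + 2 * pi) = f x" and orth: "\<And>n. fint f n = 0"
  shows "f x = 0"
proof -
  have c: "continuous_on A f" for A using cont continuous_on_subset by blast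
  have orth': "fint (\<lambda>x. - f x) n = 0" for n using orth[of n] by (simp add: fint_def)
  have "\<forall>x\<in>{0<..<2 * pi}. f x = 0"
  proof
    fix x assume x: "x \<in> {0<..<2 * pi}"
    have "f x \<le> 0" using x by (intro fourier_complete_interior[OF c orth]) auto
    moreover have "- f x \<le> 0"
      using x by (intro fourier_complete_interior[of "\<lambda>x. - f x", OF _ orth']) (auto intro!: continuous_intros c)
    ultimately show "f x = 0" by simp
  qed
  then have "f x = 0" if "x \<in> closure {0<..<2 * pi}" for x
    using continuous_constant_on_closure[OF c _ that, of 0] by blast
  then have z: "f x = 0" if "x \<in> {0..2 * pi}" for x using that by simp
  have "f (x + of_int k * (2 * pi)) = f x" for k x
  proof -
    interpret periodic_fun_simple f "2 * pi" by unfold_locales (rule per)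
    show ?thesis by (rule plus_of_int)
  qed
  from this[of "x - of_int \<lfloor>x / (2 * pi)\<rfloor> * (2 * pi)" "\<lfloor>x / (2 * pi)\<rfloor>"]
  have "f x = f (x - of_int \<lfloor>x / (2 * pi)\<rfloor> * (2 * pi))" by simp
  also have "\<dots> = 0"
  proof (rule z)
    have "of_int \<lfloor>x / (2 * pi)\<rfloor> * (2 * pi) \<le> x" "x < (of_int \<lfloor>x / (2 * pi)\<rfloor> + 1) * (2 * pi)"
      by (intro floor_divide_lower floor_divide_upper; simp)+
    then show "x - of_int \<lfloor>x / (2 * pi)\<rfloor> * (2 * pi) \<in> {0..2 * pi}"
      by (simp add: algebra_simps)
  qed
  finally show ?thesis .
qed

section \<open>Fourier coefficients of smooth periodic functions\<close>

lemma smooth_on_deriv: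
  fixes u :: "real \<Rightarrow> real"
  assumes "smooth_on UNIV u"
  shows "(u has_real_derivative deriv u x) (at x)" "smooth_on UNIV (deriv u)"
proof -
  have *: "Ck_on n UNIV (deriv u) \<and> (\<forall>x. (u has_real_derivative deriv u x) (at x))" for n
  proof -
    obtain u' where u': "\<And>x. (u has_vector_derivative u' x) (at x)" "Ck_on n UNIV u'"
      using assms Ck_on_real_SucE[of n UNIV u] unfolding smooth_on_def by (metis UNIV_I)
    have "(u has_real_derivative u' x) (at x)" for x
      using u'(1) by (simp add: has_real_derivative_iff_has_vector_derivative)
    moreover from this have "deriv u = u'" by (intro ext DERIV_imp_deriv)
    ultimately show ?thesis using u'(2) by simp
  qed
  show "(u has_real_derivative deriv u x) (at x)" "smooth_on UNIV (deriv u)"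
    using * by (auto simp: smooth_on_def)
qed

lemma smooth_on_imp_cont: "smooth_on S f \<Longrightarrow> continuous_on S f"
  unfolding smooth_on_def by (metis Ck_on.simps(1))

lemma periodic_deriv:
  fixes u :: "real \<Rightarrow> real"
  assumes "smooth_on UNIV u" "\<And>x. u (x + p) = u x"
  shows "deriv u (x + p) = deriv u x"
proof -
  have "((\<lambda>x. u (x + p)) has_real_derivative deriv u (x + p)) (at x)"
    using smooth_on_deriv(1)[OF assms(1), of "x + p"] by (simp add: DERIV_shift)
  then have "(u has_real_derivative deriv u (x + p)) (at x)" by (simp add: assms(2))
  then show ?thesis using DERIV_imp_deriv by fastforce
qed

lemma fint_deriv:
  assumes u: "\<And>x. x \<in> {0..2 * pi} \<Longrightarrow> (u has_real_derivative u' x) (at x within {0..2 * pi})"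
    and c: "continuous_on {0..2 * pi} u'" and per: "u (2 * pi) = u 0"
  shows "fint u' n = \<i> * of_nat n * fint u n"
proof -
  have cu: "continuous_on {0..2 * pi} u" by (rule DERIV_continuous_on[OF u])
  have "((\<lambda>x. of_real (u' x) * cis (- (real n * x)) - \<i> * of_nat n * (of_real (u x) * cis (- (real n * x)))) has_integral
     of_real (u (2 * pi)) * cis (- (real n * (2 * pi))) - of_real (u 0) * cis (- (real n * 0))) {0..2 * pi}"
  proof (rule fundamental_theorem_of_calculus)
    fix x assume x: "x \<in> {0..2 * pi}"
    have 1: "((\<lambda>x. cis (- (real n * x))) has_vector_derivative (- real n) *\<^sub>R (\<i> * cis (- (real n * x)))) (at x within {0..2 * pi})"
    proof -
      have "((\<lambda>x. - (real n * x)) has_vector_derivative - real n) (at x within {0..2 * pi})"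
        by (auto simp: has_real_derivative_iff_has_vector_derivative[symmetric] intro!: derivative_eq_intros)
      from vector_diff_chain_within[OF this has_vector_derivative_cis] show ?thesis by (simp only: o_def)
    qed
    have 2: "((\<lambda>x. complex_of_real (u x)) has_vector_derivative of_real (u' x)) (at x within {0..2 * pi})"
      using u[OF x] by (intro bounded_linear.has_vector_derivative[OF bounded_linear_of_real])
        (simp add: has_real_derivative_iff_has_vector_derivative)
    show "((\<lambda>x. of_real (u x) * cis (- (real n * x))) has_vector_derivative
       of_real (u' x) * cis (- (real n * x)) - \<i> * of_nat n * (of_real (u x) * cis (- (real n * x)))) (at x within {0..2 * pi})"
      using has_vector_derivative_mult[OF 2 1] by (simp add: scaleR_conv_of_real algebra_simps)
  qed simp
  moreover have "cis (- (real n * (2 * pi))) = 1"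
    using cis_multiple_2pi[of "- real n"] by (simp add: mult_ac)
  ultimately have A: "((\<lambda>x. of_real (u' x) * cis (- (real n * x)) - \<i> * of_nat n * (of_real (u x) * cis (- (real n * x)))) has_integral 0) {0..2 * pi}"
    by (simp add: per)
  have B: "((\<lambda>x. of_real (u' x) * cis (- (real n * x)) - \<i> * of_nat n * (of_real (u x) * cis (- (real n * x)))) has_integral
      fint u' n - \<i> * of_nat n * fint u n) {0..2 * pi}"
    unfolding fint_def
    by (intro has_integral_diff has_integral_mult_right integrable_integral integrable_continuous_interval continuous_intros c cu)
  show ?thesis using has_integral_unique[OF A B] by simp
qed

lemma fint_deriv_smooth:
  assumes u: "smooth_on UNIV u" and per: "\<And>x. u (x + 2 * pi) = u x"
  shows "fint (deriv u) n = \<i> * of_nat n * fint u n"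
  by (rule fint_deriv)
    (use smooth_on_deriv[OF u] per[of 0] in \<open>auto intro: has_field_derivative_at_within
       continuous_on_subset[OF smooth_on_imp_cont]\<close>)

lemma fcoef_deriv:
  assumes "smooth_on UNIV u" "\<And>x. u (x + 2 * pi) = u x"
  shows "fcoef (deriv u) = dcoef (fcoef u)"
  by (rule ext) (simp add: fcoef_def dcoef_def fint_deriv_smooth[OF assms])

lemma fint_add:
  assumes "continuous_on {0..2 * pi} f" "continuous_on {0..2 * pi} g"
  shows "fint (\<lambda>x. f x + g x) n = fint f n + fint g n"
proof -
  have "((\<lambda>x. of_real (f x) * cis (- (real n * x)) + of_real (g x) * cis (- (real n * x))) has_integral fint f n + fint g n) {0..2 * pi}"
    unfolding fint_def
    by (intro has_integral_add integrable_integral integrable_continuous_interval continuous_intros assms)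
  then show ?thesis by (simp add: fint_def distrib_right integral_unique)
qed

lemma fint_minus: "fint (\<lambda>x. - f x) n = - fint f n"
  by (simp add: fint_def)

lemma fint_diff:
  assumes "continuous_on {0..2 * pi} f" "continuous_on {0..2 * pi} g"
  shows "fint (\<lambda>x. f x - g x) n = fint f n - fint g n"
  using fint_add[OF assms(1), of "\<lambda>x. - g x"] assms by (simp add: fint_minus continuous_on_minus)

lemma fint_const: "fint (\<lambda>x. a) n = (if n = 0 then of_real (2 * pi * a) else 0)"
proof -
  have "((\<lambda>x. of_real a * cis (of_int (- int n) * x)) has_integral
      of_real a * (if - int n = 0 then of_real (2 * pi) else 0)) {0..2 * pi}"
    by (intro has_integral_mult_right integral_cis_period)
  then show ?thesis by (auto simp: fint_def dest!: integral_unique)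
qed

text \<open>Each derivative trades one factor n against a coefficient of a smooth function, and all
  such coefficients are bounded. Two derivatives more than the power p leave a multiple of 1 / n^2,
  which is summable.\<close>

lemma rapid_fcoef:
  assumes "smooth_on UNIV u" "\<And>x. u (x + 2 * pi) = u x"
  shows "rapid (fcoef u)"
proof -
  have bound: "\<exists>M. \<forall>n. real n ^ p * norm (fcoef u n) \<le> M"
    if "smooth_on UNIV u" "\<And>x. u (x + 2 * pi) = u x" for p u
    using that
  proof (induction p arbitrary: u)
    case 0
    have c: "continuous_on {0..2 * pi} u" using smooth_on_imp_cont[OF 0(1)] continuous_on_subset by blast
    have "norm (fcoef u n) \<le> integral {0..2 * pi} (\<lambda>x. \<bar>u x\<bar>) / pi" for n
    proof -
      have "norm (fint u n) \<le> integral {0..2 * pi} (\<lambda>x. \<bar>u x\<bar>)"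
        unfolding fint_def
        by (rule integral_norm_bound_integral)
          (auto intro!: integrable_continuous_interval continuous_intros c simp: norm_mult)
      moreover have "0 \<le> integral {0..2 * pi} (\<lambda>x. \<bar>u x\<bar>)"
        by (intro Henstock_Kurzweil_Integration.integral_nonneg integrable_continuous_interval continuous_intros c) auto
      ultimately show ?thesis by (auto simp: fcoef_def norm_divide divide_right_mono)
    qed
    then show ?case by auto
  next
    case (Suc p)
    have "\<exists>M. \<forall>n. real n ^ p * norm (fcoef (deriv u) n) \<le> M"
      by (intro Suc.IH smooth_on_deriv(2) periodic_deriv Suc.prems)
    then show ?case unfolding fcoef_deriv[OF Suc.prems] norm_dcoef by (simp add: mult_ac)
  qed
  show ?thesis unfolding rapid_def
  proof
    fix p
    obtain M where M: "\<And>n. real n ^ (p + 2) * norm (fcoef u n) \<le> M" using bound[OF assms] by blast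
    have "summable (\<lambda>n. M * (1 / real n ^ 2))"
      using inverse_power_summable[of 2, where 'a=real] by (intro summable_mult) (simp add: field_simps)
    then show "summable (\<lambda>n. real n ^ p * norm (fcoef u n))"
    proof (rule summable_comparison_test'[of _ 1])
      fix n :: nat assume n: "n \<ge> 1"
      show "norm (real n ^ p * norm (fcoef u n)) \<le> M * (1 / real n ^ 2)"
        using M[of n] n by (simp add: field_simps power_add power2_eq_square)
    qed
  qed
qed

lemma continuous_on_hsum:
  assumes "rapid c" "t \<ge> 0" shows "continuous_on A (\<lambda>\<theta>. hsum c \<theta> t)"
  using hsum_dtheta[OF assms] by (intro continuous_at_imp_continuous_on ballI DERIV_isCont)

lemma fourier_unique:
  assumes f: "continuous_on UNIV f" "\<And>x. f (x + 2 * pi) = f x"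
    and g: "continuous_on UNIV g" "\<And>x. g (x + 2 * pi) = g x"
    and eq: "\<And>n. fint f n = fint g n"
  shows "f x = g x"
proof -
  have c: "continuous_on A f" "continuous_on A g" for A using f(1) g(1) continuous_on_subset by blast+
  have "f x - g x = 0"
    by (rule fourier_complete[of "\<lambda>x. f x - g x"])
      (auto intro!: continuous_intros f(1) g(1) simp: f(2) g(2) fint_diff c eq)
  then show ?thesis by simp
qed

text \<open>The damping up to time t is absorbed into new coefficients \<open>d\<close>. This
  reduces the claim to time 0, where both sides have the same Fourier integrals.\<close>

lemma fourier_series:
  fixes f :: "real \<Rightarrow> real"
  assumes f: "continuous_on UNIV f" "\<And>x. f (x + 2 * pi) = f x"
    and m: "integral {0..2 * pi} f = 2 * pi * m"
    and c: "rapid c" "c 0 = 0" "t \<ge> 0" "\<And>n. n > 0 \<Longrightarrow> fint f n = of_real (pi * exp (- (real n)\<^sup>2 * t)) * c n"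
  shows "f x = m + hsum c x t"
proof -
  define d where "d n = of_real (exp (- (real n)\<^sup>2 * t)) * c n" for n
  have nd: "norm (d n) \<le> norm (c n)" for n
    using c(3) by (simp add: d_def norm_mult mult_left_le_one_le)
  have d: "rapid d" unfolding rapid_def
  proof
    fix p
    have "summable (\<lambda>n. real n ^ p * norm (c n))" using c(1) by (simp add: rapid_def)
    then show "summable (\<lambda>n. real n ^ p * norm (d n))"
      by (rule summable_comparison_test'[of _ 0]) (simp add: nd mult_left_mono)
  qed
  have d0: "d 0 = 0" by (simp add: d_def c(2))
  have hd: "hsum c x t = hsum d x 0" for x
    unfolding hsum_def hterm_def d_def by (simp add: mult.assoc)
  have cf: "continuous_on A f" for A using f(1) continuous_on_subset by blast
  have "fint f 0 = of_real (2 * pi * m)"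
    using integral_linear[OF integrable_continuous_interval[OF cf] bounded_linear_of_real[where 'a=complex], of 0 "2 * pi"] m
    by (simp add: fint_def o_def)
  moreover have "fint (\<lambda>x. m + hsum d x 0) n = (if n = 0 then of_real (2 * pi * m) else 0) + of_real pi * d n" for n
    using fint_add[OF continuous_on_const continuous_on_hsum[OF d], of 0 m n]
    by (simp only: fint_const fint_hsum[OF d d0])
  ultimately have eq: "fint f n = fint (\<lambda>x. m + hsum d x 0) n" for n
    using c(4)[of n] d0 by (cases "n = 0") (simp_all add: d_def)
  have "continuous_on UNIV (\<lambda>x. m + hsum d x 0)"
    by (intro continuous_on_add continuous_on_const continuous_on_hsum d) simp
  then show ?thesis unfolding hd
    using fourier_unique[OF f, of "\<lambda>x. m + hsum d x 0" x] eq by (simp add: hsum_periodic)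
qed

lemma fourier_series_smooth:
  assumes u: "smooth_on UNIV u" "\<And>x. u (x + 2 * pi) = u x"
  shows "u x = integral {0..2 * pi} u / (2 * pi) + hsum (fcoef u) x 0"
  by (rule fourier_series[OF smooth_on_imp_cont[OF u(1)] u(2) _ rapid_fcoef[OF u]]) (auto simp: fcoef_def)

subsection \<open>The heat kernel acting on Fourier series\<close>

text \<open>The substitution x = \<xi> / sqrt (2 * t) turns the kernel into the standard normal
  density and the frequency k into s = k * sqrt (2 * t); the value is that of the characteristic
  function of the normal distribution.\<close>

lemma gaussian_fourier:
  assumes "t > 0"
  shows "has_bochner_integral lborel (\<lambda>\<xi>. exp (- \<xi>\<^sup>2 / (4 * t)) *\<^sub>R cis (k * \<xi>)) (of_real (2 * sqrt (pi * t) * exp (- k\<^sup>2 * t)))"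
proof -
  define s where "s = k * sqrt (2 * t)"
  let ?f = "\<lambda>x. std_normal_density x *\<^sub>R iexp (s * x)"
  have "(LINT x|lborel. ?f x) = char std_normal_distribution s"
    unfolding char_def by (subst integral_density) (auto simp: normal_density_nonneg)
  then have I: "(LINT x|lborel. ?f x) = of_real (exp (- (s\<^sup>2) / 2))"
    by (simp add: char_std_normal_distribution)
  \<comment> \<open>A function that is not integrable has Bochner integral 0, whereas this integral
    is the value of an exponential.\<close>
  then have "integrable lborel ?f" using not_integrable_integral_eq by fastforce
  then have "has_bochner_integral lborel ?f (of_real (exp (- (s\<^sup>2) / 2)))"
    using I has_bochner_integral_iff by blast
  then have "has_bochner_integral lborel (\<lambda>\<xi>. ?f (0 + (1 / sqrt (2 * t)) * \<xi>))
      (of_real (exp (- (s\<^sup>2) / 2)) /\<^sub>R \<bar>1 / sqrt (2 * t)\<bar>)"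
    using assms by (subst lborel_has_bochner_integral_real_affine_iff[symmetric]) auto
  then have "has_bochner_integral lborel (\<lambda>\<xi>. sqrt (2 * pi) *\<^sub>R ?f (0 + (1 / sqrt (2 * t)) * \<xi>))
      (sqrt (2 * pi) *\<^sub>R (of_real (exp (- (s\<^sup>2) / 2)) /\<^sub>R \<bar>1 / sqrt (2 * t)\<bar>))"
    by (rule has_bochner_integral_scaleR_right)
  moreover have "sqrt (2 * pi) *\<^sub>R ?f (0 + (1 / sqrt (2 * t)) * \<xi>) = exp (- \<xi>\<^sup>2 / (4 * t)) *\<^sub>R cis (k * \<xi>)" for \<xi>
    using assms by (simp add: std_normal_density_def s_def power_divide real_sqrt_mult power_mult_distrib cis_conv_exp mult.commute)
  moreover have "sqrt (2 * pi) *\<^sub>R (complex_of_real (exp (- (s\<^sup>2) / 2)) /\<^sub>R \<bar>1 / sqrt (2 * t)\<bar>)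
      = of_real (2 * sqrt (pi * t) * exp (- k\<^sup>2 * t))"
  proof -
    have 1: "s\<^sup>2 / 2 = k\<^sup>2 * t" using assms by (simp add: s_def power_mult_distrib)
    have 2: "sqrt (2 * pi) * sqrt (2 * t) = 2 * sqrt (pi * t)"
      by (simp add: real_sqrt_mult)
    have "sqrt (2 * pi) *\<^sub>R (complex_of_real (exp (- (s\<^sup>2) / 2)) /\<^sub>R \<bar>1 / sqrt (2 * t)\<bar>)
      = of_real (sqrt (2 * pi) * sqrt (2 * t) * exp (- (s\<^sup>2 / 2)))"
      using assms by (simp add: scaleR_conv_of_real)
    then show ?thesis unfolding 1 2 by simp
  qed
  ultimately show ?thesis by (simp only:)
qed

text \<open>Every mode is an eigenfunction of the convolution with the Gaussian. The sum may be
  interchanged with the integral because the n-th term is dominated by the kernel times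
  \<open>norm (c n)\<close>.\<close>

lemma heat_average_hsum:
  assumes c: "rapid c" and t: "t > 0" and m: "c 0 = 0"
  shows "heat_average t (\<lambda>\<eta>. m + hsum c \<eta> 0) \<theta> = exp t * (m + hsum c \<theta> t)"
proof -
  let ?K = "\<lambda>\<xi>. exp (- \<xi>\<^sup>2 / (4 * t))" and ?s = "2 * sqrt (pi * t)"
  have K: "has_bochner_integral lborel ?K ?s"
    using has_bochner_integral_bounded_linear[OF bounded_linear_Re gaussian_fourier[OF t, of 0]] by simp
  have T: "has_bochner_integral lborel (\<lambda>\<xi>. ?K \<xi> * hterm c n (\<theta> - \<xi>) 0) (?s * hterm c n \<theta> t)" for n
  proof -
    have "has_bochner_integral lborel (\<lambda>\<xi>. Re (c n * cis (real n * \<theta>) * (?K \<xi> *\<^sub>R cis (- real n * \<xi>))))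
       (Re (c n * cis (real n * \<theta>) * of_real (?s * exp (- (- real n)\<^sup>2 * t))))"
      by (intro has_bochner_integral_bounded_linear[OF bounded_linear_Re] has_bochner_integral_mult_right gaussian_fourier t)
    moreover have "Re (c n * cis (real n * \<theta>) * (?K \<xi> *\<^sub>R cis (- real n * \<xi>))) = ?K \<xi> * hterm c n (\<theta> - \<xi>) 0" for \<xi>
    proof -
      have "c n * cis (real n * \<theta>) * (?K \<xi> *\<^sub>R cis (- real n * \<xi>)) = ?K \<xi> *\<^sub>R (c n * (cis (real n * \<theta>) * cis (- real n * \<xi>)))"
        by simp
      also have "cis (real n * \<theta>) * cis (- real n * \<xi>) = cis (real n * (\<theta> - \<xi>))"
        by (simp add: cis_mult algebra_simps)
      finally show ?thesis by (simp only: hterm_def scaleR_complex.sel) simp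
    qed
    moreover have "Re (c n * cis (real n * \<theta>) * of_real (?s * exp (- (- real n)\<^sup>2 * t))) = ?s * hterm c n \<theta> t"
      by (simp add: hterm_def)
    ultimately show ?thesis by (simp only:)
  qed
  have i: "integrable lborel (\<lambda>\<xi>. ?K \<xi> * hterm c n (\<theta> - \<xi>) 0)" for n using T has_bochner_integral_iff by blast
  have iK: "integrable lborel ?K" and IK: "integral\<^sup>L lborel ?K = ?s" using K has_bochner_integral_iff by blast+
  have 1: "AE \<xi> in lborel. summable (\<lambda>n. norm (?K \<xi> * hterm c n (\<theta> - \<xi>) 0))"
    by (intro AE_I2 summable_comparison_test'[OF summable_mult[OF rapid_summable[OF c]], of 0])
      (auto simp: abs_mult hterm_bound intro!: mult_left_mono)
  have 2: "summable (\<lambda>n. \<integral>\<xi>. norm (?K \<xi> * hterm c n (\<theta> - \<xi>) 0) \<partial>lborel)"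
  proof (rule summable_comparison_test'[OF summable_mult[OF rapid_summable[OF c], of ?s], of 0])
    fix n
    have "(\<integral>\<xi>. norm (?K \<xi> * hterm c n (\<theta> - \<xi>) 0) \<partial>lborel) \<le> (\<integral>\<xi>. norm (c n) * ?K \<xi> \<partial>lborel)"
      by (intro integral_mono integrable_norm i integrable_mult_right iK) (auto simp: abs_mult hterm_bound)
    also have "\<dots> = ?s * norm (c n)" using IK by simp
    finally show "norm (\<integral>\<xi>. norm (?K \<xi> * hterm c n (\<theta> - \<xi>) 0) \<partial>lborel) \<le> ?s * norm (c n)" by simp
  qed
  have sm: "?K \<xi> * hsum c (\<theta> - \<xi>) 0 = (\<Sum>n. ?K \<xi> * hterm c n (\<theta> - \<xi>) 0)" for \<xi>
    unfolding hsum_def by (rule suminf_mult[OF hterm_summable[OF c], symmetric]) simp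
  have i2: "integrable lborel (\<lambda>\<xi>. ?K \<xi> * hsum c (\<theta> - \<xi>) 0)"
    unfolding sm by (rule integrable_suminf[OF i 1 2])
  have "(\<integral>\<xi>. ?K \<xi> * hsum c (\<theta> - \<xi>) 0 \<partial>lborel) = (\<Sum>n. \<integral>\<xi>. ?K \<xi> * hterm c n (\<theta> - \<xi>) 0 \<partial>lborel)"
    unfolding sm by (rule integral_suminf[OF i 1 2])
  also have "\<dots> = (\<Sum>n. ?s * hterm c n \<theta> t)" by (simp only: has_bochner_integral_integral_eq[OF T])
  also have "\<dots> = ?s * hsum c \<theta> t"
    unfolding hsum_def using t by (intro suminf_mult hterm_summable c) simp
  finally have 3: "(\<integral>\<xi>. ?K \<xi> * hsum c (\<theta> - \<xi>) 0 \<partial>lborel) = ?s * hsum c \<theta> t" .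
  have i3: "integrable lborel (\<lambda>\<xi>. m * ?K \<xi> + ?K \<xi> * hsum c (\<theta> - \<xi>) 0)"
    by (intro Bochner_Integration.integrable_add integrable_mult_right iK i2)
  have "integral UNIV (\<lambda>\<xi>. ?K \<xi> * (m + hsum c (\<theta> - \<xi>) 0)) = integral UNIV (\<lambda>\<xi>. m * ?K \<xi> + ?K \<xi> * hsum c (\<theta> - \<xi>) 0)"
    by (simp only: distrib_left distrib_right mult.commute)
  also have "\<dots> = (\<integral>\<xi>. m * ?K \<xi> \<partial>lborel) + (\<integral>\<xi>. ?K \<xi> * hsum c (\<theta> - \<xi>) 0 \<partial>lborel)"
    unfolding integral_lborel[OF i3]
    by (rule Bochner_Integration.integral_add[OF integrable_mult_right[OF iK] i2])
  also have "\<dots> = m * ?s + ?s * hsum c \<theta> t"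
    by (simp only: Bochner_Integration.integral_mult_right_zero IK 3)
  also have "\<dots> = ?s * (m + hsum c \<theta> t)" by (simp add: algebra_simps)
  finally show ?thesis using t by (simp add: heat_average_def)
qed

subsection \<open>Curves with a given support function\<close>

text \<open>The envelope of the lines x \<bullet> cis \<theta> = u \<theta>, parametrized by the
  angle \<theta> of the outward normal and written in the frame of normal and tangent.\<close>

definition support_curve :: "(real \<Rightarrow> real) \<Rightarrow> real \<Rightarrow> complex" where
  "support_curve u \<theta> = u \<theta> *\<^sub>R cis \<theta> + deriv u \<theta> *\<^sub>R (\<i> * cis \<theta>)"

definition curv_radius :: "(real \<Rightarrow> real) \<Rightarrow> real \<Rightarrow> real" where
  "curv_radius u \<theta> = deriv (deriv u) \<theta> + u \<theta>"

text \<open>A lift of a diffeomorphism of the circle. The sign \<sigma> records its orientation,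
  since an initial parametrization may run clockwise or counterclockwise.\<close>

definition angle_fun :: "real \<Rightarrow> (real \<Rightarrow> real) \<Rightarrow> bool" where
  "angle_fun \<sigma> \<alpha> \<longleftrightarrow> (\<sigma> = 1 \<or> \<sigma> = - 1) \<and> smooth_on UNIV \<alpha> \<and> (\<forall>\<phi>. \<sigma> * deriv \<alpha> \<phi> > 0) \<and>
     (\<forall>\<phi>. \<alpha> (\<phi> + 2 * pi) = \<alpha> \<phi> + \<sigma> * (2 * pi))"

lemma antiderivative_real:
  fixes f :: "real \<Rightarrow> 'a::euclidean_space"
  assumes "continuous_on UNIV f"
  obtains G where "\<And>x. (G has_vector_derivative f x) (at x)"
proof -
  define G where "G x = (if x \<ge> 0 then integral {0..x} f else - integral {x..0} f)" for x
  have c: "continuous_on A f" for A using assms continuous_on_subset by blast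
  have i: "f integrable_on {a..b}" for a b by (intro integrable_continuous_interval c)
  have "(G has_vector_derivative f x) (at x)" for x
  proof -
    define r where "r = \<bar>x\<bar> + 1"
    have x: "x \<in> {- r<..<r}" by (auto simp: r_def)
    have eq: "integral {- r..y} f - integral {- r..0} f = G y" if "y \<in> {- r<..<r}" for y
    proof (cases "y \<ge> 0")
      case True
      then show ?thesis using Henstock_Kurzweil_Integration.integral_combine[where a="- r" and c=0 and b=y and f=f] i that by (auto simp: G_def algebra_simps)
    next
      case False
      then show ?thesis using Henstock_Kurzweil_Integration.integral_combine[where a="- r" and c=y and b=0 and f=f] i that by (auto simp: G_def algebra_simps)
    qed
    have "((\<lambda>y. integral {- r..y} f) has_vector_derivative f x) (at x within {- r..r})"
      using x by (intro integral_has_vector_derivative c) auto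
    then have "((\<lambda>y. integral {- r..y} f) has_vector_derivative f x) (at x)"
      using x by (simp add: at_within_Icc_at)
    then have "((\<lambda>y. integral {- r..y} f - integral {- r..0} f) has_vector_derivative f x) (at x)"
      using has_vector_derivative_diff[OF _ has_vector_derivative_const] by fastforce
    then show ?thesis
      by (rule has_vector_derivative_transform_within_open[of _ _ _ "{- r<..<r}"]) (use x eq in auto)
  qed
  then show ?thesis by (rule that)
qed

lemma cis_eq_iff: "cis a = cis b \<longleftrightarrow> (\<exists>k::int. a = b + of_int k * (2 * pi))"
proof
  assume "cis a = cis b"
  then have "sin a = sin b \<and> cos a = cos b" by (simp add: complex_eq_iff)
  then show "\<exists>k::int. a = b + of_int k * (2 * pi)" unfolding sin_cos_eq_iff by (auto simp: mult_ac)
next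
  assume "\<exists>k::int. a = b + of_int k * (2 * pi)"
  then obtain k :: int where "a = b + of_int k * (2 * pi)" by blast
  then show "cis a = cis b"
    using cis_multiple_2pi[of "of_int k"] by (simp add: cis_mult[symmetric] mult_ac)
qed

lemma exists_shift:
  fixes x a :: real
  obtains k :: int where "a \<le> x + of_int k * (2 * pi)" "x + of_int k * (2 * pi) < a + 2 * pi"
proof -
  let ?k = "- \<lfloor>(x - a) / (2 * pi)\<rfloor>"
  have "of_int \<lfloor>(x - a) / (2 * pi)\<rfloor> * (2 * pi) \<le> x - a" "x - a < (of_int \<lfloor>(x - a) / (2 * pi)\<rfloor> + 1) * (2 * pi)"
    by (intro floor_divide_lower floor_divide_upper; simp)+
  then show ?thesis by (intro that[of ?k]) (auto simp: algebra_simps)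
qed

lemma inner_cis_cis: "cis a \<bullet> cis b = cos (b - a)" "(\<i> * cis a) \<bullet> cis b = sin (b - a)"
  by (simp_all add: inner_complex_def cos_diff sin_diff)

lemma complex_cis_frame: "x = (x \<bullet> cis \<theta>) *\<^sub>R cis \<theta> + (x \<bullet> (\<i> * cis \<theta>)) *\<^sub>R (\<i> * cis \<theta>)"
proof -
  have e: "cos \<theta> * cos \<theta> = 1 - sin \<theta> * sin \<theta>" using sin_cos_squared_add[of \<theta>] by (simp add: power2_eq_square)
  show ?thesis by (simp add: complex_eq_iff inner_complex_def algebra_simps e)
qed

locale convex_support =
  fixes u :: "real \<Rightarrow> real"
  assumes smooth: "smooth_on UNIV u" and periodic: "\<And>\<theta>. u (\<theta> + 2 * pi) = u \<theta>"
    and radius_pos: "\<And>\<theta>. curv_radius u \<theta> > 0"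
begin

abbreviation "Y \<equiv> support_curve u"
abbreviation "\<rho> \<equiv> curv_radius u"

lemma du: "(u has_real_derivative deriv u \<theta>) (at \<theta> within A)"
  by (rule has_field_derivative_at_within[OF smooth_on_deriv(1)[OF smooth]])

lemma ddu: "(deriv u has_real_derivative deriv (deriv u) \<theta>) (at \<theta> within A)"
  by (rule has_field_derivative_at_within[OF smooth_on_deriv(1)[OF smooth_on_deriv(2)[OF smooth]]])

lemma periodic_int: "u (\<theta> + of_int k * (2 * pi)) = u \<theta>"
proof -
  interpret periodic_fun_simple u "2 * pi" by unfold_locales (rule periodic)
  show ?thesis by (rule plus_of_int)
qed

lemma Y_cong: "cis a = cis b \<Longrightarrow> Y a = Y b"
proof -
  assume *: "cis a = cis b"
  then obtain k :: int where k: "a = b + of_int k * (2 * pi)" using cis_eq_iff by blast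
  interpret d: periodic_fun_simple "deriv u" "2 * pi"
    by unfold_locales (rule periodic_deriv[OF smooth periodic])
  have "deriv u a = deriv u b" unfolding k by (rule d.plus_of_int)
  then show ?thesis using * periodic_int by (simp add: support_curve_def k)
qed

text \<open>The derivative of the frame cancels the two terms with u', so no normal component
  remains and u'' + u is the speed.\<close>

lemma Y_derivative: "(Y has_vector_derivative \<rho> \<theta> *\<^sub>R (\<i> * cis \<theta>)) (at \<theta> within A)"
proof -
  have c: "(cis has_vector_derivative \<i> * cis \<theta>) (at \<theta> within A)" by (rule has_vector_derivative_cis)
  have ci: "((\<lambda>\<theta>. \<i> * cis \<theta>) has_vector_derivative \<i> * (\<i> * cis \<theta>)) (at \<theta> within A)"
    by (rule bounded_linear.has_vector_derivative[OF bounded_linear_mult_right c])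
  show ?thesis unfolding support_curve_def[abs_def]
    using has_vector_derivative_add[OF has_vector_derivative_scaleR[OF du c] has_vector_derivative_scaleR[OF ddu ci]]
    by (simp add: curv_radius_def algebra_simps)
qed

lemma Y_inner: "Y \<theta> \<bullet> cis \<eta> = u \<theta> * cos (\<eta> - \<theta>) + deriv u \<theta> * sin (\<eta> - \<theta>)"
  by (simp add: support_curve_def inner_add_left inner_cis_cis)

lemma Y_inner_same: "Y \<theta> \<bullet> cis \<theta> = u \<theta>"
  by (simp add: Y_inner)

lemma Y_inner_derivative: "((\<lambda>\<theta>. Y \<theta> \<bullet> cis \<eta>) has_real_derivative \<rho> \<theta> * sin (\<eta> - \<theta>)) (at \<theta>)"
  using bounded_linear.has_vector_derivative[OF bounded_linear_inner_left Y_derivative, of "cis \<eta>" \<theta> UNIV]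
  by (simp add: has_real_derivative_iff_has_vector_derivative inner_cis_cis)

text \<open>\<open>Y \<theta> \<bullet> cis \<eta>\<close> increases in \<open>\<theta>\<close> on \<open>[\<eta> - \<pi>, \<eta>]\<close> and decreases on \<open>[\<eta>, \<eta> + \<pi>]\<close>.\<close>

lemma support_strict:
  assumes "cis \<theta> \<noteq> cis \<eta>" shows "Y \<theta> \<bullet> cis \<eta> < u \<eta>"
proof -
  obtain k :: int where k: "\<eta> - pi \<le> \<theta> + of_int k * (2 * pi)" "\<theta> + of_int k * (2 * pi) < \<eta> - pi + 2 * pi"
    by (rule exists_shift)
  define a where "a = \<theta> + of_int k * (2 * pi)"
  have ca: "cis a = cis \<theta>" unfolding cis_eq_iff a_def by blast
  then have ne: "a \<noteq> \<eta>" using assms by auto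
  have "Y a \<bullet> cis \<eta> < Y \<eta> \<bullet> cis \<eta>"
  proof (cases "a < \<eta>")
    case True
    show ?thesis
    proof (rule DERIV_pos_imp_increasing_open[OF True])
      fix x assume "a < x" "x < \<eta>"
      then have "sin (\<eta> - x) > 0" using k by (intro sin_gt_zero) (auto simp: a_def)
      then show "\<exists>y. ((\<lambda>\<theta>. Y \<theta> \<bullet> cis \<eta>) has_real_derivative y) (at x) \<and> y > 0"
        using Y_inner_derivative radius_pos by (intro exI[of _ "\<rho> x * sin (\<eta> - x)"]) auto
    next
      show "continuous_on {a..\<eta>} (\<lambda>\<theta>. Y \<theta> \<bullet> cis \<eta>)"
        using Y_inner_derivative by (intro continuous_at_imp_continuous_on ballI DERIV_isCont)
    qed
  next
    case False
    then have l: "\<eta> < a" using ne by simp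
    show ?thesis
    proof (rule DERIV_neg_imp_decreasing_open[OF l])
      fix x assume "\<eta> < x" "x < a"
      then have "sin (x - \<eta>) > 0" using k by (intro sin_gt_zero) (auto simp: a_def)
      then have "sin (\<eta> - x) < 0" using sin_minus[of "x - \<eta>"] by simp
      then show "\<exists>y. ((\<lambda>\<theta>. Y \<theta> \<bullet> cis \<eta>) has_real_derivative y) (at x) \<and> y < 0"
        using Y_inner_derivative radius_pos by (intro exI[of _ "\<rho> x * sin (\<eta> - x)"]) (auto simp: mult_pos_neg)
    next
      show "continuous_on {\<eta>..a} (\<lambda>\<theta>. Y \<theta> \<bullet> cis \<eta>)"
        using Y_inner_derivative by (intro continuous_at_imp_continuous_on ballI DERIV_isCont)
    qed
  qed
  then show ?thesis using Y_cong[OF ca] by (simp add: Y_inner_same)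
qed

lemma support_le: "Y \<theta> \<bullet> cis \<eta> \<le> u \<eta>"
proof (cases "cis \<theta> = cis \<eta>")
  case True
  have "Y \<theta> \<bullet> cis \<eta> = u \<eta>" unfolding Y_cong[OF True] by (rule Y_inner_same)
  then show ?thesis by simp
next
  case False then show ?thesis using support_strict[OF False] by simp
qed

lemma Y_eq_iff: "Y a = Y b \<longleftrightarrow> cis a = cis b"
proof
  assume e: "Y a = Y b"
  show "cis a = cis b"
  proof (rule ccontr)
    assume "cis a \<noteq> cis b"
    then have "Y a \<bullet> cis b < u b" by (rule support_strict)
    then show False unfolding e Y_inner_same by simp
  qed
qed (rule Y_cong)

section \<open>The open convex body cut out by a support function\<close>

definition body :: "complex set" where "body = {x. \<forall>\<eta>. x \<bullet> cis \<eta> < u \<eta>}"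

lemma continuous_u: "continuous_on A u"
  using smooth_on_imp_cont[OF smooth] continuous_on_subset by blast

text \<open>Over a compact set of directions the strict inequalities have a common margin d, which
  can absorb a small displacement of x.\<close>

lemma body_gap:
  assumes A: "compact A" and "\<And>\<eta>. \<eta> \<in> A \<Longrightarrow> x \<bullet> cis \<eta> < u \<eta>"
  obtains d where "d > 0" "\<And>\<eta>. \<eta> \<in> A \<Longrightarrow> x \<bullet> cis \<eta> + d \<le> u \<eta>"
proof (cases "A = {}")
  case False
  have "continuous_on A (\<lambda>\<eta>. u \<eta> - x \<bullet> cis \<eta>)" by (intro continuous_intros continuous_u)
  then obtain \<eta>0 where "\<eta>0 \<in> A" "\<And>\<eta>. \<eta> \<in> A \<Longrightarrow> u \<eta>0 - x \<bullet> cis \<eta>0 \<le> u \<eta> - x \<bullet> cis \<eta>"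
    using continuous_attains_inf[OF A False] by blast
  then show ?thesis using that[of "u \<eta>0 - x \<bullet> cis \<eta>0"] assms(2) by force
qed (use that[of 1] in auto)

lemma body_alt: "x \<in> body \<longleftrightarrow> (\<forall>\<eta>\<in>{a..a + 2 * pi}. x \<bullet> cis \<eta> < u \<eta>)"
proof
  assume *: "\<forall>\<eta>\<in>{a..a + 2 * pi}. x \<bullet> cis \<eta> < u \<eta>"
  show "x \<in> body" unfolding body_def
  proof safe
    fix \<eta>
    obtain k :: int where k: "a \<le> \<eta> + of_int k * (2 * pi)" "\<eta> + of_int k * (2 * pi) < a + 2 * pi"
      by (rule exists_shift)
    have "x \<bullet> cis (\<eta> + of_int k * (2 * pi)) < u (\<eta> + of_int k * (2 * pi))" using k * by auto
    moreover have "cis (\<eta> + of_int k * (2 * pi)) = cis \<eta>" unfolding cis_eq_iff by blast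
    ultimately show "x \<bullet> cis \<eta> < u \<eta>" by (simp add: periodic_int)
  qed
qed (auto simp: body_def)

lemma inner_cis_le: "y \<bullet> cis \<eta> \<le> norm y"
  using Cauchy_Schwarz_ineq2[of y "cis \<eta>"] by simp

lemma open_body: "open body"
  unfolding open_contains_ball
proof
  fix x assume x: "x \<in> body"
  obtain d where d: "d > 0" "\<And>\<eta>. \<eta> \<in> {0..0 + 2 * pi} \<Longrightarrow> x \<bullet> cis \<eta> + d \<le> u \<eta>"
    using body_gap[of "{0..0 + 2 * pi}" x] x by (auto simp: body_def)
  have "ball x d \<subseteq> body"
  proof
    fix y assume "y \<in> ball x d"
    then have "norm (y - x) < d" by (simp add: dist_norm norm_minus_commute)
    then have "y \<bullet> cis \<eta> < x \<bullet> cis \<eta> + d" for \<eta>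
      using inner_cis_le[of "y - x" \<eta>] by (simp add: inner_diff_left)
    then show "y \<in> body" unfolding body_alt[of _ 0] using less_le_trans[OF _ d(2)] by blast
  qed
  then show "\<exists>e>0. ball x e \<subseteq> body" using d by blast
qed

lemma convex_body: "convex body"
proof -
  have "body = (\<Inter>\<eta>. {x. cis \<eta> \<bullet> x < u \<eta>})" by (auto simp: body_def inner_commute)
  then show ?thesis by (simp add: convex_INT convex_halfspace_lt)
qed

text \<open>Testing x against its own direction \<open>Arg2pi x\<close> yields its norm, which is
  therefore bounded by the values of u over one period.\<close>

lemma bounded_body: "bounded body"
proof -
  obtain M where M: "\<And>x. x \<in> {0..2 * pi} \<Longrightarrow> \<bar>u x\<bar> \<le> M"
    using compact_imp_bounded[OF compact_continuous_image[OF continuous_u, of "{0..2 * pi}"]] by (force simp: bounded_iff)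
  have "norm x \<le> M" if "x \<in> body" for x
  proof -
    have "x \<bullet> cis (Arg2pi x) < u (Arg2pi x)" using that by (simp add: body_def)
    moreover have "x \<bullet> cis (Arg2pi x) = norm x"
    proof -
      have "x = norm x *\<^sub>R cis (Arg2pi x)"
        using Arg2pi_eq[of x] by (simp add: cis_conv_exp scaleR_conv_of_real)
      then have "x \<bullet> cis (Arg2pi x) = (norm x *\<^sub>R cis (Arg2pi x)) \<bullet> cis (Arg2pi x)" by simp
      also have "\<dots> = norm x" by (simp add: inner_cis_cis)
      finally show ?thesis .
    qed
    ultimately show ?thesis using M[of "Arg2pi x"] Arg2pi_ge_0[of x] Arg2pi_lt_2pi[of x] by auto
  qed
  then show ?thesis by (auto simp: bounded_iff)
qed

text \<open>Moving against \<open>cis \<theta>\<close> lowers the height in every direction at an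
  acute angle to it. The remaining directions form a compact set A that avoids the contact
  direction, so a uniform margin is available there.\<close>

lemma inward_in_body: "\<forall>\<^sub>F s in at_right 0. Y \<theta> + s *\<^sub>R (- cis \<theta>) \<in> body"
proof -
  define A where "A = {\<theta>..\<theta> + 2 * pi} \<inter> {\<eta>. cos (\<eta> - \<theta>) \<le> 0}"
  have cA: "compact A" unfolding A_def
    by (intro compact_Int_closed closed_Collect_le continuous_intros) auto
  have sA: "Y \<theta> \<bullet> cis \<eta> < u \<eta>" if "\<eta> \<in> A" for \<eta>
  proof (rule support_strict)
    show "cis \<theta> \<noteq> cis \<eta>"
    proof
      assume "cis \<theta> = cis \<eta>"
      then have "cos (\<eta> - \<theta>) = 1" using inner_cis_cis(1)[of \<theta> \<eta>] inner_cis_cis(1)[of \<theta> \<theta>] by simp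
      then show False using that by (simp add: A_def)
    qed
  qed
  obtain d where d: "d > 0" "\<And>\<eta>. \<eta> \<in> A \<Longrightarrow> Y \<theta> \<bullet> cis \<eta> + d \<le> u \<eta>"
    using body_gap[OF cA sA] by blast
  have "Y \<theta> + s *\<^sub>R (- cis \<theta>) \<in> body" if s: "0 < s" "s < d" for s
    unfolding body_alt[of _ \<theta>]
  proof
    fix \<eta> assume \<eta>: "\<eta> \<in> {\<theta>..\<theta> + 2 * pi}"
    have e: "(Y \<theta> + s *\<^sub>R (- cis \<theta>)) \<bullet> cis \<eta> = Y \<theta> \<bullet> cis \<eta> - s * cos (\<eta> - \<theta>)"
      by (simp add: inner_add_left inner_diff_left inner_cis_cis)
    show "(Y \<theta> + s *\<^sub>R (- cis \<theta>)) \<bullet> cis \<eta> < u \<eta>"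
    proof (cases "\<eta> \<in> A")
      case True
      have "- (s * cos (\<eta> - \<theta>)) \<le> s" using s mult_left_mono[OF cos_ge_minus_one[of "\<eta> - \<theta>"], of s] by simp
      then show ?thesis using d(2)[OF True] s e by linarith
    next
      case False
      then have "s * cos (\<eta> - \<theta>) > 0" using \<eta> s by (auto simp: A_def)
      then show ?thesis using support_le[of \<theta> \<eta>] e by linarith
    qed
  qed
  then show ?thesis using d(1) by (auto simp: eventually_at_right intro!: exI[of _ d])
qed

lemma outward_not_in_body: "s \<ge> 0 \<Longrightarrow> Y \<theta> + s *\<^sub>R cis \<theta> \<notin> body"
proof
  assume s: "s \<ge> 0" and "Y \<theta> + s *\<^sub>R cis \<theta> \<in> body"
  then have "(Y \<theta> + s *\<^sub>R cis \<theta>) \<bullet> cis \<theta> < u \<theta>" by (simp add: body_def)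
  then show False using s by (simp add: inner_add_left Y_inner_same inner_cis_cis)
qed

lemma Y_in_closure: "Y \<theta> \<in> closure body"
proof -
  have "((\<lambda>s. Y \<theta> + s *\<^sub>R (- cis \<theta>)) \<longlongrightarrow> Y \<theta> + 0 *\<^sub>R (- cis \<theta>)) (at_right 0)"
    by (intro tendsto_intros)
  then have lim: "((\<lambda>s. Y \<theta> + s *\<^sub>R (- cis \<theta>)) \<longlongrightarrow> Y \<theta>) (at_right 0)" by simp
  have "\<forall>\<^sub>F s in at_right 0. Y \<theta> + s *\<^sub>R (- cis \<theta>) \<in> closure body"
    by (rule eventually_mono[OF inward_in_body]) (use closure_subset in blast)
  from Lim_in_closed_set[OF closed_closure this _ lim] show ?thesis by simp
qed

lemma closure_body_le: "x \<in> closure body \<Longrightarrow> x \<bullet> cis \<eta> \<le> u \<eta>"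
proof -
  have "closure body \<subseteq> {x. cis \<eta> \<bullet> x \<le> u \<eta>}"
  proof (rule closure_minimal)
    show "body \<subseteq> {x. cis \<eta> \<bullet> x \<le> u \<eta>}"
      by (auto simp: body_def inner_commute[of "cis \<eta>"] intro: less_imp_le)
  qed (rule closed_halfspace_le)
  then show "x \<in> closure body \<Longrightarrow> x \<bullet> cis \<eta> \<le> u \<eta>" by (auto simp: inner_commute)
qed

text \<open>A boundary point x attains u \<eta> for some \<eta>, so \<eta> minimizes u \<zeta> - x
  \<bullet> cis \<zeta>. The first-order condition determines the tangential component of x as well,
  and hence x = Y \<eta>.\<close>

lemma frontier_body: "frontier body = range Y"
proof -
  have "x \<in> range Y" if x: "x \<in> closure body" "x \<notin> body" for x
  proof -
    obtain \<eta> where "\<not> x \<bullet> cis \<eta> < u \<eta>" using x by (auto simp: body_def)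
    then have e: "x \<bullet> cis \<eta> = u \<eta>" using closure_body_le[OF x(1), of \<eta>] by simp
    have "((\<lambda>\<zeta>. u \<zeta> - x \<bullet> cis \<zeta>) has_real_derivative deriv u \<eta> - x \<bullet> (\<i> * cis \<eta>)) (at \<eta>)"
      using DERIV_diff[OF du[of \<eta> UNIV]] bounded_linear.has_vector_derivative[OF bounded_linear_inner_right has_vector_derivative_cis, of x \<eta> UNIV]
      by (simp add: has_real_derivative_iff_has_vector_derivative)
    then have "deriv u \<eta> - x \<bullet> (\<i> * cis \<eta>) = 0"
      by (rule DERIV_local_min[of _ _ _ 1]) (use e closure_body_le[OF x(1)] in auto)
    then have "x = Y \<eta>" using complex_cis_frame[of x \<eta>] e by (simp add: support_curve_def)
    then show ?thesis by blast
  qed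
  moreover have "Y \<theta> \<notin> body" for \<theta> using outward_not_in_body[of 0 \<theta>] by simp
  ultimately show ?thesis using Y_in_closure interior_open[OF open_body] by (auto simp: frontier_def)
qed

lemma inside_range: "inside (range Y) = body"
  using inside_frontier_eq_interior[OF bounded_body convex_body] interior_open[OF open_body] frontier_body by simp

text \<open>No direction is normal to the curve at both end points, so in every direction at least
  one of the two support inequalities is strict.\<close>

lemma between_in_body:
  assumes "cis a \<noteq> cis b" "0 < s" "s < 1"
  shows "(1 - s) *\<^sub>R Y a + s *\<^sub>R Y b \<in> body"
  unfolding body_def
proof safe
  fix \<eta>
  have "cis a \<noteq> cis \<eta> \<or> cis b \<noteq> cis \<eta>" using assms(1) by auto
  then have "Y a \<bullet> cis \<eta> < u \<eta> \<or> Y b \<bullet> cis \<eta> < u \<eta>" using support_strict by blast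
  then have "(1 - s) * (Y a \<bullet> cis \<eta>) + s * (Y b \<bullet> cis \<eta>) < (1 - s) * u \<eta> + s * u \<eta>"
    using assms(2,3) support_le[of a \<eta>] support_le[of b \<eta>]
  proof (elim disjE)
    assume "Y a \<bullet> cis \<eta> < u \<eta>"
    then show ?thesis using assms(2,3) support_le[of b \<eta>]
      by (intro add_less_le_mono mult_strict_left_mono mult_left_mono) auto
  next
    assume "Y b \<bullet> cis \<eta> < u \<eta>"
    then show ?thesis using assms(2,3) support_le[of a \<eta>]
      by (intro add_le_less_mono mult_strict_left_mono mult_left_mono) auto
  qed
  then show "((1 - s) *\<^sub>R Y a + s *\<^sub>R Y b) \<bullet> cis \<eta> < u \<eta>"
    by (simp add: inner_add_left algebra_simps)
qed

lemma Ck_on_u: "Ck_on n UNIV u" "Ck_on n UNIV (deriv u)" "Ck_on n UNIV (deriv (deriv u))"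
  using smooth smooth_on_deriv(2)[OF smooth] smooth_on_deriv(2)[OF smooth_on_deriv(2)[OF smooth]]
  by (auto simp: smooth_on_def)

lemma Ck_on_\<rho>: "Ck_on n UNIV \<rho>"
  unfolding curv_radius_def[abs_def] by (intro Ck_intros Ck_on_u fat_open open_UNIV)

lemma Ck_on_Y: "Ck_on n UNIV Y"
  unfolding support_curve_def[abs_def] by (intro Ck_intros Ck_on_u Ck_on_cis fat_open open_UNIV)

lemma continuous_\<rho>: "continuous_on A \<rho>"
  using Ck_on_imp_cont[OF Ck_on_\<rho>] continuous_on_subset by blast

end

section \<open>Monotone angles that cover the circle once\<close>

lemma angle_funD:
  assumes "angle_fun \<sigma> \<alpha>"
  shows "(\<alpha> has_real_derivative deriv \<alpha> \<phi>) (at \<phi>)" "\<phi>1 < \<phi>2 \<Longrightarrow> \<sigma> * \<alpha> \<phi>1 < \<sigma> * \<alpha> \<phi>2"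
    "\<exists>\<phi>. \<alpha> \<phi> = \<eta>" "\<alpha> (\<phi> + of_int k * (2 * pi)) = \<alpha> \<phi> + \<sigma> * of_int k * (2 * pi)" "continuous_on A \<alpha>"
    "\<sigma> * \<sigma> = 1" "\<bar>\<sigma>\<bar> = 1"
proof -
  have sm: "smooth_on UNIV \<alpha>" and \<sigma>: "\<sigma> = 1 \<or> \<sigma> = - 1" and pos: "\<And>\<phi>. \<sigma> * deriv \<alpha> \<phi> > 0"
    and per: "\<And>\<phi>. \<alpha> (\<phi> + 2 * pi) = \<alpha> \<phi> + \<sigma> * (2 * pi)"
    using assms by (auto simp: angle_fun_def)
  show ss: "\<sigma> * \<sigma> = 1" "\<bar>\<sigma>\<bar> = 1" using \<sigma> by auto
  show d: "(\<alpha> has_real_derivative deriv \<alpha> \<phi>) (at \<phi>)" for \<phi> by (rule smooth_on_deriv(1)[OF sm])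
  show c: "continuous_on A \<alpha>" for A using smooth_on_imp_cont[OF sm] continuous_on_subset by blast
  show "\<sigma> * \<alpha> \<phi>1 < \<sigma> * \<alpha> \<phi>2" if "\<phi>1 < \<phi>2"
  proof (rule DERIV_pos_imp_increasing[OF that])
    fix x show "\<exists>y. ((\<lambda>x. \<sigma> * \<alpha> x) has_real_derivative y) (at x) \<and> 0 < y"
      using DERIV_cmult[OF d] pos by blast
  qed
  show k: "\<alpha> (\<phi> + of_int k * (2 * pi)) = \<alpha> \<phi> + \<sigma> * of_int k * (2 * pi)" for k \<phi>
  proof -
    interpret periodic_fun_simple "\<lambda>x. \<alpha> x - \<sigma> * x" "2 * pi"
      by unfold_locales (subst per, simp add: algebra_simps)
    show ?thesis using plus_of_int[of \<phi> k] by (simp add: algebra_simps)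
  qed
  show "\<exists>\<phi>. \<alpha> \<phi> = \<eta>"
  proof -
    define y where "y = \<sigma> * \<eta>"
    \<comment> \<open>Over one period \<sigma> * \<alpha> rises by exactly 2 * pi, so some shift of
      the target by a multiple of 2 * pi lies among its values there.\<close>
    obtain j :: int where j: "\<sigma> * \<alpha> 0 \<le> y + of_int j * (2 * pi)" "y + of_int j * (2 * pi) < \<sigma> * \<alpha> 0 + 2 * pi"
      by (rule exists_shift)
    have e: "\<sigma> * \<alpha> (2 * pi) = \<sigma> * \<alpha> 0 + 2 * pi"
      using per[of 0] ss by (simp add: distrib_left mult.assoc[symmetric])
    have "continuous_on {0..2 * pi} (\<lambda>x. \<sigma> * \<alpha> x)" by (intro continuous_intros c)
    from IVT'[OF j(1) _ _ this] obtain x where "\<sigma> * \<alpha> x = y + of_int j * (2 * pi)"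
      using j(2) e by auto
    then have "\<sigma> * (\<sigma> * \<alpha> x) = \<sigma> * y + \<sigma> * of_int j * (2 * pi)" by (simp add: algebra_simps)
    then have "\<alpha> x = \<eta> + \<sigma> * of_int j * (2 * pi)"
      using ss by (simp add: y_def mult.assoc[symmetric])
    then have "\<alpha> (x + of_int (- j) * (2 * pi)) = \<eta>" unfolding k by simp
    then show ?thesis by blast
  qed
qed

text \<open>Within less than one period \<sigma> * \<alpha> rises by less than 2 * pi but by more
  than 0, so the two angles cannot differ by a multiple of 2 * pi.\<close>

lemma angle_fun_inj:
  assumes a: "angle_fun \<sigma> \<alpha>" and "\<phi>1 < \<phi>2" "\<phi>2 < \<phi>1 + 2 * pi"
  shows "cis (\<alpha> \<phi>1) \<noteq> cis (\<alpha> \<phi>2)"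
proof
  assume "cis (\<alpha> \<phi>1) = cis (\<alpha> \<phi>2)"
  then obtain k :: int where k: "\<alpha> \<phi>2 = \<alpha> \<phi>1 + of_int k * (2 * pi)" using cis_eq_iff by metis
  have 1: "\<sigma> * \<alpha> \<phi>1 < \<sigma> * \<alpha> \<phi>2" "\<sigma> * \<alpha> \<phi>2 < \<sigma> * \<alpha> (\<phi>1 + 2 * pi)"
    using angle_funD(2)[OF a] assms by auto
  have "\<sigma> * \<alpha> (\<phi>1 + 2 * pi) = \<sigma> * \<alpha> \<phi>1 + 2 * pi"
    using angle_funD(4)[OF a, of \<phi>1 1] angle_funD(6)[OF a] by (simp add: distrib_left mult.assoc[symmetric])
  then have "0 < (\<sigma> * of_int k) * (2 * pi)" "(\<sigma> * of_int k) * (2 * pi) < 1 * (2 * pi)"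
    using 1 k by (simp_all add: algebra_simps)
  then have "0 < \<sigma> * of_int k" "\<sigma> * of_int k < 1"
    by (simp_all add: zero_less_mult_iff)
  then show False using a by (auto simp: angle_fun_def)
qed

section \<open>The area enclosed by a support curve\<close>

lemma nn_integral_lborel_complex:
  fixes f :: "complex \<Rightarrow> ennreal"
  assumes f: "f \<in> borel_measurable borel"
  shows "(\<integral>\<^sup>+z. f z \<partial>lborel) = (\<integral>\<^sup>+x. \<integral>\<^sup>+y. f (Complex x y) \<partial>lborel \<partial>lborel)"
proof -
  let ?C = "\<lambda>p::real \<times> real. Complex (fst p) (snd p)"
  have C: "?C = (\<lambda>p. of_real (fst p) + \<i> * of_real (snd p))" by (auto simp: complex_eq_iff)
  have m: "?C \<in> borel_measurable (lborel \<Otimes>\<^sub>M lborel)"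
    unfolding C by measurable
  \<comment> \<open>Lebesgue measure is determined by its values on boxes; identifying it with an
    image of the product measure makes iterated integration available on
    \<open>complex\<close>.\<close>
  have "lborel = distr (lborel \<Otimes>\<^sub>M lborel) borel ?C"
  proof (rule lborel_eqI)
    fix l u :: complex assume le: "\<And>b. b \<in> Basis \<Longrightarrow> l \<bullet> b \<le> u \<bullet> b"
    have le': "Re l \<le> Re u" "Im l \<le> Im u" using le[of 1] le[of \<i>] by (auto simp: Basis_complex_def)
    have "?C -` box l u \<inter> space (lborel \<Otimes>\<^sub>M lborel) = {Re l<..<Re u} \<times> {Im l<..<Im u}"
      by (auto simp: box_complex_eq space_pair_measure)
    then have "emeasure (distr (lborel \<Otimes>\<^sub>M lborel) borel ?C) (box l u) =
        emeasure (lborel \<Otimes>\<^sub>M lborel) ({Re l<..<Re u} \<times> {Im l<..<Im u})"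
      by (subst emeasure_distr[OF m]) auto
    also have "\<dots> = ennreal (Re u - Re l) * ennreal (Im u - Im l)"
      using le' by (simp add: lborel.emeasure_pair_measure_Times)
    also have "\<dots> = (\<Prod>b\<in>Basis. (u - l) \<bullet> b)"
      using le' by (simp add: Basis_complex_def ennreal_mult[symmetric])
    finally show "emeasure (distr (lborel \<Otimes>\<^sub>M lborel) borel ?C) (box l u) = (\<Prod>b\<in>Basis. (u - l) \<bullet> b)" .
  qed simp
  then have "(\<integral>\<^sup>+z. f z \<partial>lborel) = (\<integral>\<^sup>+z. f z \<partial>distr (lborel \<Otimes>\<^sub>M lborel) borel ?C)" by simp
  also have "\<dots> = (\<integral>\<^sup>+p. f (?C p) \<partial>(lborel \<Otimes>\<^sub>M lborel))"
    by (rule nn_integral_distr[OF m]) (use f in simp)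
  also have "\<dots> = (\<integral>\<^sup>+x. \<integral>\<^sup>+y. f (?C (x, y)) \<partial>lborel \<partial>lborel)"
    by (rule lborel.nn_integral_fst[symmetric]) (use measurable_compose[OF m f] in simp)
  finally show ?thesis by simp
qed

context convex_support
begin

abbreviation "\<xi> \<equiv> \<lambda>\<theta>. Re (Y \<theta>)"
abbreviation "\<upsilon> \<equiv> \<lambda>\<theta>. Im (Y \<theta>)"

lemma d\<xi>: "(\<xi> has_real_derivative - \<rho> \<theta> * sin \<theta>) (at \<theta> within A)"
  using bounded_linear.has_vector_derivative[OF bounded_linear_Re Y_derivative, of \<theta> A]
  by (simp add: has_real_derivative_iff_has_vector_derivative)

lemma d\<upsilon>: "(\<upsilon> has_real_derivative \<rho> \<theta> * cos \<theta>) (at \<theta> within A)"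
  using bounded_linear.has_vector_derivative[OF bounded_linear_Im Y_derivative, of \<theta> A]
  by (simp add: has_real_derivative_iff_has_vector_derivative)

lemma continuous_\<xi>\<upsilon>: "continuous_on A \<xi>" "continuous_on A \<upsilon>"
  using DERIV_continuous_on[OF d\<xi>] DERIV_continuous_on[OF d\<upsilon>] by auto

lemma \<xi>_decreasing: "0 \<le> a \<Longrightarrow> a < b \<Longrightarrow> b \<le> pi \<Longrightarrow> \<xi> b < \<xi> a"
proof (rule DERIV_neg_imp_decreasing_open[of a b \<xi>])
  fix x assume "0 \<le> a" "b \<le> pi" "a < x" "x < b"
  then have "\<rho> x * sin x > 0" using radius_pos[of x] sin_gt_zero[of x] by simp
  then show "\<exists>y. (\<xi> has_real_derivative y) (at x) \<and> y < 0" using d\<xi>[of x UNIV] by (intro exI conjI) auto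
qed (auto intro: continuous_\<xi>\<upsilon>)

lemma \<xi>_increasing: "pi \<le> a \<Longrightarrow> a < b \<Longrightarrow> b \<le> 2 * pi \<Longrightarrow> \<xi> a < \<xi> b"
proof (rule DERIV_pos_imp_increasing_open[of a b \<xi>])
  fix x assume "pi \<le> a" "b \<le> 2 * pi" "a < x" "x < b"
  then have "\<rho> x * sin x < 0" using radius_pos[of x] sin_lt_zero[of x] by (simp add: mult_pos_neg)
  then show "\<exists>y. (\<xi> has_real_derivative y) (at x) \<and> y > 0" using d\<xi>[of x UNIV] by (intro exI conjI) auto
qed (auto intro: continuous_\<xi>\<upsilon>)

lemma \<xi>_ends: "\<xi> 0 = u 0" "\<xi> (2 * pi) = u 0" "\<xi> pi = - u pi"
  using Y_inner_same[of 0] Y_inner_same[of pi] Y_cong[of "2 * pi" 0]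
  by (auto simp: inner_complex_def complex_eq_iff)

text \<open>The abscissa decreases on the upper arc [0, pi] and increases on the lower arc
  [pi, 2 pi], so each arc is a graph over the same interval [- u pi, u 0].\<close>

definition inv_top :: "real \<Rightarrow> real" where "inv_top = the_inv_into {0..pi} \<xi>"
definition inv_bot :: "real \<Rightarrow> real" where "inv_bot = the_inv_into {pi..2 * pi} \<xi>"

lemma \<xi>_inj: "inj_on \<xi> {0..pi}" "inj_on \<xi> {pi..2 * pi}"
  by (rule linorder_inj_onI; use \<xi>_decreasing \<xi>_increasing in force)+

lemma \<xi>_image: "\<xi> ` {0..pi} = {- u pi..u 0}" "\<xi> ` {pi..2 * pi} = {- u pi..u 0}"
proof -
  show "\<xi> ` {0..pi} = {- u pi..u 0}"
  proof safe
    fix x assume "x \<in> {0..pi}"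
    then show "\<xi> x \<in> {- u pi..u 0}"
      using \<xi>_decreasing[of 0 x] \<xi>_decreasing[of x pi] \<xi>_ends by (cases "x = 0"; cases "x = pi") auto
  next
    fix x assume "x \<in> {- u pi..u 0}"
    then show "x \<in> \<xi> ` {0..pi}"
      using IVT2'[of \<xi> pi x 0] \<xi>_ends continuous_\<xi>\<upsilon>(1)[of "{0..pi}"] by (auto simp: image_iff)
  qed
  show "\<xi> ` {pi..2 * pi} = {- u pi..u 0}"
  proof safe
    fix x assume "x \<in> {pi..2 * pi}"
    then show "\<xi> x \<in> {- u pi..u 0}"
      using \<xi>_increasing[of pi x] \<xi>_increasing[of x "2 * pi"] \<xi>_ends by (cases "x = 2 * pi"; cases "x = pi") auto
  next
    fix x assume "x \<in> {- u pi..u 0}"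
    then show "x \<in> \<xi> ` {pi..2 * pi}"
      using IVT'[of \<xi> pi x "2 * pi"] \<xi>_ends continuous_\<xi>\<upsilon>(1)[of "{pi..2 * pi}"] by (auto simp: image_iff)
  qed
qed

lemma inv_top: "\<theta> \<in> {0..pi} \<Longrightarrow> inv_top (\<xi> \<theta>) = \<theta>" "x \<in> {- u pi..u 0} \<Longrightarrow> \<xi> (inv_top x) = x"
  "x \<in> {- u pi..u 0} \<Longrightarrow> inv_top x \<in> {0..pi}" "continuous_on {- u pi..u 0} inv_top"
  unfolding inv_top_def
  using the_inv_into_f_f[OF \<xi>_inj(1)] f_the_inv_into_f[OF \<xi>_inj(1)] the_inv_into_into[OF \<xi>_inj(1) _ order_refl]
    continuous_on_inv[OF continuous_\<xi>\<upsilon>(1) compact_Icc, of 0 pi "the_inv_into {0..pi} \<xi>"]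
  unfolding \<xi>_image by auto

lemma inv_bot: "\<theta> \<in> {pi..2 * pi} \<Longrightarrow> inv_bot (\<xi> \<theta>) = \<theta>" "x \<in> {- u pi..u 0} \<Longrightarrow> \<xi> (inv_bot x) = x"
  "x \<in> {- u pi..u 0} \<Longrightarrow> inv_bot x \<in> {pi..2 * pi}" "continuous_on {- u pi..u 0} inv_bot"
  unfolding inv_bot_def
  using the_inv_into_f_f[OF \<xi>_inj(2)] f_the_inv_into_f[OF \<xi>_inj(2)] the_inv_into_into[OF \<xi>_inj(2) _ order_refl]
    continuous_on_inv[OF continuous_\<xi>\<upsilon>(1) compact_Icc, of pi "2 * pi" "the_inv_into {pi..2 * pi} \<xi>"]
  unfolding \<xi>_image by auto

definition slice_top :: "real \<Rightarrow> real" where "slice_top x = \<upsilon> (inv_top x)"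
definition slice_bot :: "real \<Rightarrow> real" where "slice_bot x = \<upsilon> (inv_bot x)"

lemma slice_continuous: "continuous_on {- u pi..u 0} slice_top" "continuous_on {- u pi..u 0} slice_bot"
  unfolding slice_top_def[abs_def] slice_bot_def[abs_def]
  by (auto intro!: continuous_on_compose2[OF continuous_\<xi>\<upsilon>(2)[of UNIV]] inv_top inv_bot)

lemma width_pos: "- u pi < u 0"
  using \<xi>_decreasing[of 0 pi] \<xi>_ends by simp

lemma slice_points:
  assumes x: "x \<in> {- u pi<..<u 0}"
  shows "Y (inv_top x) = Complex x (slice_top x)" "Y (inv_bot x) = Complex x (slice_bot x)"
    "inv_top x \<in> {0<..<pi}" "inv_bot x \<in> {pi<..<2 * pi}" "slice_bot x < slice_top x"
proof -
  have x': "x \<in> {- u pi..u 0}" using x by auto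
  show Y: "Y (inv_top x) = Complex x (slice_top x)" "Y (inv_bot x) = Complex x (slice_bot x)"
    using inv_top(2)[OF x'] inv_bot(2)[OF x'] by (auto simp: slice_top_def slice_bot_def complex_eq_iff)
  have "inv_top x \<noteq> 0" "inv_top x \<noteq> pi" "inv_bot x \<noteq> pi" "inv_bot x \<noteq> 2 * pi"
    using inv_top(2)[OF x'] inv_bot(2)[OF x'] \<xi>_ends x by auto
  then show t: "inv_top x \<in> {0<..<pi}" "inv_bot x \<in> {pi<..<2 * pi}"
    using inv_top(3)[OF x'] inv_bot(3)[OF x'] by auto
  have s: "sin (inv_top x) > 0" "sin (inv_bot x) < 0" using t by (auto intro: sin_gt_zero sin_lt_zero)
  then have ne: "cis (inv_top x) \<noteq> cis (inv_bot x)" by (auto simp: complex_eq_iff)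
  have "Y (inv_bot x) \<bullet> cis (inv_top x) < Y (inv_top x) \<bullet> cis (inv_top x)"
    using support_strict[of "inv_bot x" "inv_top x"] ne Y_inner_same by metis
  then show "slice_bot x < slice_top x" using s(1) by (simp add: Y inner_complex_def)
qed

text \<open>If a point of the body lay on or beyond one of the two arc points of its vertical line,
  that arc point would be a convex combination of it and the other arc point, and would satisfy its
  own support inequality strictly. Conversely, points between the arcs are proper convex
  combinations of two curve points.\<close>

lemma body_slice: "Complex x y \<in> body \<longleftrightarrow> x \<in> {- u pi<..<u 0} \<and> slice_bot x < y \<and> y < slice_top x"
proof
  assume b: "Complex x y \<in> body"
  then have "Complex x y \<bullet> cis 0 < u 0" "Complex x y \<bullet> cis pi < u pi" unfolding body_def by blast+
  then have x: "x \<in> {- u pi<..<u 0}" by (auto simp: inner_complex_def)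
  note P = slice_points[OF x]
  have seg: False if "w \<in> {0<..1}" "z \<in> closure body" "z' = w *\<^sub>R Complex x y + (1 - w) *\<^sub>R z" "z' = Y \<eta>" for w z z' \<eta>
  proof -
    have "Complex x y \<bullet> cis \<eta> < u \<eta>" using b by (simp add: body_def)
    then have "w * (Complex x y \<bullet> cis \<eta>) + (1 - w) * (z \<bullet> cis \<eta>) < w * u \<eta> + (1 - w) * u \<eta>"
      using that closure_body_le[of z \<eta>] by (intro add_less_le_mono mult_strict_left_mono mult_left_mono) auto
    then have "z' \<bullet> cis \<eta> < u \<eta>" by (simp add: that(3) inner_add_left algebra_simps)
    then show False using that(4) Y_inner_same by simp
  qed
  have t: "y < slice_top x"
  proof (rule ccontr)
    assume n: "\<not> y < slice_top x"
    define w where "w = (slice_top x - slice_bot x) / (y - slice_bot x)"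
    have "w \<in> {0<..1}" using n P(5) by (auto simp: w_def field_simps)
    moreover have "Y (inv_top x) = w *\<^sub>R Complex x y + (1 - w) *\<^sub>R Y (inv_bot x)"
    proof -
      have "w * (y - slice_bot x) = slice_top x - slice_bot x" using n P(5) by (simp add: w_def)
      then show ?thesis by (simp add: P complex_eq_iff algebra_simps)
    qed
    ultimately show False using seg[of w "Y (inv_bot x)"] Y_in_closure by blast
  qed
  have "slice_bot x < y"
  proof (rule ccontr)
    assume n: "\<not> slice_bot x < y"
    define w where "w = (slice_top x - slice_bot x) / (slice_top x - y)"
    have "w \<in> {0<..1}" using n P(5) by (auto simp: w_def field_simps)
    moreover have "Y (inv_bot x) = w *\<^sub>R Complex x y + (1 - w) *\<^sub>R Y (inv_top x)"
    proof -
      have "w * (slice_top x - y) = slice_top x - slice_bot x" using n P(5) by (simp add: w_def)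
      then show ?thesis by (simp add: P complex_eq_iff algebra_simps)
    qed
    ultimately show False using seg[of w "Y (inv_top x)"] Y_in_closure by blast
  qed
  then show "x \<in> {- u pi<..<u 0} \<and> slice_bot x < y \<and> y < slice_top x" using x t by blast
next
  assume a: "x \<in> {- u pi<..<u 0} \<and> slice_bot x < y \<and> y < slice_top x"
  then have x: "x \<in> {- u pi<..<u 0}" by blast
  note P = slice_points[OF x]
  define w where "w = (y - slice_bot x) / (slice_top x - slice_bot x)"
  have w: "0 < w" "w < 1" using a P(5) by (auto simp: w_def field_simps)
  have ne: "cis (inv_bot x) \<noteq> cis (inv_top x)" using P(1,2,5) Y_cong by (metis complex.sel(2) less_irrefl)
  have "w * (slice_top x - slice_bot x) = y - slice_bot x" using P(5) by (simp add: w_def)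
  then have "Complex x y = (1 - w) *\<^sub>R Y (inv_bot x) + w *\<^sub>R Y (inv_top x)"
    by (simp add: P complex_eq_iff algebra_simps)
  then show "Complex x y \<in> body" using between_in_body[OF ne w] by simp
qed

lemma emeasure_body: "emeasure lborel body = ennreal (integral {- u pi..u 0} (\<lambda>x. slice_top x - slice_bot x))"
proof -
  define h where "h x = indicator {- u pi..u 0} x *\<^sub>R (slice_top x - slice_bot x)" for x
  have cont: "continuous_on {- u pi..u 0} (\<lambda>x. slice_top x - slice_bot x)"
    by (intro continuous_intros slice_continuous)
  have le: "slice_bot x \<le> slice_top x" if "x \<in> {- u pi..u 0}" for x
  proof -
    have "slice_top x - slice_bot x \<ge> 0"
      by (rule continuous_ge_on_closure[of "{- u pi<..<u 0}"])
        (use that cont width_pos slice_points(5) less_imp_le in auto)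
    then show ?thesis by simp
  qed
  have m: "h \<in> borel_measurable borel" unfolding h_def
    by (rule borel_measurable_continuous_on_indicator[OF _ cont]) auto
  have hI: "(h has_integral integral {- u pi..u 0} (\<lambda>x. slice_top x - slice_bot x)) UNIV"
  proof -
    have "((\<lambda>x. if x \<in> {- u pi..u 0} then slice_top x - slice_bot x else 0) has_integral
        integral {- u pi..u 0} (\<lambda>x. slice_top x - slice_bot x)) UNIV"
      unfolding has_integral_restrict_UNIV by (intro integrable_integral integrable_continuous_interval cont)
    moreover have "h = (\<lambda>x. if x \<in> {- u pi..u 0} then slice_top x - slice_bot x else 0)"
      by (auto simp: h_def indicator_def)
    ultimately show ?thesis by simp
  qed
  have "emeasure lborel body = (\<integral>\<^sup>+z. indicator body z \<partial>lborel)"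
    using open_body by (simp add: nn_integral_indicator)
  also have "\<dots> = (\<integral>\<^sup>+x. \<integral>\<^sup>+y. indicator body (Complex x y) \<partial>lborel \<partial>lborel)"
    by (rule nn_integral_lborel_complex) (use open_body in auto)
  also have "\<dots> = (\<integral>\<^sup>+x. ennreal (h x) \<partial>lborel)"
  proof (rule nn_integral_cong_AE)
    \<comment> \<open>The two extreme abscissae, where \<open>slice_points\<close> does not apply,
      form a null set.\<close>
    have "AE x in lborel. x \<noteq> - u pi \<and> x \<noteq> u 0" by (intro AE_conjI AE_lborel_singleton)
    then show "AE x in lborel. (\<integral>\<^sup>+y. indicator body (Complex x y) \<partial>lborel) = ennreal (h x)"
    proof eventually_elim
      case (elim x)
      show ?case
      proof (cases "x \<in> {- u pi<..<u 0}")
        case True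
        have "(\<lambda>y. indicator body (Complex x y) :: ennreal) = indicator {slice_bot x<..<slice_top x}"
          using True by (auto simp: indicator_def body_slice fun_eq_iff)
        then show ?thesis using True slice_points(5)[OF True] by (simp add: h_def nn_integral_indicator)
      next
        case False
        then have "(\<lambda>y. indicator body (Complex x y) :: ennreal) = (\<lambda>y. 0)"
          by (auto simp: indicator_def body_slice fun_eq_iff)
        moreover have "x \<notin> {- u pi..u 0}" using False elim by auto
        ultimately show ?thesis by (simp add: h_def)
      qed
    qed
  qed
  also have "\<dots> = ennreal (integral {- u pi..u 0} (\<lambda>x. slice_top x - slice_bot x))"
    by (rule nn_integral_has_integral_lborel[OF m _ hI]) (use le in \<open>auto simp: h_def indicator_def\<close>)
  finally show ?thesis .
qed

text \<open>Substituting x = \<xi> \<theta> on each arc. The abscissa runs backwards on the upper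
  arc, so both arcs contribute with the same sign and join to one integral over the period.\<close>

lemma integral_slices:
  "integral {- u pi..u 0} (\<lambda>x. slice_top x - slice_bot x) = integral {0..2 * pi} (\<lambda>\<theta>. \<rho> \<theta> * sin \<theta> * \<upsilon> \<theta>)"
proof -
  have le: "- u pi \<le> u 0" using width_pos by simp
  have c: "continuous_on {a..b} (\<lambda>\<theta>. \<rho> \<theta> * sin \<theta> * \<upsilon> \<theta>)" for a b
    by (intro continuous_intros continuous_\<xi>\<upsilon> continuous_\<rho>)
  have "((\<lambda>\<theta>. (- \<rho> \<theta> * sin \<theta>) *\<^sub>R slice_top (\<xi> \<theta>)) has_integral
      (integral {\<xi> 0..\<xi> pi} slice_top - integral {\<xi> pi..\<xi> 0} slice_top)) {0..pi}"
    by (rule has_integral_substitution_general[of "{}" 0 pi \<xi> "- u pi" "u 0"])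
      (use \<xi>_image(1) slice_continuous d\<xi> continuous_\<xi>\<upsilon> in auto)
  \<comment> \<open>The substitution rule subtracts two integrals so as to cover decreasing
    substitutions; here the first one is over an empty interval.\<close>
  moreover have "integral {\<xi> 0..\<xi> pi} slice_top = 0"
    unfolding \<xi>_ends using width_pos by simp
  ultimately have "((\<lambda>\<theta>. (- \<rho> \<theta> * sin \<theta>) *\<^sub>R slice_top (\<xi> \<theta>)) has_integral - integral {- u pi..u 0} slice_top) {0..pi}"
    by (simp add: \<xi>_ends)
  from has_integral_neg[OF this] have "((\<lambda>\<theta>. \<rho> \<theta> * sin \<theta> * \<upsilon> \<theta>) has_integral integral {- u pi..u 0} slice_top) {0..pi}"
    by (rule has_integral_eq[rotated, THEN iffD2[OF arg_cong2[where f="(has_integral) _"], rotated 2]]) (auto simp: slice_top_def inv_top)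
  then have 1: "integral {0..pi} (\<lambda>\<theta>. \<rho> \<theta> * sin \<theta> * \<upsilon> \<theta>) = integral {- u pi..u 0} slice_top"
    by (rule integral_unique)
  have "((\<lambda>\<theta>. (- \<rho> \<theta> * sin \<theta>) *\<^sub>R slice_bot (\<xi> \<theta>)) has_integral integral {\<xi> pi..\<xi> (2 * pi)} slice_bot) {pi..2 * pi}"
    by (rule has_integral_substitution[of pi "2 * pi" \<xi> "- u pi" "u 0"])
      (use \<xi>_image(2) slice_continuous d\<xi> \<xi>_ends le in auto)
  from has_integral_neg[OF this] have "((\<lambda>\<theta>. \<rho> \<theta> * sin \<theta> * \<upsilon> \<theta>) has_integral - integral {- u pi..u 0} slice_bot) {pi..2 * pi}"
    unfolding \<xi>_ends by (rule has_integral_eq[rotated]) (auto simp: slice_bot_def inv_bot)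
  then have 2: "integral {pi..2 * pi} (\<lambda>\<theta>. \<rho> \<theta> * sin \<theta> * \<upsilon> \<theta>) = - integral {- u pi..u 0} slice_bot"
    by (rule integral_unique)
  have "integral {0..pi} (\<lambda>\<theta>. \<rho> \<theta> * sin \<theta> * \<upsilon> \<theta>) + integral {pi..2 * pi} (\<lambda>\<theta>. \<rho> \<theta> * sin \<theta> * \<upsilon> \<theta>)
      = integral {0..2 * pi} (\<lambda>\<theta>. \<rho> \<theta> * sin \<theta> * \<upsilon> \<theta>)"
    by (rule Henstock_Kurzweil_Integration.integral_combine) (auto intro!: integrable_continuous_interval c)
  moreover have "integral {- u pi..u 0} (\<lambda>x. slice_top x - slice_bot x) =
      integral {- u pi..u 0} slice_top - integral {- u pi..u 0} slice_bot"
    by (intro Henstock_Kurzweil_Integration.integral_diff integrable_continuous_interval slice_continuous)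
  ultimately show ?thesis using 1 2 by simp
qed

text \<open>The two integrands differ by the derivative of - \<xi> * \<upsilon> / 2, which takes
  equal values at both ends of the period.\<close>

lemma integral_area: "integral {0..2 * pi} (\<lambda>\<theta>. \<rho> \<theta> * sin \<theta> * \<upsilon> \<theta>) = 1 / 2 * integral {0..2 * pi} (\<lambda>\<theta>. u \<theta> * \<rho> \<theta>)"
proof -
  have e: "\<xi> \<theta> * cos \<theta> + \<upsilon> \<theta> * sin \<theta> = u \<theta>" for \<theta>
    using Y_inner_same[of \<theta>] by (simp add: inner_complex_def)
  have "((\<lambda>\<theta>. - 1 / 2 * (\<xi> \<theta> * \<upsilon> \<theta>)) has_real_derivative (\<rho> \<theta> * sin \<theta> * \<upsilon> \<theta> - 1 / 2 * (u \<theta> * \<rho> \<theta>))) (at \<theta> within A)" for \<theta> A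
  proof -
    have *: "u \<theta> * \<rho> \<theta> = (\<xi> \<theta> * cos \<theta> + \<upsilon> \<theta> * sin \<theta>) * \<rho> \<theta>" by (simp only: e)
    have "((\<lambda>\<theta>. - 1 / 2 * (\<xi> \<theta> * \<upsilon> \<theta>)) has_real_derivative
        - 1 / 2 * (- \<rho> \<theta> * sin \<theta> * \<upsilon> \<theta> + \<rho> \<theta> * cos \<theta> * \<xi> \<theta>)) (at \<theta> within A)"
      by (rule DERIV_cmult[OF DERIV_mult[OF d\<xi> d\<upsilon>]])
    then show ?thesis
      by (rule DERIV_cong) (simp only: *, simp add: field_simps)
  qed
  then have "((\<lambda>\<theta>. \<rho> \<theta> * sin \<theta> * \<upsilon> \<theta> - 1 / 2 * (u \<theta> * \<rho> \<theta>)) has_integral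
      (- 1 / 2 * (\<xi> (2 * pi) * \<upsilon> (2 * pi)) - - 1 / 2 * (\<xi> 0 * \<upsilon> 0))) {0..2 * pi}"
    unfolding has_real_derivative_iff_has_vector_derivative by (intro fundamental_theorem_of_calculus) simp
  moreover have "Y (2 * pi) = Y 0" by (rule Y_cong) (simp add: complex_eq_iff)
  ultimately have "integral {0..2 * pi} (\<lambda>\<theta>. \<rho> \<theta> * sin \<theta> * \<upsilon> \<theta> - 1 / 2 * (u \<theta> * \<rho> \<theta>)) = 0"
    by (simp add: integral_unique)
  moreover have "integral {0..2 * pi} (\<lambda>\<theta>. \<rho> \<theta> * sin \<theta> * \<upsilon> \<theta> - 1 / 2 * (u \<theta> * \<rho> \<theta>)) =
      integral {0..2 * pi} (\<lambda>\<theta>. \<rho> \<theta> * sin \<theta> * \<upsilon> \<theta>) - integral {0..2 * pi} (\<lambda>\<theta>. 1 / 2 * (u \<theta> * \<rho> \<theta>))"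
    by (intro Henstock_Kurzweil_Integration.integral_diff integrable_continuous_interval
        continuous_intros continuous_\<xi>\<upsilon> continuous_\<rho> continuous_u)
  ultimately show ?thesis by simp
qed

lemma measure_body: "measure lebesgue body = 1 / 2 * integral {0..2 * pi} (\<lambda>\<theta>. u \<theta> * \<rho> \<theta>)" "measure lebesgue body > 0"
proof -
  let ?I = "integral {- u pi..u 0} (\<lambda>x. slice_top x - slice_bot x)"
  have e: "emeasure lebesgue body = ennreal ?I"
    using emeasure_body open_body by (simp add: emeasure_completion)
  have "body \<noteq> {}" using Y_in_closure[of 0] by auto
  \<comment> \<open>Since \<open>ennreal\<close> truncates at 0, the integral is recovered from the
    measure only after it is known to be positive; that follows because a nonempty open set is not
    negligible.\<close>
  then have "\<not> negligible body" using open_not_negligible open_body by blast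
  moreover have "body \<in> sets lebesgue"
    by (intro sets_completionI_sets) (simp add: open_body)
  ultimately have nz: "emeasure lebesgue body \<noteq> 0" by (simp only: negligible_iff_emeasure0 not_False_eq_True)
  have p: "?I > 0"
  proof (rule ccontr)
    assume "\<not> ?I > 0"
    then have "ennreal ?I = 0" by (intro ennreal_neg) simp
    then show False using nz e by simp
  qed
  have "measure lebesgue body = ?I" unfolding measure_def e by (rule enn2real_ennreal) (use p in simp)
  then show "measure lebesgue body = 1 / 2 * integral {0..2 * pi} (\<lambda>\<theta>. u \<theta> * \<rho> \<theta>)" "measure lebesgue body > 0"
    using p integral_slices integral_area by auto
qed

end

section \<open>Geometry of a support curve under a change of parameter\<close>

locale convex_param = convex_support +
  fixes \<sigma> \<alpha>
  assumes angle: "angle_fun \<sigma> \<alpha>"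
begin

abbreviation "g \<equiv> (\<lambda>\<phi>. Y (\<alpha> \<phi>))"

lemmas angleD = angle_funD[OF angle]

lemma range_g: "range g = range Y"
proof -
  have "range g = Y ` range \<alpha>" by auto
  moreover have "range \<alpha> = UNIV" using angleD(3) by (auto simp: image_iff) metis
  ultimately show ?thesis by simp
qed

lemma Ck_on_angle: "Ck_on n UNIV \<alpha>" "Ck_on n UNIV (deriv \<alpha>)"
  using angle smooth_on_deriv(2)[of \<alpha>] by (auto simp: angle_fun_def smooth_on_def)

lemma smooth_g: "smooth_on UNIV g"
  unfolding smooth_on_def
  by (intro allI Ck_on_compose[OF fat_open[OF open_UNIV] _ Ck_on_Y Ck_on_angle(1)]) simp

text \<open>The signed speed; its sign is the orientation \<sigma>.\<close>

definition speed :: "real \<Rightarrow> real" where "speed \<phi> = deriv \<alpha> \<phi> * \<rho> (\<alpha> \<phi>)"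

lemma speed_nz: "speed \<phi> \<noteq> 0" "deriv \<alpha> \<phi> \<noteq> 0"
proof -
  show "deriv \<alpha> \<phi> \<noteq> 0" using angle by (auto simp: angle_fun_def dest!: spec[of _ \<phi>])
  then show "speed \<phi> \<noteq> 0" using radius_pos[of "\<alpha> \<phi>"] by (simp add: speed_def)
qed

lemma smooth_speed: "smooth_on UNIV speed"
  unfolding smooth_on_def speed_def[abs_def]
  by (intro allI Ck_intros Ck_on_compose[OF fat_open[OF open_UNIV] _ Ck_on_\<rho>] Ck_on_angle fat_open open_UNIV) simp

lemma g_derivative: "(g has_vector_derivative speed \<phi> *\<^sub>R (\<i> * cis (\<alpha> \<phi>))) (at \<phi>)"
  using vector_diff_chain_at[OF angleD(1)[unfolded has_real_derivative_iff_has_vector_derivative] Y_derivative]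
  by (simp add: o_def speed_def)

lemma vector_derivative_g: "vector_derivative g (at \<phi>) = speed \<phi> *\<^sub>R (\<i> * cis (\<alpha> \<phi>))"
  by (rule vector_derivative_at[OF g_derivative])

text \<open>Orthogonality to the tangent leaves only the two candidates \<plusminus>
  \<open>cis (\<alpha> \<phi>)\<close>, and moving along \<open>cis (\<alpha> \<phi>)\<close>
  violates the support inequality in that direction.\<close>

lemma inward_normal_g: "inward_normal g \<phi> = - cis (\<alpha> \<phi>)"
  unfolding inward_normal_def range_g inside_range
proof (rule the_equality)
  show "norm (- cis (\<alpha> \<phi>)) = 1 \<and> - cis (\<alpha> \<phi>) \<bullet> vector_derivative g (at \<phi>) = 0 \<and>
    (\<forall>\<^sub>F s in at_right 0. g \<phi> + s *\<^sub>R - cis (\<alpha> \<phi>) \<in> body)"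
    using inward_in_body[of "\<alpha> \<phi>"]
    by (auto simp: vector_derivative_g inner_commute[of "cis (\<alpha> \<phi>)"] inner_cis_cis)
next
  fix n assume n: "norm n = 1 \<and> n \<bullet> vector_derivative g (at \<phi>) = 0 \<and>
    (\<forall>\<^sub>F s in at_right 0. g \<phi> + s *\<^sub>R n \<in> body)"
  then have "n \<bullet> (\<i> * cis (\<alpha> \<phi>)) = 0" using speed_nz[of \<phi>] by (simp add: vector_derivative_g)
  then have e: "n = (n \<bullet> cis (\<alpha> \<phi>)) *\<^sub>R cis (\<alpha> \<phi>)" using complex_cis_frame[of n "\<alpha> \<phi>"] by simp
  then have "norm n = \<bar>n \<bullet> cis (\<alpha> \<phi>)\<bar>" by (metis norm_cis norm_scaleR mult.right_neutral)
  then consider "n \<bullet> cis (\<alpha> \<phi>) = 1" | "n \<bullet> cis (\<alpha> \<phi>) = - 1" using n by linarith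
  then show "n = - cis (\<alpha> \<phi>)"
  proof cases
    case 1
    have "\<forall>\<^sub>F s in at_right (0::real). False"
      using conjunct2[OF conjunct2[OF n]] eventually_at_right_less[of 0]
    proof eventually_elim
      case (elim s)
      then show ?case using outward_not_in_body[of s "\<alpha> \<phi>"] e 1 by simp
    qed
    then show ?thesis by simp
  next
    case 2 then show ?thesis using e by simp
  qed
qed

text \<open>The change of speed is purely tangential, so the normal component of the second
  derivative comes only from the turning of the direction. One factor \<open>deriv \<alpha>\<close>
  of it remains against the square of the speed.\<close>

lemma curvature_g: "curvature g \<phi> = 1 / \<rho> (\<alpha> \<phi>)"
proof -
  have 1: "((\<lambda>\<phi>. \<i> * cis (\<alpha> \<phi>)) has_vector_derivative \<i> * (deriv \<alpha> \<phi> *\<^sub>R (\<i> * cis (\<alpha> \<phi>)))) (at \<phi>)"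
    using vector_diff_chain_at[OF angleD(1)[unfolded has_real_derivative_iff_has_vector_derivative] has_vector_derivative_cis]
    by (intro bounded_linear.has_vector_derivative[OF bounded_linear_mult_right]) (simp add: o_def)
  have "vector_derivative (\<lambda>s. vector_derivative g (at s)) (at \<phi>) =
      speed \<phi> *\<^sub>R (\<i> * (deriv \<alpha> \<phi> *\<^sub>R (\<i> * cis (\<alpha> \<phi>)))) + deriv speed \<phi> *\<^sub>R (\<i> * cis (\<alpha> \<phi>))"
    unfolding vector_derivative_g
    by (rule vector_derivative_at[OF has_vector_derivative_scaleR[OF smooth_on_deriv(1)[OF smooth_speed] 1]])
  moreover have "speed \<phi> *\<^sub>R (\<i> * (deriv \<alpha> \<phi> *\<^sub>R (\<i> * cis (\<alpha> \<phi>)))) = - (speed \<phi> * deriv \<alpha> \<phi>) *\<^sub>R cis (\<alpha> \<phi>)"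
    by (simp add: complex_eq_iff)
  ultimately have "vector_derivative (\<lambda>s. vector_derivative g (at s)) (at \<phi>) \<bullet> inward_normal g \<phi> = speed \<phi> * deriv \<alpha> \<phi>"
    by (simp add: inward_normal_g inner_diff_left inner_add_left inner_cis_cis)
  moreover have "(norm (vector_derivative g (at \<phi>)))\<^sup>2 = speed \<phi> * speed \<phi>"
    by (simp add: vector_derivative_g norm_mult power2_eq_square)
  ultimately show ?thesis using speed_nz[of \<phi>] by (simp add: curvature_def speed_def)
qed

lemma periodic_g: "g (\<phi> + 2 * pi) = g \<phi>"
proof (rule Y_cong)
  show "cis (\<alpha> (\<phi> + 2 * pi)) = cis (\<alpha> \<phi>)"
    using angleD(4)[of \<phi> 1] angle unfolding cis_eq_iff angle_fun_def
    by (auto intro: exI[of _ 1] exI[of _ "- 1"])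
qed

lemma smooth_convex_closed_curve_g: "smooth_convex_closed_curve g"
  unfolding smooth_convex_closed_curve_def
proof (intro conjI allI)
  show "inj_on g {0..<2 * pi}"
  proof (rule linorder_inj_onI)
    fix x y :: real assume "x < y" "x \<in> {0..<2 * pi}" "y \<in> {0..<2 * pi}"
    then have "cis (\<alpha> x) \<noteq> cis (\<alpha> y)" by (intro angle_fun_inj[OF angle]) auto
    then show "g x \<noteq> g y" by (simp add: Y_eq_iff)
  qed auto
  show "curvature g \<phi> > 0" for \<phi> using radius_pos[of "\<alpha> \<phi>"] by (simp add: curvature_g)
  show "vector_derivative g (at \<phi>) \<noteq> 0" for \<phi> by (simp add: vector_derivative_g speed_nz)
qed (use smooth_g periodic_g in auto)

lemma support_function_g: "support_function g \<eta> = u \<eta>"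
proof -
  have "(THE p. \<exists>\<phi>. p = g \<phi> \<and> - inward_normal g \<phi> = cis \<eta>) = Y \<eta>"
  proof (rule the_equality)
    show "\<exists>\<phi>. Y \<eta> = g \<phi> \<and> - inward_normal g \<phi> = cis \<eta>"
      using angleD(3)[of \<eta>] by (auto simp: inward_normal_g)
  qed (auto simp: inward_normal_g Y_eq_iff)
  then show ?thesis by (simp add: support_function_def Y_inner_same)
qed

text \<open>The length of one turn is the increase of an antiderivative G of \<rho> along the angle.
  As \<rho> is periodic, this increase does not depend on the starting angle, and u'' integrates to
  0 over a period, so only u remains.\<close>

lemma curve_length_g: "curve_length g = integral {0..2 * pi} u"
proof -
  have sgn: "norm (vector_derivative g (at \<phi>)) = \<sigma> * deriv \<alpha> \<phi> * \<rho> (\<alpha> \<phi>)" for \<phi>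
  proof -
    have "norm (vector_derivative g (at \<phi>)) = \<bar>\<sigma> * deriv \<alpha> \<phi>\<bar> * \<bar>\<rho> (\<alpha> \<phi>)\<bar>"
      by (simp add: vector_derivative_g norm_mult speed_def abs_mult angleD(7))
    moreover have "\<sigma> * deriv \<alpha> \<phi> > 0" using angle by (simp add: angle_fun_def)
    ultimately show ?thesis using radius_pos[of "\<alpha> \<phi>"] by (simp only: abs_of_pos)
  qed
  have I1: "(u has_integral integral {0..2 * pi} u) {0..2 * pi}"
    by (intro integrable_integral integrable_continuous_interval continuous_u)
  have "((\<lambda>\<theta>. deriv (deriv u) \<theta>) has_integral deriv u (2 * pi) - deriv u 0) {0..2 * pi}"
    by (rule fundamental_theorem_of_calculus)
      (use ddu in \<open>auto simp: has_real_derivative_iff_has_vector_derivative\<close>)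
  moreover have "deriv u (2 * pi) = deriv u 0" using periodic_deriv[OF smooth periodic, of 0] by simp
  ultimately have I\<rho>: "(\<rho> has_integral integral {0..2 * pi} u) {0..2 * pi}"
    using has_integral_add[OF _ I1] unfolding curv_radius_def[abs_def] by fastforce
  have cp: "continuous_on {a..b} \<rho>" for a b by (rule continuous_\<rho>)
  have per\<rho>: "\<rho> (\<theta> + 2 * pi) = \<rho> \<theta>" for \<theta>
    using periodic_deriv[OF smooth_on_deriv(2)[OF smooth] periodic_deriv[OF smooth periodic]] periodic
    by (simp add: curv_radius_def)
  obtain G where G: "\<And>\<theta>. (G has_real_derivative \<rho> \<theta>) (at \<theta>)"
    using antiderivative_real[OF continuous_\<rho>] by (auto simp: has_real_derivative_iff_has_vector_derivative)
  have const: "G (x + 2 * pi) - G x = G (2 * pi) - G 0" for x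
  proof -
    have "((\<lambda>x. G (x + 2 * pi) - G x) has_real_derivative 0) (at x)" for x
      using DERIV_diff[OF G[of "x + 2 * pi", unfolded DERIV_shift] G[of x]] by (simp add: per\<rho>)
    from DERIV_isconst_all[OF allI[OF this], of x 0] show ?thesis by simp
  qed
  have G2: "G (2 * pi) - G 0 = integral {0..2 * pi} u"
    by (rule has_integral_unique[OF fundamental_theorem_of_calculus I\<rho>])
      (use has_field_derivative_at_within[OF G] in \<open>auto simp: has_real_derivative_iff_has_vector_derivative[symmetric]\<close>)
  have "((\<lambda>\<phi>. \<sigma> * deriv \<alpha> \<phi> * \<rho> (\<alpha> \<phi>)) has_integral \<sigma> * G (\<alpha> (2 * pi)) - \<sigma> * G (\<alpha> 0)) {0..2 * pi}"
  proof (rule fundamental_theorem_of_calculus)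
    fix x
    have "((\<lambda>x. \<sigma> * G (\<alpha> x)) has_real_derivative \<sigma> * deriv \<alpha> x * \<rho> (\<alpha> x)) (at x within {0..2 * pi})"
      using DERIV_cmult[OF DERIV_chain2[OF G has_field_derivative_at_within[OF angleD(1)]]] by (simp add: mult_ac)
    then show "((\<lambda>x. \<sigma> * G (\<alpha> x)) has_vector_derivative \<sigma> * deriv \<alpha> x * \<rho> (\<alpha> x)) (at x within {0..2 * pi})"
      by (simp add: has_real_derivative_iff_has_vector_derivative)
  qed simp
  moreover have "\<sigma> * G (\<alpha> (2 * pi)) - \<sigma> * G (\<alpha> 0) = integral {0..2 * pi} u"
  proof -
    consider "\<sigma> = 1" | "\<sigma> = - 1" using angle by (auto simp: angle_fun_def)
    then show ?thesis
    proof cases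
      case 1 then show ?thesis using const[of "\<alpha> 0"] G2 angleD(4)[of 0 1] by simp
    next
      case 2 then show ?thesis using const[of "\<alpha> (2 * pi)"] G2 angleD(4)[of 0 1] by simp
    qed
  qed
  ultimately show ?thesis by (simp add: curve_length_def sgn integral_unique)
qed

lemma enclosed_area_g:
  "enclosed_area g = 1 / 2 * integral {0..2 * pi} (\<lambda>\<theta>. u \<theta> * \<rho> \<theta>)" "enclosed_area g > 0"
  unfolding enclosed_area_def range_g inside_range using measure_body by auto

end

subsection \<open>Structure of smooth convex closed curves\<close>

abbreviation vd :: "(real \<Rightarrow> 'a::real_normed_vector) \<Rightarrow> real \<Rightarrow> 'a" where
  "vd f \<equiv> \<lambda>\<phi>. vector_derivative f (at \<phi>)"

lemma smooth_on_vd: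
  fixes f :: "real \<Rightarrow> 'a::real_normed_vector"
  assumes "smooth_on UNIV f"
  shows "(f has_vector_derivative vd f x) (at x)" "smooth_on UNIV (vd f)"
proof -
  have *: "Ck_on n UNIV (vd f) \<and> (\<forall>x. (f has_vector_derivative vd f x) (at x))" for n
  proof -
    obtain f' where f': "\<And>x. (f has_vector_derivative f' x) (at x)" "Ck_on n UNIV f'"
      using assms Ck_on_real_SucE[of n UNIV f] unfolding smooth_on_def by (metis UNIV_I)
    have "vector_derivative f (at x) = f' x" for x using f'(1) by (rule vector_derivative_at)
    then show ?thesis using f' by simp
  qed
  show "(f has_vector_derivative vd f x) (at x)" "smooth_on UNIV (vd f)"
    using * by (auto simp: smooth_on_def)
qed

locale closed_curve =
  fixes g :: "real \<Rightarrow> complex"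
  assumes smooth: "smooth_on UNIV g" and periodic: "\<And>\<phi>. g (\<phi> + 2*pi) = g \<phi>"
    and inj: "inj_on g {0..<2*pi}" and regular: "\<And>\<phi>. vd g \<phi> \<noteq> 0"
begin

abbreviation "U \<equiv> inside (range g)"
abbreviation "V \<equiv> outside (range g)"

lemma dg: "(g has_vector_derivative vd g \<phi>) (at \<phi>)" "(vd g has_vector_derivative vd (vd g) \<phi>) (at \<phi>)"
  using smooth_on_vd[OF smooth] smooth_on_vd[of "vd g"] by auto

lemma cont_g: "continuous_on A g" "continuous_on A (vd g)" "continuous_on A (vd (vd g))"
  using smooth_on_imp_cont[OF smooth] smooth_on_imp_cont[OF smooth_on_vd(2)[OF smooth]]
    smooth_on_imp_cont[OF smooth_on_vd(2)[OF smooth_on_vd(2)[OF smooth]]] continuous_on_subset by blast+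

lemma periodic_int: "g (\<phi> + of_int k * (2 * pi)) = g \<phi>"
proof -
  interpret periodic_fun_simple g "2 * pi" by unfold_locales (rule periodic)
  show ?thesis by (rule plus_of_int)
qed

lemma periodic_vd: "vd g (\<phi> + 2 * pi) = vd g \<phi>"
proof -
  have 1: "((\<lambda>x. x + 2 * pi) has_vector_derivative 1) (at \<phi>)"
    by (auto simp: has_real_derivative_iff_has_vector_derivative[symmetric] intro!: derivative_eq_intros)
  have "((\<lambda>x. g (x + 2 * pi)) has_vector_derivative vd g (\<phi> + 2 * pi)) (at \<phi>)"
    using vector_diff_chain_at[OF 1 dg(1)] by (simp add: o_def)
  then have "(g has_vector_derivative vd g (\<phi> + 2 * pi)) (at \<phi>)" by (simp add: periodic)
  then show ?thesis using vector_derivative_at by fastforce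
qed

lemma g_eq_iff: "g a = g b \<longleftrightarrow> (\<exists>k::int. a = b + of_int k * (2 * pi))"
proof
  assume e: "g a = g b"
  obtain j :: int where j: "0 \<le> a + of_int j * (2 * pi)" "a + of_int j * (2 * pi) < 0 + 2 * pi" by (rule exists_shift)
  obtain k :: int where k: "0 \<le> b + of_int k * (2 * pi)" "b + of_int k * (2 * pi) < 0 + 2 * pi" by (rule exists_shift)
  have "a + of_int j * (2 * pi) = b + of_int k * (2 * pi)"
    by (rule inj_onD[OF inj]) (use e j k periodic_int in auto)
  then have "a = b + of_int (k - j) * (2 * pi)" by (simp add: algebra_simps)
  then show "\<exists>k::int. a = b + of_int k * (2 * pi)" by blast
qed (auto simp: periodic_int)

lemma range_g_eq: "range g = g ` {a..a + 2 * pi}"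
proof -
  have "g x \<in> g ` {a..a + 2 * pi}" for x
  proof -
    obtain j :: int where "a \<le> x + of_int j * (2 * pi)" "x + of_int j * (2 * pi) < a + 2 * pi" by (rule exists_shift)
    then show ?thesis using periodic_int[of x j] by (intro image_eqI[of _ _ "x + of_int j * (2 * pi)"]) auto
  qed
  then show ?thesis by auto
qed

lemma Jordan: "U \<noteq> {}" "open U" "connected U" "open V" "U \<inter> V = {}" "U \<union> V = - range g"
  "frontier U = range g" "frontier V = range g"
proof -
  define c where "c = (\<lambda>s. g (2 * pi * s))"
  have "(\<lambda>s. 2 * pi * s) ` {0..1} = {0..2 * pi}"
    using image_mult_atLeastAtMost[of "2 * pi" 0 1] by simp
  then have im: "path_image c = range g"
    unfolding path_image_def c_def range_g_eq[of 0] by (metis add_0 image_image)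
  have "path c" unfolding path_def c_def
    by (rule continuous_on_compose2[OF cont_g(1)[of UNIV]]) (auto intro!: continuous_intros)
  moreover have "loop_free c" unfolding loop_free_def c_def
  proof (intro ballI impI)
    fix x y :: real assume x: "x \<in> {0..1}" and y: "y \<in> {0..1}" and e: "g (2 * pi * x) = g (2 * pi * y)"
    then obtain k :: int where "2 * pi * x = 2 * pi * y + of_int k * (2 * pi)" unfolding g_eq_iff by blast
    then have "2 * pi * x = 2 * pi * (y + of_int k)" by (simp add: algebra_simps)
    then have k: "x = y + of_int k" by simp
    then have "\<bar>of_int k\<bar> \<le> (1::real)" using x y by auto
    then have "k = 0 \<or> k = 1 \<or> k = - 1" by linarith
    then show "x = y \<or> x = 0 \<and> y = 1 \<or> x = 1 \<and> y = 0" using k x y by auto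
  qed
  ultimately have "simple_path c" by (simp add: simple_path_def)
  moreover have "pathfinish c = pathstart c" using periodic[of 0] by (simp add: pathfinish_def pathstart_def c_def)
  ultimately show "U \<noteq> {}" "open U" "connected U" "open V" "U \<inter> V = {}" "U \<union> V = - range g"
    "frontier U = range g" "frontier V = range g"
    using Jordan_inside_outside[of c] unfolding im by auto
qed

section \<open>The two sides of a closed curve near one of its points\<close>

definition tang :: "real \<Rightarrow> complex" where "tang \<phi> = vd g \<phi> /\<^sub>R norm (vd g \<phi>)"

lemma norm_tang: "norm (tang \<phi>) = 1" "tang \<phi> \<bullet> tang \<phi> = 1"
  using regular[of \<phi>] by (auto simp: tang_def dot_square_norm)

lemma vd_tang: "vd g \<phi> = norm (vd g \<phi>) *\<^sub>R tang \<phi>"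
  using regular[of \<phi>] by (simp add: tang_def)

lemma frame_inner: "(\<i> * z) \<bullet> z = 0" "z \<bullet> (\<i> * z) = 0" "(\<i> * z) \<bullet> (\<i> * z) = z \<bullet> z"
  by (auto simp: inner_complex_def)

lemma complex_frame:
  assumes "z \<bullet> z = 1" "e * e = (1::real)"
  shows "w = (w \<bullet> z) *\<^sub>R z + (w \<bullet> (e *\<^sub>R (\<i> * z))) *\<^sub>R (e *\<^sub>R (\<i> * z))"
proof -
  have z: "Re z * Re z = 1 - Im z * Im z" using assms(1) by (simp add: inner_complex_def)
  have e: "e * (e * x) = x" for x using assms(2) by (simp add: mult.assoc[symmetric])
  have "(w \<bullet> (e *\<^sub>R (\<i> * z))) *\<^sub>R (e *\<^sub>R (\<i> * z)) = (w \<bullet> (\<i> * z)) *\<^sub>R (\<i> * z)"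
    by (simp add: e mult.commute)
  then show ?thesis by (simp add: complex_eq_iff inner_complex_def algebra_simps z)
qed

text \<open>Near \<phi>0 the tangential coordinate x is strictly increasing, so the near arc is a
  graph over the tangent. The far arc is compact and misses g \<phi>0, hence it stays out of a small
  box, and the graph is all of the curve in that box.\<close>

lemma local_graph:
  assumes "\<eta>0 > 0"
  obtains \<delta> h f where "\<delta> > 0" "h > 0" "f 0 = 0" "continuous_on {- \<delta><..<\<delta>} f"
    "\<And>a. \<bar>a\<bar> < \<delta> \<Longrightarrow> \<bar>f a\<bar> < h"
    "\<And>a. \<bar>a\<bar> < \<delta> \<Longrightarrow> \<exists>\<phi>. \<bar>\<phi> - \<phi>0\<bar> < \<eta>0 \<and> g \<phi> = g \<phi>0 + a *\<^sub>R tang \<phi>0 + f a *\<^sub>R (\<i> * tang \<phi>0)"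
    "\<And>a b. \<bar>a\<bar> < \<delta> \<Longrightarrow> \<bar>b\<bar> < h \<Longrightarrow> g \<phi>0 + a *\<^sub>R tang \<phi>0 + b *\<^sub>R (\<i> * tang \<phi>0) \<in> range g \<Longrightarrow> b = f a"
proof -
  define x where "x \<phi> = (g \<phi> - g \<phi>0) \<bullet> tang \<phi>0" for \<phi>
  define y where "y \<phi> = (g \<phi> - g \<phi>0) \<bullet> (\<i> * tang \<phi>0)" for \<phi>
  have dx: "(x has_real_derivative vd g \<phi> \<bullet> tang \<phi>0) (at \<phi>)" for \<phi>
  proof -
    have "((\<lambda>\<phi>. (g \<phi> - g \<phi>0) \<bullet> tang \<phi>0) has_vector_derivative (vd g \<phi> - 0) \<bullet> tang \<phi>0) (at \<phi>)"
      by (intro bounded_linear.has_vector_derivative[OF bounded_linear_inner_left]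
          has_vector_derivative_diff dg has_vector_derivative_const)
    then show ?thesis unfolding x_def[abs_def] by (simp add: has_real_derivative_iff_has_vector_derivative)
  qed
  have cx: "continuous_on A x" and cy: "continuous_on A y" for A
    unfolding x_def[abs_def] y_def[abs_def] by (intro continuous_intros cont_g)+
  have gxy: "g \<phi> = g \<phi>0 + x \<phi> *\<^sub>R tang \<phi>0 + y \<phi> *\<^sub>R (\<i> * tang \<phi>0)" for \<phi>
    using complex_frame[OF norm_tang(2), of 1 "g \<phi> - g \<phi>0" \<phi>0] by (simp add: x_def y_def algebra_simps)
  have "open {\<phi>. 0 < vd g \<phi> \<bullet> tang \<phi>0}"
    by (intro open_Collect_less continuous_intros cont_g)
  moreover have "vd g \<phi>0 \<bullet> tang \<phi>0 > 0"
  proof -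
    have "vd g \<phi>0 \<bullet> tang \<phi>0 = norm (vd g \<phi>0) * (tang \<phi>0 \<bullet> tang \<phi>0)"
      by (subst vd_tang) simp
    then show ?thesis using regular[of \<phi>0] by (simp add: norm_tang)
  qed
  ultimately obtain d where "d > 0" "ball \<phi>0 d \<subseteq> {\<phi>. 0 < vd g \<phi> \<bullet> tang \<phi>0}"
    by (metis (mono_tags) mem_Collect_eq openE)
  then have d: "d > 0" "\<And>\<phi>. \<bar>\<phi> - \<phi>0\<bar> < d \<Longrightarrow> vd g \<phi> \<bullet> tang \<phi>0 > 0"
    by (auto simp: dist_real_def abs_minus_commute subset_eq)
  define \<eta> where "\<eta> = min (d / 2) (min (\<eta>0 / 2) 1)"
  have \<eta>: "\<eta> > 0" "\<eta> < d" "\<eta> < \<eta>0" "\<eta> < pi" using d assms pi_gt3 by (auto simp: \<eta>_def min_def)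
  let ?I = "{\<phi>0 - \<eta>..\<phi>0 + \<eta>}"
  have mono: "x a < x b" if "a \<in> ?I" "b \<in> ?I" "a < b" for a b
  proof (rule DERIV_pos_imp_increasing[OF that(3)])
    fix c assume "a \<le> c" "c \<le> b"
    then have "\<bar>c - \<phi>0\<bar> < d" using that \<eta> by auto
    then show "\<exists>y. (x has_real_derivative y) (at c) \<and> 0 < y" using d(2) dx by blast
  qed
  have injx: "inj_on x ?I" by (rule linorder_inj_onI) (use mono in force)+
  define \<psi> where "\<psi> = the_inv_into ?I x"
  have \<psi>x: "\<psi> (x \<phi>) = \<phi>" if "\<phi> \<in> ?I" for \<phi>
    unfolding \<psi>_def using the_inv_into_f_f[OF injx that] .
  have x0: "x \<phi>0 = 0" "y \<phi>0 = 0" by (auto simp: x_def y_def)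
  have ends: "x (\<phi>0 - \<eta>) < 0" "0 < x (\<phi>0 + \<eta>)"
    using mono[of "\<phi>0 - \<eta>" \<phi>0] mono[of \<phi>0 "\<phi>0 + \<eta>"] x0 \<eta> by auto
  have im: "{x (\<phi>0 - \<eta>)..x (\<phi>0 + \<eta>)} \<subseteq> x ` ?I"
  proof
    fix a assume "a \<in> {x (\<phi>0 - \<eta>)..x (\<phi>0 + \<eta>)}"
    then show "a \<in> x ` ?I" using IVT'[of x "\<phi>0 - \<eta>" a "\<phi>0 + \<eta>"] \<eta> cx by (auto simp: image_iff)
  qed
  have c\<psi>: "continuous_on (x ` ?I) \<psi>"
    by (rule continuous_on_inv[OF cx compact_Icc]) (use \<psi>x in auto)
  define f where "f a = y (\<psi> a)" for a
  have cf: "continuous_on (x ` ?I) f" unfolding f_def[abs_def]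
    by (rule continuous_on_compose2[OF cy[of UNIV] c\<psi>]) auto
  \<comment> \<open>The far arc: what remains of one period after the near arc ?I has been removed,
    with the common end points kept so that it is compact.\<close>
  let ?F = "g ` {\<phi>0 + \<eta>..\<phi>0 + 2 * pi - \<eta>}"
  have "compact ?F" by (intro compact_continuous_image cont_g) auto
  moreover have "g \<phi>0 \<notin> ?F"
  proof
    assume "g \<phi>0 \<in> ?F"
    then obtain b where b: "b \<in> {\<phi>0 + \<eta>..\<phi>0 + 2 * pi - \<eta>}" "g b = g \<phi>0" by force
    then obtain k :: int where k: "b = \<phi>0 + of_int k * (2 * pi)" unfolding g_eq_iff by blast
    have "0 < of_int k * (2 * pi)" "of_int k * (2 * pi) < 1 * (2 * pi)"
      using b(1) k \<eta>(1) unfolding atLeastAtMost_iff by linarith+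
    then have "0 < k" "k < 1" by (simp_all add: zero_less_mult_iff)
    then show False by simp
  qed
  ultimately have "open (- ?F)" "g \<phi>0 \<in> - ?F" using compact_imp_closed by auto
  then obtain r where r: "r > 0" "ball (g \<phi>0) r \<subseteq> - ?F" by (meson openE)
  \<comment> \<open>Both half-widths of the box are at most r / 2, so by the triangle inequality the
    box lies in the ball of radius r that misses the far arc.\<close>
  define h where "h = r / 2"
  have h: "h > 0" using r by (simp add: h_def)
  have f0: "f 0 = 0" using \<psi>x[of \<phi>0] x0 \<eta> by (simp add: f_def)
  have "0 \<in> x ` ?I" using im ends by auto
  then obtain d2 where d2: "d2 > 0" "\<And>a. a \<in> x ` ?I \<Longrightarrow> \<bar>a\<bar> < d2 \<Longrightarrow> \<bar>f a\<bar> < h"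
    using cf[unfolded continuous_on_iff, rule_format, of 0 h] h f0 by (auto simp: dist_real_def)
  define \<delta> where "\<delta> = min (min d2 (r / 2)) (min (- x (\<phi>0 - \<eta>)) (x (\<phi>0 + \<eta>)))"
  have \<delta>: "\<delta> > 0" "\<delta> \<le> d2" "\<delta> \<le> r / 2" "\<delta> \<le> - x (\<phi>0 - \<eta>)" "\<delta> \<le> x (\<phi>0 + \<eta>)"
    using d2 r ends by (auto simp: \<delta>_def)
  have sub: "a \<in> x ` ?I" if "\<bar>a\<bar> < \<delta>" for a
  proof -
    have "a \<in> {x (\<phi>0 - \<eta>)..x (\<phi>0 + \<eta>)}" using that \<delta> by (simp add: abs_less_iff)
    then show ?thesis using im by blast
  qed
  show ?thesis
  proof (rule that[of \<delta> h f])
    show "continuous_on {- \<delta><..<\<delta>} f" by (rule continuous_on_subset[OF cf]) (use sub in \<open>auto simp: abs_less_iff\<close>)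
    show "\<bar>f a\<bar> < h" if "\<bar>a\<bar> < \<delta>" for a using d2(2)[OF sub[OF that]] that \<delta>(2) by simp
    show "\<exists>\<phi>. \<bar>\<phi> - \<phi>0\<bar> < \<eta>0 \<and> g \<phi> = g \<phi>0 + a *\<^sub>R tang \<phi>0 + f a *\<^sub>R (\<i> * tang \<phi>0)" if a: "\<bar>a\<bar> < \<delta>" for a
    proof -
      obtain \<phi> where \<phi>: "\<phi> \<in> ?I" "a = x \<phi>" using sub[OF a] by blast
      then have "f a = y \<phi>" using \<psi>x by (simp add: f_def)
      moreover have "\<bar>\<phi> - \<phi>0\<bar> < \<eta>0" using \<phi>(1) \<eta> by auto
      ultimately show ?thesis using gxy[of \<phi>] \<phi>(2) by auto
    qed
    show "b = f a" if ab: "\<bar>a\<bar> < \<delta>" "\<bar>b\<bar> < h" "g \<phi>0 + a *\<^sub>R tang \<phi>0 + b *\<^sub>R (\<i> * tang \<phi>0) \<in> range g" for a b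
    proof -
      let ?p = "g \<phi>0 + a *\<^sub>R tang \<phi>0 + b *\<^sub>R (\<i> * tang \<phi>0)"
      obtain \<phi> where \<phi>: "\<phi> \<in> {\<phi>0 - \<eta>..\<phi>0 - \<eta> + 2 * pi}" "?p = g \<phi>" using ab(3) range_g_eq[of "\<phi>0 - \<eta>"] by auto
      have "norm (a *\<^sub>R tang \<phi>0 + b *\<^sub>R (\<i> * tang \<phi>0)) \<le> \<bar>a\<bar> + \<bar>b\<bar>"
        by (rule order_trans[OF norm_triangle_ineq]) (simp add: norm_mult norm_tang)
      then have "norm (?p - g \<phi>0) < r" using ab(1,2) \<delta>(3) by (simp add: h_def)
      then have "dist (g \<phi>0) ?p < r" by (metis dist_commute dist_norm)
      then have "?p \<notin> ?F" using r(2) by auto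
      then have I: "\<phi> \<in> ?I" using \<phi> by auto
      have "a = x \<phi>" "b = y \<phi>" unfolding x_def y_def \<phi>(2)[symmetric]
        by (simp_all add: inner_add_left norm_tang frame_inner)
      then show "b = f a" using \<psi>x[OF I] by (simp add: f_def)
    qed
  qed (use \<delta> h f0 in auto)
qed

text \<open>
  The two sides of the graph inside the box are connected and avoid the curve; since the centre of the
  box lies on the frontier of both components, one side is inside and the other one outside.
\<close>

lemma local_sides:
  assumes "\<eta>0 > 0"
  obtains e \<delta> h f where "e = 1 \<or> e = - 1" "\<delta> > 0" "h > 0" "f 0 = 0"
    "\<And>a. \<bar>a\<bar> < \<delta> \<Longrightarrow> \<exists>\<phi>. \<bar>\<phi> - \<phi>0\<bar> < \<eta>0 \<and> g \<phi> = g \<phi>0 + a *\<^sub>R tang \<phi>0 + f a *\<^sub>R (e *\<^sub>R (\<i> * tang \<phi>0))"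
    "\<And>a b. \<bar>a\<bar> < \<delta> \<Longrightarrow> \<bar>b\<bar> < h \<Longrightarrow> f a < b \<Longrightarrow> g \<phi>0 + a *\<^sub>R tang \<phi>0 + b *\<^sub>R (e *\<^sub>R (\<i> * tang \<phi>0)) \<in> U"
    "\<And>a b. \<bar>a\<bar> < \<delta> \<Longrightarrow> \<bar>b\<bar> < h \<Longrightarrow> b < f a \<Longrightarrow> g \<phi>0 + a *\<^sub>R tang \<phi>0 + b *\<^sub>R (e *\<^sub>R (\<i> * tang \<phi>0)) \<in> V"
proof -
  obtain \<delta> h f where L: "\<delta> > 0" "h > 0" "f 0 = 0" "continuous_on {- \<delta><..<\<delta>} f"
    "\<And>a. \<bar>a\<bar> < \<delta> \<Longrightarrow> \<bar>f a\<bar> < h"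
    "\<And>a. \<bar>a\<bar> < \<delta> \<Longrightarrow> \<exists>\<phi>. \<bar>\<phi> - \<phi>0\<bar> < \<eta>0 \<and> g \<phi> = g \<phi>0 + a *\<^sub>R tang \<phi>0 + f a *\<^sub>R (\<i> * tang \<phi>0)"
    "\<And>a b. \<bar>a\<bar> < \<delta> \<Longrightarrow> \<bar>b\<bar> < h \<Longrightarrow> g \<phi>0 + a *\<^sub>R tang \<phi>0 + b *\<^sub>R (\<i> * tang \<phi>0) \<in> range g \<Longrightarrow> b = f a"
  proof (rule local_graph[OF assms, of \<phi>0], goal_cases)
    case (1 \<delta> h f)
    show ?case by (rule 1(1)[OF 1(2-8)])
  qed
  define P where "P a b = g \<phi>0 + a *\<^sub>R tang \<phi>0 + b *\<^sub>R (\<i> * tang \<phi>0)" for a b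
  have side: "(\<forall>a b. \<bar>a\<bar> < \<delta> \<longrightarrow> \<bar>b\<bar> < h \<longrightarrow> e * f a < e * b \<longrightarrow> P a b \<in> U) \<or>
      (\<forall>a b. \<bar>a\<bar> < \<delta> \<longrightarrow> \<bar>b\<bar> < h \<longrightarrow> e * f a < e * b \<longrightarrow> P a b \<in> V)" if e: "e = 1 \<or> e = - 1" for e :: real
  proof -
    \<comment> \<open>One side of the graph as the image of a rectangle: for fixed a, the parameter
      s leads from the graph to the edge e * h of the box. Continuity of this map makes the side
      connected.\<close>
    define S where "S = (\<lambda>(a, s). P a (f a + s * (e * h - f a))) ` ({- \<delta><..<\<delta>} \<times> {0<..<1})"
    have "connected S" unfolding S_def
    proof (rule connected_continuous_image)
      have "continuous_on ({- \<delta><..<\<delta>} \<times> {0<..<1::real}) (\<lambda>p. f (fst p))"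
        by (rule continuous_on_compose2[OF L(4)]) (auto intro!: continuous_intros)
      then show "continuous_on ({- \<delta><..<\<delta>} \<times> {0<..<1}) (\<lambda>(a, s). P a (f a + s * (e * h - f a)))"
        unfolding P_def case_prod_unfold by (intro continuous_intros)
      show "connected ({- \<delta><..<\<delta>} \<times> {0<..<1::real})"
        by (intro convex_connected convex_Times) auto
    qed
    moreover have S: "P a b \<in> S" if "\<bar>a\<bar> < \<delta>" "\<bar>b\<bar> < h" "e * f a < e * b" for a b
    proof -
      define s where "s = (b - f a) / (e * h - f a)"
      have fa: "\<bar>f a\<bar> < h" by (rule L(5)[OF that(1)])
      have nz: "e * h - f a \<noteq> 0" and s: "s \<in> {0<..<1}"
        using e that fa by (auto simp: s_def field_simps abs_less_iff)
      have "b = f a + s * (e * h - f a)" using nz by (simp add: s_def)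
      then have "P a b = (\<lambda>(a, s). P a (f a + s * (e * h - f a))) (a, s)" by simp
      moreover have "(a, s) \<in> {- \<delta><..<\<delta>} \<times> {0<..<1}" using that s by (auto simp: abs_less_iff)
      ultimately show ?thesis unfolding S_def by blast
    qed
    moreover have "S \<subseteq> U \<union> V"
      unfolding Jordan(6)
    proof
      fix p assume "p \<in> S"
      then obtain q where q: "q \<in> {- \<delta><..<\<delta>} \<times> {0<..<1}" "p = (\<lambda>(a, s). P a (f a + s * (e * h - f a))) q"
        unfolding S_def by blast
      define a s where "a = fst q" and "s = snd q"
      have as: "\<bar>a\<bar> < \<delta>" "0 < s" "s < 1" "p = P a (f a + s * (e * h - f a))"
        using q by (auto simp: a_def s_def abs_less_iff case_prod_unfold)
      have fa: "\<bar>f a\<bar> < h" by (rule L(5)[OF as(1)])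
      let ?b = "f a + s * (e * h - f a)"
      have eb: "?b = (1 - s) * f a + s * (e * h)" by (simp add: algebra_simps)
      have "\<bar>?b\<bar> \<le> (1 - s) * \<bar>f a\<bar> + s * h"
        unfolding eb using as e L(2) by (intro order_trans[OF abs_triangle_ineq]) (auto simp: abs_mult)
      also have "\<dots> < (1 - s) * h + s * h" using as fa by simp
      finally have "\<bar>?b\<bar> < h" by (simp add: algebra_simps)
      moreover have "?b \<noteq> f a" using as e fa by auto
      ultimately have "P a ?b \<notin> range g" using L(7)[OF as(1), of ?b, folded P_def] by blast
      then show "p \<in> - range g" unfolding as(4) by (simp only: Compl_iff not_False_eq_True)
    qed
    ultimately have "U \<inter> S = {} \<or> V \<inter> S = {}"
      using Jordan(2,4,5) by (intro connectedD) auto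
    then show ?thesis using S \<open>S \<subseteq> U \<union> V\<close> by blast
  qed
  have not_both: "\<not> (\<forall>a b. \<bar>a\<bar> < \<delta> \<longrightarrow> \<bar>b\<bar> < h \<longrightarrow> P a b \<notin> W)"
    if "W = U \<or> W = V" for W
  proof
    assume n: "\<forall>a b. \<bar>a\<bar> < \<delta> \<longrightarrow> \<bar>b\<bar> < h \<longrightarrow> P a b \<notin> W"
    have "g \<phi>0 \<in> frontier W" using that Jordan(7,8) by auto
    moreover have "min \<delta> h > 0" using L(1,2) by simp
    ultimately have "\<exists>x\<in>W. dist (g \<phi>0) x < min \<delta> h" unfolding frontier_straddle by blast
    then obtain p where p: "p \<in> W" "norm (p - g \<phi>0) < min \<delta> h" by (auto simp: dist_norm norm_minus_commute)
    define a b where "a = (p - g \<phi>0) \<bullet> tang \<phi>0" and "b = (p - g \<phi>0) \<bullet> (\<i> * tang \<phi>0)"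
    have "p = P a b" using complex_frame[OF norm_tang(2), of 1 "p - g \<phi>0" \<phi>0]
      by (simp add: P_def a_def b_def algebra_simps)
    moreover have "\<bar>a\<bar> \<le> norm (p - g \<phi>0)" "\<bar>b\<bar> \<le> norm (p - g \<phi>0)"
      using Cauchy_Schwarz_ineq2[of "p - g \<phi>0" "tang \<phi>0"] Cauchy_Schwarz_ineq2[of "p - g \<phi>0" "\<i> * tang \<phi>0"]
      by (auto simp: a_def b_def norm_tang norm_mult)
    ultimately show False using n p by auto
  qed
  have on: "P a (f a) \<in> range g" if "\<bar>a\<bar> < \<delta>" for a using L(6)[OF that] unfolding P_def by (metis rangeI)
  have nW: "P a (f a) \<notin> U" "P a (f a) \<notin> V" if "\<bar>a\<bar> < \<delta>" for a
    using on[OF that] Jordan(6) by (metis ComplD UnI1, metis ComplD UnI2)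
  have "\<exists>e. (e = 1 \<or> e = - 1) \<and> (\<forall>a b. \<bar>a\<bar> < \<delta> \<longrightarrow> \<bar>b\<bar> < h \<longrightarrow> e * f a < e * b \<longrightarrow> P a b \<in> U) \<and>
      (\<forall>a b. \<bar>a\<bar> < \<delta> \<longrightarrow> \<bar>b\<bar> < h \<longrightarrow> e * b < e * f a \<longrightarrow> P a b \<in> V)"
  proof -
    have tri: "f a < b \<or> b < f a \<or> b = f a" for a b by linarith
    have s1: "(\<forall>a b. \<bar>a\<bar> < \<delta> \<longrightarrow> \<bar>b\<bar> < h \<longrightarrow> f a < b \<longrightarrow> P a b \<in> U) \<or> (\<forall>a b. \<bar>a\<bar> < \<delta> \<longrightarrow> \<bar>b\<bar> < h \<longrightarrow> f a < b \<longrightarrow> P a b \<in> V)"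
      using side[of 1] by simp
    have s2: "(\<forall>a b. \<bar>a\<bar> < \<delta> \<longrightarrow> \<bar>b\<bar> < h \<longrightarrow> b < f a \<longrightarrow> P a b \<in> U) \<or> (\<forall>a b. \<bar>a\<bar> < \<delta> \<longrightarrow> \<bar>b\<bar> < h \<longrightarrow> b < f a \<longrightarrow> P a b \<in> V)"
      using side[of "- 1"] by simp
    consider (uu) "\<forall>a b. \<bar>a\<bar> < \<delta> \<longrightarrow> \<bar>b\<bar> < h \<longrightarrow> f a < b \<longrightarrow> P a b \<in> U" "\<forall>a b. \<bar>a\<bar> < \<delta> \<longrightarrow> \<bar>b\<bar> < h \<longrightarrow> b < f a \<longrightarrow> P a b \<in> U"
      | (uv) "\<forall>a b. \<bar>a\<bar> < \<delta> \<longrightarrow> \<bar>b\<bar> < h \<longrightarrow> f a < b \<longrightarrow> P a b \<in> U" "\<forall>a b. \<bar>a\<bar> < \<delta> \<longrightarrow> \<bar>b\<bar> < h \<longrightarrow> b < f a \<longrightarrow> P a b \<in> V"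
      | (vu) "\<forall>a b. \<bar>a\<bar> < \<delta> \<longrightarrow> \<bar>b\<bar> < h \<longrightarrow> f a < b \<longrightarrow> P a b \<in> V" "\<forall>a b. \<bar>a\<bar> < \<delta> \<longrightarrow> \<bar>b\<bar> < h \<longrightarrow> b < f a \<longrightarrow> P a b \<in> U"
      | (vv) "\<forall>a b. \<bar>a\<bar> < \<delta> \<longrightarrow> \<bar>b\<bar> < h \<longrightarrow> f a < b \<longrightarrow> P a b \<in> V" "\<forall>a b. \<bar>a\<bar> < \<delta> \<longrightarrow> \<bar>b\<bar> < h \<longrightarrow> b < f a \<longrightarrow> P a b \<in> V"
      using s1 s2 by argo
    then show ?thesis
    proof cases
      case uu
      have "\<forall>a b. \<bar>a\<bar> < \<delta> \<longrightarrow> \<bar>b\<bar> < h \<longrightarrow> P a b \<notin> V" using uu nW(2) tri Jordan(5) by blast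
      then show ?thesis using not_both[of V] by blast
    next
      case vv
      have "\<forall>a b. \<bar>a\<bar> < \<delta> \<longrightarrow> \<bar>b\<bar> < h \<longrightarrow> P a b \<notin> U" using vv nW(1) tri Jordan(5) by blast
      then show ?thesis using not_both[of U] by blast
    next
      case uv then show ?thesis by (intro exI[of _ 1]) simp
    next
      case vu then show ?thesis by (intro exI[of _ "- 1"]) simp
    qed
  qed
  then obtain e :: real where e: "e = 1 \<or> e = - 1"
    and eU: "\<And>a b. \<bar>a\<bar> < \<delta> \<Longrightarrow> \<bar>b\<bar> < h \<Longrightarrow> e * f a < e * b \<Longrightarrow> P a b \<in> U"
    and eV: "\<And>a b. \<bar>a\<bar> < \<delta> \<Longrightarrow> \<bar>b\<bar> < h \<Longrightarrow> e * b < e * f a \<Longrightarrow> P a b \<in> V" by blast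
  have ee: "e * (e * x) = x" "\<bar>e * x\<bar> = \<bar>x\<bar>" for x using e by auto
  have Pe: "g \<phi>0 + a *\<^sub>R tang \<phi>0 + b *\<^sub>R (e *\<^sub>R (\<i> * tang \<phi>0)) = P a (e * b)" for a b
    by (simp add: P_def mult.commute)
  show ?thesis
  proof (rule that[of e \<delta> h "\<lambda>a. e * f a"])
    show "\<exists>\<phi>. \<bar>\<phi> - \<phi>0\<bar> < \<eta>0 \<and> g \<phi> = g \<phi>0 + a *\<^sub>R tang \<phi>0 + (e * f a) *\<^sub>R (e *\<^sub>R (\<i> * tang \<phi>0))" if "\<bar>a\<bar> < \<delta>" for a
      unfolding Pe ee using L(6)[OF that] by (simp add: P_def)
    show "g \<phi>0 + a *\<^sub>R tang \<phi>0 + b *\<^sub>R (e *\<^sub>R (\<i> * tang \<phi>0)) \<in> U" if "\<bar>a\<bar> < \<delta>" "\<bar>b\<bar> < h" "e * f a < b" for a b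
      unfolding Pe by (rule eU; simp only: ee that)
    show "g \<phi>0 + a *\<^sub>R tang \<phi>0 + b *\<^sub>R (e *\<^sub>R (\<i> * tang \<phi>0)) \<in> V" if "\<bar>a\<bar> < \<delta>" "\<bar>b\<bar> < h" "b < e * f a" for a b
      unfolding Pe by (rule eV; simp only: ee that)
  qed (use e L in auto)
qed

lemma inward_normal_side:
  assumes e: "e = 1 \<or> e = - 1" and \<delta>: "h > 0"
    and U: "\<And>b. 0 < b \<Longrightarrow> b < h \<Longrightarrow> g \<phi> + b *\<^sub>R (e *\<^sub>R (\<i> * tang \<phi>)) \<in> U"
    and V: "\<And>b. 0 < b \<Longrightarrow> b < h \<Longrightarrow> g \<phi> - b *\<^sub>R (e *\<^sub>R (\<i> * tang \<phi>)) \<in> V"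
  shows "inward_normal g \<phi> = e *\<^sub>R (\<i> * tang \<phi>)"
  unfolding inward_normal_def
proof (rule the_equality)
  let ?N = "e *\<^sub>R (\<i> * tang \<phi>)"
  have t: "vd g \<phi> = norm (vd g \<phi>) *\<^sub>R tang \<phi>" by (rule vd_tang)
  have ev: "\<forall>\<^sub>F s in at_right 0. 0 < s \<and> s < h" using \<delta> by (auto simp: eventually_at_right intro!: exI[of _ h])
  have "norm ?N = 1" using e by (auto simp: norm_mult norm_tang)
  moreover have "?N \<bullet> vector_derivative g (at \<phi>) = 0" by (subst t) (simp add: frame_inner)
  moreover have "\<forall>\<^sub>F s in at_right 0. g \<phi> + s *\<^sub>R ?N \<in> U" using ev by eventually_elim (use U in auto)
  ultimately show "norm ?N = 1 \<and> ?N \<bullet> vector_derivative g (at \<phi>) = 0 \<and> (\<forall>\<^sub>F s in at_right 0. g \<phi> + s *\<^sub>R ?N \<in> U)" by blast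
  fix n assume n: "norm n = 1 \<and> n \<bullet> vector_derivative g (at \<phi>) = 0 \<and> (\<forall>\<^sub>F s in at_right 0. g \<phi> + s *\<^sub>R n \<in> U)"
  have "n \<bullet> tang \<phi> = 0" using n regular[of \<phi>] by (simp add: tang_def)
  moreover have ee: "e * e = 1" using e by auto
  ultimately have ne: "n = (n \<bullet> ?N) *\<^sub>R ?N" using complex_frame[OF norm_tang(2) ee, of n \<phi>] by simp
  have "norm n = \<bar>n \<bullet> ?N\<bar> * norm ?N" using ne by (metis norm_scaleR)
  then have "\<bar>n \<bullet> ?N\<bar> = 1" using n \<open>norm ?N = 1\<close> by simp
  moreover have "n \<bullet> ?N \<noteq> - 1"
  proof
    assume "n \<bullet> ?N = - 1"
    then have n': "n = - ?N" using ne by simp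
    have "\<forall>\<^sub>F s in at_right (0::real). False"
      using conjunct2[OF conjunct2[OF n]] ev
    proof eventually_elim
      case (elim s)
      then have "g \<phi> - s *\<^sub>R ?N \<in> U" "g \<phi> - s *\<^sub>R ?N \<in> V" using V[of s] by (auto simp: n')
      then show ?case using Jordan(5) by blast
    qed
    then show False by simp
  qed
  ultimately have "n \<bullet> ?N = 1" by linarith
  then show "n = ?N" using ne by simp
qed

lemma normal_sides:
  assumes "\<eta>0 > 0"
  obtains e \<delta> h f where "e = 1 \<or> e = - 1" "inward_normal g \<phi>0 = e *\<^sub>R (\<i> * tang \<phi>0)" "\<delta> > 0" "h > 0" "f 0 = 0"
    "\<And>a. \<bar>a\<bar> < \<delta> \<Longrightarrow> \<exists>\<phi>. \<bar>\<phi> - \<phi>0\<bar> < \<eta>0 \<and> g \<phi> = g \<phi>0 + a *\<^sub>R tang \<phi>0 + f a *\<^sub>R inward_normal g \<phi>0"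
    "\<And>a b. \<bar>a\<bar> < \<delta> \<Longrightarrow> \<bar>b\<bar> < h \<Longrightarrow> b < f a \<Longrightarrow> g \<phi>0 + a *\<^sub>R tang \<phi>0 + b *\<^sub>R inward_normal g \<phi>0 \<in> V"
proof -
  obtain e \<delta> h f where L: "e = 1 \<or> e = - 1" "\<delta> > 0" "h > 0" "f 0 = 0"
    "\<And>a. \<bar>a\<bar> < \<delta> \<Longrightarrow> \<exists>\<phi>. \<bar>\<phi> - \<phi>0\<bar> < \<eta>0 \<and> g \<phi> = g \<phi>0 + a *\<^sub>R tang \<phi>0 + f a *\<^sub>R (e *\<^sub>R (\<i> * tang \<phi>0))"
    "\<And>a b. \<bar>a\<bar> < \<delta> \<Longrightarrow> \<bar>b\<bar> < h \<Longrightarrow> f a < b \<Longrightarrow> g \<phi>0 + a *\<^sub>R tang \<phi>0 + b *\<^sub>R (e *\<^sub>R (\<i> * tang \<phi>0)) \<in> U"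
    "\<And>a b. \<bar>a\<bar> < \<delta> \<Longrightarrow> \<bar>b\<bar> < h \<Longrightarrow> b < f a \<Longrightarrow> g \<phi>0 + a *\<^sub>R tang \<phi>0 + b *\<^sub>R (e *\<^sub>R (\<i> * tang \<phi>0)) \<in> V"
  proof (rule local_sides[OF assms, of \<phi>0], goal_cases)
    case (1 e \<delta> h f)
    show ?case by (rule 1(1)[OF 1(2-8)])
  qed
  have N: "inward_normal g \<phi>0 = e *\<^sub>R (\<i> * tang \<phi>0)"
  proof (rule inward_normal_side[OF L(1,3)])
    fix b assume b: "0 < b" "b < h"
    show "g \<phi>0 + b *\<^sub>R (e *\<^sub>R (\<i> * tang \<phi>0)) \<in> U" using L(6)[of 0 b] L(2,4) b by simp
    show "g \<phi>0 - b *\<^sub>R (e *\<^sub>R (\<i> * tang \<phi>0)) \<in> V" using L(7)[of 0 "- b"] L(2,4) b by simp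
  qed
  show ?thesis using that[of e \<delta> h f, OF L(1) N L(2,3,4)] L(5,7) unfolding N by blast
qed

end

section \<open>Closed curves of positive curvature bound convex sets\<close>

locale convex_closed_curve = closed_curve +
  assumes curvature_pos: "\<And>\<phi>. curvature g \<phi> > 0"
begin

abbreviation "N \<equiv> inward_normal g"

lemma N_tang: "N \<phi> = tang \<phi> * \<i> \<or> N \<phi> = - (tang \<phi> * \<i>)"
proof -
  obtain e :: real where "e = 1 \<or> e = - 1" "N \<phi> = e *\<^sub>R (\<i> * tang \<phi>)"
    by (rule normal_sides[of 1 \<phi>]) auto
  then show ?thesis by (auto simp: mult.commute)
qed

lemma vd2_normal: "vd (vd g) \<phi> \<bullet> N \<phi> > 0" "vd g \<phi> \<bullet> N \<phi> = 0"
proof -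
  show "vd (vd g) \<phi> \<bullet> N \<phi> > 0" using curvature_pos[of \<phi>] regular[of \<phi>]
    by (simp add: curvature_def zero_less_divide_iff)
  have "tang \<phi> \<bullet> N \<phi> = 0" using N_tang[of \<phi>] by (auto simp: inner_complex_def)
  then show "vd g \<phi> \<bullet> N \<phi> = 0" by (subst vd_tang) simp
qed

text \<open>The height over the tangent line has zero derivative at \<phi>0 and positive second
  derivative near it, so it grows strictly in both directions.\<close>

lemma above_tangent:
  obtains \<eta> where "\<eta> > 0" "\<And>\<phi>. \<bar>\<phi> - \<phi>0\<bar> < \<eta> \<Longrightarrow> \<phi> \<noteq> \<phi>0 \<Longrightarrow> (g \<phi> - g \<phi>0) \<bullet> N \<phi>0 > 0"
proof -
  have "open {\<phi>. 0 < vd (vd g) \<phi> \<bullet> N \<phi>0}" by (intro open_Collect_less continuous_intros cont_g)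
  then obtain \<eta> where "\<eta> > 0" "ball \<phi>0 \<eta> \<subseteq> {\<phi>. 0 < vd (vd g) \<phi> \<bullet> N \<phi>0}"
    using vd2_normal(1)[of \<phi>0] by (metis (mono_tags) mem_Collect_eq openE)
  then have \<eta>: "\<eta> > 0" "\<And>\<phi>. \<bar>\<phi> - \<phi>0\<bar> < \<eta> \<Longrightarrow> vd (vd g) \<phi> \<bullet> N \<phi>0 > 0"
    by (auto simp: dist_real_def abs_minus_commute subset_eq)
  have d2: "((\<lambda>\<phi>. vd g \<phi> \<bullet> N \<phi>0) has_real_derivative vd (vd g) \<phi> \<bullet> N \<phi>0) (at \<phi>)" for \<phi>
    using bounded_linear.has_vector_derivative[OF bounded_linear_inner_left dg(2)]
    by (simp add: has_real_derivative_iff_has_vector_derivative)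
  have "((\<lambda>\<phi>. (g \<phi> - g \<phi>0) \<bullet> N \<phi>0) has_vector_derivative (vd g \<phi> - 0) \<bullet> N \<phi>0) (at \<phi>)" for \<phi>
    by (intro bounded_linear.has_vector_derivative[OF bounded_linear_inner_left]
        has_vector_derivative_diff dg has_vector_derivative_const)
  then have d1: "((\<lambda>\<phi>. (g \<phi> - g \<phi>0) \<bullet> N \<phi>0) has_real_derivative vd g \<phi> \<bullet> N \<phi>0) (at \<phi>)" for \<phi>
    by (simp add: has_real_derivative_iff_has_vector_derivative)
  have z: "vd g \<phi>0 \<bullet> N \<phi>0 = 0" by (rule vd2_normal(2))
  have r: "vd g \<phi> \<bullet> N \<phi>0 > 0" if "\<phi>0 < \<phi>" "\<phi> < \<phi>0 + \<eta>" for \<phi>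
  proof -
    have "vd g \<phi>0 \<bullet> N \<phi>0 < vd g \<phi> \<bullet> N \<phi>0"
      by (rule DERIV_pos_imp_increasing[OF that(1)]) (use \<eta>(2) d2 that in \<open>force intro!: exI\<close>)
    then show ?thesis using z by simp
  qed
  have l: "vd g \<phi> \<bullet> N \<phi>0 < 0" if "\<phi> < \<phi>0" "\<phi>0 - \<eta> < \<phi>" for \<phi>
  proof -
    have "vd g \<phi> \<bullet> N \<phi>0 < vd g \<phi>0 \<bullet> N \<phi>0"
      by (rule DERIV_pos_imp_increasing[OF that(1)]) (use \<eta>(2) d2 that in \<open>force intro!: exI\<close>)
    then show ?thesis using z by simp
  qed
  have cont: "continuous_on A (\<lambda>\<phi>. (g \<phi> - g \<phi>0) \<bullet> N \<phi>0)" for A by (intro continuous_intros cont_g)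
  show ?thesis
  proof (rule that[OF \<eta>(1)])
    fix \<phi> assume \<phi>: "\<bar>\<phi> - \<phi>0\<bar> < \<eta>" "\<phi> \<noteq> \<phi>0"
    show "(g \<phi> - g \<phi>0) \<bullet> N \<phi>0 > 0"
    proof (cases "\<phi>0 < \<phi>")
      case True
      have "(g \<phi>0 - g \<phi>0) \<bullet> N \<phi>0 < (g \<phi> - g \<phi>0) \<bullet> N \<phi>0"
        by (rule DERIV_pos_imp_increasing_open[OF True _ cont]) (use r d1 \<phi> in \<open>force intro!: exI\<close>)
      then show ?thesis by simp
    next
      case False
      then have lt: "\<phi> < \<phi>0" using \<phi> by simp
      have "(g \<phi>0 - g \<phi>0) \<bullet> N \<phi>0 < (g \<phi> - g \<phi>0) \<bullet> N \<phi>0"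
        by (rule DERIV_neg_imp_decreasing_open[OF lt _ cont]) (use l d1 \<phi> in \<open>force intro!: exI\<close>)
      then show ?thesis by simp
    qed
  qed
qed

text \<open>The exterior V is open and disjoint from U, so nearby points of the closure lie on or
  above the local graph. The graph in turn lies strictly above the tangent except at the point of
  contact.\<close>

lemma local_strict:
  obtains \<epsilon> where "\<epsilon> > 0" "\<And>p. p \<in> closure U \<Longrightarrow> norm (p - g \<phi>0) < \<epsilon> \<Longrightarrow> p \<noteq> g \<phi>0 \<Longrightarrow> (p - g \<phi>0) \<bullet> N \<phi>0 > 0"
proof -
  obtain \<eta> where \<eta>: "\<eta> > 0" "\<And>\<phi>. \<bar>\<phi> - \<phi>0\<bar> < \<eta> \<Longrightarrow> \<phi> \<noteq> \<phi>0 \<Longrightarrow> (g \<phi> - g \<phi>0) \<bullet> N \<phi>0 > 0"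
    using above_tangent[of \<phi>0] by blast
  obtain e \<delta> h f where L: "e = 1 \<or> e = - 1" "N \<phi>0 = e *\<^sub>R (\<i> * tang \<phi>0)" "\<delta> > 0" "h > 0" "f 0 = 0"
    "\<And>a. \<bar>a\<bar> < \<delta> \<Longrightarrow> \<exists>\<phi>. \<bar>\<phi> - \<phi>0\<bar> < \<eta> \<and> g \<phi> = g \<phi>0 + a *\<^sub>R tang \<phi>0 + f a *\<^sub>R N \<phi>0"
    "\<And>a b. \<bar>a\<bar> < \<delta> \<Longrightarrow> \<bar>b\<bar> < h \<Longrightarrow> b < f a \<Longrightarrow> g \<phi>0 + a *\<^sub>R tang \<phi>0 + b *\<^sub>R N \<phi>0 \<in> V"
  proof (rule normal_sides[OF \<eta>(1), of \<phi>0], goal_cases)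
    case (1 e \<delta> h f)
    show ?case by (rule 1(1)[OF 1(2-8)])
  qed
  have ee: "e * e = 1" using L(1) by auto
  have NN: "N \<phi>0 \<bullet> N \<phi>0 = 1" "tang \<phi>0 \<bullet> N \<phi>0 = 0" "norm (N \<phi>0) = 1"
    using L(1) by (auto simp: L(2) norm_tang frame_inner norm_mult)
  show ?thesis
  proof (rule that[of "min \<delta> h"])
    fix p assume p: "p \<in> closure U" "norm (p - g \<phi>0) < min \<delta> h" "p \<noteq> g \<phi>0"
    define a b where "a = (p - g \<phi>0) \<bullet> tang \<phi>0" and "b = (p - g \<phi>0) \<bullet> N \<phi>0"
    have pab: "p = g \<phi>0 + a *\<^sub>R tang \<phi>0 + b *\<^sub>R N \<phi>0"
      using complex_frame[OF norm_tang(2) ee, of "p - g \<phi>0" \<phi>0] by (simp add: a_def b_def L(2) algebra_simps)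
    have ab: "\<bar>a\<bar> < \<delta>" "\<bar>b\<bar> < h"
      using Cauchy_Schwarz_ineq2[of "p - g \<phi>0" "tang \<phi>0"] Cauchy_Schwarz_ineq2[of "p - g \<phi>0" "N \<phi>0"] p(2)
      by (auto simp: a_def b_def norm_tang NN)
    have "closure U \<inter> V = {}" using Jordan(4,5) open_Int_closure_eq_empty by blast
    then have bf: "b \<ge> f a" using L(7)[OF ab] p(1) pab by force
    obtain \<phi> where \<phi>: "\<bar>\<phi> - \<phi>0\<bar> < \<eta>" "g \<phi> = g \<phi>0 + a *\<^sub>R tang \<phi>0 + f a *\<^sub>R N \<phi>0" using L(6)[OF ab(1)] by blast
    have "b > 0"
    proof (cases "a = 0")
      case True
      then have "b \<noteq> 0" using pab p(3) by auto
      then show ?thesis using bf L(5) True by simp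
    next
      case False
      have "\<phi> \<noteq> \<phi>0"
      proof
        assume "\<phi> = \<phi>0"
        then have "a *\<^sub>R tang \<phi>0 + f a *\<^sub>R N \<phi>0 = 0" using \<phi>(2) by simp
        then have "(a *\<^sub>R tang \<phi>0 + f a *\<^sub>R N \<phi>0) \<bullet> tang \<phi>0 = 0" by simp
        moreover have "N \<phi>0 \<bullet> tang \<phi>0 = 0" using NN(2) by (simp add: inner_commute)
        ultimately show False using False by (simp add: inner_add_left norm_tang)
      qed
      then have "(g \<phi> - g \<phi>0) \<bullet> N \<phi>0 > 0" using \<eta>(2) \<phi>(1) by blast
      then have "f a > 0" by (simp add: \<phi>(2) inner_add_left NN)
      then show ?thesis using bf by simp
    qed
    then show "(p - g \<phi>0) \<bullet> N \<phi>0 > 0" by (simp add: b_def)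
  qed (use L in auto)
qed

text \<open>A limit of segments inside \<open>U\<close> cannot touch the curve: near a touching point both halves of the segment would lie strictly on the inner side of the tangent.\<close>

lemma convex_inside: "convex U"
  unfolding convex_contains_segment
proof (intro ballI)
  fix x y assume x: "x \<in> U" and y: "y \<in> U"
  \<comment> \<open>The points visible from x are shown to form an open and closed subset of the
    connected set U.\<close>
  define S where "S = {y \<in> U. closed_segment x y \<subseteq> U}"
  have "openin (top_of_set U) S"
    unfolding openin_open_eq[OF Jordan(2)] 
  proof
    show "open S" unfolding open_dist
    proof
      fix y assume y: "y \<in> S"
      then have "compact (closed_segment x y)" "closed_segment x y \<subseteq> U" by (auto simp: S_def)
      then obtain r where r: "r > 0" "(\<Union>p\<in>closed_segment x y. ball p r) \<subseteq> U"
        using compact_subset_open_imp_ball_epsilon_subset[OF _ Jordan(2)] by blast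
      have "y' \<in> S" if "dist y' y < r" for y'
      proof -
        have "p \<in> U" if pp: "p \<in> closed_segment x y'" for p
        proof -
          obtain s where s: "0 \<le> s" "s \<le> 1" "p = (1 - s) *\<^sub>R x + s *\<^sub>R y'" using pp by (auto simp: closed_segment_def)
          have "dist ((1 - s) *\<^sub>R x + s *\<^sub>R y) p = s * dist y y'"
            using s by (simp add: dist_norm scaleR_diff_right[symmetric])
          also have "\<dots> \<le> 1 * dist y y'" using s by (intro mult_right_mono) auto
          also have "\<dots> < r" using \<open>dist y' y < r\<close> by (simp add: dist_commute)
          finally have "p \<in> ball ((1 - s) *\<^sub>R x + s *\<^sub>R y) r" by simp
          moreover have "(1 - s) *\<^sub>R x + s *\<^sub>R y \<in> closed_segment x y" using s by (auto simp: closed_segment_def)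
          ultimately show ?thesis using r(2) by blast
        qed
        then show ?thesis unfolding S_def using ends_in_segment(2)[of y' x] by blast
      qed
      then show "\<exists>e>0. \<forall>y'. dist y' y < e \<longrightarrow> y' \<in> S" using r(1) by blast
    qed
  qed (auto simp: S_def)
  moreover have "closedin (top_of_set U) S"
    unfolding closedin_limpt
  proof (intro conjI allI impI)
    fix y assume y: "y islimpt S \<and> y \<in> U"
    then obtain Y where "\<forall>n. Y n \<in> S - {y}" and Yl: "Y \<longlonglongrightarrow> y" unfolding islimpt_sequential by blast
    then have Y: "Y n \<in> S" for n by blast
    have cl: "(1 - s) *\<^sub>R x + s *\<^sub>R y \<in> closure U" if "s \<in> {0..1}" for s
    proof (rule Lim_in_closed_set[OF closed_closure _ sequentially_bot])
      show "((\<lambda>n. (1 - s) *\<^sub>R x + s *\<^sub>R Y n) \<longlongrightarrow> (1 - s) *\<^sub>R x + s *\<^sub>R y) sequentially"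
        by (intro tendsto_intros Yl)
      have "(1 - s) *\<^sub>R x + s *\<^sub>R Y n \<in> U" for n
        using Y[of n] that by (auto simp: S_def closed_segment_def)
      then show "\<forall>\<^sub>F n in sequentially. (1 - s) *\<^sub>R x + s *\<^sub>R Y n \<in> closure U"
        using closure_subset by (intro always_eventually allI) blast
    qed
    have "(1 - s) *\<^sub>R x + s *\<^sub>R y \<in> U" if s: "s \<in> {0..1}" for s
    proof (rule ccontr)
      let ?p = "\<lambda>s. (1 - s) *\<^sub>R x + s *\<^sub>R y"
      assume n: "?p s \<notin> U"
      then have "s \<noteq> 0" "s \<noteq> 1" using x y by auto
      then have s': "0 < s" "s < 1" using s by auto
      have "?p s \<in> frontier U" using cl[OF s] n by (simp add: frontier_def interior_open[OF Jordan(2)])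
      then obtain \<phi> where \<phi>: "?p s = g \<phi>" using Jordan(7) by auto
      obtain \<epsilon> where \<epsilon>: "\<epsilon> > 0" "\<And>p. p \<in> closure U \<Longrightarrow> norm (p - g \<phi>) < \<epsilon> \<Longrightarrow> p \<noteq> g \<phi> \<Longrightarrow> (p - g \<phi>) \<bullet> N \<phi> > 0"
        using local_strict[of \<phi>] by blast
      define v where "v = y - x"
      have v: "v \<noteq> 0" using n x by (auto simp: v_def algebra_simps)
      define d where "d = min (min s (1 - s)) (\<epsilon> / (2 * norm v))"
      have d: "d > 0" "d \<le> s" "d \<le> 1 - s" using s' \<epsilon> v by (auto simp: d_def)
      have "d * norm v \<le> \<epsilon> / (2 * norm v) * norm v" by (intro mult_right_mono) (auto simp: d_def)
      then have dv: "d * norm v < \<epsilon>" using \<epsilon> v by simp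
      have e: "?p (s + c) - g \<phi> = c *\<^sub>R v" for c unfolding \<phi>[symmetric] by (simp add: v_def algebra_simps)
      have "(?p (s + c) - g \<phi>) \<bullet> N \<phi> > 0" if c: "\<bar>c\<bar> = d" for c
      proof (rule \<epsilon>(2))
        show "?p (s + c) \<in> closure U" by (rule cl) (use c d in auto)
        show "norm (?p (s + c) - g \<phi>) < \<epsilon>" unfolding e using c dv by simp
        show "?p (s + c) \<noteq> g \<phi>" using e[of c] v c d by auto
      qed
      from this[of d] this[of "- d"] show False unfolding e using d(1) by simp
    qed
    then show "y \<in> S" using y by (auto simp: S_def closed_segment_def)
  qed (auto simp: S_def)
  moreover have "x \<in> S" using x by (simp add: S_def)
  ultimately have "S = U" using Jordan(3) unfolding connected_clopen by blast
  then show "closed_segment x y \<subseteq> U" using y by (auto simp: S_def)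
qed

text \<open>By convexity p may be pulled towards g \<phi> along a segment in the closure of U until
  the local statement applies, and this does not change the sign of the inner product.\<close>

lemma strict_support:
  assumes p: "p \<in> closure U" "p \<noteq> g \<phi>"
  shows "(p - g \<phi>) \<bullet> N \<phi> > 0"
proof -
  obtain \<epsilon> where \<epsilon>: "\<epsilon> > 0" "\<And>p. p \<in> closure U \<Longrightarrow> norm (p - g \<phi>) < \<epsilon> \<Longrightarrow> p \<noteq> g \<phi> \<Longrightarrow> (p - g \<phi>) \<bullet> N \<phi> > 0"
    using local_strict[of \<phi>] by blast
  define v where "v = p - g \<phi>"
  have v: "v \<noteq> 0" using p by (simp add: v_def)
  define s where "s = min 1 (\<epsilon> / (2 * norm v))"
  have s: "0 < s" "s \<le> 1" using \<epsilon> v by (auto simp: s_def)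
  have "s * norm v \<le> \<epsilon> / (2 * norm v) * norm v" by (intro mult_right_mono) (auto simp: s_def)
  then have sv: "s * norm v < \<epsilon>" using \<epsilon> v by simp
  have "g \<phi> \<in> closure U" using Jordan(7) by (auto simp: frontier_def)
  then have "(1 - s) *\<^sub>R g \<phi> + s *\<^sub>R p \<in> closure U"
    using convex_closure[OF convex_inside] p s by (intro convexD_alt) auto
  then have c: "g \<phi> + s *\<^sub>R v \<in> closure U" by (simp add: v_def algebra_simps)
  have "(g \<phi> + s *\<^sub>R v - g \<phi>) \<bullet> N \<phi> > 0" using \<epsilon>(2)[OF c] sv s v by simp
  then show ?thesis using s by (simp add: v_def zero_less_mult_iff)
qed

text \<open>With a common normal, the support inequalities at two distinct points contradict each
  other.\<close>

lemma N_inj: "N a = N b \<Longrightarrow> g a = g b"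
proof (rule ccontr)
  assume e: "N a = N b" and n: "g a \<noteq> g b"
  have "g a \<in> closure U" "g b \<in> closure U" using Jordan(7) by (auto simp: frontier_def)
  then have "(g a - g b) \<bullet> N b > 0" "(g b - g a) \<bullet> N a > 0" using n strict_support by auto
  then show False by (simp add: e inner_diff_left)
qed

text \<open>The normal component of the second derivative never vanishes, so neither does w. A
  continuous function without zeros has constant sign, and hence the inward normal stays on the same
  side of the tangent along the whole curve.\<close>

lemma signed_curvature:
  obtains \<sigma> where "\<sigma> = 1 \<or> \<sigma> = - 1" "\<And>\<phi>. N \<phi> = \<sigma> *\<^sub>R (\<i> * tang \<phi>)" "\<And>\<phi>. \<sigma> * (vd (vd g) \<phi> \<bullet> (\<i> * vd g \<phi>)) > 0"
proof -
  define w where "w \<phi> = vd (vd g) \<phi> \<bullet> (\<i> * vd g \<phi>)" for \<phi>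
  have cw: "continuous_on A w" for A unfolding w_def[abs_def] by (intro continuous_intros cont_g)
  have key: "(N \<phi> = \<i> * tang \<phi> \<and> w \<phi> > 0) \<or> (N \<phi> = - (\<i> * tang \<phi>) \<and> w \<phi> < 0)" for \<phi>
  proof -
    have "\<i> * vd g \<phi> = norm (vd g \<phi>) *\<^sub>R (\<i> * tang \<phi>)"
      using arg_cong[OF vd_tang[of \<phi>], of "\<lambda>z. \<i> * z"] by simp
    then have w: "w \<phi> = norm (vd g \<phi>) * (vd (vd g) \<phi> \<bullet> (\<i> * tang \<phi>))" by (simp add: w_def)
    have n: "norm (vd g \<phi>) > 0" using regular by simp
    show ?thesis
      using N_tang[of \<phi>]
    proof
      assume "N \<phi> = tang \<phi> * \<i>"
      then have N: "N \<phi> = \<i> * tang \<phi>" by (simp add: mult.commute)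
      have "w \<phi> > 0" using vd2_normal(1)[of \<phi>] n unfolding w N by (rule mult_pos_pos[rotated])
      then show ?thesis using N by blast
    next
      assume "N \<phi> = - (tang \<phi> * \<i>)"
      then have N: "N \<phi> = - (\<i> * tang \<phi>)" by (simp add: mult.commute)
      have "vd (vd g) \<phi> \<bullet> (\<i> * tang \<phi>) < 0" using vd2_normal(1)[of \<phi>] unfolding N by simp
      then have "w \<phi> < 0" using n unfolding w by (rule mult_pos_neg[rotated])
      then show ?thesis using N by blast
    qed
  qed
  have nz: "w \<phi> \<noteq> 0" for \<phi> using key[of \<phi>] by auto
  have "connected (range w)" by (intro connected_continuous_image cw connected_UNIV)
  then have "(\<forall>\<phi>. w \<phi> > 0) \<or> (\<forall>\<phi>. w \<phi> < 0)"
  proof (rule contrapos_pp)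
    assume "\<not> ((\<forall>\<phi>. w \<phi> > 0) \<or> (\<forall>\<phi>. w \<phi> < 0))"
    then obtain a b where "w a \<le> 0" "0 \<le> w b" by (meson not_le)
    then show "\<not> connected (range w)"
      using connectedD_interval[of "range w" "w a" "w b" 0] nz by (metis rangeE rangeI)
  qed
  then show ?thesis
  proof
    assume p: "\<forall>\<phi>. w \<phi> > 0"
    show ?thesis
    proof (rule that[of 1])
      fix \<phi>
      show "N \<phi> = 1 *\<^sub>R (\<i> * tang \<phi>)" using key[of \<phi>] p[rule_format, of \<phi>] by auto
      show "1 * (vd (vd g) \<phi> \<bullet> (\<i> * vd g \<phi>)) > 0" using p by (simp add: w_def)
    qed simp
  next
    assume p: "\<forall>\<phi>. w \<phi> < 0"
    show ?thesis
    proof (rule that[of "- 1"])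
      fix \<phi>
      show "N \<phi> = - 1 *\<^sub>R (\<i> * tang \<phi>)" using key[of \<phi>] p[rule_format, of \<phi>] by auto
      show "- 1 * (vd (vd g) \<phi> \<bullet> (\<i> * vd g \<phi>)) > 0" using p by (simp add: w_def)
    qed simp
  qed
qed

text \<open>A logarithm of the velocity: in its own frame the second derivative is (\<nu> + i
  \<kappa>) times the first one. With antiderivatives M of \<nu> and A of \<kappa>, the product of
  the velocity with exp (- M - i A) is therefore constant, and A is the angle up to an additive
  constant.\<close>

lemma tangent_angle:
  obtains A where "\<And>\<phi>. tang \<phi> = cis (A \<phi>)"
    "\<And>\<phi>. (A has_real_derivative (vd (vd g) \<phi> \<bullet> (\<i> * vd g \<phi>)) / (vd g \<phi> \<bullet> vd g \<phi>)) (at \<phi>)"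
proof -
  let ?q = "\<lambda>\<phi>. vd g \<phi> \<bullet> vd g \<phi>"
  have q: "?q \<phi> \<noteq> 0" for \<phi> using regular by simp
  define \<kappa> \<nu> where "\<kappa> \<phi> = (vd (vd g) \<phi> \<bullet> (\<i> * vd g \<phi>)) / ?q \<phi>" and "\<nu> \<phi> = (vd (vd g) \<phi> \<bullet> vd g \<phi>) / ?q \<phi>" for \<phi>
  have c: "continuous_on UNIV \<kappa>" "continuous_on UNIV \<nu>" unfolding \<kappa>_def[abs_def] \<nu>_def[abs_def]
    by (auto intro!: continuous_intros cont_g simp: regular)
  obtain A where A: "\<And>x. (A has_vector_derivative \<kappa> x) (at x)" using antiderivative_real[OF c(1)] by blast
  obtain M where M: "\<And>x. (M has_vector_derivative \<nu> x) (at x)" using antiderivative_real[OF c(2)] by blast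
  have dec: "vd (vd g) \<phi> = \<nu> \<phi> *\<^sub>R vd g \<phi> + \<kappa> \<phi> *\<^sub>R (\<i> * vd g \<phi>)" for \<phi>
    using complex_frame[OF norm_tang(2), of 1 "vd (vd g) \<phi>" \<phi>]
    by (simp add: tang_def \<nu>_def \<kappa>_def dot_square_norm power2_eq_square divide_inverse mult_ac)
  let ?Q = "\<lambda>\<phi>. vd g \<phi> * exp (of_real (- M \<phi>) - \<i> * of_real (A \<phi>))"
  have "(?Q has_vector_derivative 0) (at \<phi>)" for \<phi>
  proof -
    have 1: "((\<lambda>\<phi>. of_real (- M \<phi>) - \<i> * of_real (A \<phi>)) has_vector_derivative (of_real (- \<nu> \<phi>) - \<i> * of_real (\<kappa> \<phi>))) (at \<phi>)"
      by (intro has_vector_derivative_diff bounded_linear.has_vector_derivative[OF bounded_linear_of_real]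
          bounded_linear.has_vector_derivative[OF bounded_linear_mult_right] has_vector_derivative_minus A M)
    have 2: "((\<lambda>\<phi>. exp (of_real (- M \<phi>) - \<i> * of_real (A \<phi>))) has_vector_derivative
        (of_real (- \<nu> \<phi>) - \<i> * of_real (\<kappa> \<phi>)) * exp (of_real (- M \<phi>) - \<i> * of_real (A \<phi>))) (at \<phi>)"
      using field_vector_diff_chain_at[OF 1 DERIV_exp] by (simp add: o_def)
    have "vd (vd g) \<phi> = (of_real (\<nu> \<phi>) + \<i> * of_real (\<kappa> \<phi>)) * vd g \<phi>"
      by (subst dec) (simp add: scaleR_conv_of_real algebra_simps)
    then show ?thesis using has_vector_derivative_mult[OF dg(2) 2] by (simp add: algebra_simps)
  qed
  then have Qc: "?Q \<phi> = ?Q 0" for \<phi>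
    using has_vector_derivative_zero_constant[of UNIV ?Q] by (metis UNIV_I convex_UNIV has_vector_derivative_at_within)
  define R a where "R = norm (?Q 0)" and "a = Arg (?Q 0)"
  have "?Q 0 \<noteq> 0" using regular[of 0] by simp
  then have R: "R > 0" "?Q 0 = R *\<^sub>R cis a"
    by (auto simp: R_def a_def scaleR_conv_of_real cis_conv_exp mult.commute Arg_eq[symmetric])
  have "tang \<phi> = cis (A \<phi> + a)" for \<phi>
  proof -
    have "vd g \<phi> = ?Q 0 * exp (of_real (M \<phi>) + \<i> * of_real (A \<phi>))"
      unfolding Qc[of \<phi>, symmetric] by (simp add: exp_diff exp_add exp_minus field_simps)
    also have "\<dots> = (R * exp (M \<phi>)) *\<^sub>R cis (A \<phi> + a)"
      unfolding R(2) by (simp add: exp_add cis_mult[symmetric] cis_conv_exp[of "A \<phi>"] scaleR_conv_of_real exp_of_real)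
    finally have e: "vd g \<phi> = (R * exp (M \<phi>)) *\<^sub>R cis (A \<phi> + a)" .
    have "(x *\<^sub>R cis b) /\<^sub>R norm (x *\<^sub>R cis b) = cis b" if "x > 0" for x b using that by simp
    then show ?thesis unfolding tang_def e using R(1) by (metis exp_gt_zero mult_pos_pos)
  qed
  moreover have "((\<lambda>\<phi>. A \<phi> + a) has_real_derivative \<kappa> \<phi>) (at \<phi>)" for \<phi>
    using DERIV_add[OF A[folded has_real_derivative_iff_has_vector_derivative] DERIV_const[of a]] by simp
  ultimately show ?thesis using that[of "\<lambda>\<phi>. A \<phi> + a"] by (simp add: \<kappa>_def)
qed

text \<open>The tangent angle is monotone, and the normal being injective on a period, it makes exactly one turn.\<close>

lemma outward_angle:
  obtains \<sigma> \<alpha> where "angle_fun \<sigma> \<alpha>" "\<And>\<phi>. - N \<phi> = cis (\<alpha> \<phi>)" "\<And>\<phi>. vd g \<phi> = (\<sigma> * norm (vd g \<phi>)) *\<^sub>R (\<i> * cis (\<alpha> \<phi>))"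
proof -
  obtain \<sigma> where \<sigma>: "\<sigma> = 1 \<or> \<sigma> = - 1" "\<And>\<phi>. N \<phi> = \<sigma> *\<^sub>R (\<i> * tang \<phi>)"
    "\<And>\<phi>. \<sigma> * (vd (vd g) \<phi> \<bullet> (\<i> * vd g \<phi>)) > 0"
    using signed_curvature by blast
  obtain A where A: "\<And>\<phi>. tang \<phi> = cis (A \<phi>)"
    "\<And>\<phi>. (A has_real_derivative (vd (vd g) \<phi> \<bullet> (\<i> * vd g \<phi>)) / (vd g \<phi> \<bullet> vd g \<phi>)) (at \<phi>)"
    using tangent_angle by blast
  define \<kappa> where "\<kappa> \<phi> = (vd (vd g) \<phi> \<bullet> (\<i> * vd g \<phi>)) / (vd g \<phi> \<bullet> vd g \<phi>)" for \<phi>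
  \<comment> \<open>The outward normal is - \<sigma> * i times the tangent, which shifts the angle
    by - \<sigma> * pi / 2.\<close>
  define \<alpha> where "\<alpha> \<phi> = A \<phi> + \<sigma> * (- (pi / 2))" for \<phi>
  have d\<alpha>: "(\<alpha> has_real_derivative \<kappa> \<phi>) (at \<phi>)" for \<phi>
    unfolding \<alpha>_def[abs_def] \<kappa>_def by (rule DERIV_cong[OF DERIV_add[OF A(2) DERIV_const]]) simp
  have ic: "cis (- (pi / 2)) = - \<i>" "cis (pi / 2) = \<i>" by (simp_all add: complex_eq_iff)
  have out: "- N \<phi> = cis (\<alpha> \<phi>)" for \<phi>
    using \<sigma>(1) by (auto simp: \<sigma>(2) A(1) \<alpha>_def cis_mult[symmetric] ic mult.commute diff_conv_add_uminus simp del: add_uminus_conv_diff)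
  have ss: "\<sigma> * \<sigma> = 1" using \<sigma>(1) by auto
  have tc: "tang \<phi> = \<sigma> *\<^sub>R (\<i> * cis (\<alpha> \<phi>))" for \<phi>
    unfolding out[symmetric] \<sigma>(2) by (simp add: ss)
  have sm: "smooth_on UNIV \<alpha>"
  proof -
    have k: "Ck_on n UNIV \<kappa>" for n unfolding \<kappa>_def[abs_def]
      using smooth_on_vd(2)[OF smooth] smooth_on_vd(2)[OF smooth_on_vd(2)[OF smooth]]
      by (intro Ck_on_divide Ck_intros fat_open open_UNIV) (auto simp: smooth_on_def regular)
    have "Ck_on (Suc n) UNIV \<alpha>" for n
      by (rule Ck_on_real_SucI[OF fat_open[OF open_UNIV] _ k])
        (use d\<alpha> in \<open>auto simp: has_real_derivative_iff_has_vector_derivative\<close>)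
    then show ?thesis unfolding smooth_on_def using Ck_on_SucD by blast
  qed
  have deriv\<alpha>: "deriv \<alpha> \<phi> = \<kappa> \<phi>" for \<phi> by (rule DERIV_imp_deriv[OF d\<alpha>])
  have pos: "\<sigma> * deriv \<alpha> \<phi> > 0" for \<phi>
    using \<sigma>(3)[of \<phi>] regular[of \<phi>] unfolding deriv\<alpha> \<kappa>_def by (simp add: zero_less_divide_iff)
  have c\<alpha>: "continuous_on B \<alpha>" for B using d\<alpha> by (intro continuous_at_imp_continuous_on ballI DERIV_isCont)
  have per: "vd g (\<phi> + 2 * pi) = vd g \<phi>" for \<phi> by (rule periodic_vd)
  have vper: "vd (vd g) (\<phi> + 2 * pi) = vd (vd g) \<phi>" for \<phi>
  proof -
    have 1: "((\<lambda>x. x + 2 * pi) has_vector_derivative 1) (at \<phi>)"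
      by (auto simp: has_real_derivative_iff_has_vector_derivative[symmetric] intro!: derivative_eq_intros)
    have "((\<lambda>x. vd g (x + 2 * pi)) has_vector_derivative vd (vd g) (\<phi> + 2 * pi)) (at \<phi>)"
      using vector_diff_chain_at[OF 1 dg(2)] by (simp add: o_def)
    then have "(vd g has_vector_derivative vd (vd g) (\<phi> + 2 * pi)) (at \<phi>)" unfolding per .
    then show ?thesis by (rule vector_derivative_at[symmetric])
  qed
  have const: "\<alpha> (\<phi> + 2 * pi) - \<alpha> \<phi> = \<alpha> (2 * pi) - \<alpha> 0" for \<phi>
  proof -
    have "\<kappa> (\<phi> + 2 * pi) = \<kappa> \<phi>" for \<phi> unfolding \<kappa>_def per vper ..
    then have "((\<lambda>x. \<alpha> (x + 2 * pi) - \<alpha> x) has_real_derivative 0) (at x)" for x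
      using DERIV_diff[OF d\<alpha>[of "x + 2 * pi", unfolded DERIV_shift] d\<alpha>[of x]] by simp
    from DERIV_isconst_all[OF allI[OF this], of \<phi> 0] show ?thesis by simp
  qed
  have "tang (2 * pi) = tang 0" using per[of 0] by (simp add: tang_def)
  then have "cis (\<alpha> (2 * pi)) = cis (\<alpha> 0)" unfolding out[symmetric] \<sigma>(2) by simp
  then obtain k :: int where k: "\<alpha> (2 * pi) = \<alpha> 0 + of_int k * (2 * pi)" unfolding cis_eq_iff by blast
  have inc: "\<sigma> * \<alpha> a < \<sigma> * \<alpha> b" if "a < b" for a b
    by (rule DERIV_pos_imp_increasing[OF that]) (use DERIV_cmult[OF d\<alpha>] pos deriv\<alpha> in fastforce)
  have sk: "\<sigma> * of_int k > 0"
    using inc[of 0 "2 * pi"] by (simp add: k distrib_left mult.assoc[symmetric] zero_less_mult_iff)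
  \<comment> \<open>With more than one turn the angle would have advanced by exactly 2 * pi at some
    parameter strictly inside the period. The normal would be that of the parameter 0, and
    \<open>N_inj\<close> would give a double point.\<close>
  have "\<not> \<sigma> * of_int k > 1"
  proof
    assume k1: "\<sigma> * of_int k > 1"
    have e: "\<sigma> * \<alpha> (2 * pi) = \<sigma> * \<alpha> 0 + (\<sigma> * of_int k) * (2 * pi)" by (simp add: k distrib_left mult.assoc)
    have "1 * (2 * pi) < (\<sigma> * of_int k) * (2 * pi)" using k1 by (intro mult_strict_right_mono) auto
    then have lt: "\<sigma> * \<alpha> 0 + 2 * pi < \<sigma> * \<alpha> (2 * pi)" using e by linarith
    have "continuous_on {0..2 * pi} (\<lambda>x. \<sigma> * \<alpha> x)" by (intro continuous_intros c\<alpha>)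
    from IVT'[OF _ _ _ this, of "\<sigma> * \<alpha> 0 + 2 * pi"] obtain x
      where x: "0 \<le> x" "x \<le> 2 * pi" "\<sigma> * \<alpha> x = \<sigma> * \<alpha> 0 + 2 * pi" using lt by auto
    have "\<sigma> * (\<sigma> * \<alpha> x) = \<sigma> * (\<sigma> * \<alpha> 0) + \<sigma> * (2 * pi)" unfolding x(3) by (simp add: distrib_left)
    then have ax: "\<alpha> x = \<alpha> 0 + \<sigma> * (2 * pi)" by (simp add: ss mult.assoc[symmetric])
    have "cis (\<alpha> x) = cis (\<alpha> 0)" unfolding cis_eq_iff
      using \<sigma>(1) ax by (auto intro: exI[of _ 1] exI[of _ "- 1"])
    then have "N x = N 0" unfolding out[symmetric] by simp
    then have "g x = g 0" by (rule N_inj)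
    then obtain j :: int where j: "x = of_int j * (2 * pi)" using g_eq_iff[of x 0] by auto
    have "x \<noteq> 0" "x \<noteq> 2 * pi" using x(3) lt by auto
    then have "0 < of_int j * (2 * pi)" "of_int j * (2 * pi) < 1 * (2 * pi)" using x(1,2) j by linarith+
    then have "0 < j" "j < 1" by (simp_all add: zero_less_mult_iff)
    then show False by simp
  qed
  then have "\<sigma> * of_int k = 1" using sk \<sigma>(1) by (elim disjE) auto
  then have "of_int k = \<sigma>" using \<sigma>(1) by auto
  then have p: "\<alpha> (\<phi> + 2 * pi) = \<alpha> \<phi> + \<sigma> * (2 * pi)" for \<phi> using const[of \<phi>] k by simp
  show ?thesis
  proof (rule that[of \<sigma> \<alpha>])
    show "angle_fun \<sigma> \<alpha>" unfolding angle_fun_def using \<sigma>(1) sm pos p by blast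
    show "- N \<phi> = cis (\<alpha> \<phi>)" for \<phi> by (rule out)
    show "vd g \<phi> = (\<sigma> * norm (vd g \<phi>)) *\<^sub>R (\<i> * cis (\<alpha> \<phi>))" for \<phi>
      using vd_tang[of \<phi>] unfolding tc by (simp add: mult.commute)
  qed
qed

text \<open>Inverting the angle reparametrizes the curve by its own normal. Then the velocity is
  tangential, so the derivative of the height u is the tangential component of the curve, and the
  frame expansion of the curve is that of \<open>support_curve u\<close>.\<close>

lemma representation:
  obtains u \<sigma> \<alpha> where "convex_param u \<sigma> \<alpha>" "\<And>\<phi>. g \<phi> = support_curve u (\<alpha> \<phi>)"
proof -
  obtain \<sigma> \<alpha> where ang: "angle_fun \<sigma> \<alpha>" and v: "\<And>\<phi>. vd g \<phi> = (\<sigma> * norm (vd g \<phi>)) *\<^sub>R (\<i> * cis (\<alpha> \<phi>))"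
  proof (rule outward_angle, goal_cases)
    case (1 \<sigma> \<alpha>)
    show ?case by (rule 1(1)[OF 1(2) 1(4)])
  qed
  note AD = angle_funD[OF ang]
  have \<sigma>: "\<sigma> = 1 \<or> \<sigma> = - 1" and pos: "\<And>\<phi>. \<sigma> * deriv \<alpha> \<phi> > 0" using ang by (auto simp: angle_fun_def)
  have inj\<alpha>: "inj \<alpha>"
  proof (rule injI)
    fix x y assume "\<alpha> x = \<alpha> y"
    then show "x = y" using AD(2)[of x y] AD(2)[of y x] by (cases x y rule: linorder_cases) auto
  qed
  define \<beta> where "\<beta> = inv \<alpha>"
  have \<beta>\<alpha>: "\<beta> (\<alpha> x) = x" for x unfolding \<beta>_def by (rule inv_f_f[OF inj\<alpha>])
  have \<alpha>\<beta>: "\<alpha> (\<beta> y) = y" for y using AD(3)[of y] \<beta>\<alpha> by auto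
  have cont\<beta>: "isCont \<beta> y" for y
  proof -
    have "isCont \<beta> (\<alpha> (\<beta> y))"
      by (rule isCont_inverse_function[of 1]) (use \<beta>\<alpha> DERIV_isCont[OF AD(1)] in auto)
    then show ?thesis by (simp add: \<alpha>\<beta>)
  qed
  have nz: "deriv \<alpha> x \<noteq> 0" for x using pos[of x] by auto
  have d\<beta>: "(\<beta> has_real_derivative inverse (deriv \<alpha> (\<beta> y))) (at y)" for y
    by (rule DERIV_inverse_function[of \<alpha> _ _ _ "y - 1" "y + 1"]) (use AD(1) nz cont\<beta> \<alpha>\<beta> in auto)
  have Ck\<alpha>': "Ck_on n UNIV (deriv \<alpha>)" for n
    using ang smooth_on_deriv(2) by (auto simp: angle_fun_def smooth_on_def)
  \<comment> \<open>The derivative of the inverse is 1 / \<open>deriv \<alpha>\<close> composed with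
    the inverse itself, so its regularity bootstraps.\<close>
  have Ck\<beta>: "Ck_on n UNIV \<beta>" for n
  proof (induction n)
    case 0
    show ?case using cont\<beta> by (simp add: continuous_at_imp_continuous_on)
  next
    case (Suc n)
    have "Ck_on n UNIV (\<lambda>y. 1 / deriv \<alpha> (\<beta> y))"
      by (intro Ck_on_divide Ck_on_const Ck_on_compose[OF fat_open[OF open_UNIV] _ Ck\<alpha>' Suc] fat_open open_UNIV nz) simp
    then show ?case
      by (rule Ck_on_real_SucI[OF fat_open[OF open_UNIV], rotated])
        (use d\<beta> in \<open>auto simp: has_real_derivative_iff_has_vector_derivative inverse_eq_divide\<close>)
  qed
  define u where "u \<eta> = g (\<beta> \<eta>) \<bullet> cis \<eta>" for \<eta>
  define r where "r \<eta> = inverse (deriv \<alpha> (\<beta> \<eta>)) * (\<sigma> * norm (vd g (\<beta> \<eta>)))" for \<eta>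
  have r: "r \<eta> > 0" for \<eta>
  proof -
    have "inverse (deriv \<alpha> (\<beta> \<eta>)) * \<sigma> > 0" using pos[of "\<beta> \<eta>"] \<sigma> by (auto simp: zero_less_mult_iff)
    moreover have "norm (vd g (\<beta> \<eta>)) > 0" using regular by simp
    ultimately show ?thesis unfolding r_def mult.assoc[symmetric] by (rule mult_pos_pos)
  qed
  have g\<beta>: "((\<lambda>\<eta>. g (\<beta> \<eta>)) has_vector_derivative r \<eta> *\<^sub>R (\<i> * cis \<eta>)) (at \<eta>)" for \<eta>
  proof -
    have "(g has_vector_derivative (\<sigma> * norm (vd g (\<beta> \<eta>))) *\<^sub>R (\<i> * cis \<eta>)) (at (\<beta> \<eta>))"
      using dg(1)[of "\<beta> \<eta>"] v[of "\<beta> \<eta>"] by (simp add: \<alpha>\<beta>)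
    from vector_diff_chain_at[OF d\<beta>[unfolded has_real_derivative_iff_has_vector_derivative] this]
    show ?thesis by (simp add: o_def r_def)
  qed
  have ci: "((\<lambda>\<theta>. \<i> * cis \<theta>) has_vector_derivative \<i> * (\<i> * cis \<theta>)) (at \<theta>)" for \<theta>
    by (rule bounded_linear.has_vector_derivative[OF bounded_linear_mult_right has_vector_derivative_cis])
  have du: "(u has_real_derivative g (\<beta> \<eta>) \<bullet> (\<i> * cis \<eta>)) (at \<eta>)" for \<eta>
    using bounded_bilinear.has_vector_derivative[OF bounded_bilinear_inner g\<beta> has_vector_derivative_cis, of \<eta>]
    unfolding u_def[abs_def] by (simp add: has_real_derivative_iff_has_vector_derivative inner_cis_cis)
  have deriv_u: "deriv u = (\<lambda>\<eta>. g (\<beta> \<eta>) \<bullet> (\<i> * cis \<eta>))" by (rule ext, rule DERIV_imp_deriv[OF du])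
  have "(deriv u has_real_derivative r \<eta> - u \<eta>) (at \<eta>)" for \<eta>
    using bounded_bilinear.has_vector_derivative[OF bounded_bilinear_inner g\<beta> ci, of \<eta>]
    unfolding deriv_u by (simp add: has_real_derivative_iff_has_vector_derivative inner_cis_cis frame_inner u_def mult.assoc[symmetric])
  then have ddu: "deriv (deriv u) \<eta> = r \<eta> - u \<eta>" for \<eta> by (rule DERIV_imp_deriv)
  have per\<beta>: "\<beta> (\<eta> + 2 * pi) = \<beta> \<eta> + \<sigma> * (2 * pi)" for \<eta>
  proof -
    have "\<alpha> (\<beta> \<eta> + \<sigma> * (2 * pi)) = \<eta> + 2 * pi"
      using \<sigma> AD(4)[of "\<beta> \<eta>" 1] AD(4)[of "\<beta> \<eta>" "- 1"] by (auto simp: \<alpha>\<beta>)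
    then show ?thesis using \<beta>\<alpha> by metis
  qed
  have cs: "convex_support u"
  proof
    have "Ck_on n UNIV g" for n using smooth by (simp add: smooth_on_def)
    then have "Ck_on n UNIV (\<lambda>\<eta>. g (\<beta> \<eta>))" for n
      by (rule Ck_on_compose[OF fat_open[OF open_UNIV] subset_UNIV _ Ck\<beta>])
    then show "smooth_on UNIV u" unfolding smooth_on_def u_def[abs_def]
      by (intro allI Ck_on_inner Ck_on_cis fat_open open_UNIV)
    show "u (\<theta> + 2 * pi) = u \<theta>" for \<theta>
    proof -
      have "g (\<beta> \<theta> + \<sigma> * (2 * pi)) = g (\<beta> \<theta>)"
        using \<sigma> periodic_int[of "\<beta> \<theta>" 1] periodic_int[of "\<beta> \<theta>" "- 1"] by auto
      moreover have "cis (\<theta> + 2 * pi) = cis \<theta>" unfolding cis_eq_iff by (intro exI[of _ 1]) simp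
      ultimately show ?thesis unfolding u_def per\<beta> by simp
    qed
    show "curv_radius u \<theta> > 0" for \<theta> using r[of \<theta>] by (simp add: curv_radius_def ddu)
  qed
  show ?thesis
  proof (rule that[of u \<sigma> \<alpha>])
    show "convex_param u \<sigma> \<alpha>" using cs ang by (simp add: convex_param_def convex_param_axioms_def)
    fix \<phi>
    have "support_curve u (\<alpha> \<phi>) = g (\<beta> (\<alpha> \<phi>))"
      unfolding support_curve_def deriv_u unfolding u_def by (rule complex_cis_frame[symmetric])
    then show "g \<phi> = support_curve u (\<alpha> \<phi>)" by (simp add: \<beta>\<alpha>)
  qed
qed

end

text \<open>The gate between the definitions of the problem and the analysis: the function u found
  above must be the support function because \<open>support_function_g\<close> computes the latter
  for any \<open>convex_param\<close>.\<close>

theorem smooth_convex_closed_curve_representation: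
  assumes "smooth_convex_closed_curve g"
  obtains \<sigma> \<alpha> where "convex_param (support_function g) \<sigma> \<alpha>" "\<And>\<phi>. g \<phi> = support_curve (support_function g) (\<alpha> \<phi>)"
proof -
  interpret convex_closed_curve g
    using assms unfolding smooth_convex_closed_curve_def by unfold_locales auto
  obtain u \<sigma> \<alpha> where u: "convex_param u \<sigma> \<alpha>" "\<And>\<phi>. g \<phi> = support_curve u (\<alpha> \<phi>)"
    using representation by blast
  have "g = (\<lambda>\<phi>. support_curve u (\<alpha> \<phi>))" using u(2) by blast
  then have "support_function g = u" using convex_param.support_function_g[OF u(1)] by auto
  then show ?thesis using that u by auto
qed

lemma convex_support_function:
  assumes "smooth_convex_closed_curve g"
  shows "convex_support (support_function g)" "integral {0..2 * pi} (support_function g) = curve_length g"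
proof -
  obtain \<sigma> \<alpha> where p: "convex_param (support_function g) \<sigma> \<alpha>" "\<And>\<phi>. g \<phi> = support_curve (support_function g) (\<alpha> \<phi>)"
    using smooth_convex_closed_curve_representation[OF assms] by blast
  show "convex_support (support_function g)" using p(1) by (simp add: convex_param_def)
  have "g = (\<lambda>\<phi>. support_curve (support_function g) (\<alpha> \<phi>))" using p(2) by blast
  then show "integral {0..2 * pi} (support_function g) = curve_length g"
    using convex_param.curve_length_g[OF p(1)] by metis
qed

subsection \<open>The flow of a periodic time-dependent vector field on the line\<close>

text \<open>Periodicity makes v and its derivative in x bounded uniformly in x on compact time
  intervals, so solutions from all starting points exist as long as J lasts.\<close>

locale periodic_field =
  fixes v :: "real \<Rightarrow> real \<Rightarrow> real" and J :: "real set"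
  assumes J: "time_interval J"
    and smooth: "\<And>n. Ck_on n (UNIV \<times> J) (\<lambda>(x, t). v x t)"
    and periodic: "\<And>x t. t \<in> J \<Longrightarrow> v (x + 2 * pi) t = v x t"
begin

lemmas TI = time_intervalD[OF J]

lemma fat: "fat ((UNIV::real set) \<times> J)" by (rule time_interval_fat[OF J])

definition vx :: "real \<Rightarrow> real \<Rightarrow> real" where "vx x t = deriv (\<lambda>x. v x t) x"

lemma vx: "\<And>x t. t \<in> J \<Longrightarrow> ((\<lambda>x. v x t) has_real_derivative vx x t) (at x)"
  "Ck_on n (UNIV \<times> J) (\<lambda>(x, t). vx x t)"
proof -
  have *: "Ck_on n (UNIV \<times> J) (\<lambda>(x, t). vx x t) \<and> (\<forall>x. \<forall>t\<in>J. ((\<lambda>x. v x t) has_real_derivative vx x t) (at x))" for n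
  proof -
    obtain fx ft where f: "\<And>x t. t \<in> J \<Longrightarrow> ((\<lambda>x. v x t) has_vector_derivative fx x t) (at x)"
      "Ck_on n (UNIV \<times> J) (\<lambda>(x, t). fx x t)"
      using Ck_on_partialsE[OF smooth[of "Suc n"]] by metis
    have d: "((\<lambda>x. v x t) has_real_derivative fx x t) (at x)" if "t \<in> J" for x t
      using f(1)[OF that] by (simp add: has_real_derivative_iff_has_vector_derivative)
    have e: "vx x t = fx x t" if "t \<in> J" for x t unfolding vx_def by (rule DERIV_imp_deriv[OF d[OF that]])
    have "Ck_on n (UNIV \<times> J) (\<lambda>(x, t). vx x t)"
      by (rule iffD2[OF Ck_on_cong f(2)]) (auto simp: e)
    then show ?thesis using d e by simp
  qed
  show "\<And>x t. t \<in> J \<Longrightarrow> ((\<lambda>x. v x t) has_real_derivative vx x t) (at x)"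
    "Ck_on n (UNIV \<times> J) (\<lambda>(x, t). vx x t)" using * by auto
qed

lemma cont_v: "continuous_on (UNIV \<times> J) (\<lambda>(x, t). v x t)" "continuous_on (UNIV \<times> J) (\<lambda>(x, t). vx x t)"
  using Ck_on_imp_cont[OF smooth] Ck_on_imp_cont[OF vx(2)] by auto

lemma periodic_vx: "t \<in> J \<Longrightarrow> vx (x + 2 * pi) t = vx x t"
proof -
  assume t: "t \<in> J"
  have "((\<lambda>x. v (x + 2 * pi) t) has_real_derivative vx (x + 2 * pi) t) (at x)"
    using vx(1)[OF t, of "x + 2 * pi"] by (simp add: DERIV_shift)
  then have "((\<lambda>x. v x t) has_real_derivative vx (x + 2 * pi) t) (at x)" by (simp add: periodic[OF t])
  then show ?thesis using DERIV_unique[OF _ vx(1)[OF t]] by blast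
qed

lemma periodic_bound:
  assumes w: "continuous_on (UNIV \<times> J) (\<lambda>(x::real, t). w x t :: real)" "\<And>x t. t \<in> J \<Longrightarrow> w (x + 2 * pi) t = w x t" and T: "T \<in> J"
  obtains K where "K > 0" "\<And>x t. t \<in> {0..T} \<Longrightarrow> \<bar>w x t\<bar> \<le> K"
proof -
  have "compact ((\<lambda>(x, t). w x t) ` ({0..2 * pi} \<times> {0..T}))"
    by (intro compact_continuous_image continuous_on_subset[OF w(1)] compact_Times) (use TI(5)[OF T] in auto)
  then obtain K where K: "\<And>x t. x \<in> {0..2 * pi} \<Longrightarrow> t \<in> {0..T} \<Longrightarrow> \<bar>w x t\<bar> \<le> K"
    using compact_imp_bounded by (force simp: bounded_iff)
  have "\<bar>w x t\<bar> \<le> max K 1" if t: "t \<in> {0..T}" for x t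
  proof -
    have tJ: "t \<in> J" using t TI(5)[OF T] by blast
    interpret periodic_fun_simple "\<lambda>x. w x t" "2 * pi" by unfold_locales (rule w(2)[OF tJ])
    obtain k :: int where k: "0 \<le> x + of_int k * (2 * pi)" "x + of_int k * (2 * pi) < 0 + 2 * pi" by (rule exists_shift)
    have "\<bar>w (x + of_int k * (2 * pi)) t\<bar> \<le> K" using k t by (intro K) auto
    then show ?thesis using plus_of_int[of x k] by simp
  qed
  then show ?thesis using that[of "max K 1"] by auto
qed

text \<open>The difference quotient is written as an integral because this form is continuous up to
  y = x.\<close>

lemma v_diff:
  assumes t: "t \<in> J"
  shows "v y t - v x t = (y - x) * integral {0..1} (\<lambda>r. vx (x + r * (y - x)) t)"
proof -
  have "((\<lambda>r. (y - x) * vx (x + r * (y - x)) t) has_integral v (x + 1 * (y - x)) t - v (x + 0 * (y - x)) t) {0..1}"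
  proof (rule fundamental_theorem_of_calculus)
    fix r
    have "((\<lambda>r. x + r * (y - x)) has_real_derivative (y - x)) (at r within {0..1})"
      by (auto intro!: derivative_eq_intros)
    from DERIV_chain2[OF vx(1)[OF t] this]
    show "((\<lambda>r. v (x + r * (y - x)) t) has_vector_derivative (y - x) * vx (x + r * (y - x)) t) (at r within {0..1})"
      by (simp add: has_real_derivative_iff_has_vector_derivative mult.commute)
  qed simp
  from integral_unique[OF this] show ?thesis by simp
qed

lemma v_lipschitz:
  assumes t: "t \<in> J" and K: "\<And>x. \<bar>vx x t\<bar> \<le> K"
  shows "\<bar>v y t - v x t\<bar> \<le> K * \<bar>y - x\<bar>"
  using field_differentiable_bound[of UNIV "\<lambda>x. v x t" "\<lambda>x. vx x t" K y x] vx(1)[OF t] K by simp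

section \<open>Picard iteration and the regularity of its limit\<close>

primrec picard :: "nat \<Rightarrow> real \<Rightarrow> real \<Rightarrow> real" where
  "picard 0 x t = x"
| "picard (Suc n) x t = x + integral {0..t} (\<lambda>s. v (picard n x s) s)"

lemma cont_v_compose:
  assumes "continuous_on (A \<times> J) (\<lambda>(x, t). f x t)"
  shows "continuous_on (A \<times> J) (\<lambda>(x, t). v (f x t) t)" "continuous_on (A \<times> J) (\<lambda>(x, t). vx (f x t) t)"
proof -
  have c: "continuous_on (A \<times> J) (\<lambda>p. (f (fst p) (snd p), snd p))"
    using assms by (intro continuous_intros) (simp add: case_prod_unfold)
  have "continuous_on (A \<times> J) (\<lambda>p. (\<lambda>(x, t). v x t) (f (fst p) (snd p), snd p))"
    by (rule continuous_on_compose2[OF cont_v(1) c]) auto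
  then show "continuous_on (A \<times> J) (\<lambda>(x, t). v (f x t) t)" by (simp add: case_prod_unfold)
  have "continuous_on (A \<times> J) (\<lambda>p. (\<lambda>(x, t). vx x t) (f (fst p) (snd p), snd p))"
    by (rule continuous_on_compose2[OF cont_v(2) c]) auto
  then show "continuous_on (A \<times> J) (\<lambda>(x, t). vx (f x t) t)" by (simp add: case_prod_unfold)
qed

lemma continuous_id_part: "continuous_on A (\<lambda>(x::real, t::real). x)"
  by (simp add: case_prod_unfold continuous_on_fst continuous_on_id)

lemma picard_continuous: "continuous_on (UNIV \<times> J) (\<lambda>(x, t). picard n x t)"
proof (induction n)
  case 0 then show ?case by (simp add: continuous_id_part)
next
  case (Suc n)
  have "Ck_on 0 (UNIV \<times> J) (\<lambda>(x, t). integral {0..t} (\<lambda>s. v (picard n x s) s))"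
    by (rule Ck_on_time_integral[OF J]) (use cont_v_compose(1)[OF Suc] in simp)
  then have "continuous_on (UNIV \<times> J) (\<lambda>(x, t). integral {0..t} (\<lambda>s. v (picard n x s) s))" by simp
  from continuous_on_add[OF continuous_id_part this]
  show ?case by (simp add: case_prod_unfold)
qed

lemma picard_periodic: "t \<in> J \<Longrightarrow> picard n (x + 2 * pi) t = picard n x t + 2 * pi"
proof (induction n arbitrary: t)
  case (Suc n)
  have "integral {0..t} (\<lambda>s. v (picard n (x + 2 * pi) s) s) = integral {0..t} (\<lambda>s. v (picard n x s) s)"
    by (rule Henstock_Kurzweil_Integration.integral_cong) (use Suc.IH TI(5)[OF Suc.prems] periodic in auto)
  then show ?case by simp
qed simp

lemma picard_integrable:
  assumes "T \<in> J" "continuous_on (UNIV \<times> J) (\<lambda>(x, t). f x t)"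
  shows "(\<lambda>s. v (f x s) s) integrable_on {0..T}"
  by (intro integrable_continuous_interval continuous_on_slice1[OF cont_v_compose(1)[OF assms(2)] TI(5)[OF assms(1)]]) simp

text \<open>With the weight \<open>e\<^sup>2\<^sup>K\<^sup>t\<close>, each Picard step halves the distance.\<close>

lemma picard_step:
  assumes T: "T \<in> J" and K: "K > 0" "\<And>x t. t \<in> {0..T} \<Longrightarrow> \<bar>vx x t\<bar> \<le> K"
    and M: "M > 0" "\<And>x t. t \<in> {0..T} \<Longrightarrow> \<bar>v x t\<bar> \<le> M" and t: "t \<in> {0..T}"
  shows "\<bar>picard (Suc n) x t - picard n x t\<bar> \<le> M * T * (1 / 2) ^ n * exp (2 * K * t)"
  using t
proof (induction n arbitrary: t)
  case 0
  have tJ: "t \<in> J" using 0 TI(5)[OF T] by blast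
  have "\<bar>integral {0..t} (\<lambda>s. v x s)\<bar> \<le> M * (t - 0)"
    using 0 M T by (intro integral_bound[where 'a=real, simplified real_norm_def]
        continuous_on_slice1[OF cont_v(1) TI(5)[OF tJ]]) auto
  also have "\<dots> \<le> M * T * exp (2 * K * t)"
    using 0 M K mult_mono[of "M * t" "M * T" 1 "exp (2 * K * t)"] by auto
  finally show ?case by simp
next
  case (Suc n)
  let ?D = "M * T * (1 / 2) ^ n"
  have tJ: "t \<in> J" using Suc.prems TI(5)[OF T] by blast
  have D: "?D \<ge> 0" using M TI(4)[OF T] by simp
  have "picard (Suc (Suc n)) x t - picard (Suc n) x t =
      integral {0..t} (\<lambda>s. v (picard (Suc n) x s) s - v (picard n x s) s)"
    using Henstock_Kurzweil_Integration.integral_diff[OF picard_integrable[OF tJ picard_continuous[of "Suc n"]] picard_integrable[OF tJ picard_continuous[of n]], of x x]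
    by simp
  also have "\<bar>\<dots>\<bar> \<le> integral {0..t} (\<lambda>s. K * (?D * exp (2 * K * s)))"
  proof (rule integral_norm_bound_integral[where 'a=real, simplified real_norm_def])
    show "(\<lambda>s. v (picard (Suc n) x s) s - v (picard n x s) s) integrable_on {0..t}"
      by (intro Henstock_Kurzweil_Integration.integrable_diff picard_integrable[OF tJ] picard_continuous)
    show "(\<lambda>s. K * (?D * exp (2 * K * s))) integrable_on {0..t}"
      by (intro integrable_continuous_interval continuous_intros)
    fix s assume s: "s \<in> {0..t}"
    then have sT: "s \<in> {0..T}" and sJ: "s \<in> J" using Suc.prems TI(5)[OF tJ] by auto
    have "\<bar>v (picard (Suc n) x s) s - v (picard n x s) s\<bar> \<le> K * \<bar>picard (Suc n) x s - picard n x s\<bar>"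
      by (rule v_lipschitz[OF sJ K(2)[OF sT]])
    also have "\<dots> \<le> K * (?D * exp (2 * K * s))" using K(1) Suc.IH[OF sT] by (intro mult_left_mono) auto
    finally show "\<bar>v (picard (Suc n) x s) s - v (picard n x s) s\<bar> \<le> K * (?D * exp (2 * K * s))" .
  qed
  also have "\<dots> = ?D / 2 * (exp (2 * K * t) - 1)"
  proof -
    have "((\<lambda>s. K * (?D * exp (2 * K * s))) has_integral ?D / 2 * exp (2 * K * t) - ?D / 2 * exp (2 * K * 0)) {0..t}"
      using Suc.prems by (intro fundamental_theorem_of_calculus)
        (auto intro!: derivative_eq_intros simp: has_real_derivative_iff_has_vector_derivative[symmetric])
    from integral_unique[OF this] show ?thesis by (simp only:) (simp add: algebra_simps)
  qed
  also have "\<dots> \<le> ?D / 2 * exp (2 * K * t)" using D by (intro mult_left_mono) auto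
  finally show ?case by (simp add: mult_ac)
qed

definition flow :: "real \<Rightarrow> real \<Rightarrow> real" where
  "flow x t = x + (\<Sum>n. picard (Suc n) x t - picard n x t)"

lemma picard_sum: "picard N x t = x + (\<Sum>n<N. picard (Suc n) x t - picard n x t)"
  by (induction N) (simp_all del: picard.simps(2) add: sum_lessThan_telescope)

lemma picard_uniform:
  assumes T: "T \<in> J"
  shows "uniform_limit (UNIV \<times> {0..T}) (\<lambda>n p. picard n (fst p) (snd p)) (\<lambda>p. flow (fst p) (snd p)) sequentially"
proof -
  obtain K where K: "K > 0" "\<And>x t. t \<in> {0..T} \<Longrightarrow> \<bar>vx x t\<bar> \<le> K"
    using periodic_bound[OF cont_v(2) periodic_vx T] by blast
  obtain M where M: "M > 0" "\<And>x t. t \<in> {0..T} \<Longrightarrow> \<bar>v x t\<bar> \<le> M"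
    using periodic_bound[OF cont_v(1) periodic T] by blast
  have ul: "uniform_limit (UNIV \<times> {0..T}) (\<lambda>N p. \<Sum>n<N. picard (Suc n) (fst p) (snd p) - picard n (fst p) (snd p))
     (\<lambda>p. \<Sum>n. picard (Suc n) (fst p) (snd p) - picard n (fst p) (snd p)) sequentially"
  proof (rule Weierstrass_m_test[where M="\<lambda>n. M * T * exp (2 * K * T) * (1 / 2) ^ n"])
    fix n and p :: "real \<times> real" assume p: "p \<in> UNIV \<times> {0..T}"
    have "\<bar>picard (Suc n) (fst p) (snd p) - picard n (fst p) (snd p)\<bar> \<le> M * T * (1 / 2) ^ n * exp (2 * K * snd p)"
      by (rule picard_step[OF T K M]) (use p in auto)
    also have "\<dots> \<le> M * T * (1 / 2) ^ n * exp (2 * K * T)"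
      using p K(1) M(1) TI(4)[OF T] by (intro mult_left_mono) auto
    finally show "norm (picard (Suc n) (fst p) (snd p) - picard n (fst p) (snd p)) \<le> M * T * exp (2 * K * T) * (1 / 2) ^ n"
      by (simp add: mult_ac)
  next
    show "summable (\<lambda>n. M * T * exp (2 * K * T) * (1 / 2) ^ n)" by (intro summable_mult summable_geometric) simp
  qed
  show ?thesis
  proof (rule uniform_limitI)
    fix e :: real assume "e > 0"
    from uniform_limitD[OF ul this]
    show "\<forall>\<^sub>F n in sequentially. \<forall>p\<in>UNIV \<times> {0..T}. dist (picard n (fst p) (snd p)) (flow (fst p) (snd p)) < e"
    proof eventually_elim
      case (elim n)
      show ?case using elim by (subst picard_sum) (simp add: flow_def dist_real_def)
    qed
  qed
qed

lemma flow_continuous: "continuous_on (UNIV \<times> J) (\<lambda>(x, t). flow x t)"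
proof -
  have c: "continuous_on (UNIV \<times> {0..T}) (\<lambda>p. flow (fst p) (snd p))" if T: "T \<in> J" for T
  proof (rule uniform_limit_theorem[OF _ picard_uniform[OF T]])
    have "continuous_on (UNIV \<times> {0..T}) (\<lambda>(x, t). picard n x t)" for n
      by (rule continuous_on_subset[OF picard_continuous]) (use TI(5)[OF T] in auto)
    then show "\<forall>\<^sub>F n in sequentially. continuous_on (UNIV \<times> {0..T}) (\<lambda>p. picard n (fst p) (snd p))"
      by (simp add: case_prod_unfold)
  qed simp
  have "continuous_on (UNIV \<times> J) (\<lambda>p. flow (fst p) (snd p))"
    unfolding continuous_on_eq_continuous_within
  proof
    fix p :: "real \<times> real" assume p: "p \<in> UNIV \<times> J"
    then obtain b where b: "b \<in> J" "snd p < b" using TI(6)[of "snd p"] by auto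
    have "continuous (at p within UNIV \<times> {0..b}) (\<lambda>p. flow (fst p) (snd p))"
      using c[OF b(1)] p b TI(4) by (auto simp: continuous_on_eq_continuous_within)
    \<comment> \<open>Near p the strip up to time b and the whole of J coincide, so uniform
      convergence on compact time intervals suffices.\<close>
    moreover have "at p within UNIV \<times> {0..b} = at p within UNIV \<times> J"
    proof (rule at_within_nhd[of _ "UNIV \<times> {..<b}"])
      show "open (UNIV \<times> {..<b} :: (real \<times> real) set)" by (intro open_Times) auto
      show "UNIV \<times> {0..b} \<inter> UNIV \<times> {..<b} - {p} = UNIV \<times> J \<inter> UNIV \<times> {..<b} - {p}"
        using TI(4,5) b by auto
    qed (use p b in \<open>auto simp: mem_Times_iff\<close>)
    ultimately show "continuous (at p within UNIV \<times> J) (\<lambda>p. flow (fst p) (snd p))" by simp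
  qed
  then show ?thesis by (simp add: case_prod_unfold)
qed

lemma picard_LIMSEQ: "t \<in> J \<Longrightarrow> (\<lambda>n. picard n x t) \<longlonglongrightarrow> flow x t"
  using tendsto_uniform_limitI[OF picard_uniform, of t "(x, t)"] TI(4)[of t] by simp

lemma flow_integral: 
  assumes t: "t \<in> J"
  shows "flow x t = x + integral {0..t} (\<lambda>s. v (flow x s) s)"
proof -
  obtain K where K: "K > 0" "\<And>x s. s \<in> {0..t} \<Longrightarrow> \<bar>vx x s\<bar> \<le> K"
    using periodic_bound[OF cont_v(2) periodic_vx t] by blast
  have ul: "uniform_limit (cbox 0 t) (\<lambda>n s. v (picard n x s) s) (\<lambda>s. v (flow x s) s) sequentially"
  proof (rule uniform_limitI)
    fix e :: real assume e: "e > 0"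
    have "e / K > 0" using e K by simp
    from uniform_limitD[OF picard_uniform[OF t] this]
    show "\<forall>\<^sub>F n in sequentially. \<forall>s\<in>cbox 0 t. dist (v (picard n x s) s) (v (flow x s) s) < e"
    proof eventually_elim
      case (elim n)
      show ?case
      proof
        fix s assume s: "s \<in> cbox 0 t"
        then have "dist (picard n x s) (flow x s) < e / K" using elim by auto
        then have "K * \<bar>picard n x s - flow x s\<bar> < e" using K(1) by (simp add: dist_real_def field_simps)
        moreover have "\<bar>v (picard n x s) s - v (flow x s) s\<bar> \<le> K * \<bar>picard n x s - flow x s\<bar>"
          using s TI(5)[OF t] by (intro v_lipschitz K(2)) auto
        ultimately show "dist (v (picard n x s) s) (v (flow x s) s) < e" by (simp add: dist_real_def)
      qed
    qed
  qed
  have "continuous_on (cbox 0 t) (\<lambda>s. v (picard n x s) s)" for n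
    using continuous_on_slice1[OF cont_v_compose(1)[OF picard_continuous] TI(5)[OF t], of x] by simp
  then obtain I L where IL: "\<And>n. ((\<lambda>s. v (picard n x s) s) has_integral I n) (cbox 0 t)"
    "((\<lambda>s. v (flow x s) s) has_integral L) (cbox 0 t)" "I \<longlonglongrightarrow> L"
    using uniform_limit_integral_cbox[OF ul] by (metis sequentially_bot)
  have "picard (Suc n) x t = x + I n" for n using IL(1)[of n] by (simp add: integral_unique)
  moreover have "(\<lambda>n. x + I n) \<longlonglongrightarrow> x + L" by (intro tendsto_intros IL)
  moreover have "(\<lambda>n. picard (Suc n) x t) \<longlonglongrightarrow> flow x t" using picard_LIMSEQ[OF t] by (rule LIMSEQ_Suc)
  ultimately have "flow x t = x + L" by (simp only: LIMSEQ_unique)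
  then show ?thesis using IL(2) by (simp add: integral_unique)
qed

lemma flow_0: "flow x 0 = x"
  using flow_integral[OF TI(3), of x] by simp

lemma flow_dt: "t \<in> J \<Longrightarrow> ((\<lambda>t. flow x t) has_real_derivative v (flow x t) t) (at t within J)"
proof -
  assume t: "t \<in> J"
  have c: "continuous_on J (\<lambda>s. v (flow x s) s)"
    by (rule continuous_on_slice1[OF cont_v_compose(1)[OF flow_continuous] order_refl]) simp
  have "((\<lambda>t. x + integral {0..t} (\<lambda>s. v (flow x s) s)) has_real_derivative 0 + v (flow x t) t) (at t within J)"
    by (intro DERIV_add DERIV_const)
      (use integral_within_time_interval[OF J t c] in \<open>simp add: has_real_derivative_iff_has_vector_derivative\<close>)
  then have "((\<lambda>t. x + integral {0..t} (\<lambda>s. v (flow x s) s)) has_real_derivative v (flow x t) t) (at t within J)" by simp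
  then show ?thesis unfolding has_field_derivative_def
    by (rule has_derivative_transform[OF t, rotated]) (rule flow_integral)
qed

lemma flow_periodic: "t \<in> J \<Longrightarrow> flow (x + 2 * pi) t = flow x t + 2 * pi"
proof -
  assume t: "t \<in> J"
  have "(\<lambda>n. picard n x t + 2 * pi) \<longlonglongrightarrow> flow x t + 2 * pi" by (intro tendsto_intros picard_LIMSEQ t)
  moreover have "(\<lambda>n. picard n x t + 2 * pi) \<longlonglongrightarrow> flow (x + 2 * pi) t"
    using picard_LIMSEQ[OF t, of "x + 2 * pi"] by (simp add: picard_periodic[OF t])
  ultimately show ?thesis using LIMSEQ_unique by blast
qed

text \<open>The solution of the equation linearized along a trajectory. As an exponential it is
  positive, which later keeps transported angles monotone.\<close>

definition flow_jac :: "real \<Rightarrow> real \<Rightarrow> real" where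
  "flow_jac x t = exp (integral {0..t} (\<lambda>s. vx (flow x s) s))"

text \<open>The difference of two solutions solves a linear equation, whose coefficient \<open>a\<close> is continuous in the initial values.\<close>

lemma flow_dx:
  assumes t: "t \<in> J" shows "((\<lambda>x. flow x t) has_real_derivative flow_jac x t) (at x)"
proof -
  define a where "a z s = integral {0..1} (\<lambda>r. vx (flow x s + r * (flow z s - flow x s)) s)" for z s
  have "continuous_on ((UNIV \<times> J) \<times> {0..1::real}) (\<lambda>q. (\<lambda>(x, t). flow x t) (fst q))"
    by (rule continuous_on_compose2[OF flow_continuous]) (auto intro!: continuous_intros)
  then have cx: "continuous_on ((UNIV \<times> J) \<times> {0..1::real}) (\<lambda>q. flow (fst (fst q)) (snd (fst q)))"
    by (simp add: case_prod_unfold)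
  have "continuous_on ((UNIV \<times> J) \<times> {0..1::real}) (\<lambda>q. (\<lambda>(x, t). flow x t) (x, snd (fst q)))" for x
    by (rule continuous_on_compose2[OF flow_continuous]) (auto intro!: continuous_intros)
  then have c0: "continuous_on ((UNIV \<times> J) \<times> {0..1::real}) (\<lambda>q. flow x (snd (fst q)))"
    by simp
  have "continuous_on ((UNIV \<times> J) \<times> cbox 0 1)
      (\<lambda>q. (\<lambda>(x, t). vx x t) (flow x (snd (fst q)) + snd q * (flow (fst (fst q)) (snd (fst q)) - flow x (snd (fst q))), snd (fst q)))"
    by (rule continuous_on_compose2[OF cont_v(2)]) (use cx c0 in \<open>auto intro!: continuous_intros\<close>)
  then have "continuous_on ((UNIV \<times> J) \<times> cbox 0 1)
      (\<lambda>(p, r). vx (flow x (snd p) + r * (flow (fst p) (snd p) - flow x (snd p))) (snd p))"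
    by (simp add: case_prod_unfold)
  from integral_continuous_on_param[OF this] have ca: "continuous_on (UNIV \<times> J) (\<lambda>(z, s). a z s)"
    by (simp add: a_def case_prod_unfold)
  have ca1: "continuous_on J (a z)" for z by (rule continuous_on_slice1[OF ca order_refl UNIV_I])
  have key: "flow z t - flow x t = exp (integral {0..t} (a z)) * (z - x)" for z
  proof -
    define q where "q s = (flow z s - flow x s) * exp (- integral {0..s} (a z))" for s
    have dq: "(q has_real_derivative 0) (at s within J)" if s: "s \<in> J" for s
    proof -
      have A: "((\<lambda>s. integral {0..s} (a z)) has_real_derivative a z s) (at s within J)"
        using integral_within_time_interval[OF J s ca1] by (simp add: has_real_derivative_iff_has_vector_derivative)
      have d: "v (flow z s) s - v (flow x s) s = (flow z s - flow x s) * a z s"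
        unfolding a_def by (rule v_diff[OF s])
      have "(q has_real_derivative (v (flow z s) s - v (flow x s) s) * exp (- integral {0..s} (a z))
          + exp (- integral {0..s} (a z)) * (- a z s) * (flow z s - flow x s)) (at s within J)"
        unfolding q_def[abs_def]
        by (intro DERIV_mult DERIV_diff flow_dt s DERIV_chain2[OF DERIV_exp] DERIV_minus A)
      then show ?thesis unfolding d by (simp add: algebra_simps)
    qed
    have "q t = q 0"
      using has_field_derivative_zero_constant[OF TI(1), of q] dq t TI(3) by metis
    then have e: "(flow z t - flow x t) * exp (- integral {0..t} (a z)) = z - x" by (simp add: q_def flow_0)
    have "flow z t - flow x t = (flow z t - flow x t) * exp (- integral {0..t} (a z)) * exp (integral {0..t} (a z))"
      by (simp add: exp_minus)
    then show ?thesis unfolding e by (simp only: mult.commute)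
  qed
  have "continuous_on (UNIV \<times> cbox 0 t) (\<lambda>(z, s). a z s)"
    by (rule continuous_on_subset[OF ca]) (use TI(5)[OF t] in auto)
  from integral_continuous_on_param[OF this] have "continuous_on UNIV (\<lambda>z. integral {0..t} (a z))" by simp
  then have "isCont (\<lambda>z. exp (integral {0..t} (a z))) x"
    by (intro continuous_on_interior[of UNIV]) (auto intro!: continuous_intros)
  moreover have "a x = (\<lambda>s. vx (flow x s) s)" by (rule ext) (simp add: a_def)
  \<comment> \<open>Caratheodory's criterion: the difference quotient is an expression in z that is
    continuous at z = x.\<close>
  ultimately show ?thesis unfolding CARAT_DERIV using key
    by (intro exI[of _ "\<lambda>z. exp (integral {0..t} (a z))"]) (auto simp: flow_jac_def)
qed

text \<open>Both partial derivatives of the flow are expressed through smooth functions evaluated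
  along the flow itself, so each order of smoothness yields the next.\<close>

lemma flow_smooth: "Ck_on n (UNIV \<times> J) (\<lambda>(x, t). flow x t)"
proof (induction n)
  case 0 then show ?case using flow_continuous by simp
next
  case (Suc n)
  have m: "Ck_on n (UNIV \<times> J) (\<lambda>p. (flow (fst p) (snd p), snd p))"
    using Suc by (intro Ck_on_Pair fat Ck_on_linear[OF fat bounded_linear_snd Ck_on_id[OF fat]]) (simp add: case_prod_unfold)
  have c: "Ck_on n (UNIV \<times> J) (\<lambda>p. (\<lambda>(x, t). w x t) (flow (fst p) (snd p), snd p))"
    if "Ck_on n (UNIV \<times> J) (\<lambda>(x, t). w x t)" for w :: "real \<Rightarrow> real \<Rightarrow> real"
    by (rule Ck_on_compose[OF fat _ that m]) auto
  show ?case
  proof (rule Ck_on_partialsI[OF TI(1,2)])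
    show "((\<lambda>x. flow x t) has_vector_derivative flow_jac x t) (at x)" if "t \<in> J" for x t
      using flow_dx[OF that] by (simp add: has_real_derivative_iff_has_vector_derivative)
    show "((\<lambda>t. flow x t) has_vector_derivative v (flow x t) t) (at t within J)" if "t \<in> J" for x t
      using flow_dt[OF that] by (simp add: has_real_derivative_iff_has_vector_derivative)
    show "Ck_on n (UNIV \<times> J) (\<lambda>(x, t). v (flow x t) t)" using c[OF smooth] by (simp add: case_prod_unfold)
    have "Ck_on n (UNIV \<times> J) (\<lambda>(x, t). vx (flow x t) t)" using c[OF vx(2)] by (simp add: case_prod_unfold)
    from Ck_on_compose[OF fat subset_UNIV Ck_on_exp Ck_on_time_integral[OF J this]]
    show "Ck_on n (UNIV \<times> J) (\<lambda>(x, t). flow_jac x t)" by (simp add: case_prod_unfold flow_jac_def)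
  qed
qed

end

subsection \<open>Maximisation over a compact set depending on a parameter\<close>

text \<open>The maximizer may jump, but G takes the same value at all maximizers. Along any sequence
  of parameters compactness gives a limit point of the selected maximizers, which is again a
  maximizer, so G has the right limit.\<close>

lemma argmax_continuous:
  fixes G :: "'z::metric_space \<Rightarrow> 'k::metric_space \<Rightarrow> real" and M :: "'z \<Rightarrow> 'k \<Rightarrow> real"
  assumes K: "compact K" and sel: "\<And>z. z \<in> Z \<Longrightarrow> sel z \<in> K"
    and M: "continuous_on (Z \<times> K) (\<lambda>(z, k). M z k)" and G: "continuous_on (Z \<times> K) (\<lambda>(z, k). G z k)"
    and max: "\<And>z k. z \<in> Z \<Longrightarrow> k \<in> K \<Longrightarrow> M z k \<le> M z (sel z)"
    and same: "\<And>z k. z \<in> Z \<Longrightarrow> k \<in> K \<Longrightarrow> M z k = M z (sel z) \<Longrightarrow> G z k = G z (sel z)"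
  shows "continuous_on Z (\<lambda>z. G z (sel z))"
  unfolding continuous_on_sequentially
proof (intro allI ballI impI, unfold o_def, elim conjE)
  fix z zs assume z: "z \<in> Z" and zs: "\<forall>n. zs n \<in> Z" and lim: "zs \<longlonglongrightarrow> z"
  show "(\<lambda>n. G (zs n) (sel (zs n))) \<longlonglongrightarrow> G z (sel z)"
  proof (rule ccontr)
    assume "\<not> ?thesis"
    then obtain e where e: "e > 0" "\<And>N. \<exists>n\<ge>N. \<not> dist (G (zs n) (sel (zs n))) (G z (sel z)) < e"
      unfolding lim_sequentially by blast
    have "infinite {n. \<not> dist (G (zs n) (sel (zs n))) (G z (sel z)) < e}"
      unfolding infinite_nat_iff_unbounded_le using e(2) by blast
    then obtain r :: "nat \<Rightarrow> nat" where r: "strict_mono r" "\<And>n. \<not> dist (G (zs (r n)) (sel (zs (r n)))) (G z (sel z)) < e"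
      using infinite_enumerate by blast
    have "\<forall>n. sel (zs (r n)) \<in> K" using sel zs by blast
    then obtain k s where k: "k \<in> K" "strict_mono s" "((\<lambda>n. sel (zs (r n))) \<circ> s) \<longlonglongrightarrow> k"
      using K unfolding compact_def by metis
    define q where "q n = r (s n)" for n
    have sk: "(\<lambda>n. sel (zs (q n))) \<longlonglongrightarrow> k" using k(3) by (simp add: o_def q_def)
    have "strict_mono q" using r(1) k(2) by (simp add: q_def strict_mono_def)
    then have zq: "(\<lambda>n. zs (q n)) \<longlonglongrightarrow> z" using LIMSEQ_subseq_LIMSEQ[OF lim] by (simp add: o_def)
    have lm: "(\<lambda>n. F (zs (q n)) (ks n)) \<longlonglongrightarrow> F z k'"
      if "continuous_on (Z \<times> K) (\<lambda>(z, k). F z k)" "ks \<longlonglongrightarrow> k'" "k' \<in> K" "\<And>n. ks n \<in> K" for F :: "'z \<Rightarrow> 'k \<Rightarrow> real" and ks k'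
    proof -
      have "(\<lambda>n. (\<lambda>(z, k). F z k) (zs (q n), ks n)) \<longlonglongrightarrow> (\<lambda>(z, k). F z k) (z, k')"
        by (rule continuous_on_tendsto_compose[OF that(1) tendsto_Pair[OF zq that(2)]]) (use z zs that in auto)
      then show ?thesis by simp
    qed
    have selK: "sel (zs (q n)) \<in> K" for n using sel zs by blast
    have Mk: "M z k' \<le> M z k" if "k' \<in> K" for k'
    proof (rule LIMSEQ_le)
      show "(\<lambda>n. M (zs (q n)) k') \<longlonglongrightarrow> M z k'" by (rule lm[OF M]) (use that in auto)
      show "(\<lambda>n. M (zs (q n)) (sel (zs (q n)))) \<longlonglongrightarrow> M z k" by (rule lm[OF M sk k(1) selK])
    qed (use max zs that in blast)
    have "M z k = M z (sel z)" using Mk[OF sel[OF z]] max[OF z k(1)] by simp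
    then have "G z k = G z (sel z)" by (rule same[OF z k(1)])
    then have "(\<lambda>n. G (zs (q n)) (sel (zs (q n)))) \<longlonglongrightarrow> G z (sel z)" using lm[OF G sk k(1) selK] by simp
    then have "\<forall>\<^sub>F n in sequentially. dist (G (zs (q n)) (sel (zs (q n)))) (G z (sel z)) < e"
      using e(1) by (rule tendstoD)
    then show False using r(2) by (auto simp: q_def eventually_sequentially)
  qed
qed

lemma mvt_within_convex:
  fixes f :: "real \<Rightarrow> real"
  assumes J: "convex J" "s \<in> J" "t \<in> J" "s < t" and f: "\<And>r. r \<in> J \<Longrightarrow> (f has_real_derivative f' r) (at r within J)"
  obtains \<xi> where "s \<le> \<xi>" "\<xi> \<le> t" "f t - f s = (t - s) * f' \<xi>"
proof -
  have sub: "{s..t} \<subseteq> J"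
    using closed_segment_subset[OF J(2,3,1)] J(4) by (simp add: closed_segment_eq_real_ivl)
  have d: "(f has_derivative (\<lambda>h. f' r * h)) (at r within {s..t})" if "r \<in> {s..t}" for r
    using has_field_derivative_subset[OF f sub, of r] that sub by (auto simp: has_field_derivative_def)
  obtain \<xi> where "\<xi> \<in> {s<..<t}" "f t - f s = f' \<xi> * (t - s)"
    using mvt_simple[of s t f "\<lambda>r h. f' r * h"] J(4) d by auto
  then show ?thesis by (intro that[of \<xi>]) auto
qed

text \<open>The selected maximizer at each of two times competes at the other one. The increment of
  the maximum thus lies between the increments for two fixed parameters, whose derivatives agree in
  the limit by continuity of \<open>mt\<close> along the selection.\<close>

lemma envelope_derivative:
  fixes m mt :: "'k::metric_space \<Rightarrow> real \<Rightarrow> real"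
  assumes J: "convex J" and K: "compact K" and sel: "\<And>t. t \<in> J \<Longrightarrow> sel t \<in> K"
    and m: "continuous_on (J \<times> K) (\<lambda>(t, k). m k t)" and mt: "continuous_on (J \<times> K) (\<lambda>(t, k). mt k t)"
    and dm: "\<And>k t. k \<in> K \<Longrightarrow> t \<in> J \<Longrightarrow> ((\<lambda>t. m k t) has_real_derivative mt k t) (at t within J)"
    and max: "\<And>t k. t \<in> J \<Longrightarrow> k \<in> K \<Longrightarrow> m k t \<le> m (sel t) t"
    and same: "\<And>t k s. t \<in> J \<Longrightarrow> k \<in> K \<Longrightarrow> s \<in> J \<Longrightarrow> m k t = m (sel t) t \<Longrightarrow> mt k s = mt (sel t) s"
    and t: "t \<in> J"
  shows "((\<lambda>t. m (sel t) t) has_real_derivative mt (sel t) t) (at t within J)"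
proof -
  have pJ: "continuous_on ((J \<times> J) \<times> K) (\<lambda>q. (fst (fst q), snd q))" "continuous_on ((J \<times> J) \<times> K) (\<lambda>q. (snd (fst q), snd q))"
    by (intro continuous_intros)+
  have c1: "continuous_on ((J \<times> J) \<times> K) (\<lambda>(z, k). m k (fst z))"
  proof -
    have "continuous_on ((J \<times> J) \<times> K) (\<lambda>q. (\<lambda>(t, k). m k t) (fst (fst q), snd q))"
      by (rule continuous_on_compose2[OF m pJ(1)]) auto
    then show ?thesis by (simp add: case_prod_unfold)
  qed
  have c2: "continuous_on ((J \<times> J) \<times> K) (\<lambda>(z, k). mt k (snd z))"
  proof -
    have "continuous_on ((J \<times> J) \<times> K) (\<lambda>q. (\<lambda>(t, k). mt k t) (snd (fst q), snd q))"
      by (rule continuous_on_compose2[OF mt pJ(2)]) auto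
    then show ?thesis by (simp add: case_prod_unfold)
  qed
  have cF: "continuous_on (J \<times> J) (\<lambda>z. mt (sel (fst z)) (snd z))"
  proof (rule argmax_continuous[where sel="\<lambda>z. sel (fst z)" and K=K and M="\<lambda>z k. m k (fst z)" and G="\<lambda>z k. mt k (snd z)", OF K _ c1 c2])
    fix z k assume z: "z \<in> J \<times> J"
    then have z': "fst z \<in> J" "snd z \<in> J" by (simp_all add: mem_Times_iff)
    show "sel (fst z) \<in> K" by (rule sel[OF z'(1)])
    assume k: "k \<in> K"
    show "m k (fst z) \<le> m (sel (fst z)) (fst z)" by (rule max[OF z'(1) k])
    assume "m k (fst z) = m (sel (fst z)) (fst z)"
    then show "mt k (snd z) = mt (sel (fst z)) (snd z)" by (rule same[OF z'(1) k z'(2)])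
  qed
  have F: "\<exists>d>0. \<forall>a\<in>J. \<forall>\<xi>\<in>J. dist (a, \<xi>) (t, t) < d \<longrightarrow> dist (mt (sel a) \<xi>) (mt (sel t) t) < e" if e: "e > 0" for e
  proof -
    have "(t, t) \<in> J \<times> J" using t by simp
    then obtain d where d: "d > 0" "\<And>z. z \<in> J \<times> J \<Longrightarrow> dist z (t, t) < d \<Longrightarrow>
        dist (mt (sel (fst z)) (snd z)) (mt (sel (fst (t, t))) (snd (t, t))) < e"
      using cF e unfolding continuous_on_iff by blast
    then show ?thesis using d(2)[of "(a, \<xi>)" for a \<xi>] by (intro exI[of _ d]) auto
  qed
  \<comment> \<open>Each comparison of maxima bounds the quotient on one side; which side it is
    depends on the sign of s - t, hence the disjunction.\<close>
  have quot: "\<exists>\<xi>1\<in>J. \<exists>\<xi>2\<in>J. \<bar>\<xi>1 - t\<bar> \<le> \<bar>s - t\<bar> \<and> \<bar>\<xi>2 - t\<bar> \<le> \<bar>s - t\<bar> \<and>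
      (mt (sel t) \<xi>1 \<le> (m (sel s) s - m (sel t) t) / (s - t) \<and> (m (sel s) s - m (sel t) t) / (s - t) \<le> mt (sel s) \<xi>2 \<or>
       mt (sel s) \<xi>2 \<le> (m (sel s) s - m (sel t) t) / (s - t) \<and> (m (sel s) s - m (sel t) t) / (s - t) \<le> mt (sel t) \<xi>1)"
    if s: "s \<in> J" "s \<noteq> t" for s
  proof -
    have sub: "\<xi> \<in> J" if "a \<in> J" "b \<in> J" "a \<le> \<xi>" "\<xi> \<le> b" for a b \<xi>
      using closed_segment_subset[OF that(1,2) J] that(3,4) by (auto simp: closed_segment_eq_real_ivl split: if_splits)
    have ex: "\<exists>\<xi>\<in>J. \<bar>\<xi> - t\<bar> \<le> \<bar>s - t\<bar> \<and> m k s - m k t = (s - t) * mt k \<xi>" if k: "k \<in> K" for k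
    proof (cases "s < t")
      case True
      obtain \<xi> where "s \<le> \<xi>" "\<xi> \<le> t" "m k t - m k s = (t - s) * mt k \<xi>"
        by (rule mvt_within_convex[OF J s(1) t True dm[OF k]])
      then show ?thesis using sub[OF s(1) t] by (intro bexI[of _ \<xi>]) (auto simp: algebra_simps)
    next
      case False
      then have lt: "t < s" using s by simp
      obtain \<xi> where "t \<le> \<xi>" "\<xi> \<le> s" "m k s - m k t = (s - t) * mt k \<xi>"
        by (rule mvt_within_convex[OF J t s(1) lt dm[OF k]])
      then show ?thesis using sub[OF t s(1)] by (intro bexI[of _ \<xi>]) auto
    qed
    obtain \<xi>1 where x1: "\<xi>1 \<in> J" "\<bar>\<xi>1 - t\<bar> \<le> \<bar>s - t\<bar>" "m (sel t) s - m (sel t) t = (s - t) * mt (sel t) \<xi>1"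
      using ex[OF sel[OF t]] by blast
    obtain \<xi>2 where x2: "\<xi>2 \<in> J" "\<bar>\<xi>2 - t\<bar> \<le> \<bar>s - t\<bar>" "m (sel s) s - m (sel s) t = (s - t) * mt (sel s) \<xi>2"
      using ex[OF sel[OF s(1)]] by blast
    have lo: "(s - t) * mt (sel t) \<xi>1 \<le> m (sel s) s - m (sel t) t" using x1(3) max[OF s(1) sel[OF t]] by simp
    have hi: "m (sel s) s - m (sel t) t \<le> (s - t) * mt (sel s) \<xi>2" using x2(3) max[OF t sel[OF s(1)]] by simp
    have "mt (sel t) \<xi>1 \<le> (m (sel s) s - m (sel t) t) / (s - t) \<and> (m (sel s) s - m (sel t) t) / (s - t) \<le> mt (sel s) \<xi>2 \<or>
       mt (sel s) \<xi>2 \<le> (m (sel s) s - m (sel t) t) / (s - t) \<and> (m (sel s) s - m (sel t) t) / (s - t) \<le> mt (sel t) \<xi>1"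
    proof (cases "s < t")
      case True
      then show ?thesis using lo hi by (intro disjI2 conjI) (auto simp: field_simps)
    next
      case False
      then show ?thesis using s(2) lo hi by (intro disjI1 conjI) (auto simp: field_simps)
    qed
    then show ?thesis using x1(1,2) x2(1,2) by blast
  qed
  show ?thesis unfolding has_field_derivative_iff
  proof (rule tendstoI)
    fix e :: real assume e: "e > 0"
    obtain d where d: "d > 0" "\<And>a \<xi>. a \<in> J \<Longrightarrow> \<xi> \<in> J \<Longrightarrow> dist (a, \<xi>) (t, t) < d \<Longrightarrow> dist (mt (sel a) \<xi>) (mt (sel t) t) < e"
      using F[OF e] by blast
    have "dist ((m (sel s) s - m (sel t) t) / (s - t)) (mt (sel t) t) < e"
      if s: "s \<in> J" "s \<noteq> t" "dist s t < d / 2" for s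
    proof -
      obtain \<xi>1 \<xi>2 where x: "\<xi>1 \<in> J" "\<xi>2 \<in> J" "\<bar>\<xi>1 - t\<bar> \<le> \<bar>s - t\<bar>" "\<bar>\<xi>2 - t\<bar> \<le> \<bar>s - t\<bar>"
        and q: "mt (sel t) \<xi>1 \<le> (m (sel s) s - m (sel t) t) / (s - t) \<and> (m (sel s) s - m (sel t) t) / (s - t) \<le> mt (sel s) \<xi>2 \<or>
       mt (sel s) \<xi>2 \<le> (m (sel s) s - m (sel t) t) / (s - t) \<and> (m (sel s) s - m (sel t) t) / (s - t) \<le> mt (sel t) \<xi>1"
        using quot[OF s(1,2)] by blast
      have dp: "dist (a, b) (t, t) < d" if "\<bar>a - t\<bar> \<le> \<bar>s - t\<bar>" "\<bar>b - t\<bar> \<le> \<bar>s - t\<bar>" for a b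
      proof -
        have "dist (a, b) (t, t) \<le> \<bar>a - t\<bar> + \<bar>b - t\<bar>"
          using sqrt_sum_squares_le_sum_abs[of "a - t" "b - t"] by (simp add: dist_Pair_Pair dist_real_def)
        then show ?thesis using that s(3) by (simp add: dist_real_def)
      qed
      have "dist (mt (sel t) \<xi>1) (mt (sel t) t) < e" "dist (mt (sel s) \<xi>2) (mt (sel t) t) < e"
        using x s(1) t by (auto intro!: d(2) dp)
      then show ?thesis using q by (auto simp: dist_real_def abs_less_iff)
    qed
    then show "\<forall>\<^sub>F s in at t within J. dist ((m (sel s) s - m (sel t) t) / (s - t)) (mt (sel t) t) < e"
      unfolding eventually_at using d(1) by (intro exI[of _ "d / 2"]) auto
  qed
qed

subsection \<open>Area and length in terms of Fourier series\<close>

text \<open>The Fourier multiplier 1 - n^2 of u'' + u. It is also the multiplier of the time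
  derivative of exp t * \<open>hsum\<close>.\<close>

definition radius_coef :: "(nat \<Rightarrow> complex) \<Rightarrow> nat \<Rightarrow> complex" where
  "radius_coef c n = c n + dcoef (dcoef c) n"

lemma rapid_radius_coef: "rapid c \<Longrightarrow> rapid (radius_coef c)"
  unfolding radius_coef_def[abs_def] by (intro rapid_add rapid_dcoef)

lemma radius_coef_0: "c 0 = 0 \<Longrightarrow> radius_coef c 0 = 0"
  by (simp add: radius_coef_def dcoef_def)

text \<open>What the modes n > 0 contribute to the area, that is, the area without L^2 / (4 * pi).
  The factor exp (2 * t) collects one exp t from each of the two series.\<close>

definition osc_area :: "(nat \<Rightarrow> complex) \<Rightarrow> real \<Rightarrow> real" where
  "osc_area c t = 1 / 2 * exp (2 * t) * integral {0..2 * pi} (\<lambda>\<theta>. hsum c \<theta> t * hsum (radius_coef c) \<theta> t)"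

lemma integral_hsum:
  assumes "rapid c" "c 0 = 0" "t \<ge> 0"
  shows "((\<lambda>\<theta>. hsum c \<theta> t) has_integral 0) {0..2 * pi}"
proof -
  have *: "((\<lambda>\<theta>. Re (of_real (hsum c \<theta> t) * cis (- (real 0 * \<theta>)))) has_integral Re (fint (\<lambda>\<theta>. hsum c \<theta> t) 0)) {0..2 * pi}"
    unfolding fint_def
    by (intro has_integral_Re integrable_integral integrable_continuous_interval continuous_intros continuous_on_hsum assms)
  define d where "d n = of_real (exp (- (real n)\<^sup>2 * t)) * c n" for n
  have nd: "norm (d n) \<le> norm (c n)" for n using assms(3) by (simp add: d_def norm_mult mult_left_le_one_le)
  have d: "rapid d" unfolding rapid_def
  proof
    fix p
    have "summable (\<lambda>n. real n ^ p * norm (c n))" using assms(1) by (simp add: rapid_def)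
    then show "summable (\<lambda>n. real n ^ p * norm (d n))"
      by (rule summable_comparison_test'[of _ 0]) (simp add: nd mult_left_mono)
  qed
  have "hsum c \<theta> t = hsum d \<theta> 0" for \<theta> unfolding hsum_def hterm_def d_def by (simp add: mult.assoc)
  then have "fint (\<lambda>\<theta>. hsum c \<theta> t) 0 = 0"
    using fint_hsum[OF d, of 0] assms(2) by (simp add: d_def)
  then show ?thesis using * by simp
qed

text \<open>Both series have mean 0, so the mixed terms with the constant b integrate to 0.\<close>

lemma series_area:
  assumes c: "rapid c" "c 0 = 0" "t \<ge> 0"
  shows "1 / 2 * integral {0..2 * pi} (\<lambda>\<theta>. (b + exp t * hsum c \<theta> t) * (b + exp t * hsum (radius_coef c) \<theta> t))
    = pi * b\<^sup>2 + osc_area c t"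
proof -
  let ?V = "\<lambda>\<theta>. hsum c \<theta> t" and ?W = "\<lambda>\<theta>. hsum (radius_coef c) \<theta> t"
  have "((\<lambda>\<theta>. b\<^sup>2 + b * exp t * ?V \<theta> + b * exp t * ?W \<theta> + exp (2 * t) * (?V \<theta> * ?W \<theta>)) has_integral
     (2 * pi - 0) *\<^sub>R b\<^sup>2 + b * exp t * 0 + b * exp t * 0 + exp (2 * t) * integral {0..2 * pi} (\<lambda>\<theta>. ?V \<theta> * ?W \<theta>)) {0..2 * pi}"
    using c
    by (intro has_integral_add has_integral_mult_right integral_hsum integrable_integral integrable_continuous_interval
        continuous_intros continuous_on_hsum rapid_radius_coef radius_coef_0 has_integral_const_real[where a=0 and b="2 * pi", simplified])
      (auto simp: has_integral_const_real[of "b\<^sup>2" 0 "2 * pi", simplified])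
  moreover have "b\<^sup>2 + b * exp t * ?V \<theta> + b * exp t * ?W \<theta> + exp (2 * t) * (?V \<theta> * ?W \<theta>)
      = (b + exp t * ?V \<theta>) * (b + exp t * ?W \<theta>)" for \<theta>
    by (simp add: algebra_simps power2_eq_square mult_exp_exp)
  ultimately show ?thesis by (simp add: integral_unique osc_area_def)
qed

lemma Ck_on_osc_area:
  assumes "rapid c" "time_interval J"
  shows "Ck_on n (UNIV \<times> J) (\<lambda>(x::real, t). osc_area c t)"
proof -
  have fat: "fat ((UNIV::real set) \<times> J)" by (rule time_interval_fat[OF assms(2)])
  have sub: "UNIV \<times> J \<subseteq> (UNIV::real set) \<times> {0..}" using time_intervalD(4)[OF assms(2)] by auto
  have h: "Ck_on n (UNIV \<times> J) (\<lambda>(x, t). hsum c x t)" if "rapid c" for c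
    by (rule Ck_on_subset[OF fat sub Ck_on_hsum[OF that]])
  have s: "Ck_on n (UNIV \<times> J) (\<lambda>p::real \<times> real. snd p)"
    by (rule Ck_on_linear[OF fat bounded_linear_snd Ck_on_id[OF fat]])
  have "Ck_on n (UNIV \<times> J) (\<lambda>p. (\<lambda>(x, t). hsum c x t) p * (\<lambda>(x, t). hsum (radius_coef c) x t) p)"
    by (intro Ck_on_mult fat h assms rapid_radius_coef)
  then have "Ck_on n (UNIV \<times> J) (\<lambda>(x::real, t). integral {0..2 * pi} (\<lambda>\<theta>. hsum c \<theta> t * hsum (radius_coef c) \<theta> t))"
    by (intro Ck_on_space_integral assms) (simp add: case_prod_unfold)
  then have "Ck_on n (UNIV \<times> J) (\<lambda>p. 1 / 2 * exp (2 * snd p) *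
      (\<lambda>(x::real, t). integral {0..2 * pi} (\<lambda>\<theta>. hsum c \<theta> t * hsum (radius_coef c) \<theta> t)) p)"
    by (intro Ck_on_mult Ck_on_const fat Ck_on_compose[OF fat _ Ck_on_exp] s) auto
  then show ?thesis by (simp add: osc_area_def case_prod_unfold)
qed

lemma osc_area_continuous: "rapid c \<Longrightarrow> continuous_on {0..} (osc_area c)"
  using continuous_on_slice1[OF Ck_on_imp_cont[OF Ck_on_osc_area[OF _ time_interval_Ici]] order_refl UNIV_I] .

text \<open>Both heat averages are exp t times a mean plus a series, and the two means agree because
  u'' has mean 0. The resulting formula is continuous up to t = 0, which settles the value that
  \<open>E1\<close> defines as a limit.\<close>

lemma E1_series:
  assumes u: "smooth_on UNIV u" "\<And>x. u (x + 2 * pi) = u x" and t: "t \<ge> 0"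
  shows "E1 u t = (integral {0..2 * pi} u)\<^sup>2 / (4 * pi) * exp (2 * t) + osc_area (fcoef u) t"
proof -
  define m where "m = integral {0..2 * pi} u / (2 * pi)"
  let ?c = "fcoef u"
  have c: "rapid ?c" "?c 0 = 0" using rapid_fcoef[OF u] by (auto simp: fcoef_def)
  have us: "u = (\<lambda>x. m + hsum ?c x 0)" using fourier_series_smooth[OF u] by (auto simp: m_def)
  have du: "deriv u = (\<lambda>x. hsum (dcoef ?c) x 0)"
  proof (rule ext, rule DERIV_imp_deriv)
    fix x show "(u has_real_derivative hsum (dcoef ?c) x 0) (at x)"
      by (subst us) (use DERIV_add[OF DERIV_const hsum_dtheta[OF c(1), of 0]] in simp)
  qed
  have ddu: "deriv (deriv u) = (\<lambda>x. hsum (dcoef (dcoef ?c)) x 0)"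
    unfolding du by (rule ext, rule DERIV_imp_deriv, rule hsum_dtheta) (auto intro: rapid_dcoef c)
  have rs: "(\<lambda>\<eta>. deriv (deriv u) \<eta> + u \<eta>) = (\<lambda>\<eta>. m + hsum (radius_coef ?c) \<eta> 0)"
  proof
    fix \<eta>
    have "hsum (radius_coef ?c) \<eta> 0 = hsum ?c \<eta> 0 + hsum (dcoef (dcoef ?c)) \<eta> 0"
      unfolding radius_coef_def[abs_def] by (intro hsum_add c rapid_dcoef) simp
    moreover have "u \<eta> = m + hsum ?c \<eta> 0" using us by metis
    ultimately show "deriv (deriv u) \<eta> + u \<eta> = m + hsum (radius_coef ?c) \<eta> 0" by (simp add: ddu)
  qed
  have pos: "E1_pos u t = pi * (exp t * m)\<^sup>2 + osc_area ?c t" if t: "t > 0" for t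
  proof -
    have 1: "heat_average t u \<theta> = exp t * m + exp t * hsum ?c \<theta> t" for \<theta>
      by (subst us) (simp add: heat_average_hsum[OF c(1) t c(2)] algebra_simps)
    have 2: "heat_average t (\<lambda>\<eta>. deriv (deriv u) \<eta> + u \<eta>) \<theta> = exp t * m + exp t * hsum (radius_coef ?c) \<theta> t" for \<theta>
      unfolding rs by (subst heat_average_hsum[OF rapid_radius_coef[OF c(1)] t radius_coef_0[of ?c, OF c(2)]]) (simp add: algebra_simps)
    show ?thesis unfolding E1_pos_def 1 2 using series_area[OF c, of t "exp t * m"] t by simp
  qed
  have fin: "pi * (exp t * m)\<^sup>2 + osc_area ?c t = (integral {0..2 * pi} u)\<^sup>2 / (4 * pi) * exp (2 * t) + osc_area ?c t" for t
  proof -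
    have "exp (2 * t) = exp t * exp t" by (simp add: mult_exp_exp)
    then show ?thesis by (simp add: m_def power_mult_distrib power_divide power2_eq_square field_simps)
  qed
  show ?thesis
  proof (cases "t > 0")
    case True
    then show ?thesis unfolding E1_def fin[symmetric] using pos by simp
  next
    case False
    then have t0: "t = 0" using t by simp
    have "continuous_on {0..} (\<lambda>t. pi * (exp t * m)\<^sup>2 + osc_area ?c t)"
      by (intro continuous_intros osc_area_continuous c)
    from this[unfolded continuous_on_def, rule_format, of 0]
    have "((\<lambda>t. pi * (exp t * m)\<^sup>2 + osc_area ?c t) \<longlongrightarrow> pi * (exp 0 * m)\<^sup>2 + osc_area ?c 0) (at 0 within {0..})"
      by simp
    then have "((\<lambda>t. pi * (exp t * m)\<^sup>2 + osc_area ?c t) \<longlongrightarrow> pi * (exp 0 * m)\<^sup>2 + osc_area ?c 0) (at_right 0)"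
      by (rule tendsto_within_subset) auto
    then have "(E1_pos u \<longlongrightarrow> pi * (exp 0 * m)\<^sup>2 + osc_area ?c 0) (at_right 0)"
      by (rule Lim_transform_eventually)
        (auto intro: eventually_mono[OF eventually_at_right_less[of "0::real"]] simp: pos)
    then have "Lim (at_right 0) (E1_pos u) = pi * (exp 0 * m)\<^sup>2 + osc_area ?c 0"
      by (intro tendsto_Lim) auto
    then show ?thesis unfolding t0 fin[symmetric] by (simp add: E1_def)
  qed
qed

subsection \<open>Uniqueness for the length equation\<close>

text \<open>The function D^2 * exp (- 2 * C * s) is nonnegative, starts at 0 and has nonpositive
  derivative.\<close>

lemma gronwall_zero:
  fixes D :: "real \<Rightarrow> real"
  assumes d: "\<And>t. t \<in> {0..T} \<Longrightarrow> (D has_real_derivative D' t) (at t within {0..T})"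
    and le: "\<And>t. t \<in> {0..T} \<Longrightarrow> \<bar>D' t\<bar> \<le> C * \<bar>D t\<bar>" and 0: "D 0 = 0" and t: "t \<in> {0..T}"
  shows "D t = 0"
proof (cases "t = 0")
  case False
  then have t0: "0 < t" using t by simp
  define E where "E s = (D s * D s) * exp (- (2 * C) * s)" for s
  define E' where "E' s = (D' s * D s + D' s * D s) * exp (- (2 * C) * s) + exp (- (2 * C) * s) * (- (2 * C)) * (D s * D s)" for s
  have dE: "(E has_real_derivative E' s) (at s within {0..T})" if "s \<in> {0..T}" for s
  proof -
    have "((\<lambda>s. exp (- (2 * C) * s)) has_real_derivative exp (- (2 * C) * s) * (- (2 * C))) (at s within {0..T})"
      by (auto intro!: derivative_eq_intros)
    from DERIV_mult[OF DERIV_mult[OF d[OF that] d[OF that]] this]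
    show ?thesis unfolding E_def[abs_def] E'_def .
  qed
  obtain \<xi> where x: "0 \<le> \<xi>" "\<xi> \<le> t" "E t - E 0 = (t - 0) * E' \<xi>"
    by (rule mvt_within_convex[OF _ _ _ t0 dE]) (use t in auto)
  have "\<xi> \<in> {0..T}" using x t by auto
  have "D' \<xi> * D \<xi> \<le> \<bar>D' \<xi>\<bar> * \<bar>D \<xi>\<bar>" by (metis abs_ge_self abs_mult)
  also have "\<dots> \<le> (C * \<bar>D \<xi>\<bar>) * \<bar>D \<xi>\<bar>" using le[OF \<open>\<xi> \<in> {0..T}\<close>] by (intro mult_right_mono) auto
  finally have "D' \<xi> * D \<xi> \<le> C * (D \<xi> * D \<xi>)" by (simp add: mult.assoc)
  then have "E' \<xi> \<le> 0"
    unfolding E'_def using mult_right_mono[of "2 * (D' \<xi> * D \<xi>)" "2 * (C * (D \<xi> * D \<xi>))" "exp (- (2 * C) * \<xi>)"]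
    by (simp add: algebra_simps)
  then have "E t \<le> 0" using x(3) t0 0 by (simp add: E_def mult_nonneg_nonpos)
  then have "D t * D t \<le> 0" unfolding E_def by (simp add: mult_le_0_iff)
  then show ?thesis using zero_le_square[of "D t"] by (metis antisym mult_eq_0_iff)
qed (use 0 in simp)

text \<open>H is smooth only on the open quadrant, where no global Lipschitz constant is available.
  On a compact box in it the two partial derivatives are bounded, and the mean value inequality
  applies since the box is convex.\<close>

lemma smooth_lipschitz_box:
  fixes H :: "real \<Rightarrow> real \<Rightarrow> real"
  assumes H: "smooth_on ({0<..} \<times> {0<..}) (\<lambda>(p, q). H p q)" and "0 < a" "0 < c"
  obtains C where "C \<ge> 0" "\<And>p q p' q'. p \<in> {a..b} \<Longrightarrow> p' \<in> {a..b} \<Longrightarrow> q \<in> {c..d} \<Longrightarrow> q' \<in> {c..d} \<Longrightarrow>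
      \<bar>H p q - H p' q'\<bar> \<le> C * (\<bar>p - p'\<bar> + \<bar>q - q'\<bar>)"
proof -
  let ?Q = "{0<..} \<times> {0<..} :: (real \<times> real) set" and ?R = "{a..b} \<times> {c..d}"
  have "Ck_on (Suc 0) ?Q (\<lambda>(p, q). H p q)" using H unfolding smooth_on_def by blast
  then obtain D where D: "\<And>x. x \<in> ?Q \<Longrightarrow> ((\<lambda>(p, q). H p q) has_derivative D x) (at x within ?Q)"
    "\<And>v. Ck_on 0 ?Q (\<lambda>x. D x v)" using Ck_on_SucE by blast
  have sub: "?R \<subseteq> ?Q" using assms by auto
  have "\<exists>M. \<forall>x\<in>?R. \<bar>D x v\<bar> \<le> M" for v
  proof -
    have "continuous_on ?R (\<lambda>x. D x v)" using D(2)[of v] sub continuous_on_subset by auto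
    moreover have "compact ?R" by (intro compact_Times compact_Icc)
    ultimately have "bounded ((\<lambda>x. D x v) ` ?R)" using compact_continuous_image compact_imp_bounded by blast
    then show ?thesis by (force simp: bounded_iff)
  qed
  then obtain M where M: "\<And>x v. x \<in> ?R \<Longrightarrow> \<bar>D x v\<bar> \<le> M v" by metis
  define C where "C = \<bar>M (1, 0)\<bar> + \<bar>M (0, 1)\<bar>"
  have on: "onorm (D x) \<le> C" if x: "x \<in> ?R" for x
  proof (rule onorm_bound)
    fix v :: "real \<times> real"
    have lin: "linear (D x)" using D(1)[of x] x sub by (auto simp: has_derivative_def bounded_linear.linear)
    have "D x v = D x (fst v *\<^sub>R (1, 0) + snd v *\<^sub>R (0, 1))" by (cases v) simp
    also have "\<dots> = fst v * D x (1, 0) + snd v * D x (0, 1)" by (simp only: linear_add[OF lin] linear_scale[OF lin] real_scaleR_def)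
    finally have e: "D x v = fst v * D x (1, 0) + snd v * D x (0, 1)" .
    have "\<bar>D x v\<bar> \<le> \<bar>fst v\<bar> * \<bar>D x (1, 0)\<bar> + \<bar>snd v\<bar> * \<bar>D x (0, 1)\<bar>"
      unfolding e by (rule order_trans[OF abs_triangle_ineq]) (simp add: abs_mult)
    also have "\<dots> \<le> norm v * \<bar>M (1, 0)\<bar> + norm v * \<bar>M (0, 1)\<bar>"
      using M[OF x, of "(1, 0)"] M[OF x, of "(0, 1)"] norm_fst_le[of "fst v" "snd v"] norm_snd_le[of "snd v" "fst v"]
      by (intro add_mono mult_mono) auto
    finally show "norm (D x v) \<le> C * norm v" by (simp add: C_def algebra_simps)
  qed (simp add: C_def)
  show ?thesis
  proof (rule that[of C])
    fix p q p' q' assume *: "p \<in> {a..b}" "p' \<in> {a..b}" "q \<in> {c..d}" "q' \<in> {c..d}"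
    have "norm ((\<lambda>(p, q). H p q) (p, q) - (\<lambda>(p, q). H p q) (p', q')) \<le> C * norm ((p, q) - (p', q'))"
    proof (rule differentiable_bound[of ?R])
      show "convex ?R" by (intro convex_Times convex_real_interval)
      show "((\<lambda>(p, q). H p q) has_derivative D x) (at x within ?R)" if "x \<in> ?R" for x
        using D(1) sub that has_derivative_subset by blast
    qed (use * on in auto)
    also have "norm ((p, q) - (p', q')) \<le> \<bar>p - p'\<bar> + \<bar>q - q'\<bar>"
      using sqrt_sum_squares_le_sum_abs[of "p - p'" "q - q'"] by (simp add: norm_Pair)
    finally show "\<bar>H p q - H p' q'\<bar> \<le> C * (\<bar>p - p'\<bar> + \<bar>q - q'\<bar>)"
      by (simp add: C_def mult_left_mono)
  qed (simp add: C_def)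
qed

lemma positive_bounds:
  fixes f :: "real \<Rightarrow> real"
  assumes "continuous_on {0..T} f" "\<And>t. t \<in> {0..T} \<Longrightarrow> f t > 0" "T \<ge> 0"
  obtains a b where "a > 0" "\<And>t. t \<in> {0..T} \<Longrightarrow> a \<le> f t \<and> f t \<le> b"
proof -
  have ne: "{0..T} \<noteq> {}" using assms(3) by simp
  obtain s where s: "s \<in> {0..T}" "\<And>t. t \<in> {0..T} \<Longrightarrow> f s \<le> f t"
    using continuous_attains_inf[OF compact_Icc ne assms(1)] by blast
  obtain r where r: "\<And>t. t \<in> {0..T} \<Longrightarrow> f t \<le> f r"
    using continuous_attains_sup[OF compact_Icc ne assms(1)] by blast
  show ?thesis by (rule that[of "f s" "f r"]) (use s r assms(2) in auto)
qed

text \<open>On a compact time interval both solutions and both area arguments stay between positive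
  bounds, hence in one box where H is Lipschitz.\<close>

lemma length_ode_unique:
  fixes H :: "real \<Rightarrow> real \<Rightarrow> real"
  assumes J: "time_interval J" and H: "smooth_on ({0<..} \<times> {0<..}) (\<lambda>(p, q). H p q)" and B: "continuous_on J B"
    and y: "\<And>t. t \<in> J \<Longrightarrow> (y has_real_derivative (y t - 2 * pi * H (y t) ((y t)\<^sup>2 / (4 * pi) + B t))) (at t within J)"
      "\<And>t. t \<in> J \<Longrightarrow> y t > 0" "\<And>t. t \<in> J \<Longrightarrow> (y t)\<^sup>2 / (4 * pi) + B t > 0"
    and z: "\<And>t. t \<in> J \<Longrightarrow> (z has_real_derivative (z t - 2 * pi * H (z t) ((z t)\<^sup>2 / (4 * pi) + B t))) (at t within J)"
      "\<And>t. t \<in> J \<Longrightarrow> z t > 0" "\<And>t. t \<in> J \<Longrightarrow> (z t)\<^sup>2 / (4 * pi) + B t > 0"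
    and init: "y 0 = z 0" and T: "T \<in> J"
  shows "y T = z T"
proof -
  have sub: "{0..T} \<subseteq> J" and T0: "T \<ge> 0" using time_intervalD(4,5)[OF J T] by auto
  have cy: "continuous_on J y" by (rule DERIV_continuous_on[OF y(1)])
  have cz: "continuous_on J z" by (rule DERIV_continuous_on[OF z(1)])
  have c: "continuous_on {0..T} y" "continuous_on {0..T} z" "continuous_on {0..T} (\<lambda>t. (y t)\<^sup>2 / (4 * pi) + B t)"
    "continuous_on {0..T} (\<lambda>t. (z t)\<^sup>2 / (4 * pi) + B t)"
    by (intro continuous_intros continuous_on_subset[OF cy sub] continuous_on_subset[OF cz sub] continuous_on_subset[OF B sub]; simp)+
  obtain a1 b1 where 1: "a1 > 0" "\<And>t. t \<in> {0..T} \<Longrightarrow> a1 \<le> y t \<and> y t \<le> b1" using positive_bounds[OF c(1)] y(2) sub T0 by blast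
  obtain a2 b2 where 2: "a2 > 0" "\<And>t. t \<in> {0..T} \<Longrightarrow> a2 \<le> z t \<and> z t \<le> b2" using positive_bounds[OF c(2)] z(2) sub T0 by blast
  obtain a3 b3 where 3: "a3 > 0" "\<And>t. t \<in> {0..T} \<Longrightarrow> a3 \<le> (y t)\<^sup>2 / (4 * pi) + B t \<and> (y t)\<^sup>2 / (4 * pi) + B t \<le> b3"
    using positive_bounds[OF c(3)] y(3) sub T0 by blast
  obtain a4 b4 where 4: "a4 > 0" "\<And>t. t \<in> {0..T} \<Longrightarrow> a4 \<le> (z t)\<^sup>2 / (4 * pi) + B t \<and> (z t)\<^sup>2 / (4 * pi) + B t \<le> b4"
    using positive_bounds[OF c(4)] z(3) sub T0 by blast
  define b where "b = max b1 b2"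
  have b: "b \<ge> 0" using 1(1) 1(2)[of 0] T0 by (auto simp: b_def)
  obtain C where C: "C \<ge> 0" "\<And>p q p' q'. p \<in> {min a1 a2..b} \<Longrightarrow> p' \<in> {min a1 a2..b} \<Longrightarrow> q \<in> {min a3 a4..max b3 b4} \<Longrightarrow>
      q' \<in> {min a3 a4..max b3 b4} \<Longrightarrow> \<bar>H p q - H p' q'\<bar> \<le> C * (\<bar>p - p'\<bar> + \<bar>q - q'\<bar>)"
    using smooth_lipschitz_box[OF H, of "min a1 a2" "min a3 a4" b "max b3 b4"] 1(1) 2(1) 3(1) 4(1) by auto
  let ?D' = "\<lambda>t. (y t - 2 * pi * H (y t) ((y t)\<^sup>2 / (4 * pi) + B t)) - (z t - 2 * pi * H (z t) ((z t)\<^sup>2 / (4 * pi) + B t))"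
  \<comment> \<open>The term 2 * b / (4 * pi) comes from factoring the difference of the squares: y
    + z is at most 2 * b. The summand 1 inside the product accounts for the first argument of H, and
    the leading 1 for the linear term of the equation.\<close>
  have "y T - z T = 0"
  proof (rule gronwall_zero[where D="\<lambda>t. y t - z t" and D'="?D'" and T=T and C="1 + 2 * pi * (C * (1 + 2 * b / (4 * pi)))"])
    fix t assume t: "t \<in> {0..T}"
    then have tJ: "t \<in> J" using sub by blast
    show "((\<lambda>t. y t - z t) has_real_derivative ?D' t) (at t within {0..T})"
      by (intro DERIV_diff has_field_derivative_subset[OF y(1)[OF tJ] sub] has_field_derivative_subset[OF z(1)[OF tJ] sub])
    have q: "\<bar>((y t)\<^sup>2 / (4 * pi) + B t) - ((z t)\<^sup>2 / (4 * pi) + B t)\<bar> \<le> 2 * b / (4 * pi) * \<bar>y t - z t\<bar>"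
    proof -
      have "((y t)\<^sup>2 / (4 * pi) + B t) - ((z t)\<^sup>2 / (4 * pi) + B t) = (y t + z t) / (4 * pi) * (y t - z t)"
        by (simp add: power2_eq_square field_simps)
      moreover have "\<bar>(y t + z t) / (4 * pi)\<bar> \<le> 2 * b / (4 * pi)"
      proof -
        have "\<bar>y t + z t\<bar> \<le> 2 * b" using 1(2)[OF t] 2(2)[OF t] 1(1) 2(1) by (auto simp: b_def)
        then have "\<bar>y t + z t\<bar> / (4 * pi) \<le> 2 * b / (4 * pi)" by (intro divide_right_mono) auto
        then show ?thesis by (simp add: abs_divide)
      qed
      ultimately show ?thesis by (simp only: abs_mult) (intro mult_right_mono, auto)
    qed
    have "\<bar>H (y t) ((y t)\<^sup>2 / (4 * pi) + B t) - H (z t) ((z t)\<^sup>2 / (4 * pi) + B t)\<bar>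
        \<le> C * (\<bar>y t - z t\<bar> + \<bar>((y t)\<^sup>2 / (4 * pi) + B t) - ((z t)\<^sup>2 / (4 * pi) + B t)\<bar>)"
      using 1(2)[OF t] 2(2)[OF t] 3(2)[OF t] 4(2)[OF t] by (intro C(2)) (auto simp: b_def)
    also have "\<dots> \<le> C * (\<bar>y t - z t\<bar> + 2 * b / (4 * pi) * \<bar>y t - z t\<bar>)"
      using q C(1) by (intro mult_left_mono add_left_mono) auto
    also have "\<dots> = (C * (1 + 2 * b / (4 * pi))) * \<bar>y t - z t\<bar>" by (simp add: distrib_left distrib_right mult.assoc)
    finally have h: "2 * pi * \<bar>H (y t) ((y t)\<^sup>2 / (4 * pi) + B t) - H (z t) ((z t)\<^sup>2 / (4 * pi) + B t)\<bar>
        \<le> 2 * pi * ((C * (1 + 2 * b / (4 * pi))) * \<bar>y t - z t\<bar>)" by (intro mult_left_mono) auto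
    have tri: "\<bar>u - 2 * pi * d\<bar> \<le> \<bar>u\<bar> + 2 * pi * \<bar>d\<bar>" for u d :: real
      using abs_triangle_ineq4[of u "2 * pi * d"] by (simp add: abs_mult)
    have D': "?D' t = (y t - z t) - 2 * pi * (H (y t) ((y t)\<^sup>2 / (4 * pi) + B t) - H (z t) ((z t)\<^sup>2 / (4 * pi) + B t))"
      by (simp add: right_diff_distrib)
    have "\<bar>?D' t\<bar> \<le> \<bar>y t - z t\<bar> + 2 * pi * \<bar>H (y t) ((y t)\<^sup>2 / (4 * pi) + B t) - H (z t) ((z t)\<^sup>2 / (4 * pi) + B t)\<bar>"
      unfolding D' by (rule tri)
    also have "\<dots> \<le> \<bar>y t - z t\<bar> + 2 * pi * ((C * (1 + 2 * b / (4 * pi))) * \<bar>y t - z t\<bar>)" using h by simp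
    also have "\<dots> = (1 + 2 * pi * (C * (1 + 2 * b / (4 * pi)))) * \<bar>y t - z t\<bar>"
      by (simp only: distrib_right mult_1_left mult.assoc)
    finally show "\<bar>?D' t\<bar> \<le> (1 + 2 * pi * (C * (1 + 2 * b / (4 * pi)))) * \<bar>y t - z t\<bar>" .
  qed (use init T0 in auto)
  then show ?thesis by simp
qed

subsection \<open>Existence of the flow from a family of support functions\<close>

lemma smooth_slice:
  fixes f :: "real \<Rightarrow> real \<Rightarrow> 'b::real_normed_vector"
  assumes "\<And>n. Ck_on n (UNIV \<times> J) (\<lambda>(x, t). f x t)" "t \<in> J"
  shows "smooth_on UNIV (\<lambda>x. f x t)"
  unfolding smooth_on_def
proof
  fix n
  have f: "fat (UNIV :: real set)" by (rule fat_open[OF open_UNIV])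
  have "Ck_on n UNIV (\<lambda>x::real. (x, t))" by (intro Ck_on_Pair Ck_on_id Ck_on_const f)
  then have "Ck_on n UNIV (\<lambda>x::real. (\<lambda>(x, t). f x t) (x, t))"
    by (rule Ck_on_compose[OF f _ assms(1), rotated]) (use assms(2) in auto)
  then show "Ck_on n UNIV (\<lambda>x. f x t)" by simp
qed

text \<open>The curve Y parametrized by its normal angle moves with velocity \<rho> - \<eta> in the
  outward normal direction, as desired, but also with velocity \<open>\<rho>1\<close> along the
  tangent. A time-dependent change of the angle has to compensate for the latter.\<close>

lemma support_flow_exists:
  fixes w w1 \<rho> \<rho>1 :: "real \<Rightarrow> real \<Rightarrow> real"
  assumes J: "time_interval J" and X0: "smooth_convex_closed_curve X0"
    and Ck: "\<And>n. Ck_on n (UNIV \<times> J) (\<lambda>(x, t). w x t)" "\<And>n. Ck_on n (UNIV \<times> J) (\<lambda>(x, t). w1 x t)"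
      "\<And>n. Ck_on n (UNIV \<times> J) (\<lambda>(x, t). \<rho> x t)" "\<And>n. Ck_on n (UNIV \<times> J) (\<lambda>(x, t). \<rho>1 x t)"
    and dx: "\<And>x t. t \<in> J \<Longrightarrow> ((\<lambda>x. w x t) has_real_derivative w1 x t) (at x)"
      "\<And>x t. t \<in> J \<Longrightarrow> ((\<lambda>x. w1 x t) has_real_derivative \<rho> x t - w x t) (at x)"
    and dt: "\<And>x t. t \<in> J \<Longrightarrow> ((\<lambda>t. w x t) has_real_derivative \<rho> x t - \<eta> t) (at t within J)"
      "\<And>x t. t \<in> J \<Longrightarrow> ((\<lambda>t. w1 x t) has_real_derivative \<rho>1 x t) (at t within J)"
    and per: "\<And>x t. t \<in> J \<Longrightarrow> w (x + 2 * pi) t = w x t" "\<And>x t. t \<in> J \<Longrightarrow> \<rho> (x + 2 * pi) t = \<rho> x t"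
      "\<And>x t. t \<in> J \<Longrightarrow> \<rho>1 (x + 2 * pi) t = \<rho>1 x t"
    and pos: "\<And>x t. t \<in> J \<Longrightarrow> \<rho> x t > 0" and init: "\<And>x. w x 0 = support_function X0 x"
    and \<eta>: "\<And>t. t \<in> J \<Longrightarrow> \<eta> t = H (integral {0..2 * pi} (\<lambda>x. w x t)) (1 / 2 * integral {0..2 * pi} (\<lambda>x. w x t * \<rho> x t))"
  shows "\<exists>X. nonlocal_flow H X0 J X"
proof -
  note TI = time_intervalD[OF J]
  have fat: "fat ((UNIV::real set) \<times> J)" by (rule time_interval_fat[OF J])
  \<comment> \<open>A moving angle adds v * \<rho> to the tangential velocity, and this choice
    cancels \<open>\<rho>1\<close>.\<close>
  define v where "v x t = - (\<rho>1 x t / \<rho> x t)" for x t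
  interpret pf: periodic_field v J
  proof
    have "Ck_on n (UNIV \<times> J) (\<lambda>p. - ((\<lambda>(x, t). \<rho>1 x t) p / (\<lambda>(x, t). \<rho> x t) p))" for n
      by (intro Ck_on_minus Ck_on_divide fat Ck) (use pos in \<open>auto simp: less_imp_neq[symmetric]\<close>)
    then show "Ck_on n (UNIV \<times> J) (\<lambda>(x, t). v x t)" for n by (simp add: v_def case_prod_unfold)
  qed (use J per in \<open>auto simp: v_def\<close>)
  obtain \<sigma> \<alpha> where cp0: "convex_param (support_function X0) \<sigma> \<alpha>"
    and X0_eq: "\<And>\<phi>. X0 \<phi> = support_curve (support_function X0) (\<alpha> \<phi>)"
    using smooth_convex_closed_curve_representation[OF X0] by blast
  have ang: "angle_fun \<sigma> \<alpha>" using cp0 by (simp add: convex_param_def convex_param_axioms_def)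
  have \<sigma>: "\<sigma> = 1 \<or> \<sigma> = - 1" using ang by (simp add: angle_fun_def)
  \<comment> \<open>Starting the transported angle at \<alpha> \<phi> reproduces the given
    parametrization X0, including its orientation.\<close>
  define A where "A \<phi> t = pf.flow (\<alpha> \<phi>) t" for \<phi> t
  define Y where "Y x t = w x t *\<^sub>R cis x + w1 x t *\<^sub>R (\<i> * cis x)" for x t
  define X where "X \<phi> t = Y (A \<phi> t) t" for \<phi> t
  have dw: "deriv (\<lambda>x. w x t) = (\<lambda>x. w1 x t)" if "t \<in> J" for t
    by (rule ext, rule DERIV_imp_deriv, rule dx(1)[OF that])
  have ddw: "curv_radius (\<lambda>x. w x t) x = \<rho> x t" if "t \<in> J" for x t
    unfolding curv_radius_def dw[OF that] using DERIV_imp_deriv[OF dx(2)[OF that]] by simp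
  have Ysc: "support_curve (\<lambda>x. w x t) = (\<lambda>x. Y x t)" if "t \<in> J" for t
    unfolding support_curve_def[abs_def] Y_def dw[OF that] ..
  have cs: "convex_support (\<lambda>x. w x t)" if "t \<in> J" for t
  proof
    show "smooth_on UNIV (\<lambda>x. w x t)" by (rule smooth_slice[OF Ck(1) that])
  qed (use per pos ddw that in auto)
  have CkA: "Ck_on n (UNIV \<times> J) (\<lambda>(\<phi>, t). A \<phi> t)" for n
  proof -
    have \<alpha>: "Ck_on n UNIV \<alpha>" using ang by (simp add: angle_fun_def smooth_on_def)
    have "Ck_on n (UNIV \<times> J) (\<lambda>p. \<alpha> (fst p))"
      by (rule Ck_on_compose[OF fat _ \<alpha> Ck_on_linear[OF fat bounded_linear_fst Ck_on_id[OF fat]]]) simp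
    then have "Ck_on n (UNIV \<times> J) (\<lambda>p. (\<alpha> (fst p), snd p))"
      by (intro Ck_on_Pair fat Ck_on_linear[OF fat bounded_linear_snd Ck_on_id[OF fat]])
    from Ck_on_compose[OF fat _ pf.flow_smooth this]
    have "Ck_on n (UNIV \<times> J) (\<lambda>p. (\<lambda>(x, t). pf.flow x t) (\<alpha> (fst p), snd p))" by force
    then show ?thesis by (simp add: A_def case_prod_unfold)
  qed
  have CkY: "Ck_on n (UNIV \<times> J) (\<lambda>(x, t). Y x t)" for n
  proof -
    have c: "Ck_on n (UNIV \<times> J) (\<lambda>p. cis (fst p))"
      by (rule Ck_on_compose[OF fat _ Ck_on_cis Ck_on_linear[OF fat bounded_linear_fst Ck_on_id[OF fat]]]) simp
    have "Ck_on n (UNIV \<times> J) (\<lambda>p. (\<lambda>(x, t). w x t) p *\<^sub>R cis (fst p) + (\<lambda>(x, t). w1 x t) p *\<^sub>R (\<i> * cis (fst p)))"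
      by (intro Ck_on_add Ck_on_scaleR Ck_on_mult Ck_on_const fat Ck c)
    then show ?thesis by (simp add: Y_def case_prod_unfold)
  qed
  have CkX: "smooth_on (UNIV \<times> J) (\<lambda>(\<phi>, t). X \<phi> t)"
    unfolding smooth_on_def
  proof
    fix n
    have "Ck_on n (UNIV \<times> J) (\<lambda>p. ((\<lambda>(\<phi>, t). A \<phi> t) p, snd p))"
      by (intro Ck_on_Pair fat CkA Ck_on_linear[OF fat bounded_linear_snd Ck_on_id[OF fat]])
    from Ck_on_compose[OF fat _ CkY this]
    have "Ck_on n (UNIV \<times> J) (\<lambda>p. (\<lambda>(x, t). Y x t) ((\<lambda>(\<phi>, t). A \<phi> t) p, snd p))" by force
    then show "Ck_on n (UNIV \<times> J) (\<lambda>(\<phi>, t). X \<phi> t)" by (simp add: X_def case_prod_unfold)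
  qed
  have angA: "angle_fun \<sigma> (\<lambda>\<phi>. A \<phi> t)" if t: "t \<in> J" for t
    unfolding angle_fun_def
  proof (intro conjI allI \<sigma>)
    show "smooth_on UNIV (\<lambda>\<phi>. A \<phi> t)" by (rule smooth_slice[OF CkA t])
    fix \<phi>
    have "((\<lambda>\<phi>. A \<phi> t) has_real_derivative pf.flow_jac (\<alpha> \<phi>) t * deriv \<alpha> \<phi>) (at \<phi>)"
      unfolding A_def by (rule DERIV_chain2[OF pf.flow_dx[OF t] angle_funD(1)[OF ang]])
    then have "deriv (\<lambda>\<phi>. A \<phi> t) \<phi> = pf.flow_jac (\<alpha> \<phi>) t * deriv \<alpha> \<phi>" by (rule DERIV_imp_deriv)
    moreover have "\<sigma> * deriv \<alpha> \<phi> > 0" using ang by (simp add: angle_fun_def)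
    moreover have "pf.flow_jac (\<alpha> \<phi>) t > 0" by (simp add: pf.flow_jac_def)
    ultimately show "\<sigma> * deriv (\<lambda>\<phi>. A \<phi> t) \<phi> > 0"
      using mult_pos_pos[of "pf.flow_jac (\<alpha> \<phi>) t" "\<sigma> * deriv \<alpha> \<phi>"] by (simp only: mult.left_commute)
    have "\<alpha> (\<phi> + 2 * pi) = \<alpha> \<phi> + \<sigma> * (2 * pi)" using ang by (simp add: angle_fun_def)
    then show "A (\<phi> + 2 * pi) t = A \<phi> t + \<sigma> * (2 * pi)"
      using \<sigma> pf.flow_periodic[OF t, of "\<alpha> \<phi>"] pf.flow_periodic[OF t, of "\<alpha> \<phi> - 2 * pi"] by (auto simp: A_def)
  qed
  have cp: "convex_param (\<lambda>x. w x t) \<sigma> (\<lambda>\<phi>. A \<phi> t)" if "t \<in> J" for t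
    using cs[OF that] angA[OF that] by (simp add: convex_param_def convex_param_axioms_def)
  have Xg: "(\<lambda>\<phi>. X \<phi> t) = (\<lambda>\<phi>. support_curve (\<lambda>x. w x t) (A \<phi> t))" if "t \<in> J" for t
    by (simp add: X_def Ysc[OF that])
  have Yx: "((\<lambda>x. Y x t) has_vector_derivative \<rho> x t *\<^sub>R (\<i> * cis x)) (at x)" if "t \<in> J" for x t
    using convex_support.Y_derivative[OF cs[OF that], of x UNIV] by (simp add: Ysc[OF that] ddw[OF that])
  have Yt: "((\<lambda>t. Y x t) has_vector_derivative (\<rho> x t - \<eta> t) *\<^sub>R cis x + \<rho>1 x t *\<^sub>R (\<i> * cis x)) (at t within J)"
    if t: "t \<in> J" for x t
    unfolding Y_def[abs_def]
    using has_vector_derivative_add[OF has_vector_derivative_scaleR[OF dt(1)[OF t] has_vector_derivative_const]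
        has_vector_derivative_scaleR[OF dt(2)[OF t] has_vector_derivative_const]] by simp
  \<comment> \<open>The chain rule needs a jointly continuous time derivative of Y. Its explicit
    formula contains \<eta>, about whose continuity nothing is known here, so continuity is taken
    from the smoothness of Y.\<close>
  obtain fx ft where "\<And>x t. t \<in> J \<Longrightarrow> ((\<lambda>t. Y x t) has_vector_derivative ft x t) (at t within J)"
    and ft: "Ck_on 0 (UNIV \<times> J) (\<lambda>(x, t). ft x t)"
    using Ck_on_partialsE[OF CkY[of "Suc 0"]] by metis
  have uniq: "a = b" if "(f has_vector_derivative a) (at t within J)" "(f has_vector_derivative b) (at t within J)" "t \<in> J"
    for f :: "real \<Rightarrow> complex" and a b t
  proof -
    have "(\<lambda>h. h *\<^sub>R a) = (\<lambda>h. h *\<^sub>R b)"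
      using fat_unique[OF TI(2) that(3)] that(1,2) unfolding has_vector_derivative_def by blast
    then show ?thesis by (metis scaleR_one)
  qed
  have fte: "ft x t = (\<rho> x t - \<eta> t) *\<^sub>R cis x + \<rho>1 x t *\<^sub>R (\<i> * cis x)" if "t \<in> J" for x t
    using uniq[OF _ Yt[OF that] that] \<open>\<And>x t. t \<in> J \<Longrightarrow> ((\<lambda>t. Y x t) has_vector_derivative ft x t) (at t within J)\<close>[OF that] by blast
  have Xt: "((\<lambda>t. X \<phi> t) has_vector_derivative (\<rho> (A \<phi> t) t - \<eta> t) *\<^sub>R cis (A \<phi> t)) (at t within J)" if t: "t \<in> J" for \<phi> t
  proof -
    have dA: "((\<lambda>t. A \<phi> t) has_real_derivative v (A \<phi> t) t) (at t within J)"
      unfolding A_def by (rule pf.flow_dt[OF t])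
    have "((\<lambda>t. Y (A \<phi> t) t) has_vector_derivative
        v (A \<phi> t) t *\<^sub>R (\<rho> (A \<phi> t) t *\<^sub>R (\<i> * cis (A \<phi> t))) + ft (A \<phi> t) t) (at t within J)"
    proof (rule has_vector_derivative_along[where f=Y and A="\<lambda>t. A \<phi> t" and ft=ft and fx="\<rho> (A \<phi> t) t *\<^sub>R (\<i> * cis (A \<phi> t))", OF TI(1) t Yx[OF t] _ _ dA])
      show "((\<lambda>t. Y x t) has_vector_derivative ft x t) (at t within J)" if "t \<in> J" for x t
        using Yt[OF that] fte[OF that] by simp
      show "continuous_on (UNIV \<times> J) (\<lambda>(x, t). ft x t)" using ft by simp
    qed
    moreover have "v (A \<phi> t) t *\<^sub>R (\<rho> (A \<phi> t) t *\<^sub>R (\<i> * cis (A \<phi> t))) + ft (A \<phi> t) t = (\<rho> (A \<phi> t) t - \<eta> t) *\<^sub>R cis (A \<phi> t)"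
      unfolding fte[OF t] using pos[OF t, of "A \<phi> t"] by (simp add: v_def)
    ultimately show ?thesis unfolding X_def by simp
  qed
  have "nonlocal_flow H X0 J X"
    unfolding nonlocal_flow_def
  proof (intro conjI ballI allI)
    show "smooth_on (UNIV \<times> J) (\<lambda>(\<phi>, t). X \<phi> t)" by (rule CkX)
    fix t assume t: "t \<in> J"
    interpret cp: convex_param "\<lambda>x. w x t" \<sigma> "\<lambda>\<phi>. A \<phi> t" by (rule cp[OF t])
    show "smooth_convex_closed_curve (\<lambda>\<phi>. X \<phi> t)" unfolding Xg[OF t] by (rule cp.smooth_convex_closed_curve_g)
  next
    fix \<phi> t assume t: "t \<in> J"
    interpret cp: convex_param "\<lambda>x. w x t" \<sigma> "\<lambda>\<phi>. A \<phi> t" by (rule cp[OF t])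
    have "H (curve_length (\<lambda>\<phi>. X \<phi> t)) (enclosed_area (\<lambda>\<phi>. X \<phi> t)) = \<eta> t"
      unfolding Xg[OF t] cp.curve_length_g cp.enclosed_area_g(1) ddw[OF t] \<eta>[OF t] ..
    moreover have "inward_normal (\<lambda>\<phi>. X \<phi> t) \<phi> = - cis (A \<phi> t)" unfolding Xg[OF t] by (rule cp.inward_normal_g)
    moreover have "curvature (\<lambda>\<phi>. X \<phi> t) \<phi> = 1 / \<rho> (A \<phi> t) t" unfolding Xg[OF t] cp.curvature_g ddw[OF t] ..
    ultimately show "((\<lambda>s. X \<phi> s) has_vector_derivative
        (H (curve_length (\<lambda>\<phi>. X \<phi> t)) (enclosed_area (\<lambda>\<phi>. X \<phi> t)) - 1 / curvature (\<lambda>\<phi>. X \<phi> t) \<phi>)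
          *\<^sub>R inward_normal (\<lambda>\<phi>. X \<phi> t) \<phi>) (at t within J)"
      using Xt[OF t, of \<phi>] by (simp add: algebra_simps)
  next
    fix \<phi>
    have "X \<phi> 0 = support_curve (\<lambda>x. w x 0) (\<alpha> \<phi>)" by (simp add: X_def A_def pf.flow_0 Ysc[OF TI(3)])
    also have "(\<lambda>x. w x 0) = support_function X0" using init by blast
    finally show "X \<phi> 0 = X0 \<phi>" by (simp add: X0_eq)
  qed
  then show ?thesis by blast
qed

subsection \<open>Solutions of the nonlocal flow\<close>

context convex_support
begin

lemma radius_cong: "cis a = cis b \<Longrightarrow> \<rho> a = \<rho> b"
proof -
  assume "cis a = cis b"
  then obtain k :: int where k: "a = b + of_int k * (2 * pi)" using cis_eq_iff by blast
  interpret r: periodic_fun_simple \<rho> "2 * pi"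
    by unfold_locales (simp only: curv_radius_def periodic
        periodic_deriv[OF smooth_on_deriv(2)[OF smooth] periodic_deriv[OF smooth periodic]])
  show ?thesis unfolding k by (rule r.plus_of_int)
qed

lemma fint_radius: "fint \<rho> n = of_real (1 - (real n)\<^sup>2) * fint u n"
proof -
  note s = smooth smooth_on_deriv(2)[OF smooth] smooth_on_deriv(2)[OF smooth_on_deriv(2)[OF smooth]]
  have c: "continuous_on {0..2 * pi} (deriv (deriv u))" "continuous_on {0..2 * pi} u"
    using smooth_on_imp_cont[OF s(3)] continuous_u continuous_on_subset by blast+
  have "fint \<rho> n = fint (deriv (deriv u)) n + fint u n"
    unfolding curv_radius_def[abs_def] by (rule fint_add[OF c])
  also have "fint (deriv (deriv u)) n = \<i> * of_nat n * (\<i> * of_nat n * fint u n)"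
    using fint_deriv_smooth[OF s(2) periodic_deriv[OF smooth periodic]] fint_deriv_smooth[OF smooth periodic] by simp
  finally show ?thesis by (simp add: complex_eq_iff power2_eq_square algebra_simps)
qed

end

lemma hsum_radius_coef:
  assumes "rapid c" "t \<ge> 0"
  shows "hsum (radius_coef c) x t = hsum c x t + hsum (dcoef (dcoef c)) x t"
  unfolding radius_coef_def[abs_def] by (intro hsum_add assms rapid_dcoef)

lemma curv_radius_series:
  assumes c: "rapid c" "t \<ge> 0"
  shows "curv_radius (\<lambda>x. b + a * hsum c x t) x = b + a * hsum (radius_coef c) x t"
proof -
  have 1: "deriv (\<lambda>x. b + a * hsum c x t) = (\<lambda>x. a * hsum (dcoef c) x t)"
  proof (rule ext, rule DERIV_imp_deriv)
    fix x show "((\<lambda>x. b + a * hsum c x t) has_real_derivative a * hsum (dcoef c) x t) (at x)"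
      using DERIV_add[OF DERIV_const DERIV_cmult[OF hsum_dtheta[OF c]]] by simp
  qed
  have 2: "deriv (\<lambda>x. a * hsum (dcoef c) x t) x = a * hsum (dcoef (dcoef c)) x t"
    by (rule DERIV_imp_deriv, rule DERIV_cmult[OF hsum_dtheta[OF rapid_dcoef[OF c(1)] c(2)]])
  show ?thesis unfolding curv_radius_def 1 2 by (simp add: hsum_radius_coef[OF c] algebra_simps)
qed

lemma fint_0: "continuous_on {0..2 * pi} f \<Longrightarrow> Re (fint f 0) = integral {0..2 * pi} f"
proof -
  assume c: "continuous_on {0..2 * pi} f"
  have "((\<lambda>x. Re (of_real (f x) * cis (- (real 0 * x)))) has_integral Re (fint f 0)) {0..2 * pi}"
    unfolding fint_def by (intro has_integral_Re integrable_integral integrable_continuous_interval continuous_intros c)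
  then show ?thesis by (simp add: integral_unique)
qed

lemma curve_length_pos:
  assumes "smooth_convex_closed_curve g" shows "curve_length g > 0"
proof -
  interpret closed_curve g using assms unfolding smooth_convex_closed_curve_def by unfold_locales auto
  have c: "continuous_on {0..2 * pi} (\<lambda>\<phi>. norm (vd g \<phi>))" by (intro continuous_intros cont_g)
  obtain a b where ab: "a > 0" "\<And>t. t \<in> {0..2 * pi} \<Longrightarrow> a \<le> norm (vd g t) \<and> norm (vd g t) \<le> b"
    using positive_bounds[OF c] regular by auto
  have "integral {0..2 * pi} (\<lambda>\<phi>. a) \<le> integral {0..2 * pi} (\<lambda>\<phi>. norm (vd g \<phi>))"
    by (intro Henstock_Kurzweil_Integration.integral_le integrable_continuous_interval c continuous_on_const) (use ab in auto)
  moreover have "0 < 2 * pi * a" using ab(1) by simp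
  ultimately show ?thesis by (simp add: curve_length_def)
qed

section \<open>The support function of an arbitrary solution\<close>

locale flow_solution =
  fixes H :: "real \<Rightarrow> real \<Rightarrow> real" and X0 :: "real \<Rightarrow> complex" and J :: "real set" and X :: "real \<Rightarrow> real \<Rightarrow> complex"
  assumes J: "time_interval J" and flow: "nonlocal_flow H X0 J X"
begin

lemmas TI = time_intervalD[OF J]

definition S :: "real \<Rightarrow> real \<Rightarrow> real" where "S t = support_function (\<lambda>\<phi>. X \<phi> t)"
definition len :: "real \<Rightarrow> real" where "len t = curve_length (\<lambda>\<phi>. X \<phi> t)"
definition area :: "real \<Rightarrow> real" where "area t = enclosed_area (\<lambda>\<phi>. X \<phi> t)"
definition \<eta> :: "real \<Rightarrow> real" where "\<eta> t = H (len t) (area t)"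

lemma curve: "t \<in> J \<Longrightarrow> smooth_convex_closed_curve (\<lambda>\<phi>. X \<phi> t)"
  using flow by (simp add: nonlocal_flow_def)

lemma representation:
  assumes "t \<in> J"
  obtains \<sigma> \<alpha> where "convex_param (S t) \<sigma> \<alpha>" "(\<lambda>\<phi>. X \<phi> t) = (\<lambda>\<phi>. support_curve (S t) (\<alpha> \<phi>))"
  using smooth_convex_closed_curve_representation[OF curve[OF assms]] unfolding S_def by (metis (no_types, lifting) ext)

lemma support: "t \<in> J \<Longrightarrow> convex_support (S t)"
  unfolding S_def by (rule convex_support_function(1)[OF curve])

lemma len_area:
  assumes t: "t \<in> J"
  shows "len t = integral {0..2 * pi} (S t)" "area t = 1 / 2 * integral {0..2 * pi} (\<lambda>\<theta>. S t \<theta> * curv_radius (S t) \<theta>)"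
    "area t > 0" "len t > 0"
proof -
  obtain \<sigma> \<alpha> where cp: "convex_param (S t) \<sigma> \<alpha>" "(\<lambda>\<phi>. X \<phi> t) = (\<lambda>\<phi>. support_curve (S t) (\<alpha> \<phi>))"
    by (rule representation[OF t])
  show "len t = integral {0..2 * pi} (S t)" "area t = 1 / 2 * integral {0..2 * pi} (\<lambda>\<theta>. S t \<theta> * curv_radius (S t) \<theta>)" "area t > 0"
    unfolding len_def area_def cp(2)
    using convex_param.curve_length_g[OF cp(1)] convex_param.enclosed_area_g[OF cp(1)] by auto
  show "len t > 0" unfolding len_def by (rule curve_length_pos[OF curve[OF t]])
qed

lemma X_inner_le: "t \<in> J \<Longrightarrow> X \<phi> t \<bullet> cis \<theta> \<le> S t \<theta>"
proof -
  assume t: "t \<in> J"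
  obtain \<sigma> \<alpha> where cp: "convex_param (S t) \<sigma> \<alpha>" "(\<lambda>\<phi>. X \<phi> t) = (\<lambda>\<phi>. support_curve (S t) (\<alpha> \<phi>))"
    by (rule representation[OF t])
  have "X \<phi> t = support_curve (S t) (\<alpha> \<phi>)" using cp(2) by metis
  then show ?thesis using convex_support.support_le[OF support[OF t]] by simp
qed

lemma X_inner_eq: "t \<in> J \<Longrightarrow> X \<phi> t \<bullet> cis \<theta> = S t \<theta> \<Longrightarrow> X \<phi> t = support_curve (S t) \<theta>"
proof -
  assume t: "t \<in> J" and e: "X \<phi> t \<bullet> cis \<theta> = S t \<theta>"
  obtain \<sigma> \<alpha> where cp: "convex_param (S t) \<sigma> \<alpha>" "(\<lambda>\<phi>. X \<phi> t) = (\<lambda>\<phi>. support_curve (S t) (\<alpha> \<phi>))"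
    by (rule representation[OF t])
  have x: "X \<phi> t = support_curve (S t) (\<alpha> \<phi>)" using cp(2) by metis
  have "cis (\<alpha> \<phi>) = cis \<theta>" using convex_support.support_strict[OF support[OF t], of "\<alpha> \<phi>" \<theta>] e x by fastforce
  then show ?thesis unfolding x by (rule convex_support.Y_cong[OF support[OF t]])
qed

lemma contact_exists:
  assumes t: "t \<in> J"
  shows "\<exists>\<phi>. \<phi> \<in> {0..2 * pi} \<and> X \<phi> t \<bullet> cis \<theta> = S t \<theta> \<and> inward_normal (\<lambda>\<phi>. X \<phi> t) \<phi> = - cis \<theta> \<and>
    curvature (\<lambda>\<phi>. X \<phi> t) \<phi> = 1 / curv_radius (S t) \<theta>"
proof -
  obtain \<sigma> \<alpha> where cp: "convex_param (S t) \<sigma> \<alpha>" "(\<lambda>\<phi>. X \<phi> t) = (\<lambda>\<phi>. support_curve (S t) (\<alpha> \<phi>))"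
    by (rule representation[OF t])
  interpret convex_param "S t" \<sigma> \<alpha> by (rule cp(1))
  obtain \<phi>' where a: "\<alpha> \<phi>' = \<theta>" using angleD(3) by blast
  obtain k :: int where k: "0 \<le> \<phi>' + of_int k * (2 * pi)" "\<phi>' + of_int k * (2 * pi) < 0 + 2 * pi" by (rule exists_shift)
  define \<phi> where "\<phi> = \<phi>' + of_int k * (2 * pi)"
  have "\<sigma> = 1 \<or> \<sigma> = - 1" using angle by (simp add: angle_fun_def)
  then have "\<exists>j::int. \<alpha> \<phi> = \<theta> + of_int j * (2 * pi)"
    using angleD(4)[of \<phi>' k] a by (auto simp: \<phi>_def intro: exI[of _ k] exI[of _ "- k"])
  then have cc: "cis (\<alpha> \<phi>) = cis \<theta>" unfolding cis_eq_iff .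
  have x: "X \<phi> t = support_curve (S t) (\<alpha> \<phi>)" using cp(2) by metis
  show ?thesis
  proof (intro exI[of _ \<phi>] conjI)
    show "\<phi> \<in> {0..2 * pi}" using k by (simp add: \<phi>_def)
    show "X \<phi> t \<bullet> cis \<theta> = S t \<theta>" unfolding x Y_cong[OF cc] by (rule Y_inner_same)
    show "inward_normal (\<lambda>\<phi>. X \<phi> t) \<phi> = - cis \<theta>" unfolding cp(2) inward_normal_g cc ..
    show "curvature (\<lambda>\<phi>. X \<phi> t) \<phi> = 1 / curv_radius (S t) \<theta>" unfolding cp(2) curvature_g radius_cong[OF cc] ..
  qed
qed

text \<open>A parameter of the point with outward normal \<open>cis \<theta>\<close>, taken from one
  compact period. Being an arbitrary choice it may be discontinuous in \<theta> and t, and only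
  quantities that agree at all contact parameters are used.\<close>

definition contact :: "real \<Rightarrow> real \<Rightarrow> real" where
  "contact \<theta> t = (SOME \<phi>. \<phi> \<in> {0..2 * pi} \<and> X \<phi> t \<bullet> cis \<theta> = S t \<theta> \<and> inward_normal (\<lambda>\<phi>. X \<phi> t) \<phi> = - cis \<theta> \<and>
    curvature (\<lambda>\<phi>. X \<phi> t) \<phi> = 1 / curv_radius (S t) \<theta>)"

lemma contact:
  assumes "t \<in> J"
  shows "contact \<theta> t \<in> {0..2 * pi}" "X (contact \<theta> t) t \<bullet> cis \<theta> = S t \<theta>"
    "inward_normal (\<lambda>\<phi>. X \<phi> t) (contact \<theta> t) = - cis \<theta>" "curvature (\<lambda>\<phi>. X \<phi> t) (contact \<theta> t) = 1 / curv_radius (S t) \<theta>"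
  using someI_ex[OF contact_exists[OF assms, of \<theta>]] unfolding contact_def[symmetric] by auto

lemma vector_derivative_unique_J:
  fixes f :: "real \<Rightarrow> complex"
  assumes "(f has_vector_derivative a) (at t within J)" "(f has_vector_derivative b) (at t within J)" "t \<in> J"
  shows "a = b"
proof -
  have "(\<lambda>h. h *\<^sub>R a) = (\<lambda>h. h *\<^sub>R b)"
    using fat_unique[OF TI(2) assms(3)] assms(1,2) unfolding has_vector_derivative_def by blast
  then show ?thesis by (metis scaleR_one)
qed

definition Xt :: "real \<Rightarrow> real \<Rightarrow> complex" where
  "Xt \<phi> t = (\<eta> t - 1 / curvature (\<lambda>\<phi>. X \<phi> t) \<phi>) *\<^sub>R inward_normal (\<lambda>\<phi>. X \<phi> t) \<phi>"

lemma Xt: "t \<in> J \<Longrightarrow> ((\<lambda>t. X \<phi> t) has_vector_derivative Xt \<phi> t) (at t within J)"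
  using flow unfolding nonlocal_flow_def Xt_def \<eta>_def len_def area_def by blast

lemma continuous_X: "continuous_on (UNIV \<times> J) (\<lambda>(\<phi>, t). X \<phi> t)" "continuous_on (UNIV \<times> J) (\<lambda>(\<phi>, t). Xt \<phi> t)"
proof -
  have sm: "Ck_on (Suc 0) (UNIV \<times> J) (\<lambda>(\<phi>, t). X \<phi> t)"
    using flow unfolding nonlocal_flow_def smooth_on_def by blast
  then show "continuous_on (UNIV \<times> J) (\<lambda>(\<phi>, t). X \<phi> t)" by (rule Ck_on_imp_cont)
  obtain ft where ft: "\<And>x t. t \<in> J \<Longrightarrow> ((\<lambda>t. X x t) has_vector_derivative ft x t) (at t within J)"
    "Ck_on 0 (UNIV \<times> J) (\<lambda>(x, t). ft x t)"
    using Ck_on_partialsE[OF sm] by metis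
  have "ft x t = Xt x t" if "t \<in> J" for x t
    by (rule vector_derivative_unique_J[OF ft(1)[OF that] Xt[OF that] that])
  then have "continuous_on (UNIV \<times> J) (\<lambda>(\<phi>, t). ft \<phi> t) = continuous_on (UNIV \<times> J) (\<lambda>(\<phi>, t). Xt \<phi> t)"
    by (intro continuous_on_cong) auto
  then show "continuous_on (UNIV \<times> J) (\<lambda>(\<phi>, t). Xt \<phi> t)" using ft(2) by simp
qed

text \<open>On a simple closed curve two parameters give the same point exactly when they differ by
  a multiple of 2 * pi, a condition that does not involve time. Hence different contact parameters
  are interchangeable at all times, as the envelope theorem requires.\<close>

lemma X_eq_everywhere:
  assumes t: "t \<in> J" and e: "X a t = X b t" and s: "s \<in> J"
  shows "X a s = X b s" "Xt a s = Xt b s"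
proof -
  have cc: "closed_curve (\<lambda>\<phi>. X \<phi> t)" if "t \<in> J" for t
    using curve[OF that] unfolding smooth_convex_closed_curve_def by unfold_locales auto
  have "\<exists>k::int. a = b + of_int k * (2 * pi)" using closed_curve.g_eq_iff[OF cc[OF t]] e by blast
  then have X: "X a s = X b s" if "s \<in> J" for s using closed_curve.g_eq_iff[OF cc[OF that]] by blast
  then show "X a s = X b s" using s .
  have "((\<lambda>t. X b t) has_vector_derivative Xt a s) (at s within J)"
    using Xt[OF s, of a] unfolding has_vector_derivative_def
    by (rule has_derivative_transform[OF s, rotated]) (simp add: X)
  then show "Xt a s = Xt b s" by (rule vector_derivative_unique_J[OF _ Xt[OF s] s])
qed

lemma contact_same:
  assumes t: "t \<in> J" and e: "X \<phi> t \<bullet> cis \<theta> = X (contact \<theta> t) t \<bullet> cis \<theta>" and s: "s \<in> J"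
  shows "X \<phi> s = X (contact \<theta> t) s" "Xt \<phi> s = Xt (contact \<theta> t) s"
proof -
  have "X \<phi> t = X (contact \<theta> t) t"
    using X_inner_eq[OF t, of \<phi> \<theta>] X_inner_eq[OF t contact(2)[OF t]] e contact(2)[OF t, of \<theta>] by simp
  then show "X \<phi> s = X (contact \<theta> t) s" "Xt \<phi> s = Xt (contact \<theta> t) s" using X_eq_everywhere[OF t _ s] by blast+
qed

text \<open>At the contact point the inward normal is - \<open>cis \<theta>\<close>, which turns the
  inward speed \<eta> - 1 / k into an outward speed.\<close>

lemma Xt_contact: "t \<in> J \<Longrightarrow> Xt (contact \<theta> t) t \<bullet> cis \<theta> = curv_radius (S t) \<theta> - \<eta> t"
  by (simp add: Xt_def contact inner_cis_cis)

lemma S_dt: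
  assumes t: "t \<in> J"
  shows "((\<lambda>t. S t \<theta>) has_real_derivative curv_radius (S t) \<theta> - \<eta> t) (at t within J)"
proof -
  let ?m = "\<lambda>\<phi> t. X \<phi> t \<bullet> cis \<theta>" and ?mt = "\<lambda>\<phi> t. Xt \<phi> t \<bullet> cis \<theta>"
  have sw: "continuous_on (J \<times> {0..2 * pi}) (\<lambda>q. (snd q, fst q))" by (intro continuous_intros)
  have "continuous_on (J \<times> {0..2 * pi}) (\<lambda>q. (\<lambda>(\<phi>, t). X \<phi> t) (snd q, fst q) \<bullet> cis \<theta>)"
    "continuous_on (J \<times> {0..2 * pi}) (\<lambda>q. (\<lambda>(\<phi>, t). Xt \<phi> t) (snd q, fst q) \<bullet> cis \<theta>)"
    by (intro continuous_intros continuous_on_compose2[OF continuous_X(1) sw] continuous_on_compose2[OF continuous_X(2) sw]; auto)+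
  then have c: "continuous_on (J \<times> {0..2 * pi}) (\<lambda>(t, \<phi>). ?m \<phi> t)" "continuous_on (J \<times> {0..2 * pi}) (\<lambda>(t, \<phi>). ?mt \<phi> t)"
    by (simp_all add: case_prod_unfold)
  have "((\<lambda>t. ?m (contact \<theta> t) t) has_real_derivative ?mt (contact \<theta> t) t) (at t within J)"
  proof (rule envelope_derivative[OF TI(1) compact_Icc _ c _ _ _ t])
    show "contact \<theta> t \<in> {0..2 * pi}" if "t \<in> J" for t by (rule contact(1)[OF that])
    show "(?m \<phi> has_real_derivative ?mt \<phi> t) (at t within J)" if "t \<in> J" for \<phi> t
      using bounded_linear.has_vector_derivative[OF bounded_linear_inner_left Xt[OF that]]
      by (simp add: has_real_derivative_iff_has_vector_derivative)
    show "?m \<phi> t \<le> ?m (contact \<theta> t) t" if "t \<in> J" for \<phi> t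
      using X_inner_le[OF that] contact(2)[OF that] by simp
    show "?mt \<phi> s = ?mt (contact \<theta> t) s" if "t \<in> J" "s \<in> J" "?m \<phi> t = ?m (contact \<theta> t) t" for t \<phi> s
      using contact_same(2)[OF that(1,3,2)] by simp
  qed
  then have "((\<lambda>t. ?m (contact \<theta> t) t) has_real_derivative curv_radius (S t) \<theta> - \<eta> t) (at t within J)"
    by (simp add: Xt_contact[OF t])
  then show ?thesis unfolding has_field_derivative_def
    by (rule has_derivative_transform[OF t, rotated]) (simp add: contact(2))
qed

text \<open>Both functions are values at the maximizer: of the height X \<bullet> cis \<theta> and
  of its time derivative. Continuity of the second one is what differentiation under the integral
  sign needs.\<close>

lemma joint_continuity:
  "continuous_on (UNIV \<times> J) (\<lambda>(\<theta>, t). S t \<theta>)" "continuous_on (UNIV \<times> J) (\<lambda>(\<theta>, t). curv_radius (S t) \<theta> - \<eta> t)"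
proof -
  let ?Z = "(UNIV \<times> J) :: (real \<times> real) set"
  have sw: "continuous_on (?Z \<times> {0..2 * pi}) (\<lambda>q. (snd q, snd (fst q)))" by (intro continuous_intros)
  have cc: "continuous_on (?Z \<times> {0..2 * pi}) (\<lambda>q. cis (fst (fst q)))"
    by (rule continuous_on_compose2[OF Ck_on_imp_cont[OF Ck_on_cis[of 0]]]) (auto intro!: continuous_intros)
  have "continuous_on (?Z \<times> {0..2 * pi}) (\<lambda>q. (\<lambda>(\<phi>, t). X \<phi> t) (snd q, snd (fst q)) \<bullet> cis (fst (fst q)))"
    "continuous_on (?Z \<times> {0..2 * pi}) (\<lambda>q. (\<lambda>(\<phi>, t). Xt \<phi> t) (snd q, snd (fst q)) \<bullet> cis (fst (fst q)))"
    by (intro continuous_on_inner cc continuous_on_compose2[OF continuous_X(1) sw] continuous_on_compose2[OF continuous_X(2) sw]; auto)+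
  then have c: "continuous_on (?Z \<times> {0..2 * pi}) (\<lambda>(z, \<phi>). X \<phi> (snd z) \<bullet> cis (fst z))"
    "continuous_on (?Z \<times> {0..2 * pi}) (\<lambda>(z, \<phi>). Xt \<phi> (snd z) \<bullet> cis (fst z))"
    by (simp_all add: case_prod_unfold)
  have am: "continuous_on ?Z (\<lambda>z. G z (contact (fst z) (snd z)))"
    if G: "continuous_on (?Z \<times> {0..2 * pi}) (\<lambda>(z, \<phi>). G z \<phi>)"
      and same: "\<And>z \<phi>. snd z \<in> J \<Longrightarrow> X \<phi> (snd z) \<bullet> cis (fst z) = X (contact (fst z) (snd z)) (snd z) \<bullet> cis (fst z) \<Longrightarrow>
         G z \<phi> = G z (contact (fst z) (snd z))" for G :: "real \<times> real \<Rightarrow> real \<Rightarrow> real"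
  proof (rule argmax_continuous[where sel="\<lambda>z. contact (fst z) (snd z)" and K="{0..2 * pi}", OF compact_Icc _ c(1) G])
    fix z :: "real \<times> real" assume "z \<in> ?Z"
    then have z: "snd z \<in> J" by (simp add: mem_Times_iff)
    show "contact (fst z) (snd z) \<in> {0..2 * pi}" by (rule contact(1)[OF z])
    fix \<phi>
    show "X \<phi> (snd z) \<bullet> cis (fst z) \<le> X (contact (fst z) (snd z)) (snd z) \<bullet> cis (fst z)"
      using X_inner_le[OF z] contact(2)[OF z] by simp
    assume "X \<phi> (snd z) \<bullet> cis (fst z) = X (contact (fst z) (snd z)) (snd z) \<bullet> cis (fst z)"
    then show "G z \<phi> = G z (contact (fst z) (snd z))" by (rule same[OF z])
  qed
  have "continuous_on ?Z (\<lambda>z. X (contact (fst z) (snd z)) (snd z) \<bullet> cis (fst z))"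
    by (rule am[OF c(1)]) simp
  then have "continuous_on ?Z (\<lambda>z. S (snd z) (fst z))"
    by (rule continuous_on_eq) (auto simp: contact(2))
  then show "continuous_on (UNIV \<times> J) (\<lambda>(\<theta>, t). S t \<theta>)" by (simp add: case_prod_unfold)
  have "continuous_on ?Z (\<lambda>z. Xt (contact (fst z) (snd z)) (snd z) \<bullet> cis (fst z))"
    by (rule am[OF c(2)]) (use contact_same(2) in metis)
  then have "continuous_on ?Z (\<lambda>z. curv_radius (S (snd z)) (fst z) - \<eta> (snd z))"
    by (rule continuous_on_eq) (auto simp: Xt_contact)
  then show "continuous_on (UNIV \<times> J) (\<lambda>(\<theta>, t). curv_radius (S t) \<theta> - \<eta> t)" by (simp add: case_prod_unfold)
qed

lemma fint_S_dt:
  assumes t: "t \<in> J"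
  shows "((\<lambda>t. fint (S t) n) has_vector_derivative of_real (1 - (real n)\<^sup>2) * fint (S t) n - fint (\<lambda>\<theta>. \<eta> t) n) (at t within J)"
proof -
  let ?f = "\<lambda>t \<theta>. complex_of_real (S t \<theta>) * cis (- (real n * \<theta>))"
  let ?ft = "\<lambda>t \<theta>. complex_of_real (curv_radius (S t) \<theta> - \<eta> t) * cis (- (real n * \<theta>))"
  have "((\<lambda>t. integral (cbox 0 (2 * pi)) (?f t)) has_vector_derivative integral (cbox 0 (2 * pi)) (?ft t)) (at t within J)"
  proof (rule leibniz_rule_vector_derivative[OF _ _ _ t TI(1)])
    fix s \<theta> assume s: "s \<in> J"
    have "((\<lambda>s. complex_of_real (S s \<theta>)) has_vector_derivative of_real (curv_radius (S s) \<theta> - \<eta> s)) (at s within J)"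
      by (rule bounded_linear.has_vector_derivative[OF bounded_linear_of_real
            S_dt[OF s, unfolded has_real_derivative_iff_has_vector_derivative]])
    then show "((\<lambda>s. ?f s \<theta>) has_vector_derivative ?ft s \<theta>) (at s within J)"
      by (rule bounded_linear.has_vector_derivative[OF bounded_linear_mult_left])
  next
    fix s assume s: "s \<in> J"
    show "?f s integrable_on cbox 0 (2 * pi)"
      by (intro integrable_continuous continuous_intros continuous_on_slice2[OF joint_continuity(1) s]) simp
  next
    have "continuous_on (J \<times> cbox 0 (2 * pi)) (\<lambda>q. (\<lambda>(\<theta>, t). curv_radius (S t) \<theta> - \<eta> t) (snd q, fst q))"
      by (rule continuous_on_compose2[OF joint_continuity(2)]) (auto intro!: continuous_intros)
    then have "continuous_on (J \<times> cbox 0 (2 * pi)) (\<lambda>q. complex_of_real (curv_radius (S (fst q)) (snd q) - \<eta> (fst q)) * cis (- (real n * snd q)))"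
      by (intro continuous_on_mult continuous_on_of_real continuous_on_compose2[OF Ck_on_imp_cont[OF Ck_on_cis[of 0]]])
        (auto intro!: continuous_intros)
    then show "continuous_on (J \<times> cbox 0 (2 * pi)) (\<lambda>(t, \<theta>). ?ft t \<theta>)" by (simp add: case_prod_unfold)
  qed
  moreover have "integral (cbox 0 (2 * pi)) (?ft t) = of_real (1 - (real n)\<^sup>2) * fint (S t) n - fint (\<lambda>\<theta>. \<eta> t) n"
  proof -
    interpret convex_support "S t" by (rule support[OF t])
    have "integral (cbox 0 (2 * pi)) (?ft t) = fint (\<lambda>\<theta>. curv_radius (S t) \<theta> - \<eta> t) n" by (simp add: fint_def)
    also have "\<dots> = fint (curv_radius (S t)) n - fint (\<lambda>\<theta>. \<eta> t) n" by (rule fint_diff[OF continuous_\<rho> continuous_on_const])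
    finally show ?thesis by (simp add: fint_radius)
  qed
  ultimately show ?thesis by (simp add: fint_def)
qed

lemma support_0: "S 0 = support_function X0"
proof -
  have "(\<lambda>\<phi>. X \<phi> 0) = X0" using flow unfolding nonlocal_flow_def by blast
  then show ?thesis by (simp add: S_def)
qed

text \<open>This is the mode n = 0, the only one to which the constant \<eta> contributes; its
  integral over the period is 2 * pi * \<eta>.\<close>

lemma len_dt: "t \<in> J \<Longrightarrow> (len has_real_derivative len t - 2 * pi * \<eta> t) (at t within J)"
proof -
  assume t: "t \<in> J"
  have l: "len t = Re (fint (S t) 0)" if "t \<in> J" for t
    using fint_0[OF convex_support.continuous_u[OF support[OF that]]] len_area(1)[OF that] by simp
  have "((\<lambda>t. Re (fint (S t) 0)) has_real_derivative len t - 2 * pi * \<eta> t) (at t within J)"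
    using bounded_linear.has_vector_derivative[OF bounded_linear_Re fint_S_dt[OF t, of 0]]
    by (simp add: has_real_derivative_iff_has_vector_derivative fint_const l[OF t])
  then show ?thesis unfolding has_field_derivative_def
    by (rule has_derivative_transform[OF t, rotated]) (rule l)
qed

lemma fint_S:
  assumes t: "t \<in> J" and n: "n > 0"
  shows "fint (S t) n = of_real (exp ((1 - (real n)\<^sup>2) * t)) * fint (S 0) n"
proof -
  let ?a = "1 - (real n)\<^sup>2"
  define F where "F t = fint (S t) n * of_real (exp (- ?a * t))" for t
  have "(F has_vector_derivative 0) (at t within J)" if t: "t \<in> J" for t
  proof -
    have 1: "((\<lambda>t. fint (S t) n) has_vector_derivative of_real ?a * fint (S t) n) (at t within J)"
      using fint_S_dt[OF t, of n] n by (simp add: fint_const)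
    have "((\<lambda>t. exp (- ?a * t)) has_real_derivative exp (- ?a * t) * (- ?a)) (at t within J)"
      by (auto intro!: derivative_eq_intros)
    then have 2: "((\<lambda>t. complex_of_real (exp (- ?a * t))) has_vector_derivative of_real (exp (- ?a * t) * (- ?a))) (at t within J)"
      by (intro bounded_linear.has_vector_derivative[OF bounded_linear_of_real])
        (simp only: has_real_derivative_iff_has_vector_derivative)
    show ?thesis unfolding F_def[abs_def] using has_vector_derivative_mult[OF 1 2] by (simp add: algebra_simps)
  qed
  then obtain k where "\<And>t. t \<in> J \<Longrightarrow> F t = k" using has_vector_derivative_zero_constant[OF TI(1)] by metis
  then have "F t = F 0" using t TI(3) by simp
  then have e: "fint (S t) n * of_real (exp (- ?a * t)) = fint (S 0) n" by (simp add: F_def)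
  have "exp (?a * t) * exp (- ?a * t) = 1" by (simp only: mult_exp_exp) (simp add: algebra_simps)
  then have "complex_of_real (exp (?a * t)) * of_real (exp (- ?a * t)) = 1" by (metis of_real_1 of_real_mult)
  then have "fint (S t) n = of_real (exp (?a * t)) * (fint (S t) n * of_real (exp (- ?a * t)))"
    by (simp only: mult.left_commute mult_1_right)
  then show ?thesis unfolding e .
qed

lemma initial_coef: "rapid (fcoef (support_function X0))" "fcoef (support_function X0) 0 = 0"
  using rapid_fcoef convex_support.smooth[OF support[OF TI(3)]] convex_support.periodic[OF support[OF TI(3)]]
  unfolding support_0 by (auto simp: fcoef_def)

text \<open>After division by exp t the modes carry the factors exp (- n^2 t) of the heat equation,
  so that \<open>fourier_series\<close> identifies the function.\<close>

lemma S_series: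
  assumes t: "t \<in> J"
  shows "S t \<theta> = len t / (2 * pi) + exp t * hsum (fcoef (support_function X0)) \<theta> t"
proof -
  interpret convex_support "S t" by (rule support[OF t])
  let ?c = "fcoef (support_function X0)"
  have "exp (- t) * S t \<theta> = exp (- t) * (len t / (2 * pi)) + hsum ?c \<theta> t"
  proof (rule fourier_series[where f="\<lambda>\<theta>. exp (- t) * S t \<theta>"])
    show "continuous_on UNIV (\<lambda>\<theta>. exp (- t) * S t \<theta>)" by (intro continuous_intros continuous_u)
    show "integral {0..2 * pi} (\<lambda>\<theta>. exp (- t) * S t \<theta>) = 2 * pi * (exp (- t) * (len t / (2 * pi)))"
      by (simp add: len_area(1)[OF t])
    show "fint (\<lambda>\<theta>. exp (- t) * S t \<theta>) n = of_real (pi * exp (- (real n)\<^sup>2 * t)) * ?c n" if n: "n > 0" for n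
    proof -
      have "fint (\<lambda>\<theta>. exp (- t) * S t \<theta>) n = of_real (exp (- t)) * fint (S t) n"
        unfolding fint_def by (simp add: mult.assoc)
      also have "\<dots> = of_real (exp (- t) * exp ((1 - (real n)\<^sup>2) * t)) * fint (S 0) n"
        by (simp add: fint_S[OF t n])
      also have "exp (- t) * exp ((1 - (real n)\<^sup>2) * t) = exp (- (real n)\<^sup>2 * t)"
        by (simp add: mult_exp_exp algebra_simps)
      finally show ?thesis using n by (simp add: fcoef_def support_0)
    qed
  qed (use periodic initial_coef TI(4)[OF t] in auto)
  then have "exp t * (exp (- t) * S t \<theta>) = exp t * (exp (- t) * (len t / (2 * pi)) + hsum ?c \<theta> t)" by simp
  then show ?thesis by (simp add: distrib_left mult.assoc[symmetric] mult_exp_exp)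
qed

lemma radius_series:
  assumes t: "t \<in> J"
  shows "curv_radius (S t) \<theta> = len t / (2 * pi) + exp t * hsum (radius_coef (fcoef (support_function X0))) \<theta> t"
proof -
  have "S t = (\<lambda>\<theta>. len t / (2 * pi) + exp t * hsum (fcoef (support_function X0)) \<theta> t)"
    using S_series[OF t] by blast
  then show ?thesis using curv_radius_series[OF initial_coef(1) TI(4)[OF t]] by simp
qed

lemma area_series: "t \<in> J \<Longrightarrow> area t = (len t)\<^sup>2 / (4 * pi) + osc_area (fcoef (support_function X0)) t"
  using series_area[OF initial_coef TI(4), of t "len t / (2 * pi)"]
  by (simp add: len_area(2) S_series radius_series power_divide power2_eq_square field_simps)

lemma len_unique:
  assumes H: "smooth_on ({0<..} \<times> {0<..}) (\<lambda>(p, q). H p q)"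
    and L: "\<And>t. t \<in> J \<Longrightarrow> (L has_real_derivative (L t - 2 * pi * H (L t) ((L t)\<^sup>2 / (4 * pi) + osc_area (fcoef (support_function X0)) t))) (at t within J)"
      "\<And>t. t \<in> J \<Longrightarrow> L t > 0" "\<And>t. t \<in> J \<Longrightarrow> (L t)\<^sup>2 / (4 * pi) + osc_area (fcoef (support_function X0)) t > 0"
      "L 0 = curve_length X0"
    and t: "t \<in> J"
  shows "len t = L t"
proof (rule length_ode_unique[OF J H _ _ _ _ L(1,2,3) _ t])
  show "continuous_on J (osc_area (fcoef (support_function X0)))"
    by (rule continuous_on_subset[OF osc_area_continuous[OF initial_coef(1)]]) (use TI(4) in auto)
  show "(len has_real_derivative len t - 2 * pi * H (len t) ((len t)\<^sup>2 / (4 * pi) + osc_area (fcoef (support_function X0)) t)) (at t within J)"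
    if "t \<in> J" for t using len_dt[OF that] by (simp add: \<eta>_def area_series[OF that])
  show "len t > 0" if "t \<in> J" for t using len_area(4)[OF that] .
  show "(len t)\<^sup>2 / (4 * pi) + osc_area (fcoef (support_function X0)) t > 0" if "t \<in> J" for t
    using len_area(3)[OF that] area_series[OF that] by simp
  have "(\<lambda>\<phi>. X \<phi> 0) = X0" using flow unfolding nonlocal_flow_def by blast
  then show "len 0 = L 0" using L(4) by (simp add: len_def)
qed

end

subsection \<open>The solution given by the length equation\<close>

lemma rapid_funpow_dcoef: "rapid c \<Longrightarrow> rapid ((dcoef ^^ n) c)"
  by (induction n) (auto intro: rapid_dcoef)

lemma deriv_funpow_hsum:
  assumes "rapid c" "t \<ge> 0"
  shows "(deriv ^^ n) (\<lambda>x. a * hsum c x t) = (\<lambda>x. a * hsum ((dcoef ^^ n) c) x t)"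
proof (induction n)
  case (Suc n)
  have "deriv (\<lambda>x. a * hsum ((dcoef ^^ n) c) x t) x = a * hsum (dcoef ((dcoef ^^ n) c)) x t" for x
    by (rule DERIV_imp_deriv, rule DERIV_cmult[OF hsum_dtheta[OF rapid_funpow_dcoef[OF assms(1)] assms(2)]])
  then show ?case by (simp add: Suc)
qed simp

lemma deriv_funpow_hterm: "(deriv ^^ n) (\<lambda>x. hterm c m x t) = (\<lambda>x. hterm ((dcoef ^^ n) c) m x t)"
proof (induction n)
  case (Suc n)
  have "deriv (\<lambda>x. hterm ((dcoef ^^ n) c) m x t) x = hterm (dcoef ((dcoef ^^ n) c)) m x t" for x
    by (rule DERIV_imp_deriv[OF hterm_dtheta])
  then show ?case by (simp add: Suc)
qed simp

lemma Ck_on_exp_hsum: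
  assumes c: "rapid c"
  shows "Ck_on n (UNIV \<times> {0..}) (\<lambda>(x, t). exp t * hsum c x t)"
proof -
  note fat = time_interval_fat[OF time_interval_Ici]
  have "Ck_on n (UNIV \<times> {0..}) (\<lambda>p::real \<times> real. exp (snd p))"
    by (rule Ck_on_compose[OF fat _ Ck_on_exp Ck_on_linear[OF fat bounded_linear_snd Ck_on_id[OF fat]]]) simp
  from Ck_on_mult[OF fat this Ck_on_hsum[OF c]] show ?thesis by (simp add: case_prod_unfold)
qed

text \<open>Differentiating in \<theta> only replaces the coefficients by other rapidly decaying
  ones whose mode 0 still vanishes. One uniform decay estimate therefore covers all
  derivatives.\<close>

lemma exp_hsum_limit:
  assumes c: "rapid c" "c 0 = 0"
  shows "Cinf_limit (\<lambda>t x. exp t * hsum c x t) (\<lambda>x. Re (c 1 * cis x)) at_top"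
  unfolding Cinf_limit_def
proof (intro conjI allI)
  show "\<forall>\<^sub>F t in at_top. smooth_on UNIV (\<lambda>x. exp t * hsum c x t)"
    using eventually_ge_at_top[of "0::real"]
    by eventually_elim (rule smooth_slice[OF Ck_on_exp_hsum[OF c(1)]], simp)
  have f: "fat (UNIV :: real set)" by (rule fat_open[OF open_UNIV])
  show "smooth_on UNIV (\<lambda>x. Re (c 1 * cis x))"
    unfolding smooth_on_def
    by (intro allI Ck_on_linear[OF f bounded_linear_Re] Ck_on_mult Ck_on_const Ck_on_cis f)
  fix n
  let ?d = "(dcoef ^^ n) c"
  have d: "rapid ?d" "?d 0 = 0" using rapid_funpow_dcoef[OF c(1)] c(2) by (auto, cases n, auto simp: dcoef_def)
  have g: "(deriv ^^ n) (\<lambda>x. Re (c 1 * cis x)) = (\<lambda>x. Re (?d 1 * cis x))"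
    using deriv_funpow_hterm[of n c 1 0] by (simp add: hterm_def)
  define M where "M = (\<Sum>n. norm (?d n))"
  have M: "((\<lambda>t. exp (- 3 * t) * M) \<longlongrightarrow> 0) at_top"
    by real_asymp
  show "uniform_limit UNIV (\<lambda>t. (deriv ^^ n) (\<lambda>x. exp t * hsum c x t)) ((deriv ^^ n) (\<lambda>x. Re (c 1 * cis x))) at_top"
    unfolding uniform_limit_iff g
  proof (intro allI impI)
    fix e :: real assume "e > 0"
    then have "\<forall>\<^sub>F t in at_top. exp (- 3 * t) * M < e" using order_tendstoD(2)[OF M] by blast
    then show "\<forall>\<^sub>F t in at_top. \<forall>x\<in>UNIV. dist ((deriv ^^ n) (\<lambda>x. exp t * hsum c x t) x) (Re (?d 1 * cis x)) < e"
      using eventually_ge_at_top[of "0::real"]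
    proof eventually_elim
      case (elim t)
      then show ?case
        using hsum_decay[OF d, of t] unfolding deriv_funpow_hsum[OF c(1) elim(2)] M_def[symmetric] dist_real_def
        by (meson le_less_trans)
    qed
  qed
qed

lemma Cinf_limit_cong:
  assumes "\<forall>\<^sub>F t in F. f t = f' t" "Cinf_limit f' g F"
  shows "Cinf_limit f g F"
proof -
  have sm: "\<forall>\<^sub>F t in F. smooth_on UNIV (f' t)" and g: "smooth_on UNIV g"
    and lim: "\<And>n. uniform_limit UNIV (\<lambda>t. (deriv ^^ n) (f' t)) ((deriv ^^ n) g) F"
    using assms(2) unfolding Cinf_limit_def by blast+
  have "\<forall>\<^sub>F t in F. smooth_on UNIV (f t)" using assms(1) sm by eventually_elim simp
  moreover have "uniform_limit UNIV (\<lambda>t. (deriv ^^ n) (f t)) ((deriv ^^ n) g) F" for n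
    unfolding uniform_limit_iff
  proof (intro allI impI)
    fix e :: real assume "e > 0"
    then have "\<forall>\<^sub>F t in F. \<forall>x\<in>UNIV. dist ((deriv ^^ n) (f' t) x) ((deriv ^^ n) g x) < e"
      using lim unfolding uniform_limit_iff by blast
    then show "\<forall>\<^sub>F t in F. \<forall>x\<in>UNIV. dist ((deriv ^^ n) (f t) x) ((deriv ^^ n) g x) < e"
      using assms(1) by eventually_elim simp
  qed
  ultimately show ?thesis using g by (simp add: Cinf_limit_def)
qed

text \<open>By periodicity only one period matters, so the nonpositive set up to time t1 is compact
  and its time coordinate attains a minimum. Positivity at time 0 makes this minimum
  positive.\<close>

lemma first_nonpositive_time:
  fixes r :: "real \<Rightarrow> real \<Rightarrow> real"
  assumes cont: "continuous_on (UNIV \<times> {0..}) (\<lambda>(x, t). r x t)" and per: "\<And>x t. r (x + 2 * pi) t = r x t"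
    and init: "\<And>x. r x 0 > 0" and ex: "t1 \<ge> 0" "r x1 t1 \<le> 0"
  obtains t0 x0 where "t0 > 0" "r x0 t0 \<le> 0" "\<And>x t. t \<in> {0..<t0} \<Longrightarrow> r x t > 0"
proof -
  have shift: "\<exists>y\<in>{0..2 * pi}. r y t = r x t" for x t
  proof -
    interpret r: periodic_fun_simple "\<lambda>x. r x t" "2 * pi" by unfold_locales (rule per)
    obtain k :: int where "0 \<le> x + of_int k * (2 * pi)" "x + of_int k * (2 * pi) < 0 + 2 * pi" by (rule exists_shift)
    then show ?thesis by (intro bexI[of _ "x + of_int k * (2 * pi)"] r.plus_of_int) auto
  qed
  define K :: "(real \<times> real) set" where "K = {0..2 * pi} \<times> {0..t1}"
  define Z where "Z = K \<inter> (\<lambda>(x, t). r x t) -` {..0}"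
  have K: "compact K" unfolding K_def by (intro compact_Times compact_Icc)
  have "continuous_on K (\<lambda>(x, t). r x t)" by (rule continuous_on_subset[OF cont]) (auto simp: K_def)
  then have "closed Z" unfolding Z_def by (rule continuous_closed_preimage[OF _ compact_imp_closed[OF K] closed_atMost])
  then have "compact (K \<inter> Z)" by (rule compact_Int_closed[OF K])
  moreover have "K \<inter> Z = Z" by (auto simp: Z_def)
  ultimately have Z: "compact Z" by simp
  obtain y1 where "y1 \<in> {0..2 * pi}" "r y1 t1 = r x1 t1" using shift by blast
  then have "(y1, t1) \<in> Z" using ex by (auto simp: Z_def K_def)
  then have "Z \<noteq> {}" by blast
  then obtain z where z: "z \<in> Z" "\<And>y. y \<in> Z \<Longrightarrow> snd z \<le> snd y"
    using continuous_attains_inf[OF Z _ continuous_on_snd[OF continuous_on_id]] by blast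
  obtain x0 t0 where zz: "z = (x0, t0)" by (cases z)
  have t0: "r x0 t0 \<le> 0" "0 \<le> t0" "t0 \<le> t1" using z(1) by (auto simp: zz Z_def K_def)
  have "t0 \<noteq> 0" using t0(1) init[of x0] by auto
  then have "t0 > 0" using t0 by simp
  moreover have "r x t > 0" if t: "t \<in> {0..<t0}" for x t
  proof (rule ccontr)
    assume neg: "\<not> ?thesis"
    obtain y where "y \<in> {0..2 * pi}" "r y t = r x t" using shift by blast
    then have "(y, t) \<in> Z" using neg t t0 by (auto simp: Z_def K_def)
    then show False using z(2)[of "(y, t)"] t by (simp add: zz)
  qed
  ultimately show ?thesis using that t0(1) by blast
qed

section \<open>The candidate solution and the dichotomy\<close>

locale length_solution =
  fixes H :: "real \<Rightarrow> real \<Rightarrow> real" and X0 :: "real \<Rightarrow> complex" and L :: "real \<Rightarrow> real"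
  assumes H: "smooth_on ({0<..} \<times> {0<..}) (\<lambda>(p, q). H p q)" and X0: "smooth_convex_closed_curve X0"
    and L_pos: "\<And>t. t \<ge> 0 \<Longrightarrow> L t > 0"
    and area_pos: "\<And>t. t \<ge> 0 \<Longrightarrow> (L t)\<^sup>2 / (4 * pi) + osc_area (fcoef (support_function X0)) t > 0"
    and L_ode: "\<And>t. t \<ge> 0 \<Longrightarrow> (L has_real_derivative
        L t - 2 * pi * H (L t) ((L t)\<^sup>2 / (4 * pi) + osc_area (fcoef (support_function X0)) t)) (at t within {0..})"
    and L_init: "L 0 = curve_length X0"
begin

abbreviation "u0 \<equiv> support_function X0"
abbreviation "c \<equiv> fcoef u0"
definition "Q t = (L t)\<^sup>2 / (4 * pi) + osc_area c t"
definition "h t = H (L t) (Q t)"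
text \<open>The candidate support function. Together with its radius of curvature \<open>r\<close>
  it is defined for all t >= 0, also beyond the time at which \<open>r\<close> stops being positive
  and w stops describing a curve.\<close>

definition "w x t = L t / (2 * pi) + exp t * hsum c x t"
definition "r x t = L t / (2 * pi) + exp t * hsum (radius_coef c) x t"

lemma initial: "convex_support u0" "integral {0..2 * pi} u0 = L 0"
  using convex_support_function[OF X0] L_init by simp_all

lemmas u0 = convex_support.smooth[OF initial(1)] convex_support.periodic[OF initial(1)]

lemma c: "rapid c" "c 0 = 0"
  using rapid_fcoef[OF u0] by (auto simp: fcoef_def)

lemma w_0: "w x 0 = u0 x"
  using fourier_series_smooth[OF u0, of x] by (simp add: w_def initial(2))

lemma r_0: "r x 0 > 0"
proof -
  have "u0 = (\<lambda>x. L 0 / (2 * pi) + 1 * hsum c x 0)" using w_0 by (auto simp: w_def)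
  then have "curv_radius u0 x = r x 0"
    using curv_radius_series[OF c(1) order_refl, of "L 0 / (2 * pi)" 1 x] by (simp add: r_def)
  then show ?thesis using convex_support.radius_pos[OF initial(1), of x] by simp
qed

lemma periodic: "w (x + 2 * pi) t = w x t" "r (x + 2 * pi) t = r x t"
  by (simp_all add: w_def r_def hsum_periodic)

text \<open>The right-hand side of the length equation is a smooth function of L and
  \<open>osc_area\<close>, so L gains one derivative at each step; the positivity assumptions keep
  the arguments in the domain of H.\<close>

lemma Ck_L: "Ck_on n (UNIV \<times> {0..}) (\<lambda>(x::real, t). L t)"
proof (induction n)
  case 0
  have "continuous_on {0..} L" by (rule DERIV_continuous_on[OF L_ode]) simp
  then have "continuous_on (UNIV \<times> {0..}) (\<lambda>p::real \<times> real. L (snd p))"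
    by (rule continuous_on_compose2) (auto intro!: continuous_intros)
  then show ?case by (simp add: case_prod_unfold)
next
  case (Suc n)
  note TI = time_intervalD[OF time_interval_Ici] and fat = time_interval_fat[OF time_interval_Ici]
  let ?Z = "UNIV \<times> {0..} :: (real \<times> real) set"
  have LL: "Ck_on n ?Z (\<lambda>p. L (snd p))" using Suc by (simp add: case_prod_unfold)
  have oo: "Ck_on n ?Z (\<lambda>p. osc_area c (snd p))"
    using Ck_on_osc_area[OF c(1) time_interval_Ici, of n] by (simp add: case_prod_unfold)
  have "Ck_on n ?Z (\<lambda>p. L (snd p) * L (snd p) * (1 / (4 * pi)) + osc_area c (snd p))"
    by (intro Ck_on_add Ck_on_mult Ck_on_const fat LL oo)
  then have "Ck_on n ?Z (\<lambda>p. Q (snd p))" by (simp add: Q_def power2_eq_square)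
  then have P: "Ck_on n ?Z (\<lambda>p. (L (snd p), Q (snd p)))" by (intro Ck_on_Pair fat LL)
  have "Ck_on n ?Z (\<lambda>p. (\<lambda>(p, q). H p q) (L (snd p), Q (snd p)))"
    by (rule Ck_on_compose[OF fat _ _ P, where T="{0<..} \<times> {0<..}"])
      (use H L_pos area_pos in \<open>auto simp: smooth_on_def Q_def\<close>)
  then have "Ck_on n ?Z (\<lambda>p. h (snd p))" by (simp add: h_def)
  then have "Ck_on n ?Z (\<lambda>p. L (snd p) - 2 * pi * h (snd p))"
    by (intro Ck_on_diff Ck_on_mult Ck_on_const fat LL)
  then have D: "Ck_on n ?Z (\<lambda>(x, t). L t - 2 * pi * h t)" by (simp add: case_prod_unfold)
  show ?case
  proof (rule Ck_on_partialsI[OF TI(1,2) _ _ _ D])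
    show "Ck_on n ?Z (\<lambda>(x, t). 0 :: real)" using Ck_on_const[OF fat, of n "0::real"] by (simp add: case_prod_unfold)
    show "((\<lambda>x. L t) has_vector_derivative 0) (at x)" for x t by (rule has_vector_derivative_const)
    show "(L has_vector_derivative L t - 2 * pi * h t) (at t within {0..})" if "t \<in> {0..}" for x t
      using L_ode[of t] that by (simp add: has_real_derivative_iff_has_vector_derivative h_def Q_def)
  qed
qed

lemma Ck_series:
  assumes "rapid d"
  shows "Ck_on n (UNIV \<times> {0..}) (\<lambda>(x, t). L t / (2 * pi) + exp t * hsum d x t)"
proof -
  note fat = time_interval_fat[OF time_interval_Ici]
  have "Ck_on n (UNIV \<times> {0..}) (\<lambda>p. (\<lambda>(x::real, t). L t) p * (1 / (2 * pi)) + (\<lambda>(x, t). exp t * hsum d x t) p)"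
    by (intro Ck_on_add Ck_on_mult Ck_on_const fat Ck_L Ck_on_exp_hsum assms)
  then show ?thesis by (simp add: case_prod_unfold)
qed

lemma Ck_w: "Ck_on n (UNIV \<times> {0..}) (\<lambda>(x, t). w x t)" and Ck_r: "Ck_on n (UNIV \<times> {0..}) (\<lambda>(x, t). r x t)"
  unfolding w_def r_def by (intro Ck_series c rapid_radius_coef)+

lemma exp_hsum_dt:
  assumes "rapid d" "t \<ge> 0"
  shows "((\<lambda>t. exp t * hsum d x t) has_real_derivative exp t * hsum (radius_coef d) x t) (at t within {0..})"
  using DERIV_mult[OF has_field_derivative_at_within[OF DERIV_exp] hsum_dt[OF assms]]
  by (simp add: hsum_radius_coef[OF assms] algebra_simps)

lemma w_dt: "t \<ge> 0 \<Longrightarrow> ((\<lambda>t. w x t) has_real_derivative r x t - h t) (at t within {0..})"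
  unfolding w_def[abs_def]
  using DERIV_add[OF DERIV_cdivide[OF L_ode, of t "2 * pi"] exp_hsum_dt[OF c(1), of t x]]
  by (simp add: r_def h_def Q_def field_simps)

lemma length_area:
  assumes t: "t \<ge> 0"
  shows "integral {0..2 * pi} (\<lambda>x. w x t) = L t" "1 / 2 * integral {0..2 * pi} (\<lambda>x. w x t * r x t) = Q t"
proof -
  have "((\<lambda>x. w x t) has_integral (2 * pi - 0) *\<^sub>R (L t / (2 * pi)) + exp t * 0) {0..2 * pi}"
    unfolding w_def
    by (intro has_integral_add has_integral_mult_right integral_hsum c t has_integral_const_real[where a=0 and b="2 * pi", simplified])
      (use has_integral_const_real[of "L t / (2 * pi)" 0 "2 * pi"] in simp)
  then show "integral {0..2 * pi} (\<lambda>x. w x t) = L t" by (simp add: integral_unique)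
  show "1 / 2 * integral {0..2 * pi} (\<lambda>x. w x t * r x t) = Q t"
    unfolding w_def r_def series_area[OF c t] by (simp add: Q_def power2_eq_square)
qed

lemma flow_exists:
  assumes J: "time_interval J" and pos: "\<And>x t. t \<in> J \<Longrightarrow> r x t > 0"
  shows "\<exists>X. nonlocal_flow H X0 J X"
proof -
  have sub: "J \<subseteq> {0..}" using time_intervalD(4)[OF J] by auto
  have Zs: "UNIV \<times> J \<subseteq> (UNIV \<times> {0..} :: (real \<times> real) set)" using sub by auto
  note res = Ck_on_subset[OF time_interval_fat[OF J] Zs]
  show ?thesis
  proof (rule support_flow_exists[OF J X0, where w=w and ?w1.0="\<lambda>x t. exp t * hsum (dcoef c) x t" and \<rho>=r
        and ?\<rho>1.0="\<lambda>x t. exp t * hsum (radius_coef (dcoef c)) x t" and \<eta>=h])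
    show "Ck_on n (UNIV \<times> J) (\<lambda>(x, t). w x t)" "Ck_on n (UNIV \<times> J) (\<lambda>(x, t). r x t)"
      "Ck_on n (UNIV \<times> J) (\<lambda>(x, t). exp t * hsum (dcoef c) x t)"
      "Ck_on n (UNIV \<times> J) (\<lambda>(x, t). exp t * hsum (radius_coef (dcoef c)) x t)" for n
      by (intro res Ck_w Ck_r Ck_on_exp_hsum rapid_dcoef rapid_radius_coef c)+
  next
    fix x t assume "t \<in> J"
    then have t: "t \<ge> 0" using sub by auto
    show "((\<lambda>x. w x t) has_real_derivative exp t * hsum (dcoef c) x t) (at x)"
      unfolding w_def using DERIV_add[OF DERIV_const DERIV_cmult[OF hsum_dtheta[OF c(1) t]]] by simp
    show "((\<lambda>x. exp t * hsum (dcoef c) x t) has_real_derivative r x t - w x t) (at x)"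
      using DERIV_cmult[OF hsum_dtheta[OF rapid_dcoef[OF c(1)] t], of "exp t" x]
      by (simp add: r_def w_def hsum_radius_coef[OF c(1) t] algebra_simps)
    show "((\<lambda>t. w x t) has_real_derivative r x t - h t) (at t within J)"
      by (rule has_field_derivative_subset[OF w_dt[OF t] sub])
    show "((\<lambda>t. exp t * hsum (dcoef c) x t) has_real_derivative exp t * hsum (radius_coef (dcoef c)) x t) (at t within J)"
      by (rule has_field_derivative_subset[OF exp_hsum_dt[OF rapid_dcoef[OF c(1)] t] sub])
  next
    fix t assume "t \<in> J"
    then have t: "t \<ge> 0" using sub by auto
    show "h t = H (integral {0..2 * pi} (\<lambda>x. w x t)) (1 / 2 * integral {0..2 * pi} (\<lambda>x. w x t * r x t))"
      unfolding length_area[OF t] h_def ..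
  qed (simp_all add: periodic hsum_periodic pos w_0)
qed

text \<open>An arbitrary solution has the length L by uniqueness, which makes its support function
  and radius of curvature coincide with the explicit ones.\<close>

lemma flow_support:
  assumes "flow_solution H X0 J X" "t \<in> J"
  shows "support_function (\<lambda>\<phi>. X \<phi> t) x - L t / (2 * pi) = exp t * hsum c x t"
    "\<exists>\<phi>. curvature (\<lambda>\<phi>. X \<phi> t) \<phi> = 1 / r x t"
proof -
  interpret flow_solution H X0 J X by (rule assms(1))
  have sub: "J \<subseteq> {0..}" using TI(4) by auto
  have len: "len t = L t"
  proof (rule len_unique[where L=L, OF H _ _ _ L_init assms(2)])
    fix t assume t: "t \<in> J"
    then have 0: "t \<ge> 0" using sub by auto
    show "(L has_real_derivative L t - 2 * pi * H (L t) ((L t)\<^sup>2 / (4 * pi) + osc_area c t)) (at t within J)"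
      by (rule has_field_derivative_subset[OF L_ode[OF 0] sub])
    show "L t > 0" "(L t)\<^sup>2 / (4 * pi) + osc_area c t > 0" using L_pos[OF 0] area_pos[OF 0] .
  qed
  show "support_function (\<lambda>\<phi>. X \<phi> t) x - L t / (2 * pi) = exp t * hsum c x t"
    using S_series[OF assms(2), of x] by (simp add: S_def len)
  show "\<exists>\<phi>. curvature (\<lambda>\<phi>. X \<phi> t) \<phi> = 1 / r x t"
    using contact(4)[OF assms(2), of x] radius_series[OF assms(2), of x] by (auto simp: len r_def)
qed

text \<open>On the time interval r x0 is positive, and by continuity it tends to r x0 t0 <= 0. Hence
  1 / r x0, which is the curvature at some point of any solution, is unbounded.\<close>

lemma blow_up:
  assumes t0: "t0 > 0" "r x0 t0 \<le> 0" and pos: "\<And>x t. t \<in> {0..<t0} \<Longrightarrow> r x t > 0"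
    and X: "nonlocal_flow H X0 {0..<t0} X"
  shows "curvature_blows_up X t0"
  unfolding curvature_blows_up_def
proof
  fix K :: real
  interpret flow_solution H X0 "{0..<t0}" X
    by unfold_locales (use t0(1) X in \<open>auto simp: time_interval_def\<close>)
  have "continuous_on {0..t0} (r x0)"
    by (rule continuous_on_slice1[OF Ck_on_imp_cont[OF Ck_r]]) auto
  then have "(r x0 \<longlongrightarrow> r x0 t0) (at_left t0)" by (rule continuous_on_Icc_at_leftD[OF _ t0(1)])
  moreover have "r x0 t0 < 1 / (\<bar>K\<bar> + 1)" using t0(2) by (rule le_less_trans) simp
  ultimately have "\<forall>\<^sub>F t in at_left t0. r x0 t < 1 / (\<bar>K\<bar> + 1)" by (rule order_tendstoD(2))
  then have "\<forall>\<^sub>F t in at_left t0. \<exists>\<phi>. curvature (\<lambda>\<phi>. X \<phi> t) \<phi> > K"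
    using eventually_at_left_real[OF t0(1)]
  proof eventually_elim
    case (elim t)
    then have t: "t \<in> {0..<t0}" by auto
    obtain \<phi> where \<phi>: "curvature (\<lambda>\<phi>. X \<phi> t) \<phi> = 1 / r x0 t"
      using flow_support(2)[OF flow_solution_axioms t] by blast
    have "r x0 t * (\<bar>K\<bar> + 1) < 1" using elim(1) by (simp add: pos_less_divide_eq)
    then have "\<bar>K\<bar> + 1 < 1 / r x0 t" using pos[OF t, of x0] by (simp add: pos_less_divide_eq mult.commute)
    then show ?case using \<phi> by (intro exI[of _ \<phi>]) simp
  qed
  then show "\<exists>\<^sub>F t in at_left t0. \<exists>\<phi>. curvature (\<lambda>\<phi>. X \<phi> t) \<phi> > K"
    by (rule eventually_frequently[OF trivial_limit_at_left_real])
qed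

text \<open>\<open>fint\<close> integrates against the conjugate exponential, so the sine integral
  enters the imaginary part of c 1 with a minus sign, which taking the real part of the product
  turns back into plus.\<close>

lemma limit_function:
  "Re (c 1 * cis \<theta>) = (1 / pi * integral {0..2 * pi} (\<lambda>x. u0 x * cos x)) * cos \<theta>
     + (1 / pi * integral {0..2 * pi} (\<lambda>x. u0 x * sin x)) * sin \<theta>"
proof -
  have "continuous_on {0..2 * pi} u0" using smooth_on_imp_cont[OF u0(1)] continuous_on_subset by blast
  then have i: "((\<lambda>x. of_real (u0 x) * cis (- (real 1 * x))) has_integral fint u0 1) {0..2 * pi}"
    unfolding fint_def by (intro integrable_integral integrable_continuous_interval continuous_intros)
  have "Re (fint u0 1) = integral {0..2 * pi} (\<lambda>x. u0 x * cos x)"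
    using has_integral_Re[OF i] by (simp add: integral_unique)
  moreover have "((\<lambda>x. - (u0 x * sin x)) has_integral Im (fint u0 1)) {0..2 * pi}"
    using has_integral_Im[OF i] by simp
  then have "Im (fint u0 1) = - integral {0..2 * pi} (\<lambda>x. u0 x * sin x)"
    by (metis integral_neg integral_unique)
  ultimately show ?thesis by (simp add: fcoef_def field_simps)
qed

lemma convergence:
  assumes X: "nonlocal_flow H X0 {0..} X"
  shows "Cinf_limit (\<lambda>t \<theta>. support_function (\<lambda>\<phi>. X \<phi> t) \<theta> - L t / (2 * pi)) (\<lambda>\<theta>. Re (c 1 * cis \<theta>)) at_top"
proof (rule Cinf_limit_cong[OF _ exp_hsum_limit[OF c]])
  interpret flow_solution H X0 "{0..}" X
    by unfold_locales (use X time_interval_Ici in auto)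
  show "\<forall>\<^sub>F t in at_top. (\<lambda>\<theta>. support_function (\<lambda>\<phi>. X \<phi> t) \<theta> - L t / (2 * pi)) = (\<lambda>\<theta>. exp t * hsum c \<theta> t)"
    using eventually_ge_at_top[of "0::real"]
    by eventually_elim (simp add: flow_support(1)[OF flow_solution_axioms] fun_eq_iff)
qed

lemma blow_up_or_convergence:
  "(\<exists>t0>0. (\<exists>X. nonlocal_flow H X0 {0..<t0} X) \<and>
      (\<forall>X. nonlocal_flow H X0 {0..<t0} X \<longrightarrow> curvature_blows_up X t0)) \<or>
   ((\<exists>X. nonlocal_flow H X0 {0..} X) \<and>
      (\<forall>X. nonlocal_flow H X0 {0..} X \<longrightarrow>
        Cinf_limit (\<lambda>t \<theta>. support_function (\<lambda>\<phi>. X \<phi> t) \<theta> - L t / (2 * pi)) (\<lambda>\<theta>. Re (c 1 * cis \<theta>)) at_top))"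
proof (cases "\<forall>t\<ge>0. \<forall>x. r x t > 0")
  case True
  then have "\<exists>X. nonlocal_flow H X0 {0..} X" by (intro flow_exists time_interval_Ici) auto
  then show ?thesis using convergence by blast
next
  case False
  then obtain t1 x1 where "t1 \<ge> 0" "r x1 t1 \<le> 0" by (auto simp: not_less)
  then obtain t0 x0 where t0: "t0 > 0" "r x0 t0 \<le> 0" "\<And>x t. t \<in> {0..<t0} \<Longrightarrow> r x t > 0"
    using first_nonpositive_time[of r, OF Ck_on_imp_cont[OF Ck_r] periodic(2) r_0] by metis
  have "\<exists>X. nonlocal_flow H X0 {0..<t0} X"
    by (rule flow_exists[OF _ t0(3)]) (use t0(1) in \<open>auto simp: time_interval_def\<close>)
  then show ?thesis using blow_up[OF t0] t0(1) by blast
qed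

end

theorem theorem4:
  fixes H :: "real \<Rightarrow> real \<Rightarrow> real" and X0 :: "real \<Rightarrow> complex" and L :: "real \<Rightarrow> real"
  defines "u0 \<equiv> support_function X0"
  defines "Q \<equiv> (\<lambda>t. (L t)\<^sup>2 / (4 * pi) + E1 u0 t - (L 0)\<^sup>2 / (4 * pi) * exp (2 * t))"
  assumes H_smooth: "smooth_on ({0<..} \<times> {0<..}) (\<lambda>(p, q). H p q)"
    and X0: "smooth_convex_closed_curve X0"
    and L_pos: "\<And>t. t \<ge> 0 \<Longrightarrow> L t > 0 \<and> Q t > 0"
    and L_ode: "\<And>t. t \<ge> 0 \<Longrightarrow>
      (L has_real_derivative (L t - 2 * pi * H (L t) (Q t))) (at t within {0..})"
    and L_init: "L 0 = curve_length X0"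
  shows
    "(\<exists>t0>0. (\<exists>X. nonlocal_flow H X0 {0..<t0} X) \<and>
        (\<forall>X. nonlocal_flow H X0 {0..<t0} X \<longrightarrow> curvature_blows_up X t0)) \<or>
     ((\<exists>X. nonlocal_flow H X0 {0..} X) \<and>
        (\<forall>X. nonlocal_flow H X0 {0..} X \<longrightarrow>
          Cinf_limit (\<lambda>t \<theta>. support_function (\<lambda>\<phi>. X \<phi> t) \<theta> - L t / (2 * pi))
            (\<lambda>\<theta>. (1 / pi * integral {0..2*pi} (\<lambda>\<eta>. u0 \<eta> * cos \<eta>)) * cos \<theta>
                + (1 / pi * integral {0..2*pi} (\<lambda>\<eta>. u0 \<eta> * sin \<eta>)) * sin \<theta>)
            at_top))"
proof -
  interpret u: convex_support u0 unfolding u0_def by (rule convex_support_function(1)[OF X0])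
  have len: "integral {0..2 * pi} u0 = L 0" using convex_support_function(2)[OF X0] L_init by (simp add: u0_def)
  \<comment> \<open>As L 0 is the integral of u0, the subtracted exponential cancels exactly the
    mode 0 of \<open>E1\<close>.\<close>
  have Q: "Q t = (L t)\<^sup>2 / (4 * pi) + osc_area (fcoef u0) t" if "t \<ge> 0" for t
    using E1_series[OF u.smooth u.periodic that] by (simp add: Q_def len)
  interpret length_solution H X0 L
  proof
    fix t :: real assume t: "t \<ge> 0"
    note Qt = Q[OF t, unfolded u0_def]
    show "L t > 0" "(L t)\<^sup>2 / (4 * pi) + osc_area (fcoef (support_function X0)) t > 0"
      using L_pos[OF t] by (simp_all add: Qt)
    show "(L has_real_derivative L t - 2 * pi * H (L t) ((L t)\<^sup>2 / (4 * pi) + osc_area (fcoef (support_function X0)) t)) (at t within {0..})"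
      using L_ode[OF t] by (simp add: Qt)
  qed (fact H_smooth X0 L_init)+
  show ?thesis using blow_up_or_convergence unfolding limit_function u0_def .
qed

end
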